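(* Let $\delta>0$. For every $\varepsilon>0$ there is $p_0=p_0(\delta,\varepsilon)$ such that the following holds. Let $p\ge p_0$ be a prime, let $\chi$ be a non-trivial multiplicative character modulo $p$, and let $A,B,C\subset \mathbb{F}_p$ be sets with $|A|,|B|,|C|\geq \delta\sqrt p$. Then \[\left|\sum_{a\in A}\sum_{b\in B}\sum_{c\in C}\chi(a+b+c)\right|\le \varepsilon\,|A||B||C|.\] (In the paper's notation: the triple sum is $o_\delta(|A||B||C|)$.)
   Context: $\mathbb{F}_p$ denotes the field with $p$ elements, $p$ prime. A multiplicative character modulo $p$ is a homomorphism $\chi:\mathbb{F}_p^\times\to\mathbb{C}^\times$, extended to $\mathbb{F}_p$ by $\chi(0)=0$; it is non-trivial if it is not identically $1$ on $\mathbb{F}_p^\times$. *)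

theory Defs
  imports Complex_Main "HOL-Number_Theory.Residues"
begin

(* The field with p elements is residue_ring (int p), with carrier {0..int p - 1}. *)

definition complex_units :: "complex monoid" where
  "complex_units = \<lparr>carrier = - {0}, monoid.mult = (*), monoid.one = 1\<rparr>"

(* Only the values of \<chi> on the carrier {0..int p - 1} are constrained. *)
definition mult_character :: "nat \<Rightarrow> (int \<Rightarrow> complex) \<Rightarrow> bool" where
  "mult_character p \<chi> \<longleftrightarrow>
     \<chi> \<in> hom (units_of (residue_ring (int p))) complex_units \<and>
     \<chi> \<zero>\<^bsub>residue_ring (int p)\<^esub> = 0"

definition nontrivial_mult_character :: "nat \<Rightarrow> (int \<Rightarrow> complex) \<Rightarrow> bool" where
  "nontrivial_mult_character p \<chi> \<longleftrightarrow>
     mult_character p \<chi> \<and> (\<exists>x \<in> Units (residue_ring (int p)). \<chi> x \<noteq> 1)"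

end

(* Suppose that the sum is not small. By orthogonality the sets have size comparable to sqrt p, and
   the partial sums F(x) = sum of chi(x + c) over C are large on O(sqrt p) points only; Balog-Szemeredi-Gowers
   and Plunnecke then replace A by a dense subset with small doubling that keeps a positive proportion
   of the sum. Such an A has many near-periods: in a Freiman model of A in Z/N, N = O(|A|), the Bohr set
   of the large spectrum yields a set T, of size a power of p just below that of A, such that for t in T
   and j <= J the number of representations a1 - a2 + a3 - a4 = jt is almost maximal. So a + b + c may be
   replaced by a + b + c + jt, and for some z the sums over j <= J of chi(a + z + jt) are large on average
   over A and T. This contradicts Burgess' argument. The solutions of (a + z)t' = (a' + z)t are few:
   otherwise |A - lA| = O(|A|) for |T| / O(1) values of l; the set of such l is stable under the field
   operations up to the constants, so there would be at least min(p, |T|^2 / O(1)) of them, whereas A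
   admits only O(|A|). The moments of the short sums are controlled by Weil's bound, which is proved by
   Stepanov's method. *)
theory Submission
  imports Defs "HOL-Algebra.Algebraic_Closure_Type" "Berlekamp_Zassenhaus.Finite_Field"
    "HOL-Computational_Algebra.Fundamental_Theorem_Algebra" "HOL-Computational_Algebra.Polynomial_FPS"
    "HOL-Computational_Algebra.Polynomial_Factorial"
    "HOL-Library.Set_Algebras" "HOL-Analysis.Convex"
begin

hide_const (open) Polynomials.degree Divisibility.irreducible UnivPoly.coeff up_ring.coeff Module.smult
  Divisibility.prime Coset.order Polynomials.lead_coeff UnivPoly.monom up_ring.monom

section \<open>Character sums over a finite field\<close>

text \<open>Three sets are just enough at the size sqrt p. Moving \<open>A\<close> by a near-period
  costs, by Cauchy-Schwarz, the square root of a small multiple of |A|^2 |B| p |C|; as |B| |C| is at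
  least a constant times p, this is a small multiple of |A| |B| |C|. Burgess' argument needs no
  saving by a power of p in the energy here. The exponent r is fixed before p and J^r is taken of
  order sqrt p, so the moment and the sizes of the sets lose constants only, and the trivial bound
  |A| |T|^2 for the energy has to be improved by a large constant factor L, depending on r. Since T
  is a Bohr set carried back from a model and not an interval, the divisor bound usual in this place
  is not at hand. What replaces it is the absence of proper subfields in a field of prime order,
  with T of size about p^(3/8): its square is far above sqrt p, which leaves room for every
  constant.\<close>

interpretation to_ac: field_hom "to_ac :: 'a::field \<Rightarrow> 'a alg_closure"
  by unfold_locales auto

interpretation to_ac_poly: map_poly_inj_comm_ring_hom "to_ac :: 'a::field \<Rightarrow> 'a alg_closure"
  by unfold_locales

abbreviation ac_poly :: "'a::field poly \<Rightarrow> 'a alg_closure poly" where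
  "ac_poly \<equiv> map_poly to_ac"

section \<open>Frobenius orbits of roots of irreducible polynomials\<close>

lemma CHAR_eq_CARD:
  assumes "prime CARD('a::finite_field)"
  shows "CHAR('a) = CARD('a)"
  using assms CHAR_dvd_CARD[where ?'a='a] CHAR_not_1[where ?'a='a] by (auto simp: prime_nat_iff)

text \<open>The closure has the same prime characteristic, so the freshman's dream applies; applied
  to (x - y) + y it also yields injectivity.\<close>

lemma frobenius_hom:
  assumes "prime CARD('a::{finite_field,field_gcd})"
  shows "inj_comm_ring_hom (\<lambda>x :: 'a alg_closure. x ^ (CARD('a) ^ i))"
proof -
  have ch: "CHAR('a alg_closure) = CARD('a)" using CHAR_eq_CARD[OF assms] by simp
  have pos: "CARD('a) ^ i > 0" by simp
  have ad: "(x + y) ^ (CARD('a) ^ i) = x ^ (CARD('a) ^ i) + y ^ (CARD('a) ^ i)" for x y :: "'a alg_closure"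
    by (rule freshmans_dream') (use ch assms in auto)
  define N where "N = CARD('a) ^ i"
  have N: "N > 0" "\<And>x y :: 'a alg_closure. (x + y) ^ N = x ^ N + y ^ N" using pos ad by (auto simp: N_def)
  have inj: "x = y" if "x ^ N = y ^ N" for x y :: "'a alg_closure"
  proof -
    have "x ^ N = (x - y) ^ N + y ^ N" using N(2)[of "x - y" y] by simp
    hence "(x - y) ^ N = 0" using that by simp
    thus ?thesis by simp
  qed
  have "inj_comm_ring_hom (\<lambda>x :: 'a alg_closure. x ^ N)"
    by unfold_locales (use N(1) in \<open>simp_all add: power_mult_distrib N(2) inj\<close>)
  thus ?thesis by (simp only: N_def)
qed

lemma to_ac_frobenius: "to_ac (c :: 'a::{finite_field,field_gcd}) ^ (CARD('a) ^ i) = to_ac c"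
  using finite_field_power_card_power_eq_same[OF refl, of c i] by (simp flip: to_ac_power)

text \<open>X^q - X has at most q roots in the closure, and the embedded field already supplies q of
  them.\<close>

lemma frobenius_fixed_imp_to_ac:
  fixes c :: "'a::{finite_field,field_gcd} alg_closure"
  assumes "c ^ CARD('a) = c"
  shows "c \<in> range to_ac"
proof -
  have q: "CARD('a) > 1" using card_mono[of UNIV "{0, 1 :: 'a}"] by simp
  define p where "p = monom (1::'a alg_closure) CARD('a) - monom 1 1"
  have "coeff p CARD('a) = 1" using q by (simp add: p_def)
  hence p0: "p \<noteq> 0" by auto
  have deg: "degree p \<le> CARD('a)" unfolding p_def using q
    by (intro degree_diff_le) (auto simp: degree_monom_eq)
  have r: "{x. poly p x = 0} = {x. x ^ CARD('a) = x}" by (auto simp: p_def poly_monom)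
  have "card {x :: 'a alg_closure. x ^ CARD('a) = x} \<le> CARD('a)"
    using poly_roots_degree[OF p0] deg r by simp
  moreover have "range to_ac \<subseteq> {x :: 'a alg_closure. x ^ CARD('a) = x}"
    using to_ac_frobenius[where i=1] by auto
  moreover have "card (range (to_ac :: 'a \<Rightarrow> _)) = CARD('a)"
    by (rule card_image) (simp add: inj_to_ac)
  moreover have "finite {x :: 'a alg_closure. x ^ CARD('a) = x}"
    using poly_roots_finite[OF p0] r by simp
  ultimately have "range to_ac = {x :: 'a alg_closure. x ^ CARD('a) = x}"
    by (intro card_seteq) auto
  thus ?thesis using assms by auto
qed

lemma frobenius_poly:
  fixes P :: "'a::{finite_field,field_gcd} poly"
  assumes "prime CARD('a)"
  shows "poly (ac_poly P) (x ^ (CARD('a) ^ i)) = poly (ac_poly P) x ^ (CARD('a) ^ i)"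
proof -
  interpret F: inj_comm_ring_hom "\<lambda>x :: 'a alg_closure. x ^ (CARD('a) ^ i)"
    by (rule frobenius_hom[OF assms])
  have "map_poly (\<lambda>x :: 'a alg_closure. x ^ (CARD('a) ^ i)) (ac_poly P) = ac_poly P"
    by (intro poly_eqI) (simp add: coeff_map_poly to_ac_frobenius)
  thus ?thesis using F.poly_map_poly[of "ac_poly P" x] by simp
qed

text \<open>The product over the Frobenius orbit of one root has invariant coefficients, hence
  descends to the base field, where irreducibility makes \<open>P\<close> divide it. The orbit
  consists of roots of \<open>P\<close>, so the degrees agree and the least period of the root is
  \<open>degree P\<close>.\<close>

lemma irreducible_poly_frobenius_roots:
  fixes P :: "'a::{finite_field,field_gcd} poly"
  assumes q: "prime CARD('a)" and irr: "irreducible P" and mon: "monic P"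
  obtains \<alpha> where "inj_on (\<lambda>i. \<alpha> ^ (CARD('a) ^ i)) {..<degree P}" "\<alpha> ^ (CARD('a) ^ degree P) = \<alpha>"
    "ac_poly P = (\<Prod>i<degree P. [:- (\<alpha> ^ (CARD('a) ^ i)), 1:])"
proof -
  define d where "d = degree P"
  let ?q = "CARD('a)"
  have P0: "P \<noteq> 0" using irr by auto
  have d0: "d > 0" using irr is_unit_iff_degree[OF P0] unfolding d_def
    by (auto simp: irreducible_def)
  have "degree (ac_poly P) > 0" using d0 d_def by simp
  then obtain \<alpha> where root: "poly (ac_poly P) \<alpha> = 0" using alg_closed_imp_poly_has_root by blast
  have roots: "poly (ac_poly P) (\<alpha> ^ (?q ^ i)) = 0" for i
    using root frobenius_poly[OF q, of P \<alpha> i] by (simp add: power_0_left)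
  have acP0: "ac_poly P \<noteq> 0" using P0 by simp
  have fin: "finite {x. poly (ac_poly P) x = 0}" by (rule poly_roots_finite[OF acP0])
  have "\<not> inj (\<lambda>i. \<alpha> ^ (?q ^ i))"
  proof
    assume "inj (\<lambda>i. \<alpha> ^ (?q ^ i))"
    hence "infinite (range (\<lambda>i. \<alpha> ^ (?q ^ i)))" by (simp add: finite_image_iff)
    moreover have "range (\<lambda>i. \<alpha> ^ (?q ^ i)) \<subseteq> {x. poly (ac_poly P) x = 0}" using roots by auto
    ultimately show False using fin finite_subset by blast
  qed
  then obtain i j where "i \<noteq> j" "\<alpha> ^ (?q ^ i) = \<alpha> ^ (?q ^ j)" by (auto simp: inj_def)
  then obtain i j where ij: "i < j" "\<alpha> ^ (?q ^ i) = \<alpha> ^ (?q ^ j)"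
    by (metis linorder_neqE_nat)
  \<comment> \<open>Injectivity of Frobenius turns a repetition anywhere in the orbit into a return
    to the root itself.\<close>
  have period: "\<alpha> ^ (?q ^ (j - i)) = \<alpha>" if "i < j" "\<alpha> ^ (?q ^ i) = \<alpha> ^ (?q ^ j)" for i j
  proof -
    interpret F: inj_comm_ring_hom "\<lambda>x :: 'a alg_closure. x ^ (?q ^ i)" by (rule frobenius_hom[OF q])
    have "\<alpha> ^ (?q ^ j) = (\<alpha> ^ (?q ^ (j - i))) ^ (?q ^ i)"
      using that by (simp flip: power_mult power_add)
    thus ?thesis using that F.injectivity[of "\<alpha> ^ (?q ^ (j - i))" \<alpha>] by simp
  qed
  define D where "D = (LEAST d. d > 0 \<and> \<alpha> ^ (?q ^ d) = \<alpha>)"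
  have ex: "j - i > 0 \<and> \<alpha> ^ (?q ^ (j - i)) = \<alpha>" using ij period[OF ij] by simp
  have D: "D > 0 \<and> \<alpha> ^ (?q ^ D) = \<alpha>" unfolding D_def by (rule LeastI[of _ "j - i"], rule ex)
  have minD: "D \<le> k" if "k > 0" "\<alpha> ^ (?q ^ k) = \<alpha>" for k unfolding D_def using that by (intro Least_le) auto
  have inj: "inj_on (\<lambda>i. \<alpha> ^ (?q ^ i)) {..<D}"
  proof (rule inj_onI)
    fix a b assume ab: "a \<in> {..<D}" "b \<in> {..<D}" "\<alpha> ^ (?q ^ a) = \<alpha> ^ (?q ^ b)"
    have "\<not> a < b" using period[of a b] minD[of "b - a"] ab by fastforce
    moreover have "\<not> b < a" using period[of b a] minD[of "a - b"] ab by fastforce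
    ultimately show "a = b" by simp
  qed
  define Q where "Q = (\<Prod>i<D. [:- (\<alpha> ^ (?q ^ i)), 1:])"
  have degQ: "degree Q = D" unfolding Q_def by (subst degree_prod_sum_eq) auto
  have monQ: "monic Q" unfolding Q_def by (rule monic_prod) auto
  interpret F: inj_comm_ring_hom "\<lambda>x :: 'a alg_closure. x ^ ?q"
    using frobenius_hom[OF q, where i=1] by simp
  interpret FP: map_poly_inj_comm_ring_hom "\<lambda>x :: 'a alg_closure. x ^ ?q" ..
  \<comment> \<open>Frobenius moves the index by one, and the factor with index \<open>D\<close> is
    the one with index 0.\<close>
  have "map_poly (\<lambda>x. x ^ ?q) Q = (\<Prod>i<D. [:- (\<alpha> ^ (?q ^ Suc i)), 1:])"
    unfolding Q_def by (simp add: FP.hom_prod F.hom_uminus mult.commute flip: power_mult)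
  also have "\<dots> = (\<Prod>i\<in>{1..<Suc D}. [:- (\<alpha> ^ (?q ^ i)), 1:])"
    by (rule prod.reindex_bij_witness[of _ "\<lambda>i. i - 1" Suc]) auto
  also have "{1..<Suc D} = insert D {1..<D}" using D by auto
  also have "(\<Prod>i\<in>insert D {1..<D}. [:- (\<alpha> ^ (?q ^ i)), 1:]) = (\<Prod>i\<in>insert 0 {1..<D}. [:- (\<alpha> ^ (?q ^ i)), 1:])"
    using D by simp
  also have "insert 0 {1..<D} = {..<D}" using D by auto
  finally have FQ: "map_poly (\<lambda>x. x ^ ?q) Q = Q" by (simp add: Q_def)
  have "coeff Q k \<in> range to_ac" for k
  proof (rule frobenius_fixed_imp_to_ac)
    have "coeff (map_poly (\<lambda>x. x ^ ?q) Q) k = coeff Q k ^ ?q" by (rule coeff_map_poly) simp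
    thus "coeff Q k ^ ?q = coeff Q k" by (simp only: FQ)
  qed
  hence "\<forall>k. coeff Q k \<in> range to_ac" by blast
  hence Q0: "ac_poly (map_poly of_ac Q) = Q"
    by (intro poly_eqI) (simp add: coeff_map_poly to_ac_of_ac)
  define Q' where "Q' = map_poly of_ac Q"
  have acQ': "ac_poly Q' = Q" using Q0 by (simp add: Q'_def)
  have degQ': "degree Q' = D" using degQ unfolding acQ'[symmetric] by simp
  have monQ': "monic Q'"
    using monQ unfolding acQ'[symmetric] by simp
  \<comment> \<open>Otherwise the two are coprime, and Bezout's identity fails at the common
    root.\<close>
  have "P dvd Q'"
  proof (rule ccontr)
    assume "\<not> P dvd Q'"
    hence "coprime P Q'" using irr by (meson irreducible_imp_prime_elem_gcd prime_elem_imp_coprime)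
    hence "fst (bezout_coefficients P Q') * P + snd (bezout_coefficients P Q') * Q' = 1"
      by (simp add: bezout_coefficients_fst_snd)
    hence "poly (ac_poly (fst (bezout_coefficients P Q') * P + snd (bezout_coefficients P Q') * Q')) \<alpha> = 1"
      by simp
    moreover have "poly Q \<alpha> = 0" unfolding Q_def poly_prod
      using D by (intro prod_zero bexI[of _ 0]) auto
    ultimately show False by (simp add: to_ac_poly.hom_add to_ac_poly.hom_mult acQ' root)
  qed
  have "degree P \<le> D" using dvd_imp_degree_le[OF \<open>P dvd Q'\<close>] degQ' monQ' by fastforce
  moreover have "D \<le> degree P"
  proof -
    have "card ((\<lambda>i. \<alpha> ^ (?q ^ i)) ` {..<D}) = D" using inj by (simp add: card_image)
    moreover have "(\<lambda>i. \<alpha> ^ (?q ^ i)) ` {..<D} \<subseteq> {x. poly (ac_poly P) x = 0}" using roots by auto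
    ultimately have "D \<le> card {x. poly (ac_poly P) x = 0}" using card_mono[OF fin] by metis
    also have "\<dots> \<le> degree (ac_poly P)" by (rule poly_roots_degree[OF acP0])
    finally show ?thesis by simp
  qed
  ultimately have dD: "degree P = D" by simp
  obtain r where r: "Q' = P * r" using \<open>P dvd Q'\<close> by blast
  have "r \<noteq> 0" using r monQ' by force
  hence "degree r = 0" using r dD degQ' P0 by (simp add: degree_mult_eq)
  moreover have "lead_coeff r = 1" using monQ' mon unfolding r lead_coeff_mult by simp
  ultimately have "r = 1" by (metis degree_0_id lead_coeff_pCons(2) monic_degree_0)
  hence "ac_poly P = Q" using r acQ' by simp
  thus ?thesis using that[of \<alpha>] inj D dD unfolding Q_def by simp
qed

text \<open>The sum of q^i over i < k is the exponent of the norm from the field with q^k elements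
  to the base field. The conjugates of \<alpha> repeat with period \<open>degree P\<close>, so the
  norm of b - \<alpha> runs \<open>a\<close> times through the linear factors of \<open>P\<close> at
  \<open>b\<close>.\<close>

lemma norm_linear_at_root:
  fixes P :: "'a::{finite_field,field_gcd} poly"
  assumes q: "prime CARD('a)" and d: "degree P * a = k"
    and \<alpha>: "\<alpha> ^ (CARD('a) ^ degree P) = \<alpha>" "ac_poly P = (\<Prod>i<degree P. [:- (\<alpha> ^ (CARD('a) ^ i)), 1:])"
  shows "(to_ac b - \<alpha>) ^ (\<Sum>i<k. CARD('a) ^ i) = to_ac (poly P b) ^ a"
proof -
  let ?q = "CARD('a)" let ?d = "degree P"
  have fr: "(to_ac b - x) ^ (?q ^ i) = to_ac b - x ^ (?q ^ i)" for i and x :: "'a alg_closure"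
  proof -
    interpret F: inj_comm_ring_hom "\<lambda>x :: 'a alg_closure. x ^ (?q ^ i)" by (rule frobenius_hom[OF q])
    show ?thesis using F.hom_minus[of "to_ac b" x] unfolding to_ac_frobenius .
  qed
  have per: "\<alpha> ^ (?q ^ (?d * a)) = \<alpha>" for a
  proof (induction a)
    case (Suc a)
    have "\<alpha> ^ (?q ^ (?d * Suc a)) = (\<alpha> ^ (?q ^ ?d)) ^ (?q ^ (?d * a))"
      by (simp only: mult_Suc_right power_add power_mult)
    also have "\<dots> = \<alpha>" by (simp only: \<alpha> Suc.IH)
    finally show ?case .
  qed simp
  have ev: "(\<Prod>i<?d. to_ac b - \<alpha> ^ (?q ^ i)) = to_ac (poly P b)"
  proof -
    have "to_ac (poly P b) = poly (ac_poly P) (to_ac b)" by (simp add: to_ac.poly_map_poly)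
    also have "\<dots> = (\<Prod>i<?d. to_ac b - \<alpha> ^ (?q ^ i))" by (subst \<alpha>(2)) (simp add: poly_prod)
    finally show ?thesis ..
  qed
  have pr: "(\<Prod>i<?d * a. to_ac b - \<alpha> ^ (?q ^ i)) = to_ac (poly P b) ^ a" for a
  proof (induction a)
    case (Suc a)
    have "(\<Prod>i<?d * Suc a. to_ac b - \<alpha> ^ (?q ^ i)) =
       (\<Prod>i<?d * a. to_ac b - \<alpha> ^ (?q ^ i)) * (\<Prod>i\<in>{?d * a..<?d * a + ?d}. to_ac b - \<alpha> ^ (?q ^ i))"
      by (subst prod.union_disjoint[symmetric]) (auto intro!: prod.cong)
    also have "(\<Prod>i\<in>{?d * a..<?d * a + ?d}. to_ac b - \<alpha> ^ (?q ^ i)) = (\<Prod>i<?d. to_ac b - \<alpha> ^ (?q ^ (?d * a + i)))"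
      by (rule prod.reindex_bij_witness[of _ "\<lambda>i. ?d * a + i" "\<lambda>i. i - ?d * a"]) auto
    also have "\<dots> = (\<Prod>i<?d. to_ac b - \<alpha> ^ (?q ^ i))"
    proof (rule prod.cong[OF refl])
      fix i
      have "\<alpha> ^ (?q ^ (?d * a + i)) = (\<alpha> ^ (?q ^ (?d * a))) ^ (?q ^ i)" by (simp only: power_add power_mult)
      thus "to_ac b - \<alpha> ^ (?q ^ (?d * a + i)) = to_ac b - \<alpha> ^ (?q ^ i)" by (simp only: per)
    qed
    finally show ?case using Suc ev by simp
  qed auto
  moreover have "(to_ac b - \<alpha>) ^ (\<Sum>i<k. ?q ^ i) = (\<Prod>i<k. to_ac b - \<alpha> ^ (?q ^ i))"
    by (simp only: power_sum fr)
  ultimately show ?thesis using pr[of a] unfolding d by simp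
qed

section \<open>Monic polynomials, prime powers and the recurrence of the L-function\<close>

definition monics :: "nat \<Rightarrow> 'a::field poly set" where
  "monics m = {g. monic g \<and> degree g = m}"

text \<open>Small degree is expressed by vanishing coefficients throughout, so that zero is included
  and the bound 0 leaves the zero polynomial alone.\<close>

lemma polys_lt_Suc:
  "{p :: 'a::zero poly. \<forall>i\<ge>Suc B. coeff p i = 0} = (\<lambda>(a, p). pCons a p) ` (UNIV \<times> {p. \<forall>i\<ge>B. coeff p i = 0})"
proof (intro equalityI subsetI)
  fix p :: "'a poly" assume p: "p \<in> {p. \<forall>i\<ge>Suc B. coeff p i = 0}"
  obtain a r where ar: "p = pCons a r" by (cases p)
  have "coeff r i = 0" if "i \<ge> B" for i using p that by (auto simp: ar coeff_pCons split: nat.splits)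
  thus "p \<in> (\<lambda>(a, p). pCons a p) ` (UNIV \<times> {p. \<forall>i\<ge>B. coeff p i = 0})" using ar by auto
qed (auto simp: coeff_pCons split: nat.splits)

lemma card_polys_lt:
  "finite {p :: 'a::{zero,finite} poly. \<forall>i\<ge>B. coeff p i = 0} \<and> card {p :: 'a poly. \<forall>i\<ge>B. coeff p i = 0} = CARD('a) ^ B"
proof (induction B)
  case 0
  have "{p :: 'a poly. \<forall>i\<ge>0. coeff p i = 0} = {0}" by (auto simp: poly_eq_iff)
  thus ?case by simp
next
  case (Suc B)
  have "inj_on (\<lambda>(a, p). pCons a p) (UNIV \<times> {p :: 'a poly. \<forall>i\<ge>B. coeff p i = 0})"
    by (auto simp: inj_on_def)
  thus ?case unfolding polys_lt_Suc using Suc by (simp add: card_image card_cartesian_product)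
qed

lemma monics_eq_image:
  "(monics m :: 'a::field poly set) = (\<lambda>p. monom 1 m + p) ` {p. \<forall>i\<ge>m. coeff p i = 0}"
proof (intro equalityI subsetI)
  fix g :: "'a poly" assume g: "g \<in> monics m"
  have "coeff (g - monom 1 m) i = 0" if "i \<ge> m" for i
    using g that by (cases "i = m") (auto simp: monics_def coeff_eq_0)
  thus "g \<in> (\<lambda>p. monom 1 m + p) ` {p. \<forall>i\<ge>m. coeff p i = 0}"
    by (intro image_eqI[of _ _ "g - monom 1 m"]) auto
next
  fix g :: "'a poly" assume "g \<in> (\<lambda>p. monom 1 m + p) ` {p. \<forall>i\<ge>m. coeff p i = 0}"
  then obtain p where p: "g = monom 1 m + p" "\<forall>i\<ge>m. coeff p i = 0" by auto
  have c: "coeff g i = (if i = m then 1 else 0)" if "i \<ge> m" for i using p that by auto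
  have "degree g \<le> m" by (rule degree_le) (use c in auto)
  moreover have "m \<le> degree g" by (rule le_degree) (use c in auto)
  ultimately have "degree g = m" by simp
  thus "g \<in> monics m" using c[of m] by (simp add: monics_def)
qed

lemma finite_monics [simp]: "finite (monics m :: 'a::{field,finite} poly set)"
  unfolding monics_eq_image using card_polys_lt[where ?'a='a] by simp

lemma card_monics: "card (monics m :: 'a::{field,finite} poly set) = CARD('a) ^ m"
  unfolding monics_eq_image using card_polys_lt[where ?'a='a]
  by (subst card_image) (auto simp: inj_on_def)

lemma prime_poly_monic:
  fixes P :: "'a::{field_gcd} poly"
  assumes "prime P"
  shows "monic P"
proof -
  have P0: "P \<noteq> 0" using assms by auto
  have "lead_coeff P = unit_factor (lead_coeff P)"
    using unit_factor_mult_normalize[of "lead_coeff P"] is_unit_normalize[of "lead_coeff P"] P0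
    by (simp add: dvd_field_iff)
  moreover have "coeff (normalize P) (degree P) = coeff P (degree P) div unit_factor (lead_coeff P)"
    by (rule coeff_normalize)
  ultimately show ?thesis using assms P0 by (simp add: normalize_prime)
qed

lemma prime_poly_degree_pos:
  fixes P :: "'a::{field_gcd} poly"
  assumes "prime P" shows "degree P > 0"
proof -
  have "\<not> is_unit P" using assms not_prime_unit[of P] by blast
  moreover have "P \<noteq> 0" using assms by auto
  ultimately show ?thesis using is_unit_iff_degree[of P] by simp
qed

lemma degree_eq_sum_multiplicity:
  fixes g :: "'a::{field_gcd} poly"
  assumes "monic g"
  shows "degree g = (\<Sum>P\<in>prime_factors g. multiplicity P g * degree P)"
proof -
  have g0: "g \<noteq> 0" using assms by auto
  have "g = (\<Prod>P\<in>prime_factors g. P ^ multiplicity P g)"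
    using prod_prime_factors[OF g0] normalize_monic[OF assms] by simp
  hence "degree g = degree (\<Prod>P\<in>prime_factors g. P ^ multiplicity P g)" by simp
  also have "\<dots> = (\<Sum>P\<in>prime_factors g. degree (P ^ multiplicity P g))"
    by (rule degree_prod_sum_eq) (auto dest: in_prime_factors_imp_prime)
  also have "\<dots> = (\<Sum>P\<in>prime_factors g. multiplicity P g * degree P)"
    by (intro sum.cong refl) (auto simp: degree_power_eq dest: in_prime_factors_imp_prime)
  finally show ?thesis .
qed

text \<open>A pair stands for the prime power \<open>P ^ a\<close>. Weighted by
  \<open>degree P\<close>, these sets carry the analogue of von Mangoldt's function.\<close>

definition prime_powers_deg :: "nat \<Rightarrow> ('a::field_gcd poly \<times> nat) set" where
  "prime_powers_deg k = {(P, a). prime P \<and> a * degree P = k}"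

lemma finite_prime_powers_le: "finite {(P :: 'a::{field_gcd,finite} poly, a). prime P \<and> a \<ge> 1 \<and> a * degree P \<le> m}"
proof (rule finite_subset)
  show "{(P :: 'a poly, a). prime P \<and> a \<ge> 1 \<and> a * degree P \<le> m} \<subseteq> (\<Union>d\<le>m. monics d) \<times> {..m}"
  proof safe
    fix P :: "'a poly" and a :: nat assume P: "prime P" "a \<ge> 1" "a * degree P \<le> m"
    have "degree P \<ge> 1" using prime_poly_degree_pos[OF P(1)] by simp
    hence "degree P \<le> a * degree P" "a \<le> a * degree P" using P by auto
    hence "degree P \<le> m" "a \<le> m" using P(3) by linarith+
    thus "P \<in> (\<Union>d\<le>m. monics d)" "a \<le> m" using prime_poly_monic[OF P(1)] by (auto simp: monics_def)
  qed
qed auto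

text \<open>Von Mangoldt's function convolved with 1 is the logarithm, here the degree: a prime
  factor of \<open>g\<close> is counted once for each exponent up to its multiplicity.\<close>

lemma sum_degree_prime_powers_dvd:
  fixes g :: "'a::{field_gcd,finite} poly"
  assumes "g \<in> monics m"
  shows "(\<Sum>(P, a) | prime P \<and> a \<ge> 1 \<and> a * degree P \<le> m \<and> P ^ a dvd g. degree P) = m"
proof -
  have g: "monic g" "degree g = m" and g0: "g \<noteq> 0" using assms by (auto simp: monics_def)
  have eq: "{(P, a). prime P \<and> a \<ge> 1 \<and> a * degree P \<le> m \<and> P ^ a dvd g} =
    (SIGMA P:prime_factors g. {1..multiplicity P g})"
  proof safe
    fix P a assume P: "prime P" "1 \<le> a" "P ^ a dvd g"
    have "P dvd g" using P(2,3) dvd_power[of a P] dvd_trans by fastforce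
    thus "P \<in> prime_factors g" using P g0 by (simp add: prime_factors_dvd)
    have nu: "\<not> is_unit P" using P(1) not_prime_unit by blast
    show "a \<in> {1..multiplicity P g}"
      using P power_dvd_iff_le_multiplicity[OF g0 nu, of a] by simp
  next
    fix P a assume P: "P \<in># prime_factorization g" "a \<in> {1..multiplicity P g}"
    show pr: "prime P" using P by auto
    show "1 \<le> a" using P by auto
    have nu: "\<not> is_unit P" using pr not_prime_unit by blast
    show dv: "P ^ a dvd g"
      using P power_dvd_iff_le_multiplicity[OF g0 nu, of a] by simp
    have "degree (P ^ a) \<le> degree g" using dvd_imp_degree_le[OF dv g0] .
    thus "a * degree P \<le> m" using pr g by (auto simp: degree_power_eq mult.commute)
  qed
  have "(\<Sum>(P, a) | prime P \<and> a \<ge> 1 \<and> a * degree P \<le> m \<and> P ^ a dvd g. degree P) =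
     (\<Sum>P\<in>prime_factors g. \<Sum>a\<in>{1..multiplicity P g}. degree P)"
    unfolding eq by (subst sum.Sigma) auto
  also have "\<dots> = m" using degree_eq_sum_multiplicity[OF g(1)] g(2) by simp
  finally show ?thesis .
qed

text \<open>Coefficient by coefficient this is the logarithmic derivative of the Euler product. It
  is obtained without infinite products: the factor m is written as the sum of
  \<open>degree P\<close> over the prime powers dividing g, and the sum over g with a given divisor
  is a sum over the cofactor.\<close>

lemma L_function_recurrence:
  fixes \<psi> :: "'a::{field_gcd,finite} poly \<Rightarrow> complex"
  assumes psi1: "\<psi> 1 = 1" and psim: "\<And>g h. monic g \<Longrightarrow> monic h \<Longrightarrow> \<psi> (g * h) = \<psi> g * \<psi> h"
  shows "of_nat m * (\<Sum>g\<in>monics m. \<psi> g) =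
    (\<Sum>k=1..m. (\<Sum>(P, a)\<in>prime_powers_deg k. of_nat (degree P) * \<psi> P ^ a) * (\<Sum>g\<in>monics (m - k). \<psi> g))"
proof -
  define PP where "PP = {(P :: 'a poly, a). prime P \<and> a \<ge> 1 \<and> a * degree P \<le> m}"
  have fin: "finite PP" unfolding PP_def by (rule finite_prime_powers_le)
  have psipow: "\<psi> (P ^ a) = \<psi> P ^ a" if "monic P" for P a
    by (induction a) (auto simp: psi1 psim that monic_power)
  have inner: "(\<Sum>g | g \<in> monics m \<and> P ^ a dvd g. \<psi> g) = \<psi> P ^ a * (\<Sum>h\<in>monics (m - a * degree P). \<psi> h)"
    if "(P, a) \<in> PP" for P a
  proof -
    have P: "prime P" "monic P" "a * degree P \<le> m" using that prime_poly_monic by (auto simp: PP_def)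
    have mp: "monic (P ^ a)" using P by (simp add: monic_power)
    have P0: "P ^ a \<noteq> 0" "degree (P ^ a) = a * degree P" using P by (auto simp: degree_power_eq)
    have "(\<Sum>g | g \<in> monics m \<and> P ^ a dvd g. \<psi> g) = (\<Sum>h\<in>monics (m - a * degree P). \<psi> (P ^ a * h))"
    proof (rule sum.reindex_bij_witness[of _ "\<lambda>h. P ^ a * h" "\<lambda>g. g div P ^ a"])
      fix g assume g: "g \<in> {g \<in> monics m. P ^ a dvd g}"
      then obtain h where h: "g = P ^ a * h" by (auto simp: dvd_def)
      have m: "monic g" "degree g = m" using g by (auto simp: monics_def)
      hence h0: "h \<noteq> 0" using h by force
      have "degree h = m - a * degree P" using m h h0 P0 by (auto simp: degree_mult_eq)
      moreover have "monic h" using m(1) mp unfolding h lead_coeff_mult by simp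
      ultimately show "g div P ^ a \<in> monics (m - a * degree P)" using h P0 by (simp add: monics_def)
    next
      fix h :: "'a poly" assume h: "h \<in> monics (m - a * degree P)"
      hence h0: "h \<noteq> 0" and mh: "lead_coeff h = 1" by (auto simp: monics_def)
      have "degree (P ^ a * h) = m" using h h0 P0 P by (auto simp: degree_mult_eq monics_def)
      moreover have "monic (P ^ a * h)" unfolding lead_coeff_mult using mp mh by simp
      ultimately show "P ^ a * h \<in> {g \<in> monics m. P ^ a dvd g}" by (simp add: monics_def)
    qed (use P0 in auto)
    also have "\<dots> = \<psi> P ^ a * (\<Sum>h\<in>monics (m - a * degree P). \<psi> h)"
      unfolding sum_distrib_left using mp psipow[OF P(2)] psim[OF mp] by (intro sum.cong refl) (auto simp: monics_def)
    finally show ?thesis .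
  qed
  have "of_nat m * (\<Sum>g\<in>monics m. \<psi> g) = (\<Sum>g\<in>monics m. of_nat (\<Sum>(P, a) | prime P \<and> a \<ge> 1 \<and> a * degree P \<le> m \<and> P ^ a dvd g. degree P) * \<psi> g)"
    unfolding sum_distrib_left by (intro sum.cong refl) (simp only: sum_degree_prime_powers_dvd)
  also have "\<dots> = (\<Sum>g\<in>monics m. \<Sum>x\<in>{x\<in>PP. fst x ^ snd x dvd g}. of_nat (degree (fst x)) * \<psi> g)"
  proof (intro sum.cong refl)
    fix g :: "'a poly"
    have "{(P, a). prime P \<and> a \<ge> 1 \<and> a * degree P \<le> m \<and> P ^ a dvd g} = {x\<in>PP. fst x ^ snd x dvd g}"
      by (auto simp: PP_def)
    thus "of_nat (\<Sum>(P, a) | prime P \<and> a \<ge> 1 \<and> a * degree P \<le> m \<and> P ^ a dvd g. degree P) * \<psi> g =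
      (\<Sum>x\<in>{x\<in>PP. fst x ^ snd x dvd g}. of_nat (degree (fst x)) * \<psi> g)"
      by (simp add: sum_distrib_right case_prod_beta)
  qed
  also have "\<dots> = (\<Sum>x\<in>PP. \<Sum>g | g \<in> monics m \<and> fst x ^ snd x dvd g. of_nat (degree (fst x)) * \<psi> g)"
    by (rule sum.swap_restrict) (use fin in auto)
  also have "\<dots> = (\<Sum>x\<in>PP. of_nat (degree (fst x)) * (\<psi> (fst x) ^ snd x * (\<Sum>h\<in>monics (m - snd x * degree (fst x)). \<psi> h)))"
  proof (intro sum.cong refl)
    fix x assume x: "x \<in> PP"
    obtain P a where Pa: "x = (P, a)" by (cases x)
    show "(\<Sum>g | g \<in> monics m \<and> fst x ^ snd x dvd g. of_nat (degree (fst x)) * \<psi> g) =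
      of_nat (degree (fst x)) * (\<psi> (fst x) ^ snd x * (\<Sum>h\<in>monics (m - snd x * degree (fst x)). \<psi> h))"
      unfolding sum_distrib_left[symmetric] using inner[of P a] x by (simp only: Pa fst_conv snd_conv)
  qed
  also have "\<dots> = (\<Sum>k\<in>{1..m}. \<Sum>x\<in>{x\<in>PP. snd x * degree (fst x) = k}. of_nat (degree (fst x)) * (\<psi> (fst x) ^ snd x * (\<Sum>h\<in>monics (m - snd x * degree (fst x)). \<psi> h)))"
  proof (rule sum.group[symmetric])
    show "(\<lambda>x. snd x * degree (fst x)) ` PP \<subseteq> {1..m}"
    proof
      fix k assume "k \<in> (\<lambda>x. snd x * degree (fst x)) ` PP"
      then obtain P a where "(P, a) \<in> PP" "k = a * degree P" by auto
      thus "k \<in> {1..m}" using prime_poly_degree_pos[of P] by (simp add: PP_def Suc_le_eq)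
    qed
  qed (use fin in auto)
  also have "\<dots> = (\<Sum>k=1..m. (\<Sum>(P, a)\<in>prime_powers_deg k. of_nat (degree P) * \<psi> P ^ a) * (\<Sum>g\<in>monics (m - k). \<psi> g))"
  proof (intro sum.cong refl)
    fix k assume k: "k \<in> {1..m}"
    have "a \<ge> 1" if "a * degree P = k" for a and P :: "'a poly" using that k by (cases a) auto
    hence "{x\<in>PP. snd x * degree (fst x) = k} = prime_powers_deg k"
      using k by (auto simp: PP_def prime_powers_deg_def)
    thus "(\<Sum>x\<in>{x\<in>PP. snd x * degree (fst x) = k}. of_nat (degree (fst x)) * (\<psi> (fst x) ^ snd x * (\<Sum>h\<in>monics (m - snd x * degree (fst x)). \<psi> h))) =
      (\<Sum>(P, a)\<in>prime_powers_deg k. of_nat (degree P) * \<psi> P ^ a) * (\<Sum>g\<in>monics (m - k). \<psi> g)"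
      unfolding sum_distrib_right by (intro sum.cong) (auto simp: prime_powers_deg_def)
  qed
  finally show ?thesis .
qed

section \<open>Inverse zeros of the L-function and their power sums\<close>

lemma reflect_prod_linear:
  "reflect_poly (\<Prod>x\<in>#A. [:- x, 1:]) = (\<Prod>x\<in>#A. [:1, - (x::complex):])"
proof (induction A)
  case (add x A)
  have "reflect_poly [:- x, 1:] = [:1, - x:]" by (intro poly_eqI) (auto simp: coeff_reflect_poly coeff_pCons split: nat.splits)
  thus ?case using add by (simp only: image_mset_add_mset prod_mset.add_mset reflect_poly_mult)
qed auto

text \<open>Logarithmic derivative of a product, factor by factor: the factor 1 - xT contributes
  minus the sum of x^k T^k over k \<ge> 1.\<close>

lemma fps_deriv_prod_linear:
  fixes A :: "complex multiset"
  shows "fps_X * fps_deriv (fps_of_poly (\<Prod>x\<in>#A. [:1, - x:])) =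
    fps_of_poly (\<Prod>x\<in>#A. [:1, - x:]) * (\<Sum>x\<in>#A. Abs_fps (\<lambda>k. if k = 0 then 0 else - (x ^ k)))"
proof (induction A)
  case (add x A)
  let ?H = "fps_of_poly (\<Prod>x\<in>#A. [:1, - x:])"
  let ?G = "Abs_fps (\<lambda>k. if k = 0 then 0 else - (x ^ k))"
  let ?l = "fps_of_poly [:1, -x:]"
  have l: "?l = 1 - fps_const x * fps_X"
    by (simp add: fps_of_poly_pCons fps_const_neg[symmetric] mult.commute del: fps_const_neg)
  have dl: "fps_deriv ?l = - fps_const x" unfolding l by (simp add: fps_deriv_mult)
  have G: "?l * ?G = - (fps_const x * fps_X)"
  proof (rule fps_ext)
    fix n
    have "(?l * ?G) $ n = ?G $ n - x * (fps_X * ?G) $ n"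
      unfolding l by (simp add: algebra_simps)
    also have "\<dots> = (- (fps_const x * fps_X)) $ n"
      by (cases n) (auto simp: fps_X_nth)
    finally show "(?l * ?G) $ n = (- (fps_const x * fps_X)) $ n" .
  qed
  have "fps_X * fps_deriv (?l * ?H) = (- (fps_const x * fps_X)) * ?H + ?l * (fps_X * fps_deriv ?H)"
    by (simp add: dl algebra_simps)
  also have "\<dots> = ?l * ?H * (?G + (\<Sum>x\<in>#A. Abs_fps (\<lambda>k. if k = 0 then 0 else - (x ^ k))))"
    unfolding add.IH G[symmetric] by (simp add: algebra_simps)
  finally show ?case by (simp only: image_mset_add_mset prod_mset.add_mset sum_mset.add_mset fps_of_poly_mult)
qed auto

lemma fps_nth_sum_mset: "(\<Sum>x\<in>#A. f x) $ k = (\<Sum>x\<in>#A. f x $ k)"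
  by (induction A) auto

text \<open>The recurrence says T R' = R S for the polynomial \<open>R\<close> with coefficients
  \<open>L\<close> and the series \<open>S\<close>. Writing \<open>R\<close> as a product of factors
  1 - xT and comparing with its logarithmic derivative reads off \<open>S\<close>.\<close>

lemma newton_power_sums:
  fixes L S :: "nat \<Rightarrow> complex"
  assumes L0: "L 0 = 1" and Ln: "\<And>m. m \<ge> n \<Longrightarrow> L m = 0"
    and rec: "\<And>m. of_nat m * L m = (\<Sum>k=1..m. S k * L (m - k))"
  obtains A where "size A \<le> n" "\<And>k. k \<ge> 1 \<Longrightarrow> S k = - (\<Sum>x\<in>#A. x ^ k)"
proof -
  define R where "R = (\<Sum>i<n. monom (L i) i)"
  have cR: "coeff R i = L i" for i
  proof -
    have "coeff R i = (\<Sum>j<n. if j = i then L j else 0)" by (simp add: R_def coeff_sum)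
    also have "\<dots> = L i" using Ln[of i] by simp
    finally show ?thesis .
  qed
  have R0: "R \<noteq> 0" using cR[of 0] L0 by auto
  have c0: "coeff R 0 \<noteq> 0" using cR L0 by simp
  \<comment> \<open>The inverse zeros of \<open>R\<close> are the zeros of the reflected polynomial,
    which is monic because \<open>L 0 = 1\<close>.\<close>
  define p where "p = reflect_poly R"
  have Rp: "reflect_poly p = R" using c0 unfolding p_def by (rule reflect_poly_reflect_poly)
  have lp: "lead_coeff p = 1" using coeff_0_reflect_poly[of p] cR[of 0] L0 unfolding Rp by simp
  hence "p \<noteq> 0" by auto
  then obtain A where A: "size A = degree p" "p = smult (lead_coeff p) (\<Prod>x\<in>#A. [:- x, 1:])"
    using alg_closed_imp_factorization by blast
  have p: "p = (\<Prod>x\<in>#A. [:- x, 1:])" using A lp by simp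
  have R: "R = (\<Prod>x\<in>#A. [:1, - x:])" using Rp reflect_prod_linear[of A] p by simp
  have "degree p \<le> degree R" unfolding p_def by (rule degree_reflect_poly_le)
  moreover have "degree R \<le> n" by (rule degree_le) (use Ln cR in auto)
  ultimately have size: "size A \<le> n" using A by simp
  define Sf where "Sf = Abs_fps (\<lambda>k. if k = 0 then 0 else S k)"
  have "fps_X * fps_deriv (fps_of_poly R) = fps_of_poly R * Sf"
  proof (rule fps_ext)
    fix m
    have "(fps_of_poly R * Sf) $ m = (Sf * fps_of_poly R) $ m" by (simp add: mult.commute)
    also have "\<dots> = (\<Sum>k=0..m. (if k = 0 then 0 else S k) * L (m - k))" by (simp add: fps_mult_nth Sf_def cR)
    also have "\<dots> = (\<Sum>k=1..m. S k * L (m - k))"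
      by (rule sum.mono_neutral_cong_right) auto
    also have "\<dots> = of_nat m * L m" by (simp add: rec)
    also have "\<dots> = (fps_X * fps_deriv (fps_of_poly R)) $ m" by (cases m) (auto simp: cR)
    finally show "(fps_X * fps_deriv (fps_of_poly R)) $ m = (fps_of_poly R * Sf) $ m" ..
  qed
  hence eq: "fps_of_poly R * Sf = fps_of_poly R * (\<Sum>x\<in>#A. Abs_fps (\<lambda>k. if k = 0 then 0 else - (x ^ k)))"
    using fps_deriv_prod_linear[of A] by (simp only: R)
  have nz: "fps_of_poly R \<noteq> 0" using R0 by simp
  have "Sf = (\<Sum>x\<in>#A. Abs_fps (\<lambda>k. if k = 0 then 0 else - (x ^ k)))"
    using eq mult_left_cancel[OF nz] by blast
  hence S: "Sf $ k = (\<Sum>x\<in>#A. Abs_fps (\<lambda>k. if k = 0 then 0 else - (x ^ k)) $ k)" for k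
    by (simp add: fps_nth_sum_mset)
  have "S k = - (\<Sum>x\<in>#A. x ^ k)" if "k \<ge> 1" for k
  proof -
    have "S k = (\<Sum>x\<in>#A. - (x ^ k))" using S[of k] that by (simp add: Sf_def)
    also have "\<dots> = - (\<Sum>x\<in>#A. x ^ k)" by (induction A) auto
    finally show ?thesis .
  qed
  thus ?thesis using that size by blast
qed

text \<open>The map sends the unit disc to a half plane. In the next lemma this keeps the other
  terms from cancelling a pole.\<close>

lemma Re_mobius_ge:
  fixes u :: complex assumes "norm u < 1"
  shows "Re (u / (1 - u)) \<ge> - 1/2"
proof -
  have u1: "u \<noteq> 1" using assms by auto
  have "u / (1 - u) = (1 + u) / (2 * (1 - u)) - 1/2" using u1 by (simp add: field_simps)
  moreover have "Re ((1 + u) / (2 * (1 - u))) \<ge> 0"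
  proof -
    have n: "(Re u)\<^sup>2 + (Im u)\<^sup>2 \<le> 1" using power_le_one[of "cmod u" 2] assms by (simp add: cmod_power2)
    have "Re ((1 + u) / (2 * (1 - u))) = Re ((1 + u) * cnj (2 * (1 - u))) / (norm (2 * (1 - u)))\<^sup>2"
      by (simp add: complex_div_cnj[of "1 + u"])
    moreover have "Re ((1 + u) * cnj (2 * (1 - u))) = 2 * (1 - ((Re u)\<^sup>2 + (Im u)\<^sup>2))"
      by (simp add: algebra_simps power2_eq_square)
    ultimately show ?thesis using n by simp
  qed
  ultimately show ?thesis by simp
qed

text \<open>If the largest modulus R exceeded q, the power series formed from the power sums would
  stay bounded as |z| tends to 1 / R, while the geometric series of an element \<open>y0\<close> of
  modulus R has its pole at 1 / y0. The other elements contribute real parts of at least -1/2 each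
  and cannot compensate.\<close>

lemma power_sums_bound_imp_norm_le:
  fixes B :: "complex multiset" and q :: real
  assumes q: "q > 0" and bd: "\<And>m. m \<ge> 1 \<Longrightarrow> norm (\<Sum>y\<in>#B. y ^ m) \<le> C * q ^ m" and y: "y \<in># B"
  shows "norm y \<le> q"
proof (rule ccontr)
  assume "\<not> norm y \<le> q"
  define R where "R = Max (norm ` set_mset B)"
  have "R \<in> norm ` set_mset B" unfolding R_def using y by (intro Max_in) auto
  then obtain y0 where y0: "y0 \<in># B" "norm y0 = R" by auto
  have max: "norm x \<le> R" if "x \<in># B" for x unfolding R_def using that by (intro Max_ge) auto
  have R: "R > q" using max[OF y] \<open>\<not> norm y \<le> q\<close> by simp
  have C0: "C \<ge> 0" using order_trans[OF norm_ge_zero bd[of 1]] q by (simp add: zero_le_mult_iff)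
  define C' where "C' = C * ((q / R) / (1 - q / R))"
  have C': "C' \<ge> 0" unfolding C'_def using C0 R q by (intro mult_nonneg_nonneg divide_nonneg_nonneg) auto
  \<comment> \<open>\<open>C'\<close> bounds the series for every s below 1. The choice of s makes
    the singular term s / (1 - s) equal to \<open>T\<close>, more than \<open>C'\<close> and all
    other terms can balance.\<close>
  define T where "T = C' + real (size B) + 1"
  define s where "s = T / (1 + T)"
  have T: "T > 0" using C' by (simp add: T_def)
  have s: "0 < s" "s < 1" "s / (1 - s) = T" using T by (auto simp: s_def field_simps)
  define z where "z = of_real s / y0"
  have y00: "y0 \<noteq> 0" using y0 R q by auto
  have nz: "norm (x * z) < 1" if "x \<in># B" for x
  proof -
    have "norm (x * z) = norm x * s / R" using s y0 by (simp add: z_def norm_mult norm_divide)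
    also have "\<dots> \<le> s" using max[OF that] R q s by (simp add: field_simps)
    finally show ?thesis using s by simp
  qed
  have sums: "(\<lambda>m. \<Sum>x\<in>#A. (x * z) ^ Suc m) sums (\<Sum>x\<in>#A. (x * z) / (1 - x * z))" if "A \<subseteq># B" for A
    using that
  proof (induction A)
    case (add x A)
    have "x \<in># B" using mset_subset_eqD[OF add.prems] by simp
    hence "(\<lambda>m. (x * z) ^ m) sums (1 / (1 - x * z))" using nz by (intro geometric_sums) auto
    from sums_mult[OF this, of "x * z"] have "(\<lambda>m. (x * z) ^ Suc m) sums ((x * z) / (1 - x * z))" by simp
    moreover have "A \<subseteq># B" by (rule subset_mset.order_trans[OF _ add.prems]) simp
    ultimately show ?case using sums_add add.IH by (simp del: power_Suc)
  qed auto
  have tm: "norm (\<Sum>x\<in>#B. (x * z) ^ Suc m) \<le> C * (q / R) ^ Suc m" for m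
  proof -
    have "(\<Sum>x\<in>#B. (x * z) ^ Suc m) = (\<Sum>x\<in>#B. x ^ Suc m) * z ^ Suc m"
      by (simp add: power_mult_distrib sum_mset_distrib_right del: power_Suc)
    hence "norm (\<Sum>x\<in>#B. (x * z) ^ Suc m) = norm (\<Sum>x\<in>#B. x ^ Suc m) * norm z ^ Suc m"
      by (simp only: norm_mult norm_power)
    also have "\<dots> \<le> (C * q ^ Suc m) * (1 / R) ^ Suc m"
      using s y0 R q C0 by (intro mult_mono bd power_mono) (auto simp: z_def norm_divide field_simps)
    also have "\<dots> = C * (q / R) ^ Suc m" by (simp add: power_divide del: power_Suc)
    finally show ?thesis .
  qed
  have qR: "q / R < 1" "q / R > 0" using R q by auto
  have "(\<lambda>m. (q / R) ^ m) sums (1 / (1 - q / R))" using qR by (intro geometric_sums) auto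
  from sums_mult[OF this, of "C * (q / R)"] have g: "(\<lambda>m. C * (q / R) ^ Suc m) sums C'"
    by (simp add: C'_def mult.assoc)
  have up: "norm (\<Sum>x\<in>#B. (x * z) / (1 - x * z)) \<le> C'"
    using norm_suminf_le[OF tm sums_summable[OF g]]
    unfolding sums_unique[OF g, symmetric] sums_unique[OF sums[OF subset_mset.order_refl], symmetric] .
  have low: "Re (\<Sum>x\<in>#A. (x * z) / (1 - x * z)) \<ge> - real (size A) / 2" if "A \<subseteq># B" for A
    using that
  proof (induction A)
    case (add x A)
    have "x \<in># B" using mset_subset_eqD[OF add.prems] by simp
    moreover have "A \<subseteq># B" by (rule subset_mset.order_trans[OF _ add.prems]) simp
    ultimately show ?case using Re_mobius_ge[OF nz[of x]] add.IH by (simp add: field_simps)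
  qed auto
  obtain B' where B': "B = add_mset y0 B'" using multi_member_split[OF y0(1)] by blast
  have y0z: "y0 * z = of_real s" using y00 by (simp add: z_def)
  have "of_real s / (1 - of_real s) = (of_real (s / (1 - s)) :: complex)" by simp
  hence "(y0 * z) / (1 - y0 * z) = of_real T" unfolding y0z s(3) .
  hence "Re (\<Sum>x\<in>#B. (x * z) / (1 - x * z)) = T + Re (\<Sum>x\<in>#B'. (x * z) / (1 - x * z))"
    by (simp add: B')
  also have "\<dots> \<ge> T - real (size B') / 2" using low[of B'] by (simp add: B')
  finally have "T - real (size B') / 2 \<le> C'" using up complex_Re_le_cmod[of "\<Sum>x\<in>#B. (x * z) / (1 - x * z)"] by linarith
  thus False by (simp add: T_def B')
qed

text \<open>Stepanov's method below works in extensions of even degree, so only even power sums are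
  bounded, and the previous lemma is applied to the squares of the inverse zeros. The constant
  \<open>C\<close> disappears because the bound holds for every m.\<close>

lemma power_sum_one_bound:
  fixes L S :: "nat \<Rightarrow> complex" and n :: nat
  assumes L0: "L 0 = 1" and Ln: "\<And>m. m \<ge> n \<Longrightarrow> L m = 0"
    and rec: "\<And>m. of_nat m * L m = (\<Sum>k=1..m. S k * L (m - k))"
    and q: "q > 0" and bd: "\<And>m. m \<ge> 1 \<Longrightarrow> norm (S (2 * m)) \<le> C * q ^ m"
  shows "norm (S 1) \<le> real n * sqrt q"
proof -
  obtain A where A: "size A \<le> n" "\<And>k. k \<ge> 1 \<Longrightarrow> S k = - (\<Sum>x\<in>#A. x ^ k)"
    by (rule newton_power_sums[OF L0 Ln rec]) auto
  have x: "norm x \<le> sqrt q" if "x \<in># A" for x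
  proof -
    have "norm (\<Sum>y\<in>#image_mset (\<lambda>x. x ^ 2) A. y ^ m) \<le> C * q ^ m" if "m \<ge> 1" for m
      using bd[OF that] A(2)[of "2 * m"] that by (simp add: image_mset.compositionality o_def flip: power_mult)
    hence "norm (x ^ 2) \<le> q"
      by (rule power_sums_bound_imp_norm_le[OF q]) (use that in auto)
    thus ?thesis using real_le_rsqrt[of "norm x" q] by (simp add: norm_power)
  qed
  have "norm (\<Sum>x\<in>#B. x) \<le> real (size B) * sqrt q" if "B \<subseteq># A" for B using that
  proof (induction B)
    case (add y B)
    have "y \<in># A" using mset_subset_eqD[OF add.prems] by simp
    moreover have "B \<subseteq># A" by (rule subset_mset.order_trans[OF _ add.prems]) simp
    ultimately show ?case using add.IH x[of y] norm_triangle_ineq[of y "\<Sum>x\<in>#B. x"] by (simp add: algebra_simps)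
  qed auto
  from this[of A] have "norm (S 1) \<le> real (size A) * sqrt q" using A(2)[of 1] by simp
  also have "\<dots> \<le> real n * sqrt q" using A(1) q by (intro mult_right_mono) auto
  finally show ?thesis .
qed

section \<open>Stepanov's method and Weil's bound\<close>

text \<open>The s-th derivative divided by s! before reduction. Ordinary derivatives of order at
  least the characteristic vanish identically and could not detect the high multiplicities needed
  here.\<close>

definition hasse_deriv :: "nat \<Rightarrow> 'a::comm_semiring_1 poly \<Rightarrow> 'a poly" where
  "hasse_deriv s p = (\<Sum>i\<le>degree p. monom (of_nat ((i + s) choose s) * coeff p (i + s)) i)"

lemma coeff_hasse_deriv: "coeff (hasse_deriv s p) i = of_nat ((i + s) choose s) * coeff p (i + s)"
proof -
  have "coeff (hasse_deriv s p) i = (\<Sum>j\<le>degree p. if j = i then of_nat ((j + s) choose s) * coeff p (j + s) else 0)"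
    by (simp add: hasse_deriv_def coeff_sum)
  also have "\<dots> = of_nat ((i + s) choose s) * coeff p (i + s)"
    by (auto simp: coeff_eq_0)
  finally show ?thesis .
qed

lemma hasse_deriv_diff: "hasse_deriv s (p - q) = hasse_deriv s p - hasse_deriv s (q :: 'a::comm_ring_1 poly)"
  by (rule poly_eqI) (simp add: coeff_hasse_deriv algebra_simps)

lemma hasse_deriv_sum: "hasse_deriv s (\<Sum>i\<in>A. f i) = (\<Sum>i\<in>A. hasse_deriv s (f i :: 'a::comm_ring_1 poly))"
  by (rule poly_eqI) (simp add: coeff_hasse_deriv coeff_sum sum_distrib_left)

lemma hasse_deriv_smult: "hasse_deriv s (smult c p) = smult c (hasse_deriv s p)"
  by (rule poly_eqI) (simp add: coeff_hasse_deriv mult_ac)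

lemma hasse_deriv_monom: "hasse_deriv s (monom c n) = (if s \<le> n then monom (of_nat (n choose s) * c) (n - s) else 0)"
  by (rule poly_eqI) (auto simp: coeff_hasse_deriv)

lemma hasse_deriv_ac: "hasse_deriv s (ac_poly p) = ac_poly (hasse_deriv s p)"
  by (rule poly_eqI) (simp add: coeff_hasse_deriv)

text \<open>Taylor's formula in any characteristic; on a monomial it is the binomial theorem for X =
  (X - a) + a.\<close>

lemma hasse_taylor:
  fixes p :: "'a::comm_ring_1 poly"
  assumes "degree p \<le> N"
  shows "p = (\<Sum>s\<le>N. smult (poly (hasse_deriv s p) a) ([:- a, 1:] ^ s))"
proof -
  have mon: "(\<Sum>s\<le>N. smult (poly (hasse_deriv s (monom c n)) a) ([:- a, 1:] ^ s)) = monom c n" if "n \<le> N" for c n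
  proof -
    have "(\<Sum>s\<le>N. smult (poly (hasse_deriv s (monom c n)) a) ([:- a, 1:] ^ s)) =
       (\<Sum>s\<le>n. smult (poly (hasse_deriv s (monom c n)) a) ([:- a, 1:] ^ s))"
      using that by (intro sum.mono_neutral_right) (auto simp: hasse_deriv_monom)
    also have "\<dots> = (\<Sum>s\<le>n. smult c (of_nat (n choose s) * [:- a, 1:] ^ s * [:a:] ^ (n - s)))"
    proof (intro sum.cong refl)
      fix s assume "s \<in> {..n}"
      hence s: "s \<le> n" by simp
      have "of_nat (n choose s) * [:- a, 1:] ^ s * [:a:] ^ (n - s) = smult (of_nat (n choose s) * a ^ (n - s)) ([:- a, 1:] ^ s)"
        by (simp add: of_nat_poly poly_const_pow mult.commute)
      thus "smult (poly (hasse_deriv s (monom c n)) a) ([:- a, 1:] ^ s) = smult c (of_nat (n choose s) * [:- a, 1:] ^ s * [:a:] ^ (n - s))"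
        using s by (simp add: hasse_deriv_monom poly_monom mult_ac)
    qed
    also have "\<dots> = smult c (([:- a, 1:] + [:a:]) ^ n)"
      unfolding binomial_ring smult_sum2 ..
    also have "[:- a, 1:] + [:a:] = monom 1 1" by (simp add: monom_altdef)
    also have "smult c (monom 1 1 ^ n) = monom c n" by (simp add: monom_power smult_monom)
    finally show ?thesis .
  qed
  have p: "p = (\<Sum>n\<le>degree p. monom (coeff p n) n)" by (rule poly_as_sum_of_monoms[symmetric])
  have "(\<Sum>s\<le>N. smult (poly (hasse_deriv s p) a) ([:- a, 1:] ^ s)) =
     (\<Sum>s\<le>N. \<Sum>n\<le>degree p. smult (poly (hasse_deriv s (monom (coeff p n) n)) a) ([:- a, 1:] ^ s))"
    by (subst p) (simp add: hasse_deriv_sum poly_sum smult_sum)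
  also have "\<dots> = (\<Sum>n\<le>degree p. monom (coeff p n) n)"
    by (subst sum.swap) (use mon assms in \<open>auto intro!: sum.cong\<close>)
  finally show ?thesis using p by simp
qed

lemma dvd_of_hasse_deriv_zero:
  fixes p :: "'a::comm_ring_1 poly"
  assumes "\<And>s. s < l \<Longrightarrow> poly (hasse_deriv s p) a = 0"
  shows "[:- a, 1:] ^ l dvd p"
proof -
  have "[:- a, 1:] ^ l dvd (\<Sum>s\<le>degree p. smult (poly (hasse_deriv s p) a) ([:- a, 1:] ^ s))"
  proof (rule dvd_sum)
    fix s assume "s \<in> {..degree p}"
    show "[:- a, 1:] ^ l dvd smult (poly (hasse_deriv s p) a) ([:- a, 1:] ^ s)"
    proof (cases "s < l")
      case False
      thus ?thesis by (intro dvd_smult le_imp_power_dvd) simp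
    qed (simp add: assms)
  qed
  thus ?thesis by (subst hasse_taylor[OF order.refl, of p a])
qed

section \<open>The auxiliary polynomial of Stepanov's method\<close>

lemma coeff_mult_eq_0:
  fixes p r :: "'a::comm_semiring_0 poly"
  assumes "\<forall>i\<ge>M. coeff p i = 0" "degree r \<le> d"
  shows "\<forall>i\<ge>M + d. coeff (p * r) i = 0"
proof safe
  fix i assume i: "M + d \<le> i"
  have "coeff p j * coeff r (i - j) = 0" if "j \<le> i" for j
    using assms i that by (cases "M \<le> j") (auto simp: coeff_eq_0)
  thus "coeff (p * r) i = 0" by (simp add: coeff_mult)
qed

text \<open>Non-archimedean principle: the term of least order at \<open>b\<close> is alone with
  that order and cannot be cancelled.\<close>

lemma sum_distinct_orders_nonzero:
  fixes t :: "'i \<Rightarrow> 'a::idom poly"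
  assumes fin: "finite I" and ne: "I \<noteq> {}" and nz: "\<And>i. i \<in> I \<Longrightarrow> t i \<noteq> 0"
    and inj: "inj_on (\<lambda>i. order b (t i)) I"
  shows "(\<Sum>i\<in>I. t i) \<noteq> 0"
proof
  assume z: "(\<Sum>i\<in>I. t i) = 0"
  define r where "r = Min ((\<lambda>i. order b (t i)) ` I)"
  have "r \<in> (\<lambda>i. order b (t i)) ` I" unfolding r_def using fin ne by (intro Min_in) auto
  then obtain i0 where i0: "i0 \<in> I" "order b (t i0) = r" by auto
  have big: "[:- b, 1:] ^ Suc r dvd t i" if "i \<in> I - {i0}" for i
  proof -
    have "r \<le> order b (t i)" unfolding r_def using that fin by (intro Min_le) auto
    moreover have "order b (t i) \<noteq> r" using inj i0 that by (auto simp: inj_on_def)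
    ultimately have "Suc r \<le> order b (t i)" by simp
    thus ?thesis using order_1[of b "t i"] le_imp_power_dvd dvd_trans by blast
  qed
  have "[:- b, 1:] ^ Suc r dvd (\<Sum>i\<in>I - {i0}. t i)" by (rule dvd_sum) (rule big)
  moreover have "t i0 = - (\<Sum>i\<in>I - {i0}. t i)"
    using z fin i0(1) by (simp add: sum.remove eq_neg_iff_add_eq_0)
  ultimately have "[:- b, 1:] ^ Suc r dvd t i0" by (simp only: dvd_minus_iff)
  thus False using order_2[OF nz[OF i0(1)], of b] i0(2) by simp
qed

lemma card_roots_mult_le_degree:
  fixes p :: "'a::idom poly"
  assumes p: "p \<noteq> 0" and R: "\<And>x. x \<in> R \<Longrightarrow> [:- x, 1:] ^ l dvd p" and l: "l > 0"
  shows "finite R" "card R * l \<le> degree p"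
proof -
  have ord: "l \<le> order x p" if "x \<in> R" for x using R[OF that] order_max p by blast
  have sub: "R \<subseteq> {x. poly p x = 0}"
  proof
    fix x assume "x \<in> R"
    hence "order x p \<noteq> 0" using ord[of x] l by simp
    thus "x \<in> {x. poly p x = 0}" using order_root p by auto
  qed
  have fin: "finite {x. poly p x = 0}" by (rule poly_roots_finite[OF p])
  show "finite R" using sub fin finite_subset by blast
  have "card R * l \<le> (\<Sum>x\<in>R. order x p)" using ord sum_bounded_below[of R l "\<lambda>x. order x p"] by simp
  also have "\<dots> \<le> (\<Sum>x | poly p x = 0. order x p)" by (rule sum_mono2[OF fin sub]) auto
  also have "\<dots> = size (proots p)"
    unfolding size_multiset_overloaded_eq using p by (intro sum.cong) auto
  also have "\<dots> \<le> degree p" by (rule size_proots_le)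
  finally show "card R * l \<le> degree p" .
qed

lemma geometric_nat: "(q - 1) * (\<Sum>i<k. q ^ i) + 1 = (q::nat) ^ k" if "q \<ge> 1"
proof (induction k)
  case (Suc k)
  have "(q - 1) * (\<Sum>i<Suc k. q ^ i) + 1 = ((q - 1) * (\<Sum>i<k. q ^ i) + 1) + (q - 1) * q ^ k"
    by (simp add: algebra_simps)
  also have "\<dots> = q ^ k + (q - 1) * q ^ k" using Suc by simp
  also have "\<dots> = q * q ^ k" using that by (cases q) auto
  finally show ?case by simp
qed auto

text \<open>Linear conditions on the left, free coefficients on the right. As B (q - 1) = l^2 - 1,
  the leading terms are (E + n) l^2 and J l^2; the summand 4 n + 16 in \<open>J\<close> pays for the
  lower terms already from l = 2 on.\<close>

lemma stepanov_count:
  fixes E l n J B q :: nat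
  assumes "(q - 1) * B + 1 = l ^ 2" "B = E * (l + 1)" "E \<le> l" "l \<ge> 2" "J = E + 4 * n + 16"
  shows "(B + J + n * l) * l < B * ((q - 1) * J)"
proof -
  have a: "int (q - 1) * int B = int l ^ 2 - 1" using arg_cong[OF assms(1), of int]
    unfolding of_nat_add of_nat_mult of_nat_1 of_nat_power by simp
  have "int (B * ((q - 1) * J)) = (int (q - 1) * int B) * int J" by simp
  also have "\<dots> = (int l ^ 2 - 1) * int J" by (simp only: a)
  finally have R: "int (B * ((q - 1) * J)) = (int l ^ 2 - 1) * int J" .
  have L: "int ((B + J + n * l) * l) = (int E * (int l + 1) + int J + int n * int l) * int l" by (simp add: assms(2) algebra_simps)
  have "(int l ^ 2 - 1) * int J - (int E * (int l + 1) + int J + int n * int l) * int l =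
    (4 * int n + 16) * (int l ^ 2 - int l - 1) - int E * (2 * int l + 1) - int n * int l ^ 2"
    by (simp add: assms(5) algebra_simps power2_eq_square)
  moreover have "4 * (int l ^ 2 - int l - 1) \<ge> int l ^ 2"
  proof -
    have "(int l - 2) * (3 * int l + 2) \<ge> 0" using assms(4) by (intro mult_nonneg_nonneg) auto
    thus ?thesis by (simp add: algebra_simps power2_eq_square)
  qed
  hence "(int n + 4) * (4 * (int l ^ 2 - int l - 1)) \<ge> (int n + 4) * int l ^ 2" by (intro mult_left_mono) auto
  moreover have "int E * (2 * int l + 1) \<le> int l * (2 * int l + 1)" using assms(3) by (intro mult_right_mono) auto
  moreover have "int l * (2 * int l + 1) < 4 * int l ^ 2"
  proof -
    have "int l * (2 * int l - 1) > 0" using assms(4) by (intro mult_pos_pos) auto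
    thus ?thesis by (simp add: algebra_simps power2_eq_square)
  qed
  ultimately have "(int l ^ 2 - 1) * int J - (int E * (int l + 1) + int J + int n * int l) * int l > 0"
    by (simp add: algebra_simps)
  thus ?thesis using R L by linarith
qed

lemma pigeonhole_finite:
  assumes "finite Y" "g ` Xb \<subseteq> Y" "card Y < card Xb"
  obtains x y where "x \<in> Xb" "y \<in> Xb" "x \<noteq> y" "g x = g y"
proof -
  have "\<not> inj_on g Xb" using card_inj_on_le[of g Xb Y] assms by auto
  thus ?thesis using that by (auto simp: inj_on_def)
qed

text \<open>These are the points of the field with l^2 elements at which \<open>f\<close> has norm
  \<open>v\<close>; about l^2 / (q - 1), that is about E l, are expected. A nonzero polynomial of
  degree at most (n + J) l^2 is constructed that vanishes to order l at each of them, which gives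
  the expected main term up to O(l).\<close>

lemma stepanov:
  fixes S :: "'a::{finite_field,field_gcd} set" and e :: "'a \<Rightarrow> nat"
  assumes q: "prime CARD('a)" and S: "finite S" "b0 \<in> S" "e b0 = 1" and m: "m \<ge> 1" and v: "v \<noteq> 0"
  defines "f \<equiv> (\<Prod>b\<in>S. [:b, -1:] ^ e b)"
    and "n \<equiv> (\<Sum>b\<in>S. e b)"
    and "B \<equiv> (\<Sum>i<2*m. CARD('a) ^ i)" and "E \<equiv> (\<Sum>i<m. CARD('a) ^ i)" and "l \<equiv> CARD('a) ^ m"
  shows "finite {x :: 'a alg_closure. x ^ (l ^ 2) = x \<and> poly (ac_poly f) x ^ B = to_ac v} \<and>
    card {x :: 'a alg_closure. x ^ (l ^ 2) = x \<and> poly (ac_poly f) x ^ B = to_ac v} \<le> (E + 5 * n + 16) * l"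
proof -
  define R where "R = {x :: 'a alg_closure. x ^ (l ^ 2) = x \<and> poly (ac_poly f) x ^ B = to_ac v}"
  define q where "q = CARD('a)"
  define J where "J = E + 4 * n + 16"
  define Xb where "Xb = [:- b0, 1:]"
  \<comment> \<open>An index (i, j) stands for the product of f^(B i) and (X - b0)^(j l^2) in the
    auxiliary polynomial.\<close>
  define I where "I = {..<q - 1} \<times> {..<J}"
  define D where "D = B + J + n * l"
  define lt where "lt = (\<lambda>N. {p :: 'a poly. \<forall>i\<ge>N. coeff p i = 0})"
  have q2: "q \<ge> 2" using q prime_ge_2_nat by (simp add: q_def)
  have l2: "l \<ge> 2"
  proof -
    have "q ^ 1 \<le> q ^ m" by (rule power_increasing) (use m q2 in auto)
    thus ?thesis using q2 by (simp add: l_def q_def)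
  qed
  have Eg: "(q - 1) * E + 1 = l" using geometric_nat[of q m] q2 by (simp add: E_def l_def q_def)
  have lsq: "l ^ 2 = q ^ (2 * m)" by (simp add: l_def q_def flip: power_mult) (simp add: mult.commute)
  have Bg: "(q - 1) * B + 1 = l ^ 2" using geometric_nat[of q "2 * m"] q2 by (simp add: B_def lsq q_def)
  have BE: "B = E * (l + 1)"
  proof -
    have "B = (\<Sum>i<m. q ^ i) + (\<Sum>i\<in>{m..<2*m}. q ^ i)"
      unfolding B_def q_def by (subst sum.union_disjoint[symmetric]) (auto intro!: sum.cong)
    also have "(\<Sum>i\<in>{m..<2*m}. q ^ i) = (\<Sum>i<m. q ^ (m + i))"
      by (rule sum.reindex_bij_witness[of _ "\<lambda>i. m + i" "\<lambda>i. i - m"]) auto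
    also have "\<dots> = E * l" by (simp add: E_def l_def q_def power_add sum_distrib_left mult.commute)
    finally show ?thesis by (simp add: E_def q_def)
  qed
  have El: "E \<le> l"
  proof -
    have "1 * E \<le> (q - 1) * E" using q2 by (intro mult_right_mono) auto
    thus ?thesis using Eg by linarith
  qed
  have n1: "n \<ge> 1" using S member_le_sum[of b0 S e] by (simp add: n_def)
  have B1: "B \<ge> 1"
  proof (rule ccontr)
    assume "\<not> B \<ge> 1"
    hence "B = 0" by simp
    hence "l * l = 1" using Bg by (simp add: power2_eq_square)
    moreover have "2 * 2 \<le> l * l" using l2 by (intro mult_le_mono)
    ultimately show False by simp
  qed
  have J1: "J \<ge> 1" by (simp add: J_def)
  have f0: "f \<noteq> 0" unfolding f_def using S(1) by (auto simp: prod_zero_iff)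
  have degf: "degree f = n"
    unfolding f_def n_def by (subst degree_prod_sum_eq) (auto simp: degree_power_eq)
  have ordf: "order b0 f = 1"
  proof -
    define g where "g = (\<Prod>b\<in>S - {b0}. [:b, -1:] ^ e b)"
    have "f = [:b0, -1:] * g" unfolding f_def g_def using S by (subst prod.remove[of S b0]) auto
    hence f: "f = [:- b0, 1:] * (- g)" by simp
    have "poly g b0 \<noteq> 0" unfolding g_def poly_prod using S(1) by (auto simp: prod_zero_iff)
    hence "order b0 (- g) = 0" by (simp add: order_0I)
    moreover have "order b0 [:- b0, 1:] = 1" using order_power_n_n[of b0 1] by simp
    ultimately show ?thesis using f0 order_mult[of "[:- b0, 1:]" "- g" b0] unfolding f by simp
  qed
  have ordfp: "order b0 (f ^ k) = k" for k
  proof (induction k)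
    case (Suc k)
    have "f * f ^ k \<noteq> 0" using f0 by simp
    thus ?case using Suc ordf by (simp add: order_mult)
  qed simp
  have Xb0: "Xb \<noteq> 0" and ordXb: "order b0 (Xb ^ j) = j" for j using order_power_n_n[of b0 j] by (auto simp: Xb_def)
  have degXb: "degree (Xb ^ j) = j" for j by (simp add: Xb_def degree_power_eq)
  \<comment> \<open>At a point of \<open>R\<close> this is, up to a nonzero factor, the s-th Hasse
    derivative of the polynomial \<open>\<Phi>\<close> below, with the high powers replaced by their
    values there. The power of \<open>f\<close> with exponent E (q - 2 - i) clears denominators. The
    coefficients are linear in \<open>\<kappa>\<close> and lie in the base field.\<close>
  define T where "T = (\<lambda>(\<kappa> :: nat \<times> nat \<Rightarrow> 'a poly) s. \<Sum>(i, j)\<in>I.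
     smult (v ^ i) (hasse_deriv s (\<kappa> (i, j) * f ^ (E * i)) * f ^ (E * (q - 2 - i)) * Xb ^ j))"
  have finlt: "finite (lt N)" and cardlt: "card (lt N) = q ^ N" for N
    unfolding lt_def q_def using card_polys_lt by blast+
  have ltD: "T \<kappa> s \<in> lt D" if \<kappa>: "\<And>x. x \<in> I \<Longrightarrow> \<kappa> x \<in> lt B" for \<kappa> s
  proof -
    have tm: "smult (v ^ i) (hasse_deriv s (\<kappa> (i, j) * f ^ (E * i)) * f ^ (E * (q - 2 - i)) * Xb ^ j) \<in> lt D"
      if ij: "i < q - 1" "j < J" for i j
    proof -
      have "\<forall>k\<ge>B. coeff (\<kappa> (i, j)) k = 0" using \<kappa>[of "(i, j)"] ij by (auto simp: I_def lt_def)
      hence "\<forall>k\<ge>B + E * i * n. coeff (\<kappa> (i, j) * f ^ (E * i)) k = 0"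
        by (rule coeff_mult_eq_0) (simp add: degree_power_eq f0 degf)
      hence "\<forall>k\<ge>B + E * i * n. coeff (hasse_deriv s (\<kappa> (i, j) * f ^ (E * i))) k = 0"
        by (simp add: coeff_hasse_deriv)
      hence "\<forall>k\<ge>(B + E * i * n) + E * (q - 2 - i) * n. coeff (hasse_deriv s (\<kappa> (i, j) * f ^ (E * i)) * f ^ (E * (q - 2 - i))) k = 0"
        by (rule coeff_mult_eq_0) (simp add: degree_power_eq f0 degf)
      hence *: "\<forall>k\<ge>(B + E * i * n) + E * (q - 2 - i) * n + j. coeff (hasse_deriv s (\<kappa> (i, j) * f ^ (E * i)) * f ^ (E * (q - 2 - i)) * Xb ^ j) k = 0"
        by (rule coeff_mult_eq_0) (simp add: degXb)
      \<comment> \<open>Both powers of \<open>f\<close> together have exponent E (q - 2), at most l,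
        so they add at most n l to the degree whatever i is.\<close>
      have "E * i * n + E * (q - 2 - i) * n = E * (i + (q - 2 - i)) * n" by (simp add: algebra_simps)
      also have "i + (q - 2 - i) = q - 2" using ij by simp
      also have "E * (q - 2) * n \<le> l * n"
      proof (rule mult_right_mono)
        have "E * (q - 2) \<le> (q - 1) * E" by (subst mult.commute, rule mult_le_mono1) simp
        thus "E * (q - 2) \<le> l" using Eg by linarith
      qed simp
      finally have "(B + E * i * n) + E * (q - 2 - i) * n + j \<le> D" using ij by (simp add: D_def mult.commute)
      thus ?thesis using * by (simp add: lt_def)
    qed
    have "coeff (T \<kappa> s) k = 0" if "k \<ge> D" for k
      unfolding T_def coeff_sum using tm that by (intro sum.neutral) (auto simp: I_def lt_def)
    thus ?thesis by (simp add: lt_def)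
  qed
  define F where "F = PiE I (\<lambda>_. lt B)"
  define G where "G = (\<lambda>\<kappa>. restrict (T \<kappa>) {..<l})"
  have finI: "finite I" by (simp add: I_def)
  have cardF: "card F = q ^ (B * ((q - 1) * J))"
    unfolding F_def by (subst card_PiE[OF finI]) (simp add: cardlt I_def power_mult)
  have "G \<kappa> \<in> PiE {..<l} (\<lambda>_. lt D)" if "\<kappa> \<in> F" for \<kappa>
    unfolding G_def restrict_PiE_iff using that by (auto intro!: ltD simp: F_def PiE_mem)
  hence "G ` F \<subseteq> PiE {..<l} (\<lambda>_. lt D)" by blast
  moreover have "card (PiE {..<l} (\<lambda>_. lt D)) = q ^ (D * l)"
    by (simp add: card_PiE cardlt power_mult)
  moreover have "q ^ (D * l) < q ^ (B * ((q - 1) * J))"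
    using stepanov_count[OF Bg BE El l2 J_def] q2 by (intro power_strict_increasing) (auto simp: D_def)
  moreover have "finite (PiE {..<l} (\<lambda>_. lt D))" by (intro finite_PiE finlt) auto
  ultimately have "card (PiE {..<l} (\<lambda>_. lt D)) < card F" "finite (PiE {..<l} (\<lambda>_. lt D))" "G ` F \<subseteq> PiE {..<l} (\<lambda>_. lt D)"
    using cardF by auto
  \<comment> \<open>Counting replaces linear algebra: two families with the same conditions differ
    by a nonzero solution of the homogeneous system.\<close>
  then obtain k1 k2 where k12: "k1 \<in> F" "k2 \<in> F" "k1 \<noteq> k2" "G k1 = G k2"
    using pigeonhole_finite[of "PiE {..<l} (\<lambda>_. lt D)" G F] by blast
  define \<kappa> where "\<kappa> = (\<lambda>x. k1 x - k2 x)"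
  have \<kappa>lt: "\<kappa> x \<in> lt B" if "x \<in> I" for x using k12(1,2) that by (auto simp: \<kappa>_def F_def lt_def PiE_iff)
  have \<kappa>nz: "\<exists>x\<in>I. \<kappa> x \<noteq> 0"
  proof (rule ccontr)
    assume "\<not> (\<exists>x\<in>I. \<kappa> x \<noteq> 0)"
    hence "k1 = k2" using k12(1,2) unfolding F_def by (intro PiE_ext[of k1 I "\<lambda>_. lt B" k2]) (auto simp: \<kappa>_def)
    thus False using k12(3) by simp
  qed
  have T0: "T \<kappa> s = 0" if "s < l" for s
  proof -
    have "T \<kappa> s = T k1 s - T k2 s"
      unfolding T_def \<kappa>_def sum_subtractf[symmetric]
      by (intro sum.cong refl) (auto simp: hasse_deriv_diff algebra_simps smult_diff_right)
    moreover have "T k1 s = T k2 s" using fun_cong[OF k12(4), of s] that by (simp add: G_def)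
    ultimately show ?thesis by simp
  qed
  \<comment> \<open>On \<open>R\<close> the power f^B equals v, and (X - b0)^(l^2) equals X - b0; so
    this polynomial of high degree is governed there by few coefficients.\<close>
  define \<Phi> where "\<Phi> = (\<Sum>(i, j)\<in>I. \<kappa> (i, j) * f ^ (B * i) * Xb ^ (j * l ^ 2))"
  have \<Phi>0: "\<Phi> \<noteq> 0"
  proof -
    define I' where "I' = {x\<in>I. \<kappa> x \<noteq> 0}"
    define t where "t = (\<lambda>x. \<kappa> x * f ^ (B * fst x) * Xb ^ (snd x * l ^ 2))"
    have "\<Phi> = (\<Sum>x\<in>I. t x)" unfolding \<Phi>_def t_def by (intro sum.cong refl) auto
    also have "\<dots> = (\<Sum>x\<in>I'. t x)" by (rule sum.mono_neutral_right) (use finI in \<open>auto simp: I'_def t_def\<close>)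
    finally have \<Phi>: "\<Phi> = (\<Sum>x\<in>I'. t x)" .
    have tnz: "t x \<noteq> 0" if "x \<in> I'" for x using that f0 Xb0 by (auto simp: t_def I'_def)
    have ordk: "order b0 (\<kappa> x) < B" if "x \<in> I'" for x
    proof -
      have "\<kappa> x \<noteq> 0" "\<forall>i\<ge>B. coeff (\<kappa> x) i = 0" using that \<kappa>lt[of x] by (auto simp: I'_def lt_def)
      moreover hence "degree (\<kappa> x) < B" using leading_coeff_0_iff not_le by blast
      ultimately show ?thesis using order_degree[of "\<kappa> x" b0] by simp
    qed
    have ordt: "order b0 (t x) = order b0 (\<kappa> x) + B * fst x + snd x * l ^ 2" if "x \<in> I'" for x
      using tnz[OF that] order_power_n_n unfolding t_def
      by (simp add: order_mult ordXb ordfp)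
    \<comment> \<open>The order is a number in mixed radix: the order of the coefficient is a digit
      below B, then B i, and both stay below l^2 since B (q - 1) < l^2, then j l^2. That
      \<open>f\<close> vanishes exactly once at \<open>b0\<close> makes i visible.\<close>
    have inj: "inj_on (\<lambda>x. order b0 (t x)) I'"
    proof (rule inj_onI)
      fix x y assume xy: "x \<in> I'" "y \<in> I'" "order b0 (t x) = order b0 (t y)"
      have lo: "order b0 (\<kappa> x) + B * fst x < l ^ 2" if "x \<in> I'" for x
      proof -
        have "fst x + 1 \<le> q - 1" using that by (auto simp: I'_def I_def)
        hence "B * (fst x + 1) \<le> B * (q - 1)" by (intro mult_le_mono2)
        thus ?thesis using ordk[OF that] Bg by (simp add: algebra_simps)
      qed
      have eq: "(order b0 (\<kappa> x) + B * fst x) + l ^ 2 * snd x = (order b0 (\<kappa> y) + B * fst y) + l ^ 2 * snd y"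
        using xy ordt by (simp add: mult.commute)
      from arg_cong[OF eq, of "\<lambda>z. z mod l ^ 2"] arg_cong[OF eq, of "\<lambda>z. z div l ^ 2"]
      have eq1: "order b0 (\<kappa> x) + B * fst x = order b0 (\<kappa> y) + B * fst y" and s: "snd x = snd y"
        using lo[OF xy(1)] lo[OF xy(2)] l2 by auto
      from arg_cong[OF eq1, of "\<lambda>z. z div B"] have "fst x = fst y"
        using ordk[OF xy(1)] ordk[OF xy(2)] B1 by simp
      thus "x = y" using s by (simp add: prod_eq_iff)
    qed
    show ?thesis unfolding \<Phi>
      by (rule sum_distinct_orders_nonzero[where b=b0]) (use finI tnz inj \<kappa>nz in \<open>auto simp: I'_def\<close>)
  qed
  have deg\<Phi>: "degree \<Phi> \<le> (n + J) * l ^ 2"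
    unfolding \<Phi>_def
  proof (rule degree_sum_le[OF finI], safe)
    fix i j assume ij: "(i, j) \<in> I"
    have "\<forall>k\<ge>B. coeff (\<kappa> (i, j)) k = 0" using \<kappa>lt[OF ij] by (simp add: lt_def)
    hence "degree (\<kappa> (i, j)) \<le> B" by (intro degree_le) auto
    moreover have "degree (\<kappa> (i, j) * f ^ (B * i) * Xb ^ (j * l ^ 2)) \<le> degree (\<kappa> (i, j)) + n * (B * i) + j * l ^ 2"
      using degree_mult_le[of "\<kappa> (i, j) * f ^ (B * i)" "Xb ^ (j * l ^ 2)"] degree_mult_le[of "\<kappa> (i, j)" "f ^ (B * i)"]
      by (simp add: degXb degree_power_eq[OF f0] degf mult.commute)
    ultimately have "degree (\<kappa> (i, j) * f ^ (B * i) * Xb ^ (j * l ^ 2)) \<le> B + n * (B * i) + j * l ^ 2" by linarith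
    also have "\<dots> \<le> n * B + n * (B * i) + j * l ^ 2" using n1 by simp
    also have "\<dots> = n * (B * (i + 1)) + j * l ^ 2" by (simp add: algebra_simps)
    also have "\<dots> \<le> n * l ^ 2 + J * l ^ 2"
    proof (intro add_mono mult_le_mono2 mult_le_mono1)
      have "B * (i + 1) \<le> B * (q - 1)" using ij by (intro mult_le_mono2) (auto simp: I_def)
      thus "B * (i + 1) \<le> l ^ 2" using Bg by (simp add: mult.commute)
      show "j \<le> J" using ij by (auto simp: I_def)
    qed
    finally show "degree (\<kappa> (i, j) * f ^ (B * i) * Xb ^ (j * l ^ 2)) \<le> (n + J) * l ^ 2"
      by (simp only: add_mult_distrib)
  qed
  have dv: "[:- \<alpha>, 1:] ^ l dvd ac_poly \<Phi>" if \<alpha>: "\<alpha> \<in> R" for \<alpha>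
  proof -
    define M where "M = [:- \<alpha>, 1:] ^ l"
    define w where "w = poly (ac_poly f) \<alpha> ^ (l * E)"
    define c where "c = poly (ac_poly f) \<alpha>"
    have \<alpha>Q: "\<alpha> ^ (l ^ 2) = \<alpha>" and cB: "c ^ B = to_ac v" using \<alpha> by (auto simp: R_def c_def)
    have c0: "c \<noteq> 0" using cB v B1 by (auto simp: power_0_left)
    have ch: "prime CHAR('a alg_closure poly)" and ch': "CHAR('a alg_closure poly) = q"
      using CHAR_eq_CARD[where ?'a='a] q by (auto simp: q_def)
    have fr: "(x + y) ^ (q ^ i) = x ^ (q ^ i) + y ^ (q ^ i)" for x y :: "'a alg_closure poly" and i
      by (rule freshmans_dream'[OF ch, of _ i]) (simp only: ch')
    have frd: "(x - y) ^ (q ^ i) = x ^ (q ^ i) - y ^ (q ^ i)" for x y :: "'a alg_closure poly" and i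
      using fr[of "x - y" y i] by (simp add: algebra_simps)
    have congX: "[ac_poly Xb ^ (l ^ 2) = [:\<alpha> - to_ac b0:]] (mod M)"
    proof -
      have "ac_poly Xb = [:- \<alpha>, 1:] + [:\<alpha> - to_ac b0:]" by (simp add: Xb_def)
      hence "ac_poly Xb ^ (l ^ 2) = [:- \<alpha>, 1:] ^ (l ^ 2) + [:\<alpha> - to_ac b0:] ^ (l ^ 2)"
        unfolding lsq by (simp only: fr)
      moreover have "(\<alpha> - to_ac b0) ^ (l ^ 2) = \<alpha> - to_ac b0"
      proof -
        interpret F: inj_comm_ring_hom "\<lambda>x :: 'a alg_closure. x ^ (CARD('a) ^ (2 * m))" by (rule frobenius_hom[OF q])
        show ?thesis using F.hom_minus[of \<alpha> "to_ac b0"] \<alpha>Q unfolding lsq q_def to_ac_frobenius by simp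
      qed
      ultimately have "ac_poly Xb ^ (l ^ 2) = [:- \<alpha>, 1:] ^ (l ^ 2) + [:\<alpha> - to_ac b0:]" by (simp add: poly_const_pow)
      moreover have "M dvd [:- \<alpha>, 1:] ^ (l ^ 2)" unfolding M_def using l2
        by (intro le_imp_power_dvd) (simp add: power2_eq_square)
      ultimately show ?thesis by (simp add: cong_iff_dvd_diff)
    qed
    \<comment> \<open>Raising to the power l is a ring homomorphism, so f^l is constant modulo (X -
      \<alpha>)^l; as B = l E + E, only f^E remains.\<close>
    have congf: "[ac_poly f ^ B = smult w (ac_poly f ^ E)] (mod M)"
    proof -
      have "[:- \<alpha>, 1:] dvd ac_poly f - [:c:]" by (simp add: poly_eq_0_iff_dvd[symmetric] c_def)
      hence "M dvd (ac_poly f - [:c:]) ^ l" unfolding M_def by (rule dvd_power_same)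
      hence "[ac_poly f ^ l = [:c ^ l:]] (mod M)"
        using frd[of "ac_poly f" "[:c:]" m] by (simp add: cong_iff_dvd_diff l_def q_def poly_const_pow)
      hence "[(ac_poly f ^ l) ^ E * ac_poly f ^ E = [:c ^ l:] ^ E * ac_poly f ^ E] (mod M)"
        by (intro cong_mult cong_pow) auto
      moreover have "(ac_poly f ^ l) ^ E * ac_poly f ^ E = ac_poly f ^ B"
        by (simp add: BE algebra_simps flip: power_mult power_add)
      moreover have "[:c ^ l:] ^ E * ac_poly f ^ E = smult w (ac_poly f ^ E)"
        by (simp add: w_def c_def poly_const_pow power_mult)
      ultimately show ?thesis by simp
    qed
    have wc: "w * c ^ E = to_ac v" using cB unfolding w_def c_def BE by (simp add: algebra_simps flip: power_add)
    define \<beta> where "\<beta> = \<alpha> - to_ac b0"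
    define \<Psi> where "\<Psi> = (\<Sum>(i, j)\<in>I. ac_poly (\<kappa> (i, j)) * (smult (w ^ i) (ac_poly f ^ (E * i))) * [:\<beta> ^ j:])"
    have "ac_poly \<Phi> = (\<Sum>(i, j)\<in>I. ac_poly (\<kappa> (i, j)) * (ac_poly f ^ B) ^ i * (ac_poly Xb ^ (l ^ 2)) ^ j)"
      unfolding \<Phi>_def by (simp add: to_ac_poly.hom_sum to_ac_poly.hom_mult to_ac_poly.hom_power case_prod_beta mult.commute[of _ "l ^ 2"] flip: power_mult)
    moreover have "[(\<Sum>(i, j)\<in>I. ac_poly (\<kappa> (i, j)) * (ac_poly f ^ B) ^ i * (ac_poly Xb ^ (l ^ 2)) ^ j) =
       (\<Sum>(i, j)\<in>I. ac_poly (\<kappa> (i, j)) * (smult w (ac_poly f ^ E)) ^ i * [:\<beta>:] ^ j)] (mod M)"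
      unfolding case_prod_beta \<beta>_def by (intro cong_sum cong_mult cong_pow congX congf) auto
    moreover have "(\<Sum>(i, j)\<in>I. ac_poly (\<kappa> (i, j)) * (smult w (ac_poly f ^ E)) ^ i * [:\<beta>:] ^ j) = \<Psi>"
      unfolding \<Psi>_def by (simp add: smult_power poly_const_pow flip: power_mult)
    ultimately have cong: "[ac_poly \<Phi> = \<Psi>] (mod M)" by simp
    \<comment> \<open>By w c^E = v the extra factor turns each w^i into v^i times a power of c, and
      the Hasse derivatives at \<alpha> become the values of \<open>T \<kappa> s\<close>.\<close>
    have "M dvd smult (c ^ (E * (q - 2))) \<Psi>"
      unfolding M_def
    proof (rule dvd_of_hasse_deriv_zero)
      fix s assume s: "s < l"
      have "smult (c ^ (E * (q - 2))) \<Psi> = (\<Sum>(i, j)\<in>I. smult (to_ac v ^ i * c ^ (E * (q - 2 - i)) * \<beta> ^ j) (ac_poly (\<kappa> (i, j) * f ^ (E * i))))"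
        unfolding \<Psi>_def smult_sum2
      proof (intro sum.cong refl, safe)
        fix i j assume ij: "(i, j) \<in> I"
        hence "q - 2 = i + (q - 2 - i)" by (auto simp: I_def)
        hence "E * (q - 2) = E * i + E * (q - 2 - i)" using distrib_left[of E i "q - 2 - i"] by simp
        hence "c ^ (E * (q - 2)) = c ^ (E * i) * c ^ (E * (q - 2 - i))" by (simp only: power_add)
        hence eq: "c ^ (E * (q - 2)) * w ^ i = to_ac v ^ i * c ^ (E * (q - 2 - i))"
          unfolding wc[symmetric] by (simp add: power_mult_distrib power_mult)
        have "smult (c ^ (E * (q - 2))) (ac_poly (\<kappa> (i, j)) * smult (w ^ i) (ac_poly f ^ (E * i)) * [:\<beta> ^ j:]) =
          smult ((c ^ (E * (q - 2)) * w ^ i) * \<beta> ^ j) (ac_poly (\<kappa> (i, j)) * ac_poly f ^ (E * i))"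
          by (simp add: mult_ac)
        also have "\<dots> = smult (to_ac v ^ i * c ^ (E * (q - 2 - i)) * \<beta> ^ j) (ac_poly (\<kappa> (i, j) * f ^ (E * i)))"
          unfolding eq by (simp only: to_ac_poly.hom_mult to_ac_poly.hom_power)
        finally show "smult (c ^ (E * (q - 2))) (ac_poly (\<kappa> (i, j)) * smult (w ^ i) (ac_poly f ^ (E * i)) * [:\<beta> ^ j:]) =
          smult (to_ac v ^ i * c ^ (E * (q - 2 - i)) * \<beta> ^ j) (ac_poly (\<kappa> (i, j) * f ^ (E * i)))" .
      qed
      hence "poly (hasse_deriv s (smult (c ^ (E * (q - 2))) \<Psi>)) \<alpha> =
        (\<Sum>(i, j)\<in>I. to_ac v ^ i * c ^ (E * (q - 2 - i)) * \<beta> ^ j * poly (ac_poly (hasse_deriv s (\<kappa> (i, j) * f ^ (E * i)))) \<alpha>)"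
        by (simp add: hasse_deriv_sum poly_sum case_prod_beta hasse_deriv_smult hasse_deriv_ac)
      also have "\<dots> = poly (ac_poly (T \<kappa> s)) \<alpha>"
        unfolding T_def
        by (simp add: to_ac_poly.hom_sum poly_sum case_prod_beta to_ac_poly.hom_mult to_ac_poly.hom_power
            to_ac.map_poly_hom_smult c_def \<beta>_def Xb_def power_mult algebra_simps)
      also have "\<dots> = 0" using T0[OF s] by simp
      finally show "poly (hasse_deriv s (smult (c ^ (E * (q - 2))) \<Psi>)) \<alpha> = 0" .
    qed
    hence "M dvd \<Psi>" by (rule dvd_smult_cancel) (use c0 in simp)
    hence "M dvd (ac_poly \<Phi> - \<Psi>) + \<Psi>" using cong by (intro dvd_add) (auto simp: cong_iff_dvd_diff)
    thus ?thesis by (simp add: M_def)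
  qed
  have ac0: "ac_poly \<Phi> \<noteq> 0" using \<Phi>0 by simp
  have fin: "finite R" using card_roots_mult_le_degree(1)[OF ac0, of R l] dv l2 by auto
  have "card R * l \<le> degree (ac_poly \<Phi>)" using card_roots_mult_le_degree(2)[OF ac0, of R l] dv l2 by auto
  also have "\<dots> \<le> ((E + 5 * n + 16) * l) * l" using deg\<Phi> by (simp add: J_def power2_eq_square algebra_simps)
  finally have "card R \<le> (E + 5 * n + 16) * l" using l2 by simp
  thus ?thesis using fin by (simp add: R_def)
qed

section \<open>Weil's bound from one-sided counts\<close>

lemma sum_mult_char_eq_0:
  fixes \<chi> :: "'a::{field,finite} \<Rightarrow> complex"
  assumes m: "\<And>x y. \<chi> (x * y) = \<chi> x * \<chi> y" and z: "\<chi> 0 = 0" and nt: "c \<noteq> 0" "\<chi> c \<noteq> 1"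
  shows "(\<Sum>x\<in>UNIV. \<chi> x) = 0"
proof -
  have "(\<Sum>x\<in>UNIV. \<chi> x) = (\<Sum>x\<in>UNIV. \<chi> (c * x))"
    by (rule sum.reindex_bij_witness[of _ "\<lambda>x. c * x" "\<lambda>x. x / c"]) (use nt in auto)
  also have "\<dots> = \<chi> c * (\<Sum>x\<in>UNIV. \<chi> x)" by (simp add: m sum_distrib_left)
  finally have "(1 - \<chi> c) * (\<Sum>x\<in>UNIV. \<chi> x) = 0" by (simp add: algebra_simps)
  thus ?thesis using nt by simp
qed

lemma mult_char_props:
  fixes \<chi> :: "'a::{finite_field} \<Rightarrow> complex"
  assumes m: "\<And>x y. \<chi> (x * y) = \<chi> x * \<chi> y" and nt: "c \<noteq> 0" "\<chi> c \<noteq> 1" and z: "\<chi> 0 = 0" and one: "\<chi> 1 = 1"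
  shows "\<chi> (x ^ n) = \<chi> x ^ n" "x \<noteq> 0 \<Longrightarrow> norm (\<chi> x) = 1" "norm (\<chi> x) \<le> 1"
proof -
  show pow: "\<chi> (x ^ n) = \<chi> x ^ n" for x n by (induction n) (auto simp: one m)
  show nn: "norm (\<chi> x) = 1" if "x \<noteq> 0" for x
  proof -
    have "CARD('a) \<noteq> 0" by simp
    then obtain k where k: "CARD('a) = Suc k" using not0_implies_Suc by blast
    have "x * x ^ k = x * 1" using finite_field_power_card_eq_same[of x] by (simp add: k)
    hence xk: "x ^ k = 1" using that by simp
    have "k \<noteq> 0"
    proof
      assume "k = 0"
      hence "CARD('a) = 1" using k by simp
      moreover have "card {0, 1 :: 'a} \<le> CARD('a)" by (rule card_mono) auto
      ultimately show False by simp
    qed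
    moreover have "norm (\<chi> x) ^ k = 1 ^ k" using arg_cong[OF pow[of x k], of norm] xk one by (simp add: norm_power)
    ultimately show ?thesis by (intro power_eq_imp_eq_base[of "norm (\<chi> x)" k 1]) auto
  qed
  show "norm (\<chi> x) \<le> 1" by (cases "x = 0") (use nn[of x] z in auto)
qed

text \<open>The recurrence for the trivial character, whose L-function has coefficients q^m; by
  induction every term with k < m contributes q^m.\<close>

lemma sum_degree_prime_powers_deg:
  "(\<Sum>(P :: 'a::{field_gcd,finite} poly, a)\<in>prime_powers_deg k. degree P) = CARD('a) ^ k" if "k \<ge> 1"
  using that
proof (induction k rule: less_induct)
  case (less m)
  let ?\<Lambda> = "\<lambda>k. \<Sum>(P :: 'a poly, a)\<in>prime_powers_deg k. degree P"
  have "of_nat m * (\<Sum>g\<in>(monics m :: 'a poly set). (1::complex)) =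
     (\<Sum>k=1..m. (\<Sum>(P :: 'a poly, a)\<in>prime_powers_deg k. of_nat (degree P) * 1 ^ a) * (\<Sum>g\<in>(monics (m - k) :: 'a poly set). 1))"
    by (rule L_function_recurrence) auto
  hence "(of_nat (m * CARD('a) ^ m) :: complex) = of_nat (\<Sum>k=1..m. ?\<Lambda> k * CARD('a) ^ (m - k))"
    by (simp add: card_monics case_prod_beta)
  hence "m * CARD('a) ^ m = (\<Sum>k=1..m. ?\<Lambda> k * CARD('a) ^ (m - k))" by (simp only: of_nat_eq_iff)
  also have "{1..m} = insert m {1..<m}" using less.prems by auto
  also have "(\<Sum>k\<in>insert m {1..<m}. ?\<Lambda> k * CARD('a) ^ (m - k)) = ?\<Lambda> m + (\<Sum>k\<in>{1..<m}. ?\<Lambda> k * CARD('a) ^ (m - k))"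
    by simp
  also have "(\<Sum>k\<in>{1..<m}. ?\<Lambda> k * CARD('a) ^ (m - k)) = (\<Sum>k\<in>{1..<m}. CARD('a) ^ m)"
  proof (intro sum.cong refl)
    fix k assume "k \<in> {1..<m}"
    thus "?\<Lambda> k * CARD('a) ^ (m - k) = CARD('a) ^ m" using less.IH[of k] by (simp flip: power_add)
  qed
  also have "\<dots> = (m - 1) * CARD('a) ^ m" by simp
  finally show ?case using less.prems by (cases m) auto
qed

lemma prime_poly_common_root:
  fixes P Q :: "'a::{finite_field,field_gcd} poly"
  assumes "prime P" "prime Q" "poly (ac_poly P) x = 0" "poly (ac_poly Q) x = 0"
  shows "P = Q"
proof (rule ccontr)
  assume "P \<noteq> Q"
  hence "coprime P Q" using assms primes_coprime by blast
  hence "fst (bezout_coefficients P Q) * P + snd (bezout_coefficients P Q) * Q = 1"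
    by (simp add: bezout_coefficients_fst_snd)
  from arg_cong[OF this, of "\<lambda>p. poly (ac_poly p) x"] show False
    using assms by (simp add: to_ac_poly.hom_add to_ac_poly.hom_mult)
qed

lemma prime_linear_poly: "prime [:- x, 1 :: 'a::field_gcd:]"
proof -
  have "irreducible [:- x, 1:]"
  proof (rule comm_semiring_1_class.irreducibleI)
    fix a b :: "'a poly" assume ab: "[:- x, 1:] = a * b"
    hence nz: "a \<noteq> 0" "b \<noteq> 0" by auto
    hence "degree a + degree b = 1" using arg_cong[OF ab, of degree] by (simp add: degree_mult_eq)
    hence "degree a = 0 \<or> degree b = 0" by auto
    thus "is_unit a \<or> is_unit b" using nz is_unit_iff_degree by blast
  qed (use is_unit_iff_degree[of "[:- x, 1:]"] in auto)
  hence "prime_elem [:- x, 1:]" by (rule irreducible_imp_prime_elem_gcd)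
  moreover have "normalize [:- x, 1:] = [:- x, 1:]" by (rule normalize_monic) simp
  ultimately show ?thesis by (simp add: normalization_semidom_class.prime_def)
qed

lemma prime_powers_deg_1:
  "prime_powers_deg 1 = (\<lambda>x. ([:- x, 1:], 1)) ` (UNIV :: 'a::field_gcd set)"
proof (intro equalityI subsetI)
  fix z :: "'a poly \<times> nat" assume "z \<in> prime_powers_deg 1"
  then obtain P a where z: "z = (P, a)" "prime P" "a * degree P = 1" by (auto simp: prime_powers_deg_def)
  have "a = 1" "degree P = 1" using z by auto
  then obtain c d where P: "P = [:c, d:]" using degree1_coeffs by blast
  have "d = 1" using prime_poly_monic[OF z(2)] \<open>degree P = 1\<close> by (simp add: P)
  thus "z \<in> (\<lambda>x. ([:- x, 1:], 1)) ` UNIV" using z \<open>a = 1\<close> P by (intro image_eqI[of _ _ "- c"]) auto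
qed (auto simp: prime_powers_deg_def prime_linear_poly)

lemma finite_prime_powers_deg: "k \<ge> 1 \<Longrightarrow> finite (prime_powers_deg k :: ('a::{field_gcd,finite} poly \<times> nat) set)"
  by (rule finite_subset[OF _ finite_prime_powers_le[of k]])
     (auto simp: prime_powers_deg_def Suc_le_eq intro: ccontr)

lemma sum_by_value:
  fixes h :: "'b \<Rightarrow> 'a::finite" and g :: "'b \<Rightarrow> 'c::comm_monoid_add"
  assumes "finite A"
  shows "(\<Sum>v\<in>UNIV. \<Sum>x\<in>{x\<in>A. h x = v}. g x) = (\<Sum>x\<in>A. g x)"
  by (rule sum.group) (use assms in auto)

text \<open>The character \<open>\<psi>\<close> of monic polynomials evaluates g on \<open>S\<close>
  with multiplicities \<open>e\<close>. Its first power sum runs over the linear polynomials X - x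
  and is the sum in question; its L-function is a polynomial of degree below |S|. So it suffices to
  bound the even power sums, which are governed by the numbers of prime powers of given
  value.\<close>

theorem weil_bound:
  fixes \<chi> :: "'a::{finite_field,field_gcd} \<Rightarrow> complex" and S :: "'a set" and e :: "'a \<Rightarrow> nat"
  assumes q: "prime CARD('a)"
    and chm: "\<And>x y. \<chi> (x * y) = \<chi> x * \<chi> y" and ch0: "\<chi> 0 = 0" and ch1: "\<chi> 1 = 1" and nt: "c \<noteq> 0" "\<chi> c \<noteq> 1"
    and S: "b0 \<in> S" "e b0 = 1" "\<And>b. b \<in> S \<Longrightarrow> e b \<ge> 1"
  shows "norm (\<Sum>x\<in>UNIV. \<Prod>b\<in>S. \<chi> (b - x) ^ e b) \<le> real (card S) * sqrt (real CARD('a))"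
proof -
  define q where "q = CARD('a)"
  have finS: "finite S" by simp
  note chi = mult_char_props[of \<chi> c, OF chm nt ch0 ch1]
  define val where "val = (\<lambda>P :: 'a poly. \<Prod>b\<in>S. poly P b ^ e b)"
  define \<psi> where "\<psi> = (\<lambda>P. \<chi> (val P))"
  have chprod: "\<chi> (\<Prod>b\<in>S'. h b) = (\<Prod>b\<in>S'. \<chi> (h b))" for h :: "'a \<Rightarrow> 'a" and S'
    by (induction S' rule: infinite_finite_induct) (auto simp: ch1 chm)
  have valm: "val (g * h) = val g * val h" for g h by (simp add: val_def power_mult_distrib prod.distrib)
  have \<psi>1: "\<psi> 1 = 1" by (simp add: \<psi>_def val_def ch1)
  have \<psi>m: "\<psi> (g * h) = \<psi> g * \<psi> h" for g h by (simp add: \<psi>_def valm chm)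
  define L where "L = (\<lambda>m. \<Sum>g\<in>monics m. \<psi> g)"
  define SS where "SS = (\<lambda>k. \<Sum>(P, a)\<in>prime_powers_deg k. of_nat (degree P) * \<psi> P ^ a)"
  have rec: "of_nat m * L m = (\<Sum>k=1..m. SS k * L (m - k))" for m
    unfolding L_def SS_def by (rule L_function_recurrence[OF \<psi>1 \<psi>m])
  have "g = 1" if "monic g" "degree g = 0" for g :: "'a poly" using monic_degree_0[of g] that by simp
  hence "monics 0 = {1 :: 'a poly}" by (auto simp: monics_def)
  hence L0: "L 0 = 1" by (simp add: L_def \<psi>1)
  \<comment> \<open>From degree |S| on, multiples of a polynomial h of degree |S| - 1 that vanishes
    on \<open>S\<close> except at \<open>b0\<close> may be added: the values elsewhere are fixed,
    while the one at \<open>b0\<close>, whose exponent is 1, runs through the field.\<close>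
  have Ln: "L m = 0" if "m \<ge> card S" for m
  proof -
    define h where "h = (\<Prod>b\<in>S - {b0}. [:- b, 1:])"
    have degh: "degree h = card S - 1" unfolding h_def using S(1) by (subst degree_prod_sum_eq) auto
    have cS: "card S \<ge> 1" using S(1) finS by (simp add: Suc_le_eq card_gt_0_iff) auto
    have hdeg: "degree (smult t h) < m" for t using degree_smult_le[of t h] degh cS that by linarith
    have "degree h < m" using degh cS that by linarith
    hence hm: "coeff h m = 0" by (rule coeff_eq_0)
    have hb0: "poly h b0 \<noteq> 0" by (auto simp: h_def poly_prod prod_zero_iff)
    have hb: "poly h b = 0" if "b \<in> S" "b \<noteq> b0" for b using that by (auto simp: h_def poly_prod prod_zero_iff)
    have mon: "g + smult t h \<in> monics m" if "g \<in> monics m" for g t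
      using that hdeg[of t] hm by (auto simp: monics_def degree_add_eq_left)
    have shift: "(\<Sum>g\<in>monics m. \<psi> (g + smult t h)) = L m" for t
      unfolding L_def
      by (rule sum.reindex_bij_witness[of _ "\<lambda>g. g - smult t h" "\<lambda>g. g + smult t h"])
         (use mon[of _ t] mon[of _ "- t"] in auto)
    have inner: "(\<Sum>t\<in>UNIV. \<psi> (g + smult t h)) = 0" for g
    proof -
      define r where "r = (\<Prod>b\<in>S - {b0}. poly g b ^ e b)"
      have "val (g + smult t h) = (poly g b0 + t * poly h b0) * r" for t
      proof -
        have "val (g + smult t h) = poly (g + smult t h) b0 * (\<Prod>b\<in>S - {b0}. poly (g + smult t h) b ^ e b)"
          unfolding val_def using S by (subst prod.remove[of S b0]) auto
        also have "(\<Prod>b\<in>S - {b0}. poly (g + smult t h) b ^ e b) = r"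
          unfolding r_def by (intro prod.cong refl) (simp add: hb)
        finally show ?thesis by simp
      qed
      hence "(\<Sum>t\<in>UNIV. \<psi> (g + smult t h)) = (\<Sum>t\<in>UNIV. \<chi> (poly g b0 + t * poly h b0)) * \<chi> r"
        by (simp add: \<psi>_def chm sum_distrib_right)
      also have "(\<Sum>t\<in>UNIV. \<chi> (poly g b0 + t * poly h b0)) = (\<Sum>t\<in>UNIV. \<chi> t)"
        by (rule sum.reindex_bij_witness[of _ "\<lambda>x. (x - poly g b0) / poly h b0" "\<lambda>t. poly g b0 + t * poly h b0"])
           (use hb0 in auto)
      also have "\<dots> = 0" by (rule sum_mult_char_eq_0[OF chm ch0 nt])
      finally show ?thesis by simp
    qed
    have "of_nat q * L m = (\<Sum>t\<in>(UNIV :: 'a set). \<Sum>g\<in>monics m. \<psi> (g + smult t h))"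
      by (simp add: shift q_def)
    also have "\<dots> = 0" by (subst sum.swap) (simp add: inner)
    finally show ?thesis by (simp add: q_def)
  qed
  define n where "n = (\<Sum>b\<in>S. e b)"
  define CC where "CC = real (2 * (5 * n + 16) * q + n)"
  have bd: "norm (SS (2 * m)) \<le> CC * real q ^ m" if m: "m \<ge> 1" for m
  proof -
    define k where "k = 2 * m"
    have k1: "k \<ge> 1" using m by (simp add: k_def)
    define PD where "PD = (prime_powers_deg k :: ('a poly \<times> nat) set)"
    have finPD: "finite PD" unfolding PD_def by (rule finite_prime_powers_deg[OF k1])
    define l where "l = q ^ m"
    define E where "E = (\<Sum>i<m. q ^ i)"
    define B where "B = (\<Sum>i<k. q ^ i)"
    \<comment> \<open>The weight \<open>degree P\<close> is the number of roots of \<open>P\<close>,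
      so this counts points of an extension field.\<close>
    define N where "N = (\<lambda>v. \<Sum>(P, a)\<in>{(P, a)\<in>PD. val P ^ a = v}. degree P)"
    define f where "f = (\<Prod>b\<in>S. [:b, -1:] ^ e b)"
    define R where "R = (\<lambda>v. {x :: 'a alg_closure. x ^ (l ^ 2) = x \<and> poly (ac_poly f) x ^ B = to_ac v})"
    have lsq: "l ^ 2 = q ^ k" by (simp add: l_def k_def mult.commute flip: power_mult)
    have Rb: "finite (R v)" "card (R v) \<le> (E + 5 * n + 16) * l" if "v \<noteq> 0" for v
      using stepanov[where S=S and ?b0.0=b0 and e=e and m=m and v=v, OF q finS S(1) S(2) m that] unfolding R_def f_def B_def k_def E_def l_def q_def n_def by blast+
    \<comment> \<open>The norm of b minus a root of \<open>P\<close> is P(b)^a, hence every root of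
      \<open>P\<close> lies in Stepanov's set for the value v.\<close>
    have roots: "card {x. poly (ac_poly P) x = 0} = degree P \<and> {x. poly (ac_poly P) x = 0} \<subseteq> R v \<and> finite {x. poly (ac_poly P) x = 0}"
      if Pa: "(P, a) \<in> PD" "val P ^ a = v" for P a v
    proof -
      have P: "prime P" "a * degree P = k" using Pa by (auto simp: PD_def prime_powers_deg_def)
      have irr: "irreducible P" using P(1) by (simp add: prime_elem_imp_irreducible prime_imp_prime_elem)
      obtain \<alpha> where \<alpha>: "inj_on (\<lambda>i. \<alpha> ^ (q ^ i)) {..<degree P}" "\<alpha> ^ (q ^ degree P) = \<alpha>"
        "ac_poly P = (\<Prod>i<degree P. [:- (\<alpha> ^ (q ^ i)), 1:])"
        unfolding q_def using irreducible_poly_frobenius_roots[OF q irr prime_poly_monic[OF P(1)]] by blast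
      have rt: "{x. poly (ac_poly P) x = 0} = (\<lambda>i. \<alpha> ^ (q ^ i)) ` {..<degree P}"
        by (subst \<alpha>(3)) (auto simp: poly_prod prod_zero_iff)
      have per: "\<alpha> ^ (q ^ (degree P * a')) = \<alpha>" for a'
      proof (induction a')
        case (Suc a')
        have "\<alpha> ^ (q ^ (degree P * Suc a')) = (\<alpha> ^ (q ^ degree P)) ^ (q ^ (degree P * a'))"
          by (simp only: mult_Suc_right power_add power_mult)
        also have "\<dots> = \<alpha>" by (simp only: \<alpha>(2) Suc.IH)
        finally show ?case .
      qed simp
      have \<alpha>Q: "\<alpha> ^ (l ^ 2) = \<alpha>" using per[of a] P(2) unfolding lsq by (simp only: mult.commute)
      have "poly (ac_poly f) \<alpha> = (\<Prod>b\<in>S. (to_ac b - \<alpha>) ^ e b)"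
        by (simp add: f_def to_ac_poly.hom_prod to_ac_poly.hom_power poly_prod)
      hence "poly (ac_poly f) \<alpha> ^ B = (\<Prod>b\<in>S. ((to_ac b - \<alpha>) ^ B) ^ e b)"
        by (simp add: prod_power_distrib mult.commute flip: power_mult)
      also have "\<dots> = (\<Prod>b\<in>S. (to_ac (poly P b) ^ a) ^ e b)"
        using norm_linear_at_root[OF q, of P a k \<alpha>] P(2) \<alpha>(2,3) by (simp add: B_def q_def mult.commute)
      also have "\<dots> = to_ac v"
        unfolding Pa(2)[symmetric] val_def
        by (simp add: to_ac_prod prod_power_distrib mult.commute flip: power_mult)
      finally have fB: "poly (ac_poly f) \<alpha> ^ B = to_ac v" .
      have "\<alpha> ^ (q ^ i) \<in> R v" for i
      proof -
        have "(\<alpha> ^ (q ^ i)) ^ (l ^ 2) = (\<alpha> ^ (l ^ 2)) ^ (q ^ i)" by (simp add: mult.commute flip: power_mult)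
        moreover have "poly (ac_poly f) (\<alpha> ^ (q ^ i)) ^ B = (poly (ac_poly f) \<alpha> ^ B) ^ (q ^ i)"
          unfolding q_def frobenius_poly[OF q] by (simp add: mult.commute flip: power_mult)
        ultimately show ?thesis by (simp add: R_def \<alpha>Q fB to_ac_frobenius q_def)
      qed
      thus ?thesis unfolding rt using \<alpha>(1) by (auto simp: card_image)
    qed
    \<comment> \<open>Different prime powers of the same total degree have disjoint sets of roots,
      so the counts add up inside Stepanov's set.\<close>
    have Nup: "N v \<le> (E + 5 * n + 16) * l" if "v \<noteq> 0" for v
    proof -
      define Y where "Y = {(P, a)\<in>PD. val P ^ a = v}"
      have fY: "finite Y" unfolding Y_def by (rule finite_subset[OF _ finPD]) auto
      have "N v = (\<Sum>y\<in>Y. card {x. poly (ac_poly (fst y)) x = 0})"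
        unfolding N_def Y_def[symmetric] by (intro sum.cong refl) (use roots in \<open>auto simp: Y_def\<close>)
      also have "\<dots> = card (\<Union>y\<in>Y. {x. poly (ac_poly (fst y)) x = 0})"
      proof (rule card_UN_disjoint[symmetric, OF fY])
        show "\<forall>y\<in>Y. finite {x. poly (ac_poly (fst y)) x = 0}" using roots by (auto simp: Y_def)
        show "\<forall>y\<in>Y. \<forall>z\<in>Y. y \<noteq> z \<longrightarrow> {x. poly (ac_poly (fst y)) x = 0} \<inter> {x. poly (ac_poly (fst z)) x = 0} = {}"
        proof (intro ballI impI equals0I)
          fix y z x assume yz: "y \<in> Y" "z \<in> Y" "y \<noteq> z"
            and x: "x \<in> {x. poly (ac_poly (fst y)) x = 0} \<inter> {x. poly (ac_poly (fst z)) x = 0}"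
          obtain P a P' a' where eq: "y = (P, a)" "z = (P', a')" by (cases y, cases z)
          have pr: "prime P" "prime P'" "a * degree P = k" "a' * degree P' = k"
            using yz by (auto simp: eq Y_def PD_def prime_powers_deg_def)
          have "poly (ac_poly P) x = 0" "poly (ac_poly P') x = 0" using x by (auto simp: eq)
          hence "P = P'" by (rule prime_poly_common_root[OF pr(1,2)])
          moreover have "a = a'" using pr prime_poly_degree_pos[OF pr(1)] \<open>P = P'\<close> by auto
          ultimately show False using yz by (simp add: eq)
        qed
      qed
      also have "\<dots> \<le> card (R v)"
      proof (rule card_mono[OF Rb(1)[OF that]], rule UN_least)
        fix y assume y: "y \<in> Y"
        obtain P a where Pa: "y = (P, a)" by (cases y)
        have "(P, a) \<in> PD" "val P ^ a = v" using y by (auto simp: Y_def Pa)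
        from roots[OF this] show "{x. poly (ac_poly (fst y)) x = 0} \<subseteq> R v" by (simp add: Pa)
      qed
      also have "\<dots> \<le> (E + 5 * n + 16) * l" by (rule Rb(2)[OF that])
      finally show ?thesis .
    qed
    note group = sum_by_value[OF finPD, where h="\<lambda>x. val (fst x) ^ snd x"]
    have N': "N v = (\<Sum>x\<in>{x\<in>PD. val (fst x) ^ snd x = v}. degree (fst x))" for v
      unfolding N_def by (intro sum.cong) auto
    have Ntot: "(\<Sum>v\<in>UNIV. N v) = l ^ 2"
      unfolding N' group lsq q_def using sum_degree_prime_powers_deg[OF k1, where ?'a='a] by (simp add: PD_def case_prod_beta)
    \<comment> \<open>The value 0 forces \<open>P\<close> to be one of the polynomials X - b with b
      in \<open>S\<close>.\<close>
    have N0: "N 0 \<le> n"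
    proof -
      have sub: "{x\<in>PD. val (fst x) ^ snd x = 0} \<subseteq> (\<lambda>b. ([:- b, 1:], k)) ` S"
      proof
        fix x assume "x \<in> {x\<in>PD. val (fst x) ^ snd x = 0}"
        then obtain P a where x: "x = (P, a)" "prime P" "a * degree P = k" "val P ^ a = 0"
          by (cases x) (auto simp: PD_def prime_powers_deg_def)
        have "val P = 0" using x(4) by (auto simp: power_eq_0_iff)
        then obtain b where b: "b \<in> S" "poly P b = 0" by (auto simp: val_def prod_zero_iff)
        hence "[:- b, 1:] dvd P" by (simp add: poly_eq_0_iff_dvd)
        hence "P = [:- b, 1:]" using primes_dvd_imp_eq[OF prime_linear_poly x(2)] by metis
        thus "x \<in> (\<lambda>b. ([:- b, 1:], k)) ` S" using x b by auto
      qed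
      have "N 0 \<le> (\<Sum>x\<in>(\<lambda>b. ([:- b, 1:], k)) ` S. degree (fst x))" unfolding N' by (rule sum_mono2[OF _ sub]) auto
      also have "\<dots> \<le> card S * 1" using finS
        by (subst sum.reindex) (auto simp: inj_on_def)
      also have "\<dots> \<le> n" using sum_mono[of S "\<lambda>_. 1" e] S(3) by (simp add: n_def)
      finally show ?thesis .
    qed
    have "SS k = (\<Sum>x\<in>PD. of_nat (degree (fst x)) * \<chi> (val (fst x) ^ snd x))"
      unfolding SS_def PD_def \<psi>_def chi(1) by (simp add: case_prod_beta)
    also have "\<dots> = (\<Sum>v\<in>UNIV. \<Sum>x\<in>{x\<in>PD. val (fst x) ^ snd x = v}. of_nat (degree (fst x)) * \<chi> (val (fst x) ^ snd x))"
      by (rule group[symmetric])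
    also have "\<dots> = (\<Sum>v\<in>UNIV. of_nat (N v) * \<chi> v)"
      unfolding N' of_nat_sum sum_distrib_right by (intro sum.cong refl) auto
    \<comment> \<open>By orthogonality the common main term E l may be subtracted from all
      counts.\<close>
    also have "\<dots> = (\<Sum>v\<in>UNIV. (of_nat (N v) - of_nat (E * l)) * \<chi> v)"
      using sum_mult_char_eq_0[OF chm ch0 nt]
      by (simp add: left_diff_distrib sum_subtractf flip: sum_distrib_left)
    also have "\<dots> = (\<Sum>v\<in>UNIV - {0}. (of_nat (N v) - of_nat (E * l)) * \<chi> v)"
      by (rule sum.mono_neutral_right) (auto simp: ch0)
    finally have SSk: "SS k = (\<Sum>v\<in>UNIV - {0}. (of_nat (N v) - of_nat (E * l)) * \<chi> v)" .
    define U where "U = real ((5 * n + 16) * l)"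
    have "norm (SS k) \<le> (\<Sum>v\<in>UNIV - {0}. norm ((of_nat (N v) - of_nat (E * l)) * \<chi> v))" unfolding SSk by (rule norm_sum)
    \<comment> \<open>Upper bounds alone suffice: x \<le> U with U \<ge> 0 implies |x| \<le> 2 U -
      x, and the sum of all counts is known exactly.\<close>
    also have "\<dots> \<le> (\<Sum>v\<in>UNIV - {0}. 2 * U - (real (N v) - real (E * l)))"
    proof (rule sum_mono)
      fix v :: 'a assume v: "v \<in> UNIV - {0}"
      have "real (N v) \<le> real ((E + 5 * n + 16) * l)" using Nup v by (intro of_nat_mono) auto
      hence up: "real (N v) - real (E * l) \<le> U" by (simp add: U_def algebra_simps)
      have "norm ((of_nat (N v) - of_nat (E * l)) * \<chi> v) \<le> norm (of_nat (N v) - of_nat (E * l) :: complex)"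
        unfolding norm_mult using chi(3)[of v] by (intro mult_left_le) auto
      also have "\<dots> = \<bar>real (N v) - real (E * l)\<bar>"
        by (metis norm_of_real of_real_diff of_real_of_nat_eq)
      also have "\<dots> \<le> 2 * U - (real (N v) - real (E * l))" using up by (auto simp: U_def abs_if)
      finally show "norm ((of_nat (N v) - of_nat (E * l)) * \<chi> v) \<le> 2 * U - (real (N v) - real (E * l))" .
    qed
    also have "\<dots> = real (q - 1) * (2 * U) - ((\<Sum>v\<in>UNIV - {0}. real (N v)) - real (q - 1) * real (E * l))"
      by (simp add: sum_subtractf q_def)
    also have "(\<Sum>v\<in>UNIV - {0}. real (N v)) = real (l ^ 2) - real (N 0)"
      unfolding Ntot[symmetric] of_nat_sum by (simp add: sum_diff1)
    also have "real (q - 1) * real (E * l) = real (l ^ 2) - real l"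
    proof -
      have "q \<ge> 1" using q prime_ge_1_nat by (simp add: q_def)
      hence "(q - 1) * E + 1 = l" unfolding E_def l_def by (rule geometric_nat)
      hence "((q - 1) * E + 1) * l = l ^ 2" by (simp add: power2_eq_square)
      hence "real (((q - 1) * E + 1) * l) = real (l ^ 2)" by (simp only:)
      hence "(real (q - 1) * real E + 1) * real l = real (l ^ 2)" by (simp only: of_nat_mult of_nat_add of_nat_1)
      thus ?thesis by (simp add: algebra_simps)
    qed
    also have "real (q - 1) * (2 * U) - (real (l ^ 2) - real (N 0) - (real (l ^ 2) - real l)) \<le> real q * (2 * U) + real n * real l"
    proof -
      have "real (N 0) \<le> real n" using N0 by simp
      moreover have "l \<ge> 1" using q prime_ge_1_nat by (simp add: l_def q_def)
      hence "real n * 1 \<le> real n * real l" by (intro mult_left_mono) auto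
      moreover have "real (q - 1) * (2 * U) \<le> real q * (2 * U)" by (intro mult_right_mono) (auto simp: U_def)
      ultimately show ?thesis by linarith
    qed
    also have "\<dots> = CC * real q ^ m" by (simp add: CC_def U_def l_def algebra_simps)
    finally show ?thesis by (simp add: k_def)
  qed
  have q0: "real q > 0" by (simp add: q_def)
  have "norm (SS 1) \<le> real (card S) * sqrt (real q)"
    by (rule power_sum_one_bound[OF L0 Ln rec q0 bd]) auto
  moreover have "SS 1 = (\<Sum>x\<in>UNIV. \<Prod>b\<in>S. \<chi> (b - x) ^ e b)"
    unfolding SS_def prime_powers_deg_1
    by (subst sum.reindex) (auto simp: inj_on_def \<psi>_def val_def chprod chi(1))
  ultimately show ?thesis by (simp add: q_def)
qed

section \<open>Sumsets\<close>

definition diffset :: "'a::ab_group_add set \<Rightarrow> 'a set \<Rightarrow> 'a set" where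
  "diffset A B = (\<lambda>(a, b). a - b) ` (A \<times> B)"

lemma finite_diffset [simp]: "finite A \<Longrightarrow> finite B \<Longrightarrow> finite (diffset A B)"
  by (simp add: diffset_def)

lemma diffsetI: "a \<in> A \<Longrightarrow> b \<in> B \<Longrightarrow> a - b \<in> diffset A B"
  by (auto simp: diffset_def)

lemma diffset_eq_plus: "diffset A B = A + uminus ` B"
  by (force simp: diffset_def set_plus_def)

text \<open>Fix one representation d = a - c for every d. The components a - b and b - c have sum d,
  so they determine d and then b.\<close>

lemma ruzsa_triangle:
  fixes A B C :: "'a::ab_group_add set"
  assumes "finite A" "finite B" "finite C"
  shows "card (diffset A C) * card B \<le> card (diffset A B) * card (diffset B C)"
proof -
  have "\<forall>d\<in>diffset A C. \<exists>p. fst p \<in> A \<and> snd p \<in> C \<and> d = fst p - snd p" by (auto simp: diffset_def)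
  then obtain p where p: "\<And>d. d \<in> diffset A C \<Longrightarrow> fst (p d) \<in> A \<and> snd (p d) \<in> C \<and> d = fst (p d) - snd (p d)"
    by metis
  define F where "F = (\<lambda>(d, b). (fst (p d) - b, b - snd (p d)))"
  have inj: "inj_on F (diffset A C \<times> B)"
  proof (rule inj_onI, clarsimp simp: F_def)
    fix d b d' b' assume d: "d \<in> diffset A C" "d' \<in> diffset A C"
      and e: "fst (p d) - b = fst (p d') - b'" "b - snd (p d) = b' - snd (p d')"
    have "d = (fst (p d) - b) + (b - snd (p d))" using p[OF d(1)] by simp
    also have "\<dots> = d'" unfolding e using p[OF d(2)] by simp
    finally have "d = d'" .
    thus "d = d' \<and> b = b'" using e(1) by simp
  qed
  have "F ` (diffset A C \<times> B) \<subseteq> diffset A B \<times> diffset B C"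
    using p by (auto simp: F_def intro!: diffsetI)
  from card_inj_on_le[OF inj this] show ?thesis using assms by (simp add: card_cartesian_product)
qed

text \<open>The same map with the sums b + a and b + c, whose difference recovers d.\<close>

lemma ruzsa_triangle_sum:
  fixes A B C :: "'a::ab_group_add set"
  assumes "finite A" "finite Xs" "finite C"
  shows "card (diffset A C) * card Xs \<le> card (Xs + A) * card (Xs + C)"
proof -
  have "\<forall>d\<in>diffset A C. \<exists>p. fst p \<in> A \<and> snd p \<in> C \<and> d = fst p - snd p" by (auto simp: diffset_def)
  then obtain p where p: "\<And>d. d \<in> diffset A C \<Longrightarrow> fst (p d) \<in> A \<and> snd (p d) \<in> C \<and> d = fst (p d) - snd (p d)"
    by metis
  define F where "F = (\<lambda>(d, b). (b + fst (p d), b + snd (p d)))"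
  have inj: "inj_on F (diffset A C \<times> Xs)"
  proof (rule inj_onI, clarsimp simp: F_def)
    fix d b d' b' assume d: "d \<in> diffset A C" "d' \<in> diffset A C"
      and e: "b + fst (p d) = b' + fst (p d')" "b + snd (p d) = b' + snd (p d')"
    have "d = (b + fst (p d)) - (b + snd (p d))" using p[OF d(1)] by simp
    also have "\<dots> = d'" unfolding e using p[OF d(2)] by simp
    finally have "d = d'" .
    thus "d = d' \<and> b = b'" using e(1) by simp
  qed
  have "F ` (diffset A C \<times> Xs) \<subseteq> (Xs + A) \<times> (Xs + C)"
    using p by (auto simp: F_def intro!: set_plus_intro)
  from card_inj_on_le[OF inj this] show ?thesis using assms by (simp add: card_cartesian_product finite_set_plus)
qed

lemma card_translate: "card ((\<lambda>x. x + c) ` A) = card (A :: 'a::ab_group_add set)"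
  by (rule card_image) (simp add: inj_on_def)

text \<open>Induction on \<open>C\<close>. A new element c adds the translate X + B + c, of which
  the part Z + B + c was present before; minimality gives |Z + B| \<ge> K |Z|, and Z contains every
  x for which x + c already lay in X + C. So both sides grow compatibly.\<close>

lemma petridis:
  fixes Xs B C :: "'a::ab_group_add set" and K :: real
  assumes Xs: "finite Xs" and B: "finite B" and C: "finite C"
    and eq: "real (card (Xs + B)) = K * real (card Xs)"
    and min: "\<And>Z. Z \<subseteq> Xs \<Longrightarrow> K * real (card Z) \<le> real (card (Z + B))" and K: "K \<ge> 0"
  shows "real (card (Xs + B + C)) \<le> K * real (card (Xs + C))"
  using C
proof (induction C rule: finite_induct)
  case empty
  have "Xs + B + {} = {}" "Xs + {} = {}" by (auto simp: set_plus_def)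
  thus ?case by simp
next
  case (insert c C)
  define Z where "Z = {x\<in>Xs. (\<lambda>b. x + b + c) ` B \<subseteq> Xs + B + C}"
  define W where "W = {x\<in>Xs. x + c \<in> Xs + C}"
  have ins: "U + insert c C = (U + C) \<union> (\<lambda>x. x + c) ` U" for U :: "'a set"
    by (auto simp: set_plus_def)
  have fin: "finite (Xs + B)" "finite (Xs + C)" "finite (Xs + B + C)"
    using Xs B insert.hyps by (auto intro!: finite_set_plus)
  have ZX: "Z \<subseteq> Xs" "finite Z" using Xs by (auto simp: Z_def)
  have WZ: "W \<subseteq> Z"
  proof
    fix x assume "x \<in> W"
    then obtain x' c' where x: "x \<in> Xs" "x' \<in> Xs" "c' \<in> C" "x + c = x' + c'" by (auto simp: W_def elim: set_plus_elim)
    have "x + b + c \<in> Xs + B + C" if "b \<in> B" for b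
    proof -
      have "x + b + c = x' + b + c'" using x(4) by (simp add: algebra_simps)
      also have "\<dots> \<in> Xs + B + C" using x(2,3) that by (intro set_plus_intro)
      finally show ?thesis .
    qed
    thus "x \<in> Z" using x by (auto simp: Z_def)
  qed
  have sub: "Xs + B + insert c C \<subseteq> (Xs + B + C) \<union> ((\<lambda>x. x + c) ` (Xs + B) - (\<lambda>x. x + c) ` (Z + B))"
  proof
    fix y assume "y \<in> Xs + B + insert c C"
    moreover have "(\<lambda>x. x + c) ` (Z + B) \<subseteq> Xs + B + C" by (auto simp: Z_def image_subset_iff elim!: set_plus_elim)
    ultimately show "y \<in> (Xs + B + C) \<union> ((\<lambda>x. x + c) ` (Xs + B) - (\<lambda>x. x + c) ` (Z + B))" unfolding ins by blast
  qed
  have ZB: "(\<lambda>x. x + c) ` (Z + B) \<subseteq> (\<lambda>x. x + c) ` (Xs + B)" using ZX by (intro image_mono set_plus_mono2) auto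
  have "card (Xs + B + insert c C) \<le> card ((Xs + B + C) \<union> ((\<lambda>x. x + c) ` (Xs + B) - (\<lambda>x. x + c) ` (Z + B)))"
    by (rule card_mono[OF _ sub]) (use fin in auto)
  also have "\<dots> \<le> card (Xs + B + C) + card ((\<lambda>x. x + c) ` (Xs + B) - (\<lambda>x. x + c) ` (Z + B))" by (rule card_Un_le)
  also have "card ((\<lambda>x. x + c) ` (Xs + B) - (\<lambda>x. x + c) ` (Z + B)) = card (Xs + B) - card (Z + B)"
    using ZX B by (subst card_Diff_subset[OF _ ZB]) (auto simp: card_translate intro!: finite_set_plus)
  finally have 1: "real (card (Xs + B + insert c C)) \<le> real (card (Xs + B + C)) + (real (card (Xs + B)) - real (card (Z + B)))"
    using card_mono[OF _ set_plus_mono2[OF ZX(1) subset_refl[of B]]] fin by simp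
  have "card (Xs + insert c C) = card ((Xs + C) \<union> ((\<lambda>x. x + c) ` (Xs - W)))"
    unfolding ins by (rule arg_cong[of _ _ card]) (auto simp: W_def)
  also have "\<dots> = card (Xs + C) + card ((\<lambda>x. x + c) ` (Xs - W))"
    by (rule card_Un_disjoint) (use fin Xs in \<open>auto simp: W_def\<close>)
  also have "card ((\<lambda>x. x + c) ` (Xs - W)) = card Xs - card W"
    using Xs by (simp add: card_translate card_Diff_subset W_def)
  finally have 2: "real (card (Xs + insert c C)) = real (card (Xs + C)) + (real (card Xs) - real (card W))"
    using card_mono[OF Xs, of W] by (auto simp: W_def)
  have "real (card W) \<le> real (card Z)" using card_mono[OF ZX(2) WZ] by simp
  hence "K * real (card W) \<le> K * real (card Z)" using K by (rule mult_left_mono)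
  hence "K * real (card W) \<le> real (card (Z + B))" using min[OF ZX(1)] by linarith
  moreover have "K * real (card (Xs + insert c C)) = K * real (card (Xs + C)) + (K * real (card Xs) - K * real (card W))"
    unfolding 2 by (simp add: algebra_simps)
  ultimately show ?case using 1 insert.IH eq by linarith
qed

text \<open>The subset minimises |Z + B| / |Z| among nonempty Z in \<open>A\<close>; the minimum is
  at most the ratio for \<open>A\<close> itself.\<close>

lemma petridis_exists:
  fixes A B :: "'a::ab_group_add set" and K :: real
  assumes A: "finite A" "A \<noteq> {}" and B: "finite B" and K: "real (card (A + B)) \<le> K * real (card A)"
  obtains Xs where "Xs \<subseteq> A" "Xs \<noteq> {}" "\<And>C. finite C \<Longrightarrow> real (card (Xs + B + C)) \<le> K * real (card (Xs + C))"
proof -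
  define r where "r = (\<lambda>Z. real (card (Z + B)) / real (card Z))"
  define \<P> where "\<P> = {Z. Z \<subseteq> A \<and> Z \<noteq> {}}"
  have fin: "finite \<P>" using A by (simp add: \<P>_def)
  have "A \<in> \<P>" using A by (simp add: \<P>_def)
  then obtain Xs where Xs: "Xs \<in> \<P>" "\<And>Z. Z \<in> \<P> \<Longrightarrow> r Xs \<le> r Z"
    using arg_min_if_finite[OF fin, of r] by (metis empty_iff not_le)
  have fX: "finite Xs" "Xs \<noteq> {}" "Xs \<subseteq> A" using Xs A by (auto simp: \<P>_def intro: finite_subset)
  have cX: "real (card Xs) > 0" using fX by (simp add: card_gt_0_iff)
  have r0: "r Xs \<ge> 0" by (simp add: r_def)
  have "r Xs \<le> r A" using Xs(2) \<open>A \<in> \<P>\<close> by blast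
  also have "r A \<le> K" using K A by (simp add: r_def field_simps card_gt_0_iff)
  finally have rK: "r Xs \<le> K" .
  have main: "real (card (Xs + B + C)) \<le> r Xs * real (card (Xs + C))" if C: "finite C" for C
  proof (rule petridis[OF fX(1) B C _ _ r0])
    show "real (card (Xs + B)) = r Xs * real (card Xs)" using cX by (simp add: r_def)
    fix Z assume Z: "Z \<subseteq> Xs"
    show "r Xs * real (card Z) \<le> real (card (Z + B))"
    proof (cases "Z = {}")
      case False
      hence "real (card Z) > 0" using Z fX by (auto simp: card_gt_0_iff intro: finite_subset)
      moreover have "r Xs \<le> r Z" using Xs(2)[of Z] False Z fX by (auto simp: \<P>_def)
      ultimately show ?thesis by (simp add: r_def field_simps)
    qed simp
  qed
  have "real (card (Xs + B + C)) \<le> K * real (card (Xs + C))" if C: "finite C" for C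
    using main[OF C] mult_right_mono[OF rK, of "real (card (Xs + C))"] by linarith
  thus ?thesis using that fX by blast
qed

primrec nsum :: "nat \<Rightarrow> 'a::comm_monoid_add set \<Rightarrow> 'a set" where
  "nsum 0 A = {0}"
| "nsum (Suc n) A = A + nsum n A"

lemma finite_nsum [simp]: "finite A \<Longrightarrow> finite (nsum n A)"
  by (induction n) (auto intro: finite_set_plus)

text \<open>Petridis' subset of \<open>B\<close> absorbs the summands \<open>A\<close> one at a
  time, each at the price of a factor K. The triangle inequality through it then compares two
  iterated sums.\<close>

lemma plunnecke_iterated:
  fixes A B :: "'a::ab_group_add set" and K :: real
  assumes A: "finite A" and B: "finite B" "B \<noteq> {}" and K: "real (card (B + A)) \<le> K * real (card B)" "K \<ge> 0"
  shows "real (card (diffset (nsum h A) (nsum k A))) \<le> K ^ (h + k) * real (card B)"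
proof -
  obtain Xs where Xs: "Xs \<subseteq> B" "Xs \<noteq> {}" "\<And>C. finite C \<Longrightarrow> real (card (Xs + A + C)) \<le> K * real (card (Xs + C))"
    using petridis_exists[OF B A K(1)] by blast
  have fX: "finite Xs" using Xs B finite_subset by blast
  have it: "real (card (Xs + nsum n A)) \<le> K ^ n * real (card Xs)" for n
  proof (induction n)
    case 0
    have "Xs + {0} = Xs" by (auto simp: set_plus_def)
    thus ?case by simp
  next
    case (Suc n)
    have "Xs + nsum (Suc n) A = Xs + A + nsum n A" by (simp add: add.assoc)
    hence "real (card (Xs + nsum (Suc n) A)) \<le> K * real (card (Xs + nsum n A))" using Xs(3)[of "nsum n A"] A by simp
    also have "\<dots> \<le> K * (K ^ n * real (card Xs))" using Suc K by (intro mult_left_mono) auto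
    finally show ?case by simp
  qed
  have "real (card (diffset (nsum h A) (nsum k A)) * card Xs) \<le> real (card (Xs + nsum h A) * card (Xs + nsum k A))"
    using ruzsa_triangle_sum[of "nsum h A" Xs "nsum k A"] A fX by (intro of_nat_mono) auto
  also have "\<dots> \<le> (K ^ h * real (card Xs)) * (K ^ k * real (card Xs))"
    unfolding of_nat_mult using it K by (intro mult_mono) auto
  finally have "real (card (diffset (nsum h A) (nsum k A))) * real (card Xs) \<le> (K ^ (h + k) * real (card Xs)) * real (card Xs)"
    by (simp add: power_add mult_ac)
  moreover have "real (card Xs) > 0" using fX Xs by (simp add: card_gt_0_iff)
  ultimately have "real (card (diffset (nsum h A) (nsum k A))) \<le> K ^ (h + k) * real (card Xs)" by simp
  also have "\<dots> \<le> K ^ (h + k) * real (card B)" using card_mono[OF B(1) Xs(1)] K by (intro mult_left_mono) auto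
  finally show ?thesis .
qed

section \<open>The Balog-Szemeredi-Gowers theorem\<close>

lemma card_eq_sum_indicator: "finite A \<Longrightarrow> real (card {a\<in>A. P a}) = (\<Sum>a\<in>A. if P a then 1 else 0)"
  by (simp add: sum.If_cases Int_def)

lemma sum_square_ge:
  fixes f :: "'b \<Rightarrow> real"
  assumes "finite B"
  shows "(\<Sum>b\<in>B. f b)\<^sup>2 \<le> real (card B) * (\<Sum>b\<in>B. (f b)\<^sup>2)"
  using sum_squared_le_sum_of_squares[of f B] assms by (simp add: mult.commute)

text \<open>A pigeonhole choice of a neighbourhood \<open>A2\<close> in which most pairs have many common neighbours,
  after which paths of length three are counted.\<close>

lemma bsg_paths:
  fixes A B :: "'a set" and G :: "('a \<times> 'a) set" and \<alpha> :: real
  assumes fin: "finite A" "finite B" and ne: "A \<noteq> {}" "B \<noteq> {}" and G: "G \<subseteq> A \<times> B" and \<alpha>: "0 < \<alpha>" "\<alpha> \<le> 1"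
    and dens: "real (card G) \<ge> \<alpha> * real (card A) * real (card B)"
  obtains A' B' where "A' \<subseteq> A" "B' \<subseteq> B" "real (card A') \<ge> \<alpha> / 6 * real (card A)" "real (card B') \<ge> \<alpha> / 4 * real (card B)"
    "\<And>a b. a \<in> A' \<Longrightarrow> b \<in> B' \<Longrightarrow> \<alpha> ^ 5 / 3072 * real (card A) * real (card B) \<le>
       real (card {(a', b1). (a, b1) \<in> G \<and> (a', b1) \<in> G \<and> (a', b) \<in> G})"
proof -
  define nA where "nA = real (card A)"
  define nB where "nB = real (card B)"
  have pos: "nA > 0" "nB > 0" using fin ne by (auto simp: nA_def nB_def card_gt_0_iff)
  define A1 where "A1 = {a\<in>A. real (card {b\<in>B. (a, b) \<in> G}) \<ge> \<alpha> / 2 * nB}"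
  have finA1: "finite A1" "A1 \<subseteq> A" using fin by (auto simp: A1_def)
  have GG: "real (card G) = (\<Sum>a\<in>A. real (card {b\<in>B. (a, b) \<in> G}))"
  proof -
    have "G = (SIGMA a:A. {b\<in>B. (a, b) \<in> G})" using G by auto
    hence "card G = (\<Sum>a\<in>A. card {b\<in>B. (a, b) \<in> G})" using fin by (subst card_SigmaI[symmetric]) auto
    thus ?thesis by simp
  qed
  have "(\<Sum>a\<in>A - A1. real (card {b\<in>B. (a, b) \<in> G})) \<le> (\<Sum>a\<in>A - A1. \<alpha> / 2 * nB)"
    by (rule sum_mono) (auto simp: A1_def)
  also have "\<dots> \<le> (\<alpha> / 2 * nB) * nA"
    using card_mono[OF fin(1), of "A - A1"] pos \<alpha> by (simp add: nA_def mult.commute mult_left_mono)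
  finally have "(\<Sum>a\<in>A - A1. real (card {b\<in>B. (a, b) \<in> G})) \<le> \<alpha> / 2 * nA * nB" by (simp add: mult_ac)
  moreover have "real (card G) = (\<Sum>a\<in>A - A1. real (card {b\<in>B. (a, b) \<in> G})) + (\<Sum>a\<in>A1. real (card {b\<in>B. (a, b) \<in> G}))"
    unfolding GG using finA1 fin by (simp add: sum.subset_diff)
  ultimately have G1: "(\<Sum>a\<in>A1. real (card {b\<in>B. (a, b) \<in> G})) \<ge> \<alpha> / 2 * nA * nB"
    using dens by (simp add: nA_def nB_def field_simps)
  define M where "M = (\<lambda>b. {a\<in>A1. (a, b) \<in> G})"
  have finM: "finite (M b)" "M b \<subseteq> A1" for b using finA1 by (auto simp: M_def)
  have swap: "(\<Sum>a\<in>S. real (card {b\<in>B. (a, b) \<in> G})) = (\<Sum>b\<in>B. real (card {a\<in>S. (a, b) \<in> G}))" if "finite S" for S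
    using that fin by (simp add: card_eq_sum_indicator sum.swap[of _ B S])
  define common where "common = (\<lambda>a a'. real (card {b\<in>B. (a, b) \<in> G \<and> (a', b) \<in> G}))"
  \<comment> \<open>A pair is bad if it has fewer than \<tau> |B| common neighbours, and \<epsilon>
    is the tolerated proportion of bad pairs. The ratio \<tau> / \<epsilon> = \<alpha>^2 / 8 is half
    of the lower bound \<alpha>^2 / 4 for the mean of |M b|^2 / |A|^2.\<close>
  define \<epsilon> where "\<epsilon> = \<alpha> / 16"
  define \<tau> where "\<tau> = \<alpha> ^ 3 / 128"
  have eps: "\<epsilon> > 0" "\<tau> > 0" "\<tau> / \<epsilon> = \<alpha>\<^sup>2 / 8" using \<alpha> by (auto simp: \<epsilon>_def \<tau>_def power2_eq_square power3_eq_cube)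
  define bad where "bad = (\<lambda>p. common (fst p) (snd p) < \<tau> * nB)"
  define nb where "nb = (\<lambda>b. real (card {p\<in>M b \<times> M b. bad p}))"
  have sq: "(\<Sum>b\<in>B. (real (card (M b)))\<^sup>2) \<ge> \<alpha>\<^sup>2 / 4 * nA\<^sup>2 * nB"
  proof -
    have "(\<alpha> / 2 * nA * nB)\<^sup>2 \<le> (\<Sum>b\<in>B. real (card (M b)))\<^sup>2"
      using G1 pos \<alpha> swap[OF finA1(1)] by (intro power_mono) (auto simp: M_def)
    also have "\<dots> \<le> nB * (\<Sum>b\<in>B. (real (card (M b)))\<^sup>2)" unfolding nB_def by (rule sum_square_ge[OF fin(2)])
    finally have "nB * (\<alpha>\<^sup>2 / 4 * nA\<^sup>2 * nB) \<le> nB * (\<Sum>b\<in>B. (real (card (M b)))\<^sup>2)"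
      by (simp add: power2_eq_square mult_ac)
    thus ?thesis using pos by simp
  qed
  have badsum: "(\<Sum>b\<in>B. nb b) \<le> \<tau> * nB * nA\<^sup>2"
  proof -
    have "(\<Sum>b\<in>B. nb b) = (\<Sum>b\<in>B. \<Sum>p\<in>A1 \<times> A1. if (fst p, b) \<in> G \<and> (snd p, b) \<in> G \<and> bad p then 1 else 0)"
    proof (intro sum.cong refl)
      fix b
      have "{p\<in>M b \<times> M b. bad p} = {p\<in>A1 \<times> A1. (fst p, b) \<in> G \<and> (snd p, b) \<in> G \<and> bad p}" by (auto simp: M_def)
      thus "nb b = (\<Sum>p\<in>A1 \<times> A1. if (fst p, b) \<in> G \<and> (snd p, b) \<in> G \<and> bad p then 1 else 0)"
        unfolding nb_def using finA1 by (subst card_eq_sum_indicator[symmetric]) auto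
    qed
    also have "\<dots> = (\<Sum>p\<in>A1 \<times> A1. \<Sum>b\<in>B. if (fst p, b) \<in> G \<and> (snd p, b) \<in> G \<and> bad p then 1 else 0)"
      by (rule sum.swap)
    also have "\<dots> \<le> (\<Sum>p\<in>A1 \<times> A1. \<tau> * nB)"
    proof (rule sum_mono)
      fix p :: "'a \<times> 'a"
      have "(\<Sum>b\<in>B. if (fst p, b) \<in> G \<and> (snd p, b) \<in> G \<and> bad p then 1 else 0) = (if bad p then common (fst p) (snd p) else 0)"
        using fin by (simp add: common_def card_eq_sum_indicator)
      also have "\<dots> \<le> \<tau> * nB" using eps pos by (auto simp: bad_def)
      finally show "(\<Sum>b\<in>B. if (fst p, b) \<in> G \<and> (snd p, b) \<in> G \<and> bad p then 1 else 0) \<le> \<tau> * nB" .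
    qed
    also have "\<dots> = (real (card A1))\<^sup>2 * (\<tau> * nB)" by (simp add: card_cartesian_product power2_eq_square)
    also have "\<dots> \<le> nA\<^sup>2 * (\<tau> * nB)"
      using card_mono[OF fin(1) finA1(2)] eps pos by (intro mult_right_mono power_mono) (auto simp: nA_def)
    finally show ?thesis by (simp add: mult_ac)
  qed
  \<comment> \<open>Averaging the square minus a penalty for bad pairs yields one b whose
    neighbourhood is large and has few bad pairs at the same time.\<close>
  have "\<exists>b\<in>B. (real (card (M b)))\<^sup>2 - nb b / \<epsilon> \<ge> \<alpha>\<^sup>2 / 8 * nA\<^sup>2"
  proof (rule ccontr)
    assume "\<not> ?thesis"
    hence "(\<Sum>b\<in>B. (real (card (M b)))\<^sup>2 - nb b / \<epsilon>) < (\<Sum>b\<in>B. \<alpha>\<^sup>2 / 8 * nA\<^sup>2)"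
      using fin ne by (intro sum_strict_mono) auto
    hence lt: "(\<Sum>b\<in>B. (real (card (M b)))\<^sup>2) - (\<Sum>b\<in>B. nb b) / \<epsilon> < nB * (\<alpha>\<^sup>2 / 8 * nA\<^sup>2)"
      by (simp add: sum_subtractf sum_divide_distrib nB_def)
    have "(\<Sum>b\<in>B. nb b) / \<epsilon> \<le> (\<tau> * nB * nA\<^sup>2) / \<epsilon>" using badsum eps by (intro divide_right_mono) auto
    also have "(\<tau> * nB * nA\<^sup>2) / \<epsilon> = (\<tau> / \<epsilon>) * (nB * nA\<^sup>2)" by simp
    also have "\<dots> = nB * (\<alpha>\<^sup>2 / 8 * nA\<^sup>2)" unfolding eps(3) by simp
    finally have "(\<Sum>b\<in>B. nb b) / \<epsilon> \<le> nB * (\<alpha>\<^sup>2 / 8 * nA\<^sup>2)" .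
    moreover have "\<alpha>\<^sup>2 / 4 * nA\<^sup>2 * nB = 2 * (nB * (\<alpha>\<^sup>2 / 8 * nA\<^sup>2))" by simp
    ultimately show False using sq lt by linarith
  qed
  then obtain b0 where b0: "b0 \<in> B" "(real (card (M b0)))\<^sup>2 - nb b0 / \<epsilon> \<ge> \<alpha>\<^sup>2 / 8 * nA\<^sup>2" by blast
  define A2 where "A2 = M b0"
  define n2 where "n2 = real (card A2)"
  have finA2: "finite A2" "A2 \<subseteq> A1" using finM by (auto simp: A2_def)
  have nb0: "nb b0 \<ge> 0" by (simp add: nb_def)
  have n2sq: "n2\<^sup>2 \<ge> \<alpha>\<^sup>2 / 8 * nA\<^sup>2" using b0(2) nb0 eps by (simp add: n2_def A2_def) (smt (verit) divide_nonneg_pos)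
  have n2: "n2 \<ge> \<alpha> / 3 * nA"
  proof (rule power2_le_imp_le)
    have "(\<alpha> / 3 * nA)\<^sup>2 \<le> \<alpha>\<^sup>2 / 8 * nA\<^sup>2" by (simp add: power_mult_distrib power_divide mult_right_mono field_simps)
    thus "(\<alpha> / 3 * nA)\<^sup>2 \<le> n2\<^sup>2" using n2sq by linarith
  qed (simp add: n2_def)
  have n2pos: "n2 > 0" using n2 \<alpha> pos by (smt (verit) divide_pos_pos mult_pos_pos)
  have badle: "nb b0 \<le> \<epsilon> * n2\<^sup>2"
  proof -
    have "0 \<le> \<alpha>\<^sup>2 / 8 * nA\<^sup>2" by simp
    hence "nb b0 / \<epsilon> \<le> n2\<^sup>2" using b0(2) unfolding n2_def A2_def by linarith
    thus ?thesis using eps by (simp add: field_simps)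
  qed
  \<comment> \<open>An element of \<open>A'\<close> has at most 2 \<epsilon> |A2| = (\<alpha> / 8)
    |A2| bad partners, half of the number of neighbours in \<open>A2\<close> required for
    \<open>B'\<close>; so at least (\<alpha> / 8) |A2| intermediate vertices remain for every
    pair.\<close>
  define A' where "A' = {a\<in>A2. real (card {a'\<in>A2. bad (a, a')}) \<le> 2 * \<epsilon> * n2}"
  define B' where "B' = {b\<in>B. real (card {a\<in>A2. (a, b) \<in> G}) \<ge> \<alpha> / 4 * n2}"
  have A'big: "real (card A') \<ge> n2 / 2"
  proof -
    have "real (card (A2 - A')) * (2 * \<epsilon> * n2) \<le> (\<Sum>a\<in>A2 - A'. real (card {a'\<in>A2. bad (a, a')}))"
      by (subst sum_constant[symmetric], rule sum_mono) (auto simp: A'_def)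
    also have "\<dots> \<le> (\<Sum>a\<in>A2. real (card {a'\<in>A2. bad (a, a')}))" by (rule sum_mono2) (use finA2 in auto)
    also have "\<dots> = nb b0"
    proof -
      have "{p\<in>A2 \<times> A2. bad p} = (SIGMA a:A2. {a'\<in>A2. bad (a, a')})" by auto
      thus ?thesis unfolding nb_def A2_def[symmetric] using finA2 by simp
    qed
    also have "\<dots> \<le> \<epsilon> * n2\<^sup>2" by (rule badle)
    finally have "(\<epsilon> * n2) * (2 * real (card (A2 - A'))) \<le> (\<epsilon> * n2) * n2" by (simp add: power2_eq_square mult_ac)
    hence "2 * real (card (A2 - A')) \<le> n2" using eps n2pos by (simp add: mult_le_cancel_left_pos)
    moreover have "card (A2 - A') = card A2 - card A'" "card A' \<le> card A2"
      using finA2 by (auto simp: A'_def intro!: card_Diff_subset card_mono)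
    ultimately show ?thesis by (simp add: n2_def)
  qed
  have B'big: "real (card B') \<ge> \<alpha> / 4 * nB"
  proof -
    have "\<alpha> / 2 * nB * n2 \<le> (\<Sum>a\<in>A2. real (card {b\<in>B. (a, b) \<in> G}))"
      unfolding n2_def using finA2 by (subst mult.commute, subst sum_constant[symmetric], intro sum_mono) (auto simp: A1_def)
    also have "\<dots> = (\<Sum>b\<in>B. real (card {a\<in>A2. (a, b) \<in> G}))" by (rule swap[OF finA2(1)])
    also have "\<dots> \<le> (\<Sum>b\<in>B. (if b \<in> B' then n2 else 0) + \<alpha> / 4 * n2)"
    proof (rule sum_mono)
      fix b assume b: "b \<in> B"
      have "real (card {a\<in>A2. (a, b) \<in> G}) \<le> n2" unfolding n2_def using finA2 by (intro of_nat_mono card_mono) auto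
      thus "real (card {a\<in>A2. (a, b) \<in> G}) \<le> (if b \<in> B' then n2 else 0) + \<alpha> / 4 * n2"
        using b mult_pos_pos[OF \<alpha>(1) n2pos] by (auto simp: B'_def)
    qed
    also have "\<dots> = real (card B') * n2 + nB * (\<alpha> / 4 * n2)"
    proof -
      have "B \<inter> B' = B'" by (auto simp: B'_def)
      thus ?thesis using fin by (simp add: sum.distrib nB_def sum.If_cases)
    qed
    finally have "(\<alpha> / 4 * nB) * n2 \<le> real (card B') * n2" by (simp add: field_simps)
    thus ?thesis using n2pos by simp
  qed
  show ?thesis
  proof (rule that[of A' B'])
    show "A' \<subseteq> A" using finA2 finA1 by (auto simp: A'_def)
    show "B' \<subseteq> B" by (auto simp: B'_def)
    show "real (card A') \<ge> \<alpha> / 6 * real (card A)" using A'big n2 by (simp add: nA_def)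
    show "real (card B') \<ge> \<alpha> / 4 * real (card B)" using B'big by (simp add: nB_def)
    fix a b assume a: "a \<in> A'" and b: "b \<in> B'"
    define Y where "Y = {a'\<in>A2. (a', b) \<in> G \<and> \<not> bad (a, a')}"
    have finY: "finite Y" using finA2 by (simp add: Y_def)
    have "{a'\<in>A2. (a', b) \<in> G} \<subseteq> Y \<union> {a'\<in>A2. bad (a, a')}" by (auto simp: Y_def)
    hence "card {a'\<in>A2. (a', b) \<in> G} \<le> card (Y \<union> {a'\<in>A2. bad (a, a')})" using finA2 finY by (intro card_mono) auto
    also have "\<dots> \<le> card Y + card {a'\<in>A2. bad (a, a')}" by (rule card_Un_le)
    finally have "real (card Y) \<ge> \<alpha> / 4 * n2 - 2 * \<epsilon> * n2" using a b by (simp add: A'_def B'_def)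
    hence Y: "real (card Y) \<ge> \<alpha> / 8 * n2" by (simp add: \<epsilon>_def field_simps)
    define PP where "PP = {(a', b1). (a, b1) \<in> G \<and> (a', b1) \<in> G \<and> (a', b) \<in> G}"
    have finP: "finite PP" by (rule finite_subset[of _ "A \<times> B"]) (use fin G in \<open>auto simp: PP_def\<close>)
    have "real (card Y) * (\<tau> * nB) \<le> (\<Sum>a'\<in>Y. common a a')"
      by (subst sum_constant[symmetric], rule sum_mono) (auto simp: Y_def bad_def)
    also have "\<dots> = real (card (SIGMA a':Y. {b1\<in>B. (a, b1) \<in> G \<and> (a', b1) \<in> G}))"
      unfolding common_def using finY fin by simp
    also have "\<dots> \<le> real (card PP)"
      by (intro of_nat_mono card_mono[OF finP]) (auto simp: PP_def Y_def)
    finally have 1: "real (card Y) * (\<tau> * nB) \<le> real (card PP)" .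
    have "\<alpha> ^ 5 / 3072 * nA * nB = (\<alpha> / 8 * (\<alpha> / 3 * nA)) * (\<tau> * nB)"
      by (simp add: \<tau>_def power_numeral_reduce)
    also have "\<dots> \<le> real (card Y) * (\<tau> * nB)"
    proof (rule mult_right_mono)
      have "\<alpha> / 8 * (\<alpha> / 3 * nA) \<le> \<alpha> / 8 * n2" using n2 \<alpha> by (intro mult_left_mono) auto
      thus "\<alpha> / 8 * (\<alpha> / 3 * nA) \<le> real (card Y)" using Y by linarith
    qed (use eps pos in auto)
    finally show "\<alpha> ^ 5 / 3072 * real (card A) * real (card B) \<le>
       real (card {(a', b1). (a, b1) \<in> G \<and> (a', b1) \<in> G \<and> (a', b) \<in> G})"
      using 1 by (simp add: PP_def nA_def nB_def)
  qed
qed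

text \<open>A path a, b1, a', b gives a + b = (a + b1) - (a' + b1) + (a' + b), a combination of
  three sums along \<open>G\<close>. So each element of A' + B' has many representations by triples
  of such sums, and triples of different elements are different.\<close>

theorem balog_szemeredi_gowers:
  fixes A B :: "'a::ab_group_add set" and G :: "('a \<times> 'a) set" and \<alpha> :: real
  assumes fin: "finite A" "finite B" and ne: "A \<noteq> {}" "B \<noteq> {}" and G: "G \<subseteq> A \<times> B" and \<alpha>: "0 < \<alpha>" "\<alpha> \<le> 1"
    and dens: "real (card G) \<ge> \<alpha> * real (card A) * real (card B)"
  obtains A' B' where "A' \<subseteq> A" "B' \<subseteq> B" "real (card A') \<ge> \<alpha> / 6 * real (card A)" "real (card B') \<ge> \<alpha> / 4 * real (card B)"
    "real (card (A' + B')) * (\<alpha> ^ 5 / 3072 * real (card A) * real (card B)) \<le> real (card ((\<lambda>(a, b). a + b) ` G)) ^ 3"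
proof -
  obtain A' B' where AB: "A' \<subseteq> A" "B' \<subseteq> B" "real (card A') \<ge> \<alpha> / 6 * real (card A)" "real (card B') \<ge> \<alpha> / 4 * real (card B)"
    and paths: "\<And>a b. a \<in> A' \<Longrightarrow> b \<in> B' \<Longrightarrow> \<alpha> ^ 5 / 3072 * real (card A) * real (card B) \<le>
       real (card {(a', b1). (a, b1) \<in> G \<and> (a', b1) \<in> G \<and> (a', b) \<in> G})"
    using bsg_paths[OF fin ne G \<alpha> dens] by blast
  define Xs where "Xs = (\<lambda>(a, b). a + b) ` G"
  have finG: "finite G" using G fin finite_subset by blast
  have finXs: "finite Xs" using finG by (simp add: Xs_def)
  define T where "T = (\<lambda>s. {(x1, x2, x3)\<in>Xs \<times> Xs \<times> Xs. x1 - x2 + x3 = s})"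
  have finT: "finite (T s)" for s by (rule finite_subset[of _ "Xs \<times> Xs \<times> Xs"]) (use finXs in \<open>auto simp: T_def\<close>)
  have Tbig: "\<alpha> ^ 5 / 3072 * real (card A) * real (card B) \<le> real (card (T s))" if "s \<in> A' + B'" for s
  proof -
    obtain a b where ab: "a \<in> A'" "b \<in> B'" "s = a + b" using \<open>s \<in> A' + B'\<close> by (auto elim: set_plus_elim)
    have "card {(a', b1). (a, b1) \<in> G \<and> (a', b1) \<in> G \<and> (a', b) \<in> G} \<le> card (T s)"
    proof (rule card_inj_on_le[OF _ _ finT])
      show "inj_on (\<lambda>(a', b1). (a + b1, a' + b1, a' + b)) {(a', b1). (a, b1) \<in> G \<and> (a', b1) \<in> G \<and> (a', b) \<in> G}"
        by (auto simp: inj_on_def)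
      show "(\<lambda>(a', b1). (a + b1, a' + b1, a' + b)) ` {(a', b1). (a, b1) \<in> G \<and> (a', b1) \<in> G \<and> (a', b) \<in> G} \<subseteq> T s"
        by (force simp: T_def Xs_def ab(3))
    qed
    thus ?thesis using paths[OF ab(1,2)] by simp
  qed
  have finS: "finite (A' + B')" using AB fin by (intro finite_set_plus) (auto intro: finite_subset)
  have "real (card (A' + B')) * (\<alpha> ^ 5 / 3072 * real (card A) * real (card B)) \<le> (\<Sum>s\<in>A' + B'. real (card (T s)))"
    by (subst sum_constant[symmetric], rule sum_mono) (use Tbig in auto)
  also have "\<dots> = real (card (\<Union>s\<in>A' + B'. T s))"
    using finS finT by (subst card_UN_disjoint) (auto simp: T_def)
  also have "\<dots> \<le> real (card (Xs \<times> Xs \<times> Xs))"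
    using finXs by (intro of_nat_mono card_mono) (auto simp: T_def)
  also have "\<dots> = real (card Xs) ^ 3" by (simp add: card_cartesian_product power3_eq_cube)
  finally show ?thesis using that AB by (simp add: Xs_def)
qed

section \<open>Freiman models and near-periods\<close>

text \<open>Order six is what comparing multiples of near-periods asks for: a relation among three
  alternating sums of four elements has six terms on either side. The values of
  \<open>\<phi>\<close> are integers read modulo \<open>N\<close>.\<close>

definition freiman6 :: "'a::ab_group_add set \<Rightarrow> ('a \<Rightarrow> int) \<Rightarrow> nat \<Rightarrow> bool" where
  "freiman6 A \<phi> N \<longleftrightarrow> (\<forall>a1\<in>A. \<forall>a2\<in>A. \<forall>a3\<in>A. \<forall>a4\<in>A. \<forall>a5\<in>A. \<forall>a6\<in>A.
     \<forall>b1\<in>A. \<forall>b2\<in>A. \<forall>b3\<in>A. \<forall>b4\<in>A. \<forall>b5\<in>A. \<forall>b6\<in>A.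
     a1 + a2 + a3 + a4 + a5 + a6 = b1 + b2 + b3 + b4 + b5 + b6 \<longleftrightarrow>
     int N dvd (\<phi> a1 + \<phi> a2 + \<phi> a3 + \<phi> a4 + \<phi> a5 + \<phi> a6) - (\<phi> b1 + \<phi> b2 + \<phi> b3 + \<phi> b4 + \<phi> b5 + \<phi> b6))"

lemma of_nat_bij_prime_field:
  assumes "prime CARD('a::finite_field)"
  shows "bij_betw (of_nat :: nat \<Rightarrow> 'a) {..<CARD('a)} UNIV"
proof -
  have ch: "CHAR('a) = CARD('a)" by (rule CHAR_eq_CARD[OF assms])
  have inj: "inj_on (of_nat :: nat \<Rightarrow> 'a) {..<CARD('a)}"
  proof (rule inj_onI)
    fix x y assume "x \<in> {..<CARD('a)}" "y \<in> {..<CARD('a)}" "(of_nat x :: 'a) = of_nat y"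
    thus "x = y" using of_nat_eq_iff_cong_CHAR[where ?'a='a, of x y] by (simp add: ch cong_def)
  qed
  have "of_nat ` {..<CARD('a)} = (UNIV :: 'a set)"
    using inj by (intro card_seteq) (auto simp: card_image)
  thus ?thesis using inj by (simp add: bij_betw_def)
qed

lemma of_int_eq_0_iff_card:
  assumes "prime CARD('a::finite_field)"
  shows "(of_int h :: 'a) = 0 \<longleftrightarrow> int CARD('a) dvd h"
proof -
  have ch: "CHAR('a) = CARD('a)" by (rule CHAR_eq_CARD[OF assms])
  show ?thesis using of_int_eq_0_iff_char_dvd[where ?'a='a, of h] ch by simp
qed

definition lift_nat :: "'a::finite_field \<Rightarrow> nat" where
  "lift_nat = the_inv_into {..<CARD('a)} of_nat"

lemma lift_nat:
  assumes "prime CARD('a::finite_field)"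
  shows "of_nat (lift_nat x) = (x :: 'a)" "lift_nat x < CARD('a)"
proof -
  note b = of_nat_bij_prime_field[OF assms]
  have inj: "inj_on (of_nat :: nat \<Rightarrow> 'a) {..<CARD('a)}" and im: "of_nat ` {..<CARD('a)} = (UNIV :: 'a set)"
    using b by (auto simp: bij_betw_def)
  show "of_nat (lift_nat x) = x" unfolding lift_nat_def by (rule f_the_inv_into_f[OF inj]) (simp add: im)
  have "lift_nat x \<in> {..<CARD('a)}" unfolding lift_nat_def by (rule the_inv_into_into[OF inj]) (auto simp: im)
  thus "lift_nat x < CARD('a)" by simp
qed

lemma lift_nat_unique:
  assumes "prime CARD('a::finite_field)" "of_nat k = (x :: 'a)" "k < CARD('a)"
  shows "lift_nat x = k"
proof -
  have "inj_on (of_nat :: nat \<Rightarrow> 'a) {..<CARD('a)}" using of_nat_bij_prime_field[OF assms(1)] by (simp add: bij_betw_def)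
  thus ?thesis using assms lift_nat[OF assms(1), of x] by (auto simp: inj_on_def)
qed

lemma nsum_6: "a1 \<in> A \<Longrightarrow> a2 \<in> A \<Longrightarrow> a3 \<in> A \<Longrightarrow> a4 \<in> A \<Longrightarrow> a5 \<in> A \<Longrightarrow> a6 \<in> A \<Longrightarrow> a1 + a2 + a3 + a4 + a5 + a6 \<in> nsum 6 A"
proof -
  assume a: "a1 \<in> A" "a2 \<in> A" "a3 \<in> A" "a4 \<in> A" "a5 \<in> A" "a6 \<in> A"
  have "nsum 6 A = A + (A + (A + (A + (A + (A + {0})))))" by (simp add: numeral_eq_Suc)
  moreover have "a1 + (a2 + (a3 + (a4 + (a5 + (a6 + 0))))) \<in> A + (A + (A + (A + (A + (A + {0})))))"
    using a by (intro set_plus_intro) auto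
  ultimately show ?thesis by (simp add: add.assoc)
qed

lemma card_multiples_le: "card {r\<in>{1..m}. N dvd r} \<le> m div N" if "N > (0::nat)"
proof -
  have "{r\<in>{1..m}. N dvd r} \<subseteq> (\<lambda>k. N * k) ` {1..m div N}"
  proof
    fix r assume r: "r \<in> {r\<in>{1..m}. N dvd r}"
    then obtain k where k: "r = N * k" by (auto simp: dvd_def)
    have "k \<ge> 1" using r k by (cases k) auto
    moreover have "k \<le> m div N" using r k that by (simp add: less_eq_div_iff_mult_less_eq mult.commute)
    ultimately show "r \<in> (\<lambda>k. N * k) ` {1..m div N}" using k by auto
  qed
  hence "card {r\<in>{1..m}. N dvd r} \<le> card ((\<lambda>k. N * k) ` {1..m div N})" by (intro card_mono) auto
  also have "\<dots> \<le> card {1..m div N}" by (rule card_image_le) simp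
  finally show ?thesis by simp
qed

text \<open>Ruzsa's construction: dilate by z, lift to integers, reduce modulo \<open>N\<close>. A
  false relation can only come from a nonzero element of 6A - 6A whose dilate lifts to a multiple of
  \<open>N\<close>, and these elements are few enough for some z to avoid all of them.\<close>

lemma freiman_model:
  fixes A :: "'a::finite_field set"
  assumes p: "prime CARD('a)" and N: "N > 2 * card (diffset (nsum 6 A) (nsum 6 A))"
  obtains A' \<phi> where "A' \<subseteq> A" "card A \<le> 6 * card A'" "freiman6 A' \<phi> N"
proof -
  define p where "p = CARD('a)"
  have p2: "p \<ge> 2" using p prime_ge_2_nat by (simp add: p_def)
  note lift = lift_nat[OF p, folded p_def]
  define D where "D = diffset (nsum 6 A) (nsum 6 A) - {0}"
  have finA: "finite A" by simp
  have finD: "finite D" by simp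
  have cD: "2 * card D < N" using card_mono[of "diffset (nsum 6 A) (nsum 6 A)" D] N by (auto simp: D_def)
  have N0: "N > 0" using N by simp
  \<comment> \<open>An integer h with |h| < p and residue z d is either the least residue of z d or
    that residue minus p; both must be kept away from the multiples of \<open>N\<close>.\<close>
  define bad where "bad = (\<lambda>d :: 'a. {z \<in> UNIV - {0}. N dvd lift_nat (z * d) \<or> N dvd (p - lift_nat (z * d))})"
  have cbad: "card (bad d) \<le> 2 * ((p - 1) div N)" if "d \<in> D" for d
  proof -
    have d0: "d \<noteq> 0" using that by (simp add: D_def)
    have inj: "inj_on (\<lambda>z. lift_nat (z * d)) UNIV"
    proof (rule inj_onI)
      fix x y :: 'a assume "lift_nat (x * d) = lift_nat (y * d)"
      hence "(of_nat (lift_nat (x * d)) :: 'a) = of_nat (lift_nat (y * d))" by simp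
      hence "x * d = y * d" unfolding lift(1) .
      thus "x = y" using d0 by auto
    qed
    have nz: "lift_nat (z * d) \<ge> 1" if "z \<noteq> 0" for z
    proof -
      have "lift_nat (z * d) \<noteq> 0" using lift(1)[of "z * d"] that d0 by (metis mult_eq_0_iff of_nat_0)
      thus ?thesis by simp
    qed
    define b1 where "b1 = {z \<in> UNIV - {0}. N dvd lift_nat (z * d)}"
    define b2 where "b2 = {z \<in> UNIV - {0}. N dvd (p - lift_nat (z * d))}"
    have "card b1 \<le> card {r\<in>{1..p - 1}. N dvd r}"
    proof (rule card_inj_on_le[of "\<lambda>z. lift_nat (z * d)"])
      show "(\<lambda>z. lift_nat (z * d)) ` b1 \<subseteq> {r\<in>{1..p - 1}. N dvd r}"
      proof
        fix r assume "r \<in> (\<lambda>z. lift_nat (z * d)) ` b1"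
        then obtain z where "z \<noteq> 0" "r = lift_nat (z * d)" "N dvd r" by (auto simp: b1_def)
        thus "r \<in> {r\<in>{1..p - 1}. N dvd r}" using nz[of z] lift(2)[of "z * d"] by simp
      qed
    qed (use inj in \<open>auto intro: inj_on_subset\<close>)
    hence 1: "card b1 \<le> (p - 1) div N" using card_multiples_le[OF N0, of "p - 1"] by linarith
    have "card b2 \<le> card {r\<in>{1..p - 1}. N dvd r}"
    proof (rule card_inj_on_le[of "\<lambda>z. p - lift_nat (z * d)"])
      show "inj_on (\<lambda>z. p - lift_nat (z * d)) b2"
      proof (rule inj_onI)
        fix x y assume "p - lift_nat (x * d) = p - lift_nat (y * d)"
        hence "lift_nat (x * d) = lift_nat (y * d)" using lift(2)[of "x * d"] lift(2)[of "y * d"] by simp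
        thus "x = y" using inj by (auto simp: inj_on_def)
      qed
      show "(\<lambda>z. p - lift_nat (z * d)) ` b2 \<subseteq> {r\<in>{1..p - 1}. N dvd r}"
      proof
        fix r assume "r \<in> (\<lambda>z. p - lift_nat (z * d)) ` b2"
        then obtain z where "z \<noteq> 0" "r = p - lift_nat (z * d)" "N dvd r" by (auto simp: b2_def)
        moreover from this have "1 \<le> r" "r \<le> p - 1" using nz[of z] lift(2)[of "z * d"] by linarith+
        ultimately show "r \<in> {r\<in>{1..p - 1}. N dvd r}" by simp
      qed
    qed auto
    hence 2: "card b2 \<le> (p - 1) div N" using card_multiples_le[OF N0, of "p - 1"] by linarith
    have "bad d = b1 \<union> b2" by (auto simp: bad_def b1_def b2_def)
    hence "card (bad d) \<le> card b1 + card b2" by (simp add: card_Un_le)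
    thus ?thesis using 1 2 by linarith
  qed
  have "card (\<Union>d\<in>D. bad d) \<le> (\<Sum>d\<in>D. card (bad d))" by (rule card_UN_le[OF finD])
  also have "\<dots> \<le> card D * (2 * ((p - 1) div N))" using sum_mono[of D "\<lambda>d. card (bad d)" "\<lambda>_. 2 * ((p - 1) div N)"] cbad by simp
  also have "\<dots> < p - 1"
  proof (cases "(p - 1) div N = 0")
    case False
    hence "card D * (2 * ((p - 1) div N)) < N * ((p - 1) div N)" using cD by (simp flip: mult.assoc add: mult.commute)
    also have "\<dots> \<le> p - 1" by simp
    finally show ?thesis .
  next
    case True
    show ?thesis unfolding True using p2 by simp
  qed
  also have "p - 1 = card (UNIV - {0 :: 'a})" by (simp add: p_def card_Diff_subset)
  finally have lt: "card (\<Union>d\<in>D. bad d) < card (UNIV - {0 :: 'a})" .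
  have "\<not> UNIV - {0 :: 'a} \<subseteq> (\<Union>d\<in>D. bad d)"
    using card_mono[of "\<Union>d\<in>D. bad d" "UNIV - {0 :: 'a}"] lt by auto
  then obtain z where z: "z \<noteq> 0" "z \<notin> (\<Union>d\<in>D. bad d)" by auto
  define \<phi> where "\<phi> = (\<lambda>a :: 'a. int (lift_nat (z * a)))"
  \<comment> \<open>Lifts are sorted into six intervals of length p / 6. Inside one of them the
    difference of two sums of six lifts is below p in absolute value, so a relation modulo p is one
    between integers.\<close>
  define cl where "cl = (\<lambda>a :: 'a. (6 * lift_nat (z * a)) div p)"
  have clr: "cl a \<in> {..<6}" for a
    using lift(2)[of "z * a"] by (simp add: cl_def less_mult_imp_div_less)
  have "\<exists>c\<in>{..<6}. card A \<le> 6 * card {a\<in>A. cl a = c}"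
  proof (rule ccontr)
    assume "\<not> ?thesis"
    hence "6 * card {a\<in>A. cl a = c} < card A" if "c \<in> {..<6}" for c using that by force
    hence "(\<Sum>c\<in>{..<6}. 6 * card {a\<in>A. cl a = c}) < (\<Sum>c\<in>{..<6::nat}. card A)"
      by (intro sum_strict_mono) (auto simp: lessThan_empty_iff)
    moreover have "(\<Sum>c\<in>{..<6}. card {a\<in>A. cl a = c}) = card A"
      using sum.group[OF finA finite_lessThan[of 6], of cl "\<lambda>_. 1::nat"] clr by auto
    ultimately show False by (simp flip: sum_distrib_left)
  qed
  then obtain c where c: "card A \<le> 6 * card {a\<in>A. cl a = c}" by blast
  define A' where "A' = {a\<in>A. cl a = c}"
  have close: "\<bar>6 * \<phi> a - 6 * \<phi> b\<bar> < int p" if "a \<in> A'" "b \<in> A'" for a b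
  proof -
    have "int (6 * lift_nat (z * a)) div int p = int c" "int (6 * lift_nat (z * b)) div int p = int c"
      using that by (simp_all only: A'_def cl_def mem_Collect_eq zdiv_int[symmetric])
    moreover have "x - y < int p" if "x div int p = int c" "y div int p = int c" for x y
    proof -
      have "x = int p * int c + x mod int p" "y = int p * int c + y mod int p"
        using that by (metis mult_div_mod_eq)+
      moreover have "x mod int p < int p" "y mod int p \<ge> 0" using p2 by auto
      ultimately show ?thesis by linarith
    qed
    ultimately have "6 * \<phi> a - 6 * \<phi> b < int p" "6 * \<phi> b - 6 * \<phi> a < int p" by (auto simp: \<phi>_def)
    thus ?thesis by linarith
  qed
  have "freiman6 A' \<phi> N"
    unfolding freiman6_def
  proof (intro ballI)
    fix a1 a2 a3 a4 a5 a6 b1 b2 b3 b4 b5 b6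
    assume a: "a1 \<in> A'" "a2 \<in> A'" "a3 \<in> A'" "a4 \<in> A'" "a5 \<in> A'" "a6 \<in> A'"
      and b: "b1 \<in> A'" "b2 \<in> A'" "b3 \<in> A'" "b4 \<in> A'" "b5 \<in> A'" "b6 \<in> A'"
    define h where "h = (\<phi> a1 + \<phi> a2 + \<phi> a3 + \<phi> a4 + \<phi> a5 + \<phi> a6) - (\<phi> b1 + \<phi> b2 + \<phi> b3 + \<phi> b4 + \<phi> b5 + \<phi> b6)"
    define d where "d = (a1 + a2 + a3 + a4 + a5 + a6) - (b1 + b2 + b3 + b4 + b5 + b6)"
    have habs: "\<bar>h\<bar> < int p"
      unfolding h_def using close[OF a(1) b(1)] close[OF a(2) b(2)] close[OF a(3) b(3)] close[OF a(4) b(4)]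
        close[OF a(5) b(5)] close[OF a(6) b(6)] by linarith
    have of: "of_int (\<phi> a) = z * a" for a using lift(1)[of "z * a"] by (simp add: \<phi>_def)
    have hd: "of_int h = z * d" unfolding h_def d_def by (simp add: of algebra_simps)
    have dD: "d \<noteq> 0 \<Longrightarrow> d \<in> D"
      using a b unfolding D_def d_def by (auto intro!: diffsetI nsum_6 simp: A'_def)
    have "d = 0 \<longleftrightarrow> int N dvd h"
    proof
      assume "d = 0"
      hence "int p dvd h" using hd of_int_eq_0_iff_card[OF p, of h] by (simp add: p_def)
      hence "h = 0" using habs by (metis zdvd_not_zless abs_dvd_iff dvd_abs_iff abs_ge_zero linorder_neqE_linordered_idom not_less zero_less_abs_iff)
      thus "int N dvd h" by simp
    next
      assume Nh: "int N dvd h"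
      show "d = 0"
      proof (rule ccontr)
        assume d0: "d \<noteq> 0"
        have nb: "\<not> N dvd lift_nat (z * d)" "\<not> N dvd (p - lift_nat (z * d))"
          using z dD[OF d0] by (auto simp: bad_def)
        have "h \<noteq> 0" using hd d0 z by auto
        show False
        proof (cases "h > 0")
          case True
          have "lift_nat (z * d) = nat h"
            by (rule lift_nat_unique[OF p]) (use hd habs True in \<open>auto simp: p_def of_nat_nat\<close>)
          thus False using nb(1) Nh True by (simp add: nat_dvd_iff int_dvd_int_iff[symmetric])
        next
          case False
          have "lift_nat (z * d) = nat (h + int p)"
          proof (rule lift_nat_unique[OF p])
            have "(of_nat CARD('a) :: 'a) = 0" using of_int_eq_0_iff_card[OF p, of "int CARD('a)"] by simp
            thus "of_nat (nat (h + int p)) = z * d" using hd habs False by (simp add: of_nat_nat p_def)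
          qed (use habs False \<open>h \<noteq> 0\<close> in \<open>auto simp: p_def\<close>)
          hence "int (p - lift_nat (z * d)) = - h" using habs False by auto
          hence "int N dvd int (p - lift_nat (z * d))" using Nh by simp
          thus False using nb(2) by (simp only: int_dvd_int_iff)
        qed
      qed
    qed
    thus "a1 + a2 + a3 + a4 + a5 + a6 = b1 + b2 + b3 + b4 + b5 + b6 \<longleftrightarrow>
      int N dvd (\<phi> a1 + \<phi> a2 + \<phi> a3 + \<phi> a4 + \<phi> a5 + \<phi> a6) - (\<phi> b1 + \<phi> b2 + \<phi> b3 + \<phi> b4 + \<phi> b5 + \<phi> b6)"
      by (simp add: d_def h_def)
  qed
  moreover have "A' \<subseteq> A" by (auto simp: A'_def)
  ultimately show ?thesis using that[of A' \<phi>] c by (simp add: A'_def)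
qed

section \<open>Fourier analysis on the model and near-periods\<close>

definition quads :: "'a::ab_group_add set \<Rightarrow> 'a \<Rightarrow> ('a \<times> 'a \<times> 'a \<times> 'a) set" where
  "quads A t = {(a1, a2, a3, a4). a1 \<in> A \<and> a2 \<in> A \<and> a3 \<in> A \<and> a4 \<in> A \<and> a1 - a2 + a3 - a4 = t}"

definition quads_mod :: "'a set \<Rightarrow> ('a \<Rightarrow> int) \<Rightarrow> nat \<Rightarrow> int \<Rightarrow> ('a \<times> 'a \<times> 'a \<times> 'a) set" where
  "quads_mod A \<phi> N t = {(a1, a2, a3, a4). a1 \<in> A \<and> a2 \<in> A \<and> a3 \<in> A \<and> a4 \<in> A \<and>
     int N dvd \<phi> a1 - \<phi> a2 + \<phi> a3 - \<phi> a4 - t}"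

definition ex :: "nat \<Rightarrow> int \<Rightarrow> complex" where
  "ex N x = cis (2 * pi * real_of_int x / real N)"

lemma ex_add: "ex N (x + y) = ex N x * ex N y"
  by (simp add: ex_def cis_mult add_divide_distrib distrib_left)

lemma ex_0 [simp]: "ex N 0 = 1"
  by (simp add: ex_def)

lemma norm_ex [simp]: "norm (ex N x) = 1"
  by (simp add: ex_def)

lemma cnj_ex: "cnj (ex N x) = ex N (- x)"
  by (simp add: ex_def cis_cnj)

lemma ex_eq_1_iff: "N > 0 \<Longrightarrow> ex N x = 1 \<longleftrightarrow> int N dvd x"
proof -
  assume N: "N > 0"
  have "ex N x = 1 \<longleftrightarrow> (\<exists>n::int. 2 * pi * real_of_int x / real N = 2 * pi * real_of_int n)"
  proof -
    have "cis t = 1 \<longleftrightarrow> cos t = 1" for t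
      using cos_one_sin_zero[of t] by (auto simp: complex_eq_iff)
    thus ?thesis by (simp add: ex_def cos_one_2pi_int mult_ac)
  qed
  also have "\<dots> \<longleftrightarrow> (\<exists>n::int. x = int N * n)"
  proof (rule iff_exI)
    fix n :: int
    have "2 * pi * real_of_int x / real N = 2 * pi * real_of_int n \<longleftrightarrow> real_of_int x = real N * real_of_int n"
      using N by (simp add: field_simps)
    also have "\<dots> \<longleftrightarrow> x = int N * n" by (metis of_int_eq_iff of_int_mult of_int_of_nat_eq)
    finally show "2 * pi * real_of_int x / real N = 2 * pi * real_of_int n \<longleftrightarrow> x = int N * n" .
  qed
  finally show ?thesis by (simp add: dvd_def)
qed

lemma ex_cong_mod: "N > 0 \<Longrightarrow> int N dvd x - y \<Longrightarrow> ex N x = ex N y"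
  using ex_add[of N "x - y" y] ex_eq_1_iff[of N "x - y"] by simp

lemma norm_ex_minus_1_le: "norm (ex N x - 1) \<le> 2 * pi * \<bar>real_of_int x\<bar> / real N"
proof -
  have "norm (cis t - 1) \<le> \<bar>t\<bar>" for t
  proof (rule power2_le_imp_le)
    have "(norm (cis t - 1))\<^sup>2 = (cos t - 1)\<^sup>2 + (sin t)\<^sup>2" by (simp add: cmod_power2)
    also have "\<dots> = 2 - 2 * cos t" using sin_cos_squared_add[of t] by (simp add: power2_diff)
    also have "\<dots> = 4 * (sin (t / 2))\<^sup>2" using cos_double_sin[of "t / 2"] by simp
    also have "\<dots> \<le> 4 * \<bar>t / 2\<bar>\<^sup>2"
      using power_mono[OF abs_sin_x_le_abs_x[of "t / 2"] abs_ge_zero, of 2] by simp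
    finally show "(norm (cis t - 1))\<^sup>2 \<le> \<bar>t\<bar>\<^sup>2" by (simp add: power_divide)
  qed simp
  from this[of "2 * pi * real_of_int x / real N"] show ?thesis
    by (simp add: ex_def abs_mult)
qed

lemma norm_ex_mult_le: "norm (ex N (int j * x) - 1) \<le> real j * norm (ex N x - 1)"
proof (induction j)
  case (Suc j)
  have "ex N (int (Suc j) * x) - 1 = ex N x * (ex N (int j * x) - 1) + (ex N x - 1)"
    by (simp add: algebra_simps ex_add)
  hence "norm (ex N (int (Suc j) * x) - 1) \<le> norm (ex N x * (ex N (int j * x) - 1)) + norm (ex N x - 1)"
    using norm_triangle_ineq by metis
  also have "\<dots> = norm (ex N (int j * x) - 1) + norm (ex N x - 1)" by (simp add: norm_mult)
  finally show ?case using Suc by (simp add: algebra_simps)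
qed simp

lemma sum_ex: "N > 0 \<Longrightarrow> (\<Sum>\<xi><N. ex N (t * int \<xi>)) = (if int N dvd t then of_nat N else 0)"
proof -
  assume N: "N > 0"
  have pow: "ex N (t * int \<xi>) = ex N t ^ \<xi>" for \<xi>
    by (induction \<xi>) (auto simp: distrib_left ex_add)
  show ?thesis
  proof (cases "int N dvd t")
    case True
    hence "ex N t = 1" using ex_eq_1_iff[OF N] by simp
    thus ?thesis using True by (simp add: pow)
  next
    case False
    hence ne: "ex N t \<noteq> 1" using ex_eq_1_iff[OF N] by simp
    have "ex N t ^ N = ex N (t * int N)" by (simp add: pow)
    also have "\<dots> = 1" using ex_eq_1_iff[OF N] by simp
    finally have "(\<Sum>\<xi><N. ex N t ^ \<xi>) = 0" using ne geometric_sum[OF ne, of N] by simp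
    thus ?thesis using False by (simp add: pow)
  qed
qed

text \<open>Dirichlet's pigeonhole: the residues of t \<xi> for \<xi> in \<open>\<Gamma>\<close>
  place t in one of M^|\<Gamma>| cells, and the differences from one member of the fullest cell are
  small in every coordinate.\<close>

lemma bohr_set_large:
  fixes \<Gamma> :: "nat set"
  assumes N: "N > 0" and fin: "finite \<Gamma>" and M: "M \<ge> (1::nat)"
  obtains T where "T \<subseteq> {0..<int N}" "N \<le> card T * M ^ card \<Gamma>"
    "\<And>t \<xi>. t \<in> T \<Longrightarrow> \<xi> \<in> \<Gamma> \<Longrightarrow> norm (ex N (t * int \<xi>) - 1) \<le> 2 * pi / real M"
proof -
  define cell where "cell = (\<lambda>t. \<lambda>\<xi>\<in>\<Gamma>. ((t * int \<xi>) mod int N) * int M div int N)"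
  define F where "F = PiE \<Gamma> (\<lambda>_. {0..<int M})"
  have finF: "finite F" unfolding F_def by (rule finite_PiE[OF fin]) auto
  have cF: "card F = M ^ card \<Gamma>" unfolding F_def by (simp add: card_PiE[OF fin])
  have cell: "cell t \<in> F" for t
  proof -
    have "((t * int \<xi>) mod int N) * int M div int N \<in> {0..<int M}" for \<xi>
    proof -
      have "(t * int \<xi>) mod int N < int N" "(t * int \<xi>) mod int N \<ge> 0" using N by auto
      hence lt: "((t * int \<xi>) mod int N) * int M < int M * int N" (is "?x < _") using M by simp
      have nn: "?x \<ge> 0" using \<open>(t * int \<xi>) mod int N \<ge> 0\<close> by simp
      have "?x div int N < int M"
      proof (rule ccontr)
        assume "\<not> ?x div int N < int M"
        hence "int M * int N \<le> (?x div int N) * int N" by (intro mult_right_mono) auto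
        also have "\<dots> = ?x - ?x mod int N" by (rule minus_mod_eq_div_mult[symmetric])
        also have "\<dots> \<le> ?x" using N by simp
        finally show False using lt by simp
      qed
      moreover have "?x div int N \<ge> 0" using nn N by (simp add: pos_imp_zdiv_nonneg_iff)
      ultimately show ?thesis by simp
    qed
    thus ?thesis unfolding cell_def F_def by auto
  qed
  have "\<exists>c\<in>F. N \<le> card {t\<in>{0..<int N}. cell t = c} * card F"
  proof (rule ccontr)
    assume "\<not> ?thesis"
    hence lt: "card {t\<in>{0..<int N}. cell t = c} * card F < N" if "c \<in> F" for c using that by force
    have ne: "F \<noteq> {}" using cell by blast
    have "(\<Sum>c\<in>F. card {t\<in>{0..<int N}. cell t = c} * card F) < (\<Sum>c\<in>F. N)"
      using lt ne finF by (intro sum_strict_mono) auto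
    moreover have "(\<Sum>c\<in>F. card {t\<in>{0..<int N}. cell t = c}) = N"
      using sum.group[of "{0..<int N}" F cell "\<lambda>_. 1::nat"] cell finF by auto
    hence "(\<Sum>c\<in>F. card {t\<in>{0..<int N}. cell t = c} * card F) = N * card F" by (simp only: sum_distrib_right[symmetric])
    ultimately show False by simp
  qed
  then obtain c where c: "N \<le> card {t\<in>{0..<int N}. cell t = c} * card F" by blast
  define C where "C = {t\<in>{0..<int N}. cell t = c}"
  have "card C \<noteq> 0" using c N unfolding C_def[symmetric] by (cases "card C = 0") auto
  hence "C \<noteq> {}" by auto
  then obtain t0 where t0: "t0 \<in> C" by blast
  define T where "T = (\<lambda>t. (t - t0) mod int N) ` C"
  have inj: "inj_on (\<lambda>t. (t - t0) mod int N) C"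
  proof (rule inj_onI)
    fix x y assume xy: "x \<in> C" "y \<in> C" "(x - t0) mod int N = (y - t0) mod int N"
    hence "int N dvd (x - t0) - (y - t0)" by (simp add: mod_eq_dvd_iff)
    hence "int N dvd x - y" by simp
    moreover have "\<bar>x - y\<bar> < int N" using xy by (auto simp: C_def)
    ultimately show "x = y" using dvd_imp_le_int[of "x - y" "int N"] by force
  qed
  have "card T = card C" unfolding T_def by (rule card_image[OF inj])
  show ?thesis
  proof (rule that[of T])
    show "T \<subseteq> {0..<int N}" using N by (auto simp: T_def)
    show "N \<le> card T * M ^ card \<Gamma>" using c \<open>card T = card C\<close> cF by (simp add: C_def)
    fix t \<xi> assume t: "t \<in> T" and \<xi>: "\<xi> \<in> \<Gamma>"
    obtain s where s: "s \<in> C" "t = (s - t0) mod int N" using t by (auto simp: T_def)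
    define u where "u = (s * int \<xi>) mod int N"
    define v where "v = (t0 * int \<xi>) mod int N"
    have "cell s \<xi> = cell t0 \<xi>" using s t0 by (simp add: C_def)
    hence eq: "u * int M div int N = v * int M div int N" using \<xi> by (simp add: cell_def u_def v_def)
    have "\<bar>u * int M - v * int M\<bar> < int N"
    proof -
      have "u * int M = int N * (u * int M div int N) + u * int M mod int N"
        "v * int M = int N * (v * int M div int N) + v * int M mod int N" by simp_all
      moreover have "u * int M mod int N < int N" "u * int M mod int N \<ge> 0"
        "v * int M mod int N < int N" "v * int M mod int N \<ge> 0" using N by auto
      ultimately show ?thesis unfolding eq by linarith
    qed
    hence "\<bar>real_of_int (u - v)\<bar> * real M \<le> real N"
    proof -
      assume "\<bar>u * int M - v * int M\<bar> < int N"
      hence "\<bar>u - v\<bar> * int M \<le> int N" by (simp add: left_diff_distrib[symmetric] abs_mult)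
      hence "real_of_int (\<bar>u - v\<bar> * int M) \<le> real_of_int (int N)" by (simp only: of_int_le_iff)
      thus ?thesis by simp
    qed
    hence "\<bar>real_of_int (u - v)\<bar> / real N \<le> 1 / real M" using N M by (simp add: field_simps)
    have "int N dvd t * int \<xi> - (u - v)"
    proof -
      have "(t * int \<xi>) mod int N = ((s - t0) * int \<xi>) mod int N" unfolding s(2) by (simp add: mod_mult_left_eq)
      also have "\<dots> = (u - v) mod int N" unfolding u_def v_def by (simp add: left_diff_distrib mod_diff_eq)
      finally show ?thesis by (simp add: mod_eq_dvd_iff)
    qed
    hence "ex N (t * int \<xi>) = ex N (u - v)" by (rule ex_cong_mod[OF N])
    hence "norm (ex N (t * int \<xi>) - 1) \<le> 2 * pi * (\<bar>real_of_int (u - v)\<bar> / real N)"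
      using norm_ex_minus_1_le[of N "u - v"] by simp
    also have "\<dots> \<le> 2 * pi * (1 / real M)"
      using \<open>\<bar>real_of_int (u - v)\<bar> / real N \<le> 1 / real M\<close> by (intro mult_left_mono) auto
    finally show "norm (ex N (t * int \<xi>) - 1) \<le> 2 * pi / real M" by simp
  qed
qed

text \<open>A relation with four terms on either side is padded to six by adding \<open>a1\<close>
  twice to both.\<close>

lemma freiman6_4:
  assumes "freiman6 A \<phi> N" "a1 \<in> A" "a2 \<in> A" "a3 \<in> A" "a4 \<in> A" "b1 \<in> A" "b2 \<in> A" "b3 \<in> A" "b4 \<in> A"
  shows "a1 - a2 + a3 - a4 = b1 - b2 + b3 - b4 \<longleftrightarrow>
    int N dvd (\<phi> a1 - \<phi> a2 + \<phi> a3 - \<phi> a4) - (\<phi> b1 - \<phi> b2 + \<phi> b3 - \<phi> b4)"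
proof -
  have "a1 - a2 + a3 - a4 = b1 - b2 + b3 - b4 \<longleftrightarrow> a1 + a3 + b2 + b4 + a1 + a1 = b1 + b3 + a2 + a4 + a1 + a1"
  proof -
    have "(a1 - a2 + a3 - a4) - (b1 - b2 + b3 - b4) = (a1 + a3 + b2 + b4 + a1 + a1) - (b1 + b3 + a2 + a4 + a1 + a1)"
      by (simp add: algebra_simps)
    thus ?thesis by (metis right_minus_eq)
  qed
  also have "\<dots> \<longleftrightarrow> int N dvd (\<phi> a1 + \<phi> a3 + \<phi> b2 + \<phi> b4 + \<phi> a1 + \<phi> a1) - (\<phi> b1 + \<phi> b3 + \<phi> a2 + \<phi> a4 + \<phi> a1 + \<phi> a1)"
    using assms unfolding freiman6_def by blast
  also have "(\<phi> a1 + \<phi> a3 + \<phi> b2 + \<phi> b4 + \<phi> a1 + \<phi> a1) - (\<phi> b1 + \<phi> b3 + \<phi> a2 + \<phi> a4 + \<phi> a1 + \<phi> a1) =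
     (\<phi> a1 - \<phi> a2 + \<phi> a3 - \<phi> a4) - (\<phi> b1 - \<phi> b2 + \<phi> b3 - \<phi> b4)" by simp
  finally show ?thesis .
qed

lemma freiman6_12:
  assumes "freiman6 A \<phi> N" "a1 \<in> A" "a2 \<in> A" "a3 \<in> A" "a4 \<in> A" "b1 \<in> A" "b2 \<in> A" "b3 \<in> A" "b4 \<in> A"
    "c1 \<in> A" "c2 \<in> A" "c3 \<in> A" "c4 \<in> A"
  shows "(a1 - a2 + a3 - a4) + (b1 - b2 + b3 - b4) = c1 - c2 + c3 - c4 \<longleftrightarrow>
    int N dvd (\<phi> a1 - \<phi> a2 + \<phi> a3 - \<phi> a4) + (\<phi> b1 - \<phi> b2 + \<phi> b3 - \<phi> b4) - (\<phi> c1 - \<phi> c2 + \<phi> c3 - \<phi> c4)"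
proof -
  have "(a1 - a2 + a3 - a4) + (b1 - b2 + b3 - b4) = c1 - c2 + c3 - c4 \<longleftrightarrow>
     a1 + a3 + b1 + b3 + c2 + c4 = a2 + a4 + b2 + b4 + c1 + c3"
  proof -
    have "((a1 - a2 + a3 - a4) + (b1 - b2 + b3 - b4)) - (c1 - c2 + c3 - c4) =
      (a1 + a3 + b1 + b3 + c2 + c4) - (a2 + a4 + b2 + b4 + c1 + c3)"
      by (simp add: algebra_simps)
    thus ?thesis by (metis right_minus_eq)
  qed
  also have "\<dots> \<longleftrightarrow> int N dvd (\<phi> a1 + \<phi> a3 + \<phi> b1 + \<phi> b3 + \<phi> c2 + \<phi> c4) - (\<phi> a2 + \<phi> a4 + \<phi> b2 + \<phi> b4 + \<phi> c1 + \<phi> c3)"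
    using assms unfolding freiman6_def by blast
  also have "(\<phi> a1 + \<phi> a3 + \<phi> b1 + \<phi> b3 + \<phi> c2 + \<phi> c4) - (\<phi> a2 + \<phi> a4 + \<phi> b2 + \<phi> b4 + \<phi> c1 + \<phi> c3) =
     (\<phi> a1 - \<phi> a2 + \<phi> a3 - \<phi> a4) + (\<phi> b1 - \<phi> b2 + \<phi> b3 - \<phi> b4) - (\<phi> c1 - \<phi> c2 + \<phi> c3 - \<phi> c4)" by simp
  finally show ?thesis .
qed

definition fhat :: "'a set \<Rightarrow> ('a \<Rightarrow> int) \<Rightarrow> nat \<Rightarrow> nat \<Rightarrow> complex" where
  "fhat A \<phi> N \<xi> = (\<Sum>a\<in>A. ex N (\<phi> a * int \<xi>))"

lemma sum_indicator_ex:
  assumes "N > 0" "finite Q"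
  shows "(\<Sum>\<xi><N. \<Sum>q\<in>Q. ex N (h q * int \<xi>)) = of_nat N * of_nat (card {q\<in>Q. int N dvd h q})"
proof -
  have "(\<Sum>\<xi><N. \<Sum>q\<in>Q. ex N (h q * int \<xi>)) = (\<Sum>q\<in>Q. \<Sum>\<xi><N. ex N (h q * int \<xi>))" by (rule sum.swap)
  also have "\<dots> = (\<Sum>q\<in>Q. if int N dvd h q then of_nat N else 0)" by (simp add: sum_ex[OF assms(1)])
  also have "\<dots> = of_nat N * of_nat (card {q\<in>Q. int N dvd h q})"
    using assms(2) by (simp add: sum.If_cases Int_def mult.commute)
  finally show ?thesis .
qed

lemma fhat_parseval:
  assumes N: "N > 0" and fin: "finite A" and inj: "\<And>a b. a \<in> A \<Longrightarrow> b \<in> A \<Longrightarrow> int N dvd \<phi> a - \<phi> b \<Longrightarrow> a = b"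
  shows "(\<Sum>\<xi><N. (norm (fhat A \<phi> N \<xi>))\<^sup>2) = real N * real (card A)"
proof -
  have "complex_of_real ((norm (fhat A \<phi> N \<xi>))\<^sup>2) = (\<Sum>q\<in>A \<times> A. ex N ((\<phi> (fst q) - \<phi> (snd q)) * int \<xi>))" for \<xi>
  proof -
    have "complex_of_real ((norm (fhat A \<phi> N \<xi>))\<^sup>2) = fhat A \<phi> N \<xi> * cnj (fhat A \<phi> N \<xi>)"
      by (rule complex_norm_square)
    also have "\<dots> = (\<Sum>a\<in>A. \<Sum>b\<in>A. ex N (\<phi> a * int \<xi>) * ex N (- (\<phi> b * int \<xi>)))"
      by (simp add: fhat_def sum_product cnj_ex)
    also have "\<dots> = (\<Sum>(a, b)\<in>A \<times> A. ex N (\<phi> a * int \<xi>) * ex N (- (\<phi> b * int \<xi>)))" by (rule sum.cartesian_product)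
    also have "\<dots> = (\<Sum>q\<in>A \<times> A. ex N ((\<phi> (fst q) - \<phi> (snd q)) * int \<xi>))"
      by (intro sum.cong refl) (auto simp: left_diff_distrib simp flip: ex_add)
    finally show ?thesis .
  qed
  hence "complex_of_real (\<Sum>\<xi><N. (norm (fhat A \<phi> N \<xi>))\<^sup>2) = of_nat N * of_nat (card {q\<in>A \<times> A. int N dvd \<phi> (fst q) - \<phi> (snd q)})"
    unfolding of_real_sum using sum_indicator_ex[OF N, of "A \<times> A" "\<lambda>q. \<phi> (fst q) - \<phi> (snd q)"] fin by simp
  moreover have "{q\<in>A \<times> A. int N dvd \<phi> (fst q) - \<phi> (snd q)} = (\<lambda>a. (a, a)) ` A" (is "?L = ?R")
  proof (intro equalityI subsetI)
    fix q assume q: "q \<in> ?L"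
    hence "fst q = snd q" using inj[of "fst q" "snd q"] by auto
    thus "q \<in> ?R" using q by (cases q) auto
  qed auto
  moreover have "card ((\<lambda>a. (a, a)) ` A) = card A" by (rule card_image) (simp add: inj_on_def)
  ultimately have "complex_of_real (\<Sum>\<xi><N. (norm (fhat A \<phi> N \<xi>))\<^sup>2) = complex_of_real (real N * real (card A))" by simp
  thus ?thesis by (simp only: of_real_eq_iff)
qed

text \<open>Orthogonality. The alternating signs produce fourth powers of absolute values, so the
  weights are nonnegative and the count at 0 dominates.\<close>

lemma quads_mod_fourier:
  assumes N: "N > 0" and fin: "finite A"
  shows "complex_of_real (real N * real (card (quads_mod A \<phi> N t))) = (\<Sum>\<xi><N. complex_of_real (norm (fhat A \<phi> N \<xi>) ^ 4) * ex N (- t * int \<xi>))"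
proof -
  define h where "h = (\<lambda>(a1, a2, a3, a4). \<phi> a1 - \<phi> a2 + \<phi> a3 - \<phi> a4 - t)"
  have "complex_of_real (norm (fhat A \<phi> N \<xi>) ^ 4) * ex N (- t * int \<xi>) = (\<Sum>q\<in>A \<times> A \<times> A \<times> A. ex N (h q * int \<xi>))" for \<xi>
  proof -
    let ?f = "fhat A \<phi> N \<xi>"
    have "complex_of_real (norm ?f ^ 4) = complex_of_real ((norm ?f)\<^sup>2) * complex_of_real ((norm ?f)\<^sup>2)"
      by (simp flip: of_real_mult power_add)
    also have "\<dots> = ?f * (cnj ?f * (?f * cnj ?f))" unfolding complex_norm_square by (simp add: mult_ac)
    also have "\<dots> = (\<Sum>a1\<in>A. ex N (\<phi> a1 * int \<xi>)) * ((\<Sum>a2\<in>A. ex N (- (\<phi> a2 * int \<xi>))) *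
        ((\<Sum>a3\<in>A. ex N (\<phi> a3 * int \<xi>)) * (\<Sum>a4\<in>A. ex N (- (\<phi> a4 * int \<xi>)))))"
      by (simp add: fhat_def cnj_ex)
    also have "\<dots> = (\<Sum>q\<in>A \<times> A \<times> A \<times> A. case q of (a1, a2, a3, a4) \<Rightarrow> ex N (\<phi> a1 * int \<xi>) * (ex N (- (\<phi> a2 * int \<xi>)) *
        (ex N (\<phi> a3 * int \<xi>) * ex N (- (\<phi> a4 * int \<xi>)))))"
      unfolding sum_product sum.cartesian_product by (simp add: case_prod_beta)
    finally have "complex_of_real (norm ?f ^ 4) * ex N (- t * int \<xi>) = (\<Sum>q\<in>A \<times> A \<times> A \<times> A. (case q of (a1, a2, a3, a4) \<Rightarrow> ex N (\<phi> a1 * int \<xi>) * (ex N (- (\<phi> a2 * int \<xi>)) *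
        (ex N (\<phi> a3 * int \<xi>) * ex N (- (\<phi> a4 * int \<xi>))))) * ex N (- t * int \<xi>))" by (simp only: sum_distrib_right)
    also have "\<dots> = (\<Sum>q\<in>A \<times> A \<times> A \<times> A. ex N (h q * int \<xi>))"
      by (intro sum.cong refl) (auto simp: h_def algebra_simps simp flip: ex_add)
    finally show ?thesis .
  qed
  hence "(\<Sum>\<xi><N. complex_of_real (norm (fhat A \<phi> N \<xi>) ^ 4) * ex N (- t * int \<xi>)) = of_nat N * of_nat (card {q\<in>A \<times> A \<times> A \<times> A. int N dvd h q})"
    using sum_indicator_ex[OF N, of "A \<times> A \<times> A \<times> A" h] fin by simp
  moreover have "{q\<in>A \<times> A \<times> A \<times> A. int N dvd h q} = quads_mod A \<phi> N t" by (auto simp: quads_mod_def h_def)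
  ultimately show ?thesis by simp
qed

text \<open>On the large spectrum the phases move by at most \<eta>. Off it the squared coefficients
  are at most \<rho>, so by Parseval their fourth moment is at most \<rho> N n; \<rho> is chosen
  such that twice this is \<eta> n^4, itself at most \<eta> times the transform's full fourth
  moment. Each part costs \<eta>, whence 2 \<eta>.\<close>

lemma quads_mod_stable:
  assumes N: "N > 0" and fin: "finite A" "A \<noteq> {}"
    and inj: "\<And>a b. a \<in> A \<Longrightarrow> b \<in> A \<Longrightarrow> int N dvd \<phi> a - \<phi> b \<Longrightarrow> a = b"
    and \<eta>: "\<eta> > 0"
    and \<Gamma>: "\<Gamma> = {\<xi>. \<xi> < N \<and> (norm (fhat A \<phi> N \<xi>))\<^sup>2 \<ge> \<eta> * real (card A) ^ 3 / (2 * real N)}"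
    and t: "\<And>\<xi>. \<xi> \<in> \<Gamma> \<Longrightarrow> norm (ex N (t * int \<xi>) - 1) \<le> \<eta>"
  shows "real (card (quads_mod A \<phi> N t)) \<ge> (1 - 2 * \<eta>) * real (card (quads_mod A \<phi> N 0))"
proof -
  define n where "n = real (card A)"
  have n0: "n > 0" using fin by (simp add: n_def card_gt_0_iff)
  define \<rho> where "\<rho> = \<eta> * n ^ 3 / (2 * real N)"
  have \<rho>0: "\<rho> \<ge> 0" using \<eta> n0 by (simp add: \<rho>_def)
  define g where "g = (\<lambda>\<xi>. norm (fhat A \<phi> N \<xi>))"
  define Q where "Q = (\<lambda>t. real N * real (card (quads_mod A \<phi> N t)))"
  have Q: "complex_of_real (Q t) = (\<Sum>\<xi><N. complex_of_real (g \<xi> ^ 4) * ex N (- t * int \<xi>))" for t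
    unfolding Q_def g_def by (rule quads_mod_fourier[OF N fin(1)])
  have Q0: "Q 0 = (\<Sum>\<xi><N. g \<xi> ^ 4)"
  proof -
    have "complex_of_real (Q 0) = complex_of_real (\<Sum>\<xi><N. g \<xi> ^ 4)" using Q[of 0] by simp
    thus ?thesis by (simp only: of_real_eq_iff)
  qed
  have pars: "(\<Sum>\<xi><N. (g \<xi>)\<^sup>2) = real N * n" unfolding g_def n_def by (rule fhat_parseval[OF N fin(1) inj])
  have "fhat A \<phi> N 0 = of_nat (card A)" by (simp add: fhat_def)
  hence "g 0 = n" by (simp add: g_def n_def)
  hence "n ^ 4 \<le> Q 0" unfolding Q0 using N member_le_sum[of 0 "{..<N}" "\<lambda>\<xi>. g \<xi> ^ 4"] by (simp add: g_def)
  have "complex_of_real (Q 0 - Q t) = (\<Sum>\<xi><N. complex_of_real (g \<xi> ^ 4) * (1 - ex N (- t * int \<xi>)))"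
    using Q[of 0] Q[of t] by (simp add: sum_subtractf right_diff_distrib)
  hence "norm (complex_of_real (Q 0 - Q t)) \<le> (\<Sum>\<xi><N. norm (complex_of_real (g \<xi> ^ 4) * (1 - ex N (- t * int \<xi>))))"
    by (simp only: norm_sum)
  hence "\<bar>Q 0 - Q t\<bar> \<le> (\<Sum>\<xi><N. norm (complex_of_real (g \<xi> ^ 4) * (1 - ex N (- t * int \<xi>))))"
    by (simp only: norm_of_real)
  also have "\<dots> \<le> (\<Sum>\<xi><N. \<eta> * g \<xi> ^ 4 + 2 * \<rho> * (g \<xi>)\<^sup>2)"
  proof (rule sum_mono)
    fix \<xi> assume \<xi>: "\<xi> \<in> {..<N}"
    have g0: "g \<xi> \<ge> 0" by (simp add: g_def)
    have nm: "norm (complex_of_real (g \<xi> ^ 4) * (1 - ex N (- t * int \<xi>))) = g \<xi> ^ 4 * norm (1 - ex N (- t * int \<xi>))"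
      using g0 by (simp add: norm_mult norm_power)
    have "norm (1 - ex N (- t * int \<xi>)) = norm (cnj (1 - ex N (- t * int \<xi>)))" by (rule complex_mod_cnj[symmetric])
    also have "\<dots> = norm (ex N (t * int \<xi>) - 1)" by (simp add: cnj_ex norm_minus_commute)
    finally have sw: "norm (1 - ex N (- t * int \<xi>)) = norm (ex N (t * int \<xi>) - 1)" .
    show "norm (complex_of_real (g \<xi> ^ 4) * (1 - ex N (- t * int \<xi>))) \<le> \<eta> * g \<xi> ^ 4 + 2 * \<rho> * (g \<xi>)\<^sup>2"
    proof (cases "\<xi> \<in> \<Gamma>")
      case True
      have "g \<xi> ^ 4 * norm (ex N (t * int \<xi>) - 1) \<le> g \<xi> ^ 4 * \<eta>" using t[OF True] g0 by (intro mult_left_mono) auto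
      moreover have "2 * \<rho> * (g \<xi>)\<^sup>2 \<ge> 0" using \<rho>0 by simp
      ultimately show ?thesis unfolding nm sw by (simp add: mult.commute)
    next
      case False
      hence lt: "(g \<xi>)\<^sup>2 \<le> \<rho>" using \<xi> by (auto simp: \<Gamma> g_def \<rho>_def n_def)
      have "norm (ex N (t * int \<xi>) - 1) \<le> 2" using norm_triangle_ineq4[of "ex N (t * int \<xi>)" 1] by simp
      hence "g \<xi> ^ 4 * norm (ex N (t * int \<xi>) - 1) \<le> g \<xi> ^ 4 * 2" using g0 by (intro mult_left_mono) auto
      also have "g \<xi> ^ 4 * 2 = 2 * (g \<xi>)\<^sup>2 * (g \<xi>)\<^sup>2" by (simp flip: power_add)
      also have "\<dots> \<le> 2 * \<rho> * (g \<xi>)\<^sup>2" using lt by (intro mult_right_mono) auto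
      finally show ?thesis unfolding nm sw using \<eta> g0 by (simp add: add_increasing)
    qed
  qed
  also have "\<dots> = \<eta> * Q 0 + 2 * \<rho> * (real N * n)" unfolding Q0 pars[symmetric] by (simp add: sum.distrib sum_distrib_left)
  also have "2 * \<rho> * (real N * n) = \<eta> * n ^ 4" using N by (simp add: \<rho>_def power_numeral_reduce)
  also have "\<eta> * n ^ 4 \<le> \<eta> * Q 0" using \<open>n ^ 4 \<le> Q 0\<close> \<eta> by (intro mult_left_mono) auto
  finally have "Q t \<ge> (1 - 2 * \<eta>) * Q 0" by (simp add: algebra_simps abs_le_iff)
  hence "real N * ((1 - 2 * \<eta>) * real (card (quads_mod A \<phi> N 0))) \<le> real N * real (card (quads_mod A \<phi> N t))"
    by (simp add: Q_def mult_ac)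
  thus ?thesis using N by simp
qed

lemma card_spectrum_le:
  assumes N: "N > 0" and fin: "finite A"
    and inj: "\<And>a b. a \<in> A \<Longrightarrow> b \<in> A \<Longrightarrow> int N dvd \<phi> a - \<phi> b \<Longrightarrow> a = b"
    and \<rho>: "\<rho> > 0"
  shows "real (card {\<xi>. \<xi> < N \<and> (norm (fhat A \<phi> N \<xi>))\<^sup>2 \<ge> \<rho>}) * \<rho> \<le> real N * real (card A)"
proof -
  let ?\<Gamma> = "{\<xi>. \<xi> < N \<and> (norm (fhat A \<phi> N \<xi>))\<^sup>2 \<ge> \<rho>}"
  have "real (card ?\<Gamma>) * \<rho> \<le> (\<Sum>\<xi>\<in>?\<Gamma>. (norm (fhat A \<phi> N \<xi>))\<^sup>2)"
    by (subst sum_constant[symmetric], rule sum_mono) auto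
  also have "\<dots> \<le> (\<Sum>\<xi><N. (norm (fhat A \<phi> N \<xi>))\<^sup>2)" by (rule sum_mono2) auto
  also have "\<dots> = real N * real (card A)" by (rule fhat_parseval[OF N fin inj])
  finally show ?thesis .
qed

text \<open>\<open>D\<close> bounds the size of the large spectrum, and \<open>M\<close> makes J
  times the phase error at most \<eta>, as 2 pi < 8. The residues found in the model are then
  carried back: a residue with a positive count is represented by four elements of \<open>A\<close>,
  and their alternating sum in the group is the near-period.\<close>

lemma near_periods:
  fixes A :: "'a::finite_field set"
  assumes fr: "freiman6 A \<phi> N" and N: "N > 0" and ne: "A \<noteq> {}" and \<eta>: "0 < \<eta>" "\<eta> < 1/2" and J: "J \<ge> (1::nat)"
    and D: "2 * real N ^ 2 / (\<eta> * real (card A) ^ 2) \<le> real D" and M: "8 * real J / \<eta> \<le> real M"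
  obtains T where "N \<le> card T * M ^ D"
    "\<And>t j. t \<in> T \<Longrightarrow> 1 \<le> j \<Longrightarrow> j \<le> J \<Longrightarrow> real (card (quads A (of_nat j * t))) \<ge> (1 - 2 * \<eta>) * real (card (quads A 0))"
proof -
  have fin: "finite A" by simp
  define n where "n = real (card A)"
  have n0: "n > 0" using fin ne by (simp add: n_def card_gt_0_iff)
  obtain a0 where a0: "a0 \<in> A" using ne by blast
  have inj: "a = b" if "a \<in> A" "b \<in> A" "int N dvd \<phi> a - \<phi> b" for a b
    using freiman6_4[OF fr that(1) that(2) a0 a0 a0 a0 a0 a0] that(3) by simp
  define \<rho> where "\<rho> = \<eta> * n ^ 3 / (2 * real N)"
  have \<rho>: "\<rho> > 0" using \<eta> n0 N by (simp add: \<rho>_def)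
  define \<Gamma> where "\<Gamma> = {\<xi>. \<xi> < N \<and> (norm (fhat A \<phi> N \<xi>))\<^sup>2 \<ge> \<eta> * real (card A) ^ 3 / (2 * real N)}"
  have fin\<Gamma>: "finite \<Gamma>" by (rule finite_subset[of _ "{..<N}"]) (auto simp: \<Gamma>_def)
  have "real (card \<Gamma>) * \<rho> \<le> real N * n"
    using card_spectrum_le[OF N fin inj \<rho>] by (simp add: \<Gamma>_def \<rho>_def n_def)
  hence "real (card \<Gamma>) \<le> real N * n / \<rho>" using \<rho> by (simp add: pos_le_divide_eq)
  also have "\<dots> = 2 * real N ^ 2 / (\<eta> * n ^ 2)" using n0 N \<eta> by (simp add: \<rho>_def field_simps power2_eq_square power3_eq_cube)
  also have "\<dots> \<le> real D" using D by (simp add: n_def)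
  finally have c\<Gamma>: "card \<Gamma> \<le> D" by simp
  have "8 * real J / \<eta> > 0" using J \<eta> by simp
  hence M0: "real M > 0" using M by linarith
  hence M1: "M \<ge> 1" by simp
  obtain T0 where T0: "T0 \<subseteq> {0..<int N}" "N \<le> card T0 * M ^ card \<Gamma>"
    "\<And>t \<xi>. t \<in> T0 \<Longrightarrow> \<xi> \<in> \<Gamma> \<Longrightarrow> norm (ex N (t * int \<xi>) - 1) \<le> 2 * pi / real M"
    using bohr_set_large[OF N fin\<Gamma> M1] by blast
  have small: "real J * (2 * pi / real M) \<le> \<eta>"
  proof -
    have "2 * pi * real J \<le> 8 * real J" using pi_less_4 by (intro mult_right_mono) auto
    also have "\<dots> \<le> \<eta> * real M" using M \<eta> by (simp add: pos_divide_le_eq mult.commute)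
    finally show ?thesis using M0 by (simp add: field_simps)
  qed
  have stab: "real (card (quads_mod A \<phi> N (int j * t))) \<ge> (1 - 2 * \<eta>) * real (card (quads_mod A \<phi> N 0))"
    if t: "t \<in> T0" and j: "j \<le> J" for t j
  proof (rule quads_mod_stable[OF N fin ne inj \<eta>(1) \<Gamma>_def])
    fix \<xi> assume \<xi>: "\<xi> \<in> \<Gamma>"
    have "norm (ex N (int j * t * int \<xi>) - 1) \<le> real j * norm (ex N (t * int \<xi>) - 1)"
      using norm_ex_mult_le[of N j "t * int \<xi>"] by (simp add: mult.assoc)
    also have "\<dots> \<le> real J * (2 * pi / real M)" using T0(3)[OF t \<xi>] j by (intro mult_mono) auto
    finally show "norm (ex N (int j * t * int \<xi>) - 1) \<le> \<eta>" using small by linarith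
  qed
  have q0: "real (card (quads_mod A \<phi> N 0)) > 0"
  proof -
    have "(a0, a0, a0, a0) \<in> quads_mod A \<phi> N 0" using a0 by (simp add: quads_mod_def)
    moreover have "finite (quads_mod A \<phi> N 0)"
      by (rule finite_subset[of _ "A \<times> A \<times> A \<times> A"]) (use fin in \<open>auto simp: quads_mod_def\<close>)
    ultimately show ?thesis by (auto simp: card_gt_0_iff)
  qed
  have nonempty: "quads_mod A \<phi> N (int j * t) \<noteq> {}" if t: "t \<in> T0" and j: "j \<le> J" for t j
  proof -
    have "(1 - 2 * \<eta>) * real (card (quads_mod A \<phi> N 0)) > 0" using \<eta> q0 by simp
    hence "real (card (quads_mod A \<phi> N (int j * t))) > 0" using stab[OF t j] by linarith
    thus ?thesis by auto
  qed
  define sel where "sel = (\<lambda>x. SOME q. q \<in> quads_mod A \<phi> N x)"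
  define ev where "ev = (\<lambda>(a1, a2, a3, a4). a1 - a2 + a3 - a4 :: 'a)"
  have sel: "sel (int j * t) \<in> quads_mod A \<phi> N (int j * t)" if "t \<in> T0" "j \<le> J" for t j
    unfolding sel_def using nonempty[OF that] by (simp add: some_in_eq)
  \<comment> \<open>Every representation of a residue in the model has the same value in the group,
    so the counts on both sides agree.\<close>
  have same: "quads A (ev q) = quads_mod A \<phi> N x" if q: "q \<in> quads_mod A \<phi> N x" for q x
  proof -
    obtain b1 b2 b3 b4 where b: "q = (b1, b2, b3, b4)" by (cases q)
    have bA: "b1 \<in> A" "b2 \<in> A" "b3 \<in> A" "b4 \<in> A" and bx: "int N dvd \<phi> b1 - \<phi> b2 + \<phi> b3 - \<phi> b4 - x"
      using q by (auto simp: b quads_mod_def)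
    have "a1 - a2 + a3 - a4 = ev q \<longleftrightarrow> int N dvd \<phi> a1 - \<phi> a2 + \<phi> a3 - \<phi> a4 - x"
      if "a1 \<in> A" "a2 \<in> A" "a3 \<in> A" "a4 \<in> A" for a1 a2 a3 a4
    proof -
      have "a1 - a2 + a3 - a4 = ev q \<longleftrightarrow> int N dvd (\<phi> a1 - \<phi> a2 + \<phi> a3 - \<phi> a4) - (\<phi> b1 - \<phi> b2 + \<phi> b3 - \<phi> b4)"
        unfolding ev_def b using freiman6_4[OF fr that bA] by simp
      also have "\<dots> \<longleftrightarrow> int N dvd ((\<phi> a1 - \<phi> a2 + \<phi> a3 - \<phi> a4) - (\<phi> b1 - \<phi> b2 + \<phi> b3 - \<phi> b4)) + (\<phi> b1 - \<phi> b2 + \<phi> b3 - \<phi> b4 - x)"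
        using bx by (rule dvd_add_left_iff[symmetric])
      finally show ?thesis by (simp add: algebra_simps)
    qed
    thus ?thesis by (auto simp: quads_def quads_mod_def)
  qed
  \<comment> \<open>In the model j t + t = (j + 1) t; this relation between three represented
    residues is of order six and transfers to the group.\<close>
  have mult: "ev (sel (int j * t)) = of_nat j * ev (sel t)" if t: "t \<in> T0" and j: "1 \<le> j" "j \<le> J" for t j
    using j
  proof (induction j rule: nat_induct_at_least)
    case (Suc j)
    have m: "sel (int j * t) \<in> quads_mod A \<phi> N (int j * t)" "sel (int 1 * t) \<in> quads_mod A \<phi> N (int 1 * t)"
      "sel (int (Suc j) * t) \<in> quads_mod A \<phi> N (int (Suc j) * t)"
      using sel[OF t, of j] sel[OF t, of 1] sel[OF t, of "Suc j"] Suc.prems J by simp_all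
    obtain a1 a2 a3 a4 where a: "sel (int j * t) = (a1, a2, a3, a4)" by (cases "sel (int j * t)")
    obtain b1 b2 b3 b4 where b: "sel (int 1 * t) = (b1, b2, b3, b4)" by (cases "sel (int 1 * t)")
    obtain c1 c2 c3 c4 where c: "sel (int (Suc j) * t) = (c1, c2, c3, c4)" by (cases "sel (int (Suc j) * t)")
    have aA: "a1 \<in> A" "a2 \<in> A" "a3 \<in> A" "a4 \<in> A" "int N dvd \<phi> a1 - \<phi> a2 + \<phi> a3 - \<phi> a4 - int j * t"
      using m(1) unfolding a by (auto simp: quads_mod_def)
    have bA: "b1 \<in> A" "b2 \<in> A" "b3 \<in> A" "b4 \<in> A" "int N dvd \<phi> b1 - \<phi> b2 + \<phi> b3 - \<phi> b4 - t"
      using m(2) unfolding b by (auto simp: quads_mod_def)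
    have cA: "c1 \<in> A" "c2 \<in> A" "c3 \<in> A" "c4 \<in> A" "int N dvd \<phi> c1 - \<phi> c2 + \<phi> c3 - \<phi> c4 - int (Suc j) * t"
      using m(3) unfolding c by (auto simp: quads_mod_def)
    have "int N dvd (\<phi> a1 - \<phi> a2 + \<phi> a3 - \<phi> a4 - int j * t) + (\<phi> b1 - \<phi> b2 + \<phi> b3 - \<phi> b4 - t) - (\<phi> c1 - \<phi> c2 + \<phi> c3 - \<phi> c4 - int (Suc j) * t)"
      by (intro dvd_diff dvd_add aA(5) bA(5) cA(5))
    hence "int N dvd (\<phi> a1 - \<phi> a2 + \<phi> a3 - \<phi> a4) + (\<phi> b1 - \<phi> b2 + \<phi> b3 - \<phi> b4) - (\<phi> c1 - \<phi> c2 + \<phi> c3 - \<phi> c4)"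
      by (simp add: algebra_simps)
    hence "(a1 - a2 + a3 - a4) + (b1 - b2 + b3 - b4) = c1 - c2 + c3 - c4"
      using freiman6_12[OF fr aA(1-4) bA(1-4) cA(1-4)] by simp
    hence "ev (sel (int (Suc j) * t)) = ev (sel (int j * t)) + ev (sel t)"
      unfolding a c using b by (simp add: ev_def)
    thus ?case using Suc by (simp add: algebra_simps)
  qed simp
  define T where "T = (\<lambda>t. ev (sel t)) ` T0"
  have "inj_on (\<lambda>t. ev (sel t)) T0"
  proof (rule inj_onI)
    fix s t assume st: "s \<in> T0" "t \<in> T0" "ev (sel s) = ev (sel t)"
    have ms: "sel s \<in> quads_mod A \<phi> N s" "sel t \<in> quads_mod A \<phi> N t" using sel[OF st(1), of 1] sel[OF st(2), of 1] J by simp_all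
    have "quads_mod A \<phi> N s = quads_mod A \<phi> N t" using same[OF ms(1)] same[OF ms(2)] st(3) by simp
    hence "sel s \<in> quads_mod A \<phi> N t" using ms by simp
    moreover obtain a1 a2 a3 a4 where a: "sel s = (a1, a2, a3, a4)" by (cases "sel s")
    ultimately have "int N dvd \<phi> a1 - \<phi> a2 + \<phi> a3 - \<phi> a4 - s" "int N dvd \<phi> a1 - \<phi> a2 + \<phi> a3 - \<phi> a4 - t"
      using ms by (auto simp: quads_mod_def)
    from dvd_diff[OF this] have "int N dvd t - s" by simp
    moreover have "\<bar>t - s\<bar> < int N" using subsetD[OF T0(1) st(1)] subsetD[OF T0(1) st(2)] by auto
    ultimately show "s = t" using dvd_imp_le_int[of "t - s" "int N"] by force
  qed
  hence cT: "card T = card T0" unfolding T_def by (rule card_image)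
  show ?thesis
  proof (rule that[of T])
    have "M ^ card \<Gamma> \<le> M ^ D" using c\<Gamma> M1 by (intro power_increasing) auto
    hence "card T0 * M ^ card \<Gamma> \<le> card T0 * M ^ D" by (rule mult_le_mono2)
    from order_trans[OF T0(2) this] show "N \<le> card T * M ^ D" by (simp only: cT)
    fix t j assume t: "t \<in> T" and j: "1 \<le> j" "j \<le> J"
    obtain s where s: "s \<in> T0" "t = ev (sel s)" using t by (auto simp: T_def)
    have "quads A (of_nat j * t) = quads_mod A \<phi> N (int j * s)"
      unfolding s(2) mult[OF s(1) j, symmetric] by (rule same[OF sel[OF s(1) j(2)]])
    moreover have "quads A 0 = quads_mod A \<phi> N 0"
      using same[of "(a0, a0, a0, a0)" 0] a0 by (simp add: quads_mod_def ev_def)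
    ultimately show "real (card (quads A (of_nat j * t))) \<ge> (1 - 2 * \<eta>) * real (card (quads A 0))"
      using stab[OF s(1) j(2)] by simp
  qed
qed

section \<open>Shifting a convolution by a near-period\<close>

lemma sum_card_fibre:
  fixes h :: "'b \<Rightarrow> 'a::finite" and g :: "'a \<Rightarrow> 'c::comm_semiring_1"
  assumes "finite P"
  shows "(\<Sum>y\<in>UNIV. of_nat (card {p\<in>P. h p = y}) * g y) = (\<Sum>p\<in>P. g (h p))"
proof -
  have "(\<Sum>y\<in>UNIV. of_nat (card {p\<in>P. h p = y}) * g y) = (\<Sum>y\<in>UNIV. \<Sum>p\<in>{p\<in>P. h p = y}. g (h p))"
  proof (intro sum.cong refl)
    fix y
    have "(\<Sum>p\<in>{p\<in>P. h p = y}. g (h p)) = (\<Sum>p\<in>{p\<in>P. h p = y}. g y)" by (intro sum.cong) auto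
    thus "of_nat (card {p\<in>P. h p = y}) * g y = (\<Sum>p\<in>{p\<in>P. h p = y}. g (h p))" by simp
  qed
  also have "\<dots> = (\<Sum>p\<in>P. g (h p))" by (rule sum.group) (use assms in auto)
  finally show ?thesis .
qed

lemma cauchy_schwarz_complex:
  fixes f g :: "'b \<Rightarrow> complex"
  assumes "finite S"
  shows "(norm (\<Sum>x\<in>S. f x * g x))\<^sup>2 \<le> (\<Sum>x\<in>S. (norm (f x))\<^sup>2) * (\<Sum>x\<in>S. (norm (g x))\<^sup>2)"
proof -
  have "norm (\<Sum>x\<in>S. f x * g x) \<le> (\<Sum>x\<in>S. norm (f x) * norm (g x))"
    using norm_sum[of "\<lambda>x. f x * g x" S] by (simp add: norm_mult)
  hence "(norm (\<Sum>x\<in>S. f x * g x))\<^sup>2 \<le> (\<Sum>x\<in>S. norm (f x) * norm (g x))\<^sup>2" by (intro power_mono) auto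
  also have "\<dots> \<le> (\<Sum>x\<in>S. (norm (f x))\<^sup>2) * (\<Sum>x\<in>S. (norm (g x))\<^sup>2)"
    by (rule Cauchy_Schwarz_ineq_sum)
  finally show ?thesis .
qed

definition reps :: "'a::ab_group_add set \<Rightarrow> 'a \<Rightarrow> real" where
  "reps A y = real (card {p\<in>A \<times> A. fst p - snd p = y})"

lemma sum_reps: "finite A \<Longrightarrow> (\<Sum>y\<in>UNIV. reps A y * g y) = (\<Sum>p\<in>A \<times> A. g (fst p - snd p))"
  for g :: "'a::{ab_group_add,finite} \<Rightarrow> real"
  unfolding reps_def using sum_card_fibre[of "A \<times> A" "\<lambda>p. fst p - snd p" g] by simp

text \<open>The equation of \<open>quads\<close> reads a1 - a2 = (a4 - a3) + t, a coincidence of two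
  differences up to the shift t.\<close>

lemma sum_reps_shift:
  fixes A :: "'a::{ab_group_add,finite} set"
  shows "(\<Sum>y\<in>UNIV. reps A y * reps A (y + t)) = real (card (quads A t))"
proof -
  have fin: "finite A" by simp
  have "(\<Sum>y\<in>UNIV. reps A y * reps A (y + t)) = (\<Sum>p\<in>A \<times> A. reps A (fst p - snd p + t))"
    by (rule sum_reps[OF fin])
  also have "\<dots> = real (card (SIGMA p:A \<times> A. {r\<in>A \<times> A. fst r - snd r = fst p - snd p + t}))"
    by (simp add: reps_def)
  also have "card (SIGMA p:A \<times> A. {r\<in>A \<times> A. fst r - snd r = fst p - snd p + t}) = card (quads A t)"
  proof (rule bij_betw_same_card[of "\<lambda>(p, r). (fst r, snd r, snd p, fst p)"])
    show "bij_betw (\<lambda>(p, r). (fst r, snd r, snd p, fst p)) (SIGMA p:A \<times> A. {r\<in>A \<times> A. fst r - snd r = fst p - snd p + t}) (quads A t)"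
    proof (rule bij_betw_byWitness[where f' = "\<lambda>(a1, a2, a3, a4). ((a4, a3), (a1, a2))"])
      have "a1 - a2 = a4 - a3 + t \<longleftrightarrow> a1 - a2 + a3 - a4 = t" for a1 a2 a3 a4 :: 'a
      proof -
        have "(a1 - a2) - (a4 - a3 + t) = (a1 - a2 + a3 - a4) - t" by (simp add: algebra_simps)
        thus ?thesis by (metis right_minus_eq)
      qed
      thus "(\<lambda>(p, r). (fst r, snd r, snd p, fst p)) ` (SIGMA p:A \<times> A. {r\<in>A \<times> A. fst r - snd r = fst p - snd p + t}) \<subseteq> quads A t"
        "(\<lambda>(a1, a2, a3, a4). ((a4, a3), (a1, a2))) ` quads A t \<subseteq> (SIGMA p:A \<times> A. {r\<in>A \<times> A. fst r - snd r = fst p - snd p + t})"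
        by (auto simp: quads_def)
    qed auto
  qed
  finally show ?thesis .
qed

lemma sum_shift_UNIV: "(\<Sum>y\<in>UNIV. f (y + t)) = (\<Sum>y\<in>UNIV. f (y :: 'a::{ab_group_add,finite}))"
  by (rule sum.reindex_bij_witness[of _ "\<lambda>y. y - t" "\<lambda>y. y + t"]) auto

text \<open>With W the convolution of \<open>A\<close> and \<open>B\<close>, the difference pairs
  W(x - t) - W(x) with \<open>F\<close>. The squared norm of the former is twice a sum over b and b'
  of R(b' - b) - R(b' - b + t), where R counts differences in \<open>A\<close>. For fixed b this is
  at most the L1 distance of R to its translate, so one factor |B| is lost and not two.\<close>

lemma near_period_convolution:
  fixes A B :: "'a::{ab_group_add,finite} set" and F :: "'a \<Rightarrow> complex"
  assumes "real (card (quads A 0)) - real (card (quads A t)) \<le> \<delta>"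
  shows "(norm ((\<Sum>a\<in>A. \<Sum>b\<in>B. F (a + b + t)) - (\<Sum>a\<in>A. \<Sum>b\<in>B. F (a + b))))\<^sup>2 \<le>
    4 * real (card B) * sqrt (real (card (diffset A A)) * \<delta>) * (\<Sum>x\<in>UNIV. (norm (F x))\<^sup>2)"
proof -
  define W where "W = (\<lambda>x. real (card {p\<in>A \<times> B. fst p + snd p = x}))"
  have WF: "(\<Sum>x\<in>UNIV. complex_of_real (W x) * g x) = (\<Sum>a\<in>A. \<Sum>b\<in>B. g (a + b))" for g
    using sum_card_fibre[of "A \<times> B" "\<lambda>p. fst p + snd p" g] by (simp add: W_def sum.cartesian_product case_prod_beta)
  have WR: "(\<Sum>x\<in>UNIV. W x * g x) = (\<Sum>p\<in>A \<times> B. g (fst p + snd p))" for g :: "'a \<Rightarrow> real"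
    using sum_card_fibre[of "A \<times> B" "\<lambda>p. fst p + snd p" g] by (simp add: W_def)
  have eq1: "(\<Sum>a\<in>A. \<Sum>b\<in>B. F (a + b + t)) = (\<Sum>x\<in>UNIV. complex_of_real (W (x - t)) * F x)"
  proof -
    have "(\<Sum>x\<in>UNIV. complex_of_real (W (x - t)) * F x) = (\<Sum>x\<in>UNIV. complex_of_real (W x) * F (x + t))"
      using sum_shift_UNIV[of "\<lambda>x. complex_of_real (W (x - t)) * F x" t] by simp
    thus ?thesis using WF[of "\<lambda>x. F (x + t)"] by simp
  qed
  have diff: "(\<Sum>a\<in>A. \<Sum>b\<in>B. F (a + b + t)) - (\<Sum>a\<in>A. \<Sum>b\<in>B. F (a + b)) =
     (\<Sum>x\<in>UNIV. complex_of_real (W (x - t) - W x) * F x)"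
    unfolding eq1 WF[of F, symmetric] by (simp add: sum_subtractf algebra_simps)
  have Wsq: "(\<Sum>x\<in>UNIV. W x * W (x - s)) = (\<Sum>b\<in>B. \<Sum>b'\<in>B. reps A (b' - b + s))" for s
  proof -
    have fib: "W (z - s) = (\<Sum>b'\<in>B. real (card {a'\<in>A. a' + b' = z - s}))" for z
    proof -
      have "{p\<in>A \<times> B. fst p + snd p = z - s} = (\<lambda>(b', a'). (a', b')) ` (SIGMA b':B. {a'\<in>A. a' + b' = z - s})" by force
      hence "card {p\<in>A \<times> B. fst p + snd p = z - s} = card (SIGMA b':B. {a'\<in>A. a' + b' = z - s})"
        by (simp add: card_image inj_on_def split_beta prod_eq_iff)
      thus ?thesis by (simp add: W_def)
    qed
    have "(\<Sum>x\<in>UNIV. W x * W (x - s)) = (\<Sum>p\<in>A \<times> B. W (fst p + snd p - s))" by (rule WR)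
    also have "\<dots> = (\<Sum>a\<in>A. \<Sum>b\<in>B. \<Sum>b'\<in>B. real (card {a'\<in>A. a' + b' = a + b - s}))"
    proof -
      have "(\<Sum>p\<in>A \<times> B. W (fst p + snd p - s)) = (\<Sum>a\<in>A. \<Sum>b\<in>B. W (a + b - s))"
        by (simp add: sum.cartesian_product case_prod_beta)
      thus ?thesis by (simp add: fib)
    qed
    also have "\<dots> = (\<Sum>b\<in>B. \<Sum>b'\<in>B. \<Sum>a\<in>A. real (card {a'\<in>A. a' + b' = a + b - s}))"
      by (subst sum.swap) (intro sum.cong refl sum.swap)
    also have "\<dots> = (\<Sum>b\<in>B. \<Sum>b'\<in>B. reps A (b' - b + s))"
    proof (intro sum.cong refl)
      fix b b'
      have "(\<Sum>a\<in>A. real (card {a'\<in>A. a' + b' = a + b - s})) = real (card (SIGMA a:A. {a'\<in>A. a' + b' = a + b - s}))" by simp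
      also have "(SIGMA a:A. {a'\<in>A. a' + b' = a + b - s}) = {p\<in>A \<times> A. fst p - snd p = b' - b + s}"
      proof -
        have "a' + b' = a + b - s \<longleftrightarrow> a - a' = b' - b + s" for a a' :: 'a
        proof -
          have "(a' + b') - (a + b - s) = - ((a - a') - (b' - b + s))" by (simp add: algebra_simps)
          thus ?thesis by (metis right_minus_eq neg_equal_0_iff_equal)
        qed
        thus ?thesis by auto
      qed
      finally show "(\<Sum>a\<in>A. real (card {a'\<in>A. a' + b' = a + b - s})) = reps A (b' - b + s)" by (simp add: reps_def)
    qed
    finally show ?thesis .
  qed
  define R where "R = reps A"
  \<comment> \<open>Cauchy-Schwarz on the supports of R and its translate, at most 2 |A - A| points;
    the squared L2 distance is twice the defect of the count at t.\<close>
  have L1: "(\<Sum>y\<in>UNIV. \<bar>R y - R (y + t)\<bar>) \<le> 2 * sqrt (real (card (diffset A A)) * \<delta>)"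
  proof -
    define S where "S = diffset A A \<union> (\<lambda>y. y - t) ` diffset A A"
    have R0: "R y = 0" if "y \<notin> diffset A A" for y
    proof -
      have "{p\<in>A \<times> A. fst p - snd p = y} = {}" using that by (auto simp: diffset_def)
      thus ?thesis by (simp add: R_def reps_def)
    qed
    have cS: "card S \<le> 2 * card (diffset A A)"
      unfolding S_def using card_Un_le[of "diffset A A" "(\<lambda>y. y - t) ` diffset A A"] card_image_le[of "diffset A A" "\<lambda>y. y - t"] by simp
    have "(\<Sum>y\<in>UNIV. \<bar>R y - R (y + t)\<bar>) = (\<Sum>y\<in>S. \<bar>R y - R (y + t)\<bar>)"
    proof (rule sum.mono_neutral_right, simp, simp, safe)
      fix y assume y: "y \<notin> S"
      have "y \<notin> diffset A A" "y + t \<notin> diffset A A" using y by (auto simp: S_def image_iff)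
      thus "\<bar>R y - R (y + t)\<bar> = 0" by (simp add: R0)
    qed
    also have "\<dots> \<le> sqrt (real (card S) * (\<Sum>y\<in>S. \<bar>R y - R (y + t)\<bar>\<^sup>2))"
      by (rule real_le_rsqrt) (rule sum_square_ge, simp)
    also have "\<dots> \<le> sqrt (2 * real (card (diffset A A)) * (2 * \<delta>))"
    proof (rule real_sqrt_le_mono, rule mult_mono)
      show "real (card S) \<le> 2 * real (card (diffset A A))" using cS by linarith
      have "(\<Sum>y\<in>S. \<bar>R y - R (y + t)\<bar>\<^sup>2) \<le> (\<Sum>y\<in>UNIV. \<bar>R y - R (y + t)\<bar>\<^sup>2)" by (rule sum_mono2) auto
      also have "\<dots> = (\<Sum>y\<in>UNIV. R y * R y + R (y + t) * R (y + t) - 2 * (R y * R (y + t)))"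
        by (intro sum.cong refl) (simp add: power2_eq_square algebra_simps)
      also have "\<dots> = 2 * (\<Sum>y\<in>UNIV. R y * R y) - 2 * (\<Sum>y\<in>UNIV. R y * R (y + t))"
        using sum_shift_UNIV[of "\<lambda>y. R y * R y" t] by (simp add: sum_subtractf sum.distrib sum_distrib_left)
      also have "\<dots> = 2 * (real (card (quads A 0)) - real (card (quads A t)))"
        using sum_reps_shift[of A 0] sum_reps_shift[of A t] by (simp add: R_def)
      also have "\<dots> \<le> 2 * \<delta>" using assms by simp
      finally show "(\<Sum>y\<in>S. \<bar>R y - R (y + t)\<bar>\<^sup>2) \<le> 2 * \<delta>" .
    qed (auto intro!: sum_nonneg)
    also have "\<dots> = sqrt (4 * (real (card (diffset A A)) * \<delta>))" by (simp add: mult_ac)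
    also have "\<dots> = 2 * sqrt (real (card (diffset A A)) * \<delta>)" by (simp add: real_sqrt_mult)
    finally show ?thesis .
  qed
  have "(\<Sum>x\<in>UNIV. (norm (complex_of_real (W (x - t) - W x)))\<^sup>2) = (\<Sum>x\<in>UNIV. W (x - t) * W (x - t) + W x * W x - 2 * (W x * W (x - t)))"
    by (intro sum.cong refl) (simp only: norm_of_real, simp add: power2_eq_square algebra_simps)
  also have "\<dots> = 2 * (\<Sum>x\<in>UNIV. W x * W (x - 0)) - 2 * (\<Sum>x\<in>UNIV. W x * W (x - t))"
    using sum_shift_UNIV[of "\<lambda>x. W x * W x" "- t"] by (simp add: sum_subtractf sum.distrib sum_distrib_left)
  also have "\<dots> = 2 * (\<Sum>b\<in>B. \<Sum>b'\<in>B. R (b' - b) - R (b' - b + t))"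
    unfolding Wsq R_def by (simp add: sum_subtractf right_diff_distrib)
  also have "\<dots> \<le> 2 * (\<Sum>b\<in>B. 2 * sqrt (real (card (diffset A A)) * \<delta>))"
  proof (intro mult_left_mono sum_mono)
    fix b
    have "(\<Sum>b'\<in>B. R (b' - b) - R (b' - b + t)) \<le> (\<Sum>b'\<in>B. \<bar>R (b' - b) - R (b' - b + t)\<bar>)" by (rule sum_mono) simp
    also have "\<dots> = (\<Sum>y\<in>(\<lambda>b'. b' - b) ` B. \<bar>R y - R (y + t)\<bar>)" by (subst sum.reindex) (auto simp: inj_on_def)
    also have "\<dots> \<le> (\<Sum>y\<in>UNIV. \<bar>R y - R (y + t)\<bar>)" by (rule sum_mono2) auto
    also have "\<dots> \<le> 2 * sqrt (real (card (diffset A A)) * \<delta>)" by (rule L1)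
    finally show "(\<Sum>b'\<in>B. R (b' - b) - R (b' - b + t)) \<le> 2 * sqrt (real (card (diffset A A)) * \<delta>)" .
  qed simp
  also have "\<dots> = 4 * real (card B) * sqrt (real (card (diffset A A)) * \<delta>)" by simp
  finally have "(\<Sum>x\<in>UNIV. (norm (complex_of_real (W (x - t) - W x)))\<^sup>2) \<le> 4 * real (card B) * sqrt (real (card (diffset A A)) * \<delta>)" .
  hence "(\<Sum>x\<in>UNIV. (norm (complex_of_real (W (x - t) - W x)))\<^sup>2) * (\<Sum>x\<in>UNIV. (norm (F x))\<^sup>2) \<le>
    4 * real (card B) * sqrt (real (card (diffset A A)) * \<delta>) * (\<Sum>x\<in>UNIV. (norm (F x))\<^sup>2)"
    by (intro mult_right_mono) (auto intro!: sum_nonneg)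
  thus ?thesis unfolding diff
    using cauchy_schwarz_complex[OF finite[of UNIV], of "\<lambda>x. complex_of_real (W (x - t) - W x)" F] by linarith
qed

section \<open>Multiplicative energy of translates\<close>

text \<open>The dilates commensurable with \<open>A\<close>. Up to the constant they behave like a
  subfield, as the lemmas below show, with 0 included.\<close>

definition good :: "'a::field set \<Rightarrow> real \<Rightarrow> 'a \<Rightarrow> bool" where
  "good A L z \<longleftrightarrow> real (card (diffset A ((*) z ` A))) \<le> L * real (card A)"

context
  fixes A :: "'a::finite_field set" and K :: real
  assumes ne: "A \<noteq> {}"
    and KD: "real (card (diffset A A)) \<le> K * real (card A)" and KS: "real (card (A + A)) \<le> K * real (card A)"
begin

lemma card_A_pos: "real (card A) > 0"
  using ne by (simp add: card_gt_0_iff)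

lemma card_diffset_ge: "B \<noteq> {} \<Longrightarrow> card A \<le> card (diffset A B)"
proof -
  assume "B \<noteq> {}"
  then obtain b where b: "b \<in> B" by blast
  have "card A = card ((\<lambda>a. a - b) ` A)" by (rule card_image[symmetric]) (simp add: inj_on_def)
  also have "\<dots> \<le> card (diffset A B)" using b by (intro card_mono) (auto intro: diffsetI)
  finally show ?thesis .
qed

lemma good_ge_1: "good A L z \<Longrightarrow> L \<ge> 1"
proof -
  assume g: "good A L z"
  have "real (card A) \<le> real (card (diffset A ((*) z ` A)))" using card_diffset_ge[of "(*) z ` A"] ne by simp
  hence "1 * real (card A) \<le> L * real (card A)" using g by (simp add: good_def)
  thus ?thesis using card_A_pos by (simp only: mult_le_cancel_right_pos)
qed

lemma K_ge_1: "K \<ge> 1"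
proof -
  have "real (card A) \<le> real (card (diffset A A))" using card_diffset_ge[of A] ne by simp
  hence "1 * real (card A) \<le> K * real (card A)" using KD by simp
  thus ?thesis using card_A_pos by (simp only: mult_le_cancel_right_pos)
qed

lemma good_mono: "good A L z \<Longrightarrow> L \<le> L' \<Longrightarrow> good A L' z"
  unfolding good_def by (erule order_trans) (simp add: mult_right_mono)

lemma card_dilate: "z \<noteq> 0 \<Longrightarrow> card ((*) z ` B) = card (B :: 'a set)"
  by (rule card_image) (simp add: inj_on_def)

lemma card_diffset_dilate: "card (diffset ((*) x ` B) ((*) (x * y) ` C)) \<le> card (diffset B ((*) y ` (C :: 'a set)))"
proof -
  have "diffset ((*) x ` B) ((*) (x * y) ` C) \<subseteq> (*) x ` diffset B ((*) y ` C)"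
  proof
    fix u assume "u \<in> diffset ((*) x ` B) ((*) (x * y) ` C)"
    then obtain b c where "b \<in> B" "c \<in> C" "u = x * b - x * y * c" by (auto simp: diffset_def)
    hence "u = x * (b - y * c)" "b - y * c \<in> diffset B ((*) y ` C)" by (auto simp: algebra_simps intro: diffsetI)
    thus "u \<in> (*) x ` diffset B ((*) y ` C)" by blast
  qed
  hence "card (diffset ((*) x ` B) ((*) (x * y) ` C)) \<le> card ((*) x ` diffset B ((*) y ` C))" by (intro card_mono) auto
  also have "\<dots> \<le> card (diffset B ((*) y ` C))" by (rule card_image_le) simp
  finally show ?thesis .
qed

lemma good_zero: "L \<ge> 1 \<Longrightarrow> good A L 0"
proof -
  assume L: "L \<ge> 1"
  have "diffset A ((*) 0 ` A) = A" using ne by (force simp: diffset_def)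
  thus ?thesis using L card_A_pos by (simp add: good_def)
qed

lemma good_one: "good A K 1"
  using KD by (simp add: good_def)

text \<open>Triangle inequality through x A, because x A - x y A is a dilate of A - y A.\<close>

lemma good_mult:
  assumes "good A L1 x" "good A L2 y"
  shows "good A (L1 * L2) (x * y)"
proof (cases "x = 0")
  case True
  have "L1 * L2 \<ge> 1 * 1" using good_ge_1[OF assms(1)] good_ge_1[OF assms(2)] by (intro mult_mono) auto
  thus ?thesis using good_zero[of "L1 * L2"] True by simp
next
  case False
  have "real (card (diffset A ((*) (x * y) ` A)) * card ((*) x ` A)) \<le>
    real (card (diffset A ((*) x ` A)) * card (diffset ((*) x ` A) ((*) (x * y) ` A)))"
    by (intro of_nat_mono ruzsa_triangle) auto
  also have "\<dots> \<le> (L1 * real (card A)) * (L2 * real (card A))"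
    unfolding of_nat_mult
  proof (rule mult_mono)
    show "real (card (diffset A ((*) x ` A))) \<le> L1 * real (card A)" using assms(1) by (simp add: good_def)
    have "real (card (diffset ((*) x ` A) ((*) (x * y) ` A))) \<le> real (card (diffset A ((*) y ` A)))"
      using card_diffset_dilate by simp
    thus "real (card (diffset ((*) x ` A) ((*) (x * y) ` A))) \<le> L2 * real (card A)" using assms(2) by (simp add: good_def)
  qed (use good_ge_1[OF assms(1)] in auto)
  finally have "real (card (diffset A ((*) (x * y) ` A))) * real (card A) \<le> (L1 * L2 * real (card A)) * real (card A)"
    using card_dilate[OF False, of A] by (simp add: mult_ac)
  thus ?thesis using card_A_pos by (simp add: good_def)
qed

lemma good_inverse:
  assumes "good A L z"
  shows "good A L (inverse z)"
proof (cases "z = 0")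
  case False
  have "diffset A ((*) (inverse z) ` A) \<subseteq> (\<lambda>u. - (inverse z * u)) ` diffset A ((*) z ` A)"
  proof
    fix u assume "u \<in> diffset A ((*) (inverse z) ` A)"
    then obtain a b where ab: "a \<in> A" "b \<in> A" "u = a - inverse z * b" by (auto simp: diffset_def)
    have "u = - (inverse z * (b - z * a))" using False by (simp add: ab(3) algebra_simps)
    moreover have "b - z * a \<in> diffset A ((*) z ` A)" using ab by (auto intro: diffsetI)
    ultimately show "u \<in> (\<lambda>u. - (inverse z * u)) ` diffset A ((*) z ` A)" by blast
  qed
  hence "card (diffset A ((*) (inverse z) ` A)) \<le> card ((\<lambda>u. - (inverse z * u)) ` diffset A ((*) z ` A))" by (intro card_mono) auto
  also have "\<dots> \<le> card (diffset A ((*) z ` A))" by (rule card_image_le) simp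
  finally show ?thesis using assms by (simp add: good_def)
qed (use assms in simp)

text \<open>Triangle inequality through z A; here z A - (-z) A is a dilate of A + A, which is where
  the doubling for sums enters.\<close>

lemma good_uminus:
  assumes "good A L z"
  shows "good A (K * L) (- z)"
proof (cases "z = 0")
  case True
  have "1 * L \<le> K * L" using K_ge_1 good_ge_1[OF assms] by (intro mult_right_mono) auto
  thus ?thesis using good_mono[OF assms] True by simp
next
  case False
  have sub: "diffset ((*) z ` A) ((*) (- z) ` A) \<subseteq> (*) z ` (A + A)"
  proof
    fix u assume "u \<in> diffset ((*) z ` A) ((*) (- z) ` A)"
    then obtain a b where "a \<in> A" "b \<in> A" "u = z * (a + b)" by (auto simp: diffset_def algebra_simps)
    thus "u \<in> (*) z ` (A + A)" by (auto intro!: imageI set_plus_intro)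
  qed
  have "card (diffset ((*) z ` A) ((*) (- z) ` A)) \<le> card ((*) z ` (A + A))" using sub by (intro card_mono) auto
  also have "\<dots> \<le> card (A + A)" by (rule card_image_le) simp
  finally have c: "real (card (diffset ((*) z ` A) ((*) (- z) ` A))) \<le> K * real (card A)" using KS by linarith
  have "real (card (diffset A ((*) (- z) ` A)) * card ((*) z ` A)) \<le>
    real (card (diffset A ((*) z ` A)) * card (diffset ((*) z ` A) ((*) (- z) ` A)))"
    by (intro of_nat_mono ruzsa_triangle) auto
  also have "\<dots> \<le> (L * real (card A)) * (K * real (card A))"
    unfolding of_nat_mult using assms c good_ge_1[OF assms] by (intro mult_mono) (auto simp: good_def)
  finally have "real (card (diffset A ((*) (- z) ` A))) * real (card A) \<le> (K * L * real (card A)) * real (card A)"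
    using card_dilate[OF False, of A] by (simp add: mult_ac)
  thus ?thesis using card_A_pos by (simp add: good_def)
qed

text \<open>Petridis' subset X of \<open>A\<close> with respect to -x A absorbs the second summand:
  X - x A - y A is at most L1 times X - y A. It is dense, |A| \<le> L1 |X|, since X - x A has at
  least |A| elements. The triangle inequality through X costs this density once, whence the square
  of \<open>L1\<close>.\<close>

lemma good_add:
  assumes x: "good A L1 x" and y: "good A L2 y"
  shows "good A (K * L1\<^sup>2 * L2) (x + y)"
proof (cases "x = 0")
  case True
  have "1 * 1\<^sup>2 * L2 \<le> K * L1\<^sup>2 * L2"
    using K_ge_1 good_ge_1[OF x] good_ge_1[OF y] by (intro mult_mono power_mono) auto
  thus ?thesis using good_mono[OF y] True by simp
next
  case False
  have L: "L1 \<ge> 1" "L2 \<ge> 1" using good_ge_1 x y by auto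
  define n where "n = real (card A)"
  have n0: "n > 0" using card_A_pos by (simp add: n_def)
  define B where "B = uminus ` (*) x ` A"
  define C where "C = uminus ` (*) y ` A"
  have "real (card (A + B)) \<le> L1 * real (card A)" using x by (simp add: good_def diffset_eq_plus B_def)
  then obtain Xs where Xs: "Xs \<subseteq> A" "Xs \<noteq> {}" "\<And>C. finite C \<Longrightarrow> real (card (Xs + B + C)) \<le> L1 * real (card (Xs + C))"
    using petridis_exists[of A B L1] ne by auto
  have xpos: "real (card Xs) > 0" using Xs by (simp add: card_gt_0_iff)
  have "card (Xs + C) \<le> card (A + C)" by (intro card_mono set_plus_mono2 Xs) auto
  also have "real (card (A + C)) \<le> L2 * n" using y by (simp add: good_def diffset_eq_plus C_def n_def)
  finally have XC: "real (card (Xs + C)) \<le> L2 * n" by simp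
  have XBC: "real (card (Xs + B + C)) \<le> L1 * (L2 * n)"
    using order_trans[OF Xs(3)[OF finite[of C]] mult_left_mono[OF XC, of L1]] L by simp
  have "diffset Xs ((*) (x + y) ` A) \<subseteq> Xs + B + C"
  proof
    fix u assume "u \<in> diffset Xs ((*) (x + y) ` A)"
    then obtain s a where sa: "s \<in> Xs" "a \<in> A" "u = s + - (x * a) + - (y * a)" by (auto simp: diffset_def algebra_simps)
    show "u \<in> Xs + B + C" unfolding sa(3) using sa(1,2) by (intro set_plus_intro) (auto simp: B_def C_def)
  qed
  hence "card (diffset Xs ((*) (x + y) ` A)) \<le> card (Xs + B + C)" by (intro card_mono) auto
  hence c1: "real (card (diffset Xs ((*) (x + y) ` A))) \<le> L1 * (L2 * n)" using XBC by linarith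
  have "card (diffset A Xs) \<le> card (diffset A A)" using Xs by (intro card_mono) (auto simp: diffset_def)
  hence c2: "real (card (diffset A Xs)) \<le> K * n" using KD by (simp add: n_def)
  have Xbig: "n \<le> L1 * real (card Xs)"
  proof -
    obtain s where s: "s \<in> Xs" using Xs by blast
    have "card B = card ((\<lambda>b. s + b) ` B)" by (rule card_image[symmetric]) (simp add: inj_on_def)
    also have "\<dots> \<le> card (Xs + B)" using s by (intro card_mono) (auto intro: set_plus_intro)
    also have "card B = card A" unfolding B_def by (subst card_image) (auto simp: inj_on_def card_dilate[OF False])
    finally have "n \<le> real (card (Xs + B))" by (simp add: n_def)
    also have "Xs + B = Xs + B + {0}" by simp
    also have "real (card (Xs + B + {0})) \<le> L1 * real (card (Xs + {0}))" by (rule Xs(3)) simp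
    finally show ?thesis by simp
  qed
  have "real (card (diffset A ((*) (x + y) ` A)) * card Xs) \<le> real (card (diffset A Xs) * card (diffset Xs ((*) (x + y) ` A)))"
    by (intro of_nat_mono ruzsa_triangle) auto
  also have "\<dots> \<le> (K * n) * (L1 * (L2 * n))" unfolding of_nat_mult using c1 c2 K_ge_1 n0 by (intro mult_mono) auto
  finally have h: "real (card (diffset A ((*) (x + y) ` A))) * real (card Xs) \<le> K * L1 * L2 * n * n" by (simp add: mult_ac)
  have "real (card (diffset A ((*) (x + y) ` A))) * n \<le> real (card (diffset A ((*) (x + y) ` A))) * (L1 * real (card Xs))"
    using Xbig by (intro mult_left_mono) auto
  also have "\<dots> = L1 * (real (card (diffset A ((*) (x + y) ` A))) * real (card Xs))" by simp
  also have "\<dots> \<le> L1 * (K * L1 * L2 * n * n)" using h L by (intro mult_left_mono) auto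
  finally have "real (card (diffset A ((*) (x + y) ` A))) * n \<le> (K * L1\<^sup>2 * L2 * n) * n" by (simp add: power2_eq_square mult_ac)
  thus ?thesis using n0 by (simp add: good_def n_def)
qed

text \<open>Dichotomy for the quotients of differences of \<open>G\<close>. If they are stable under
  adding 1, they fill the prime field. Otherwise 1 + z is no such quotient for some quotient z, and
  all g + (1 + z) g' are distinct, since a coincidence would write 1 + z as a quotient. The
  exponents 8 and 9 add up the costs of the operations in that expression.\<close>

lemma good_generation:
  assumes q: "prime CARD('a)" and G: "\<And>g. g \<in> G \<Longrightarrow> good A L g" and L: "L \<ge> 1"
  obtains \<Lambda> where "min (CARD('a)) ((card G)\<^sup>2) \<le> card \<Lambda>" "\<And>z. z \<in> \<Lambda> \<Longrightarrow> good A (K ^ 8 * L ^ 9) z"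
proof -
  have K1: "K \<ge> 1" by (rule K_ge_1)
  have "1 * L ^ 1 \<le> K ^ 8 * L ^ 9" by (intro mult_mono power_increasing one_le_power) (use K1 L in auto)
  moreover have "K ^ 4 * L ^ 6 \<le> K ^ 8 * L ^ 9" by (intro mult_mono power_increasing) (use K1 L in auto)
  ultimately have pw: "L \<le> K ^ 8 * L ^ 9" "K ^ 4 * L ^ 6 \<le> K ^ 8 * L ^ 9" by simp_all
  show ?thesis
  proof (cases "card G \<ge> 2")
    case False
    hence "(card G)\<^sup>2 \<le> card G" by (cases "card G = 0"; cases "card G = 1") (auto simp: power2_eq_square)
    hence "min (CARD('a)) ((card G)\<^sup>2) \<le> card G" by linarith
    thus ?thesis using that[of G] G good_mono pw by auto
  next
    case True
    define R where "R = {(a - b) / (c - d) | a b c d. a \<in> G \<and> b \<in> G \<and> c \<in> G \<and> d \<in> G \<and> c \<noteq> d}"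
    have diff: "good A (K\<^sup>2 * L ^ 3) (a - b)" if "a \<in> G" "b \<in> G" for a b
      using good_add[OF G[OF that(1)] good_uminus[OF G[OF that(2)]]] by (simp add: power_numeral_reduce mult_ac)
    have Rg: "good A (K ^ 4 * L ^ 6) z" if "z \<in> R" for z
    proof -
      obtain a b c d where z: "z = (a - b) * inverse (c - d)" "a \<in> G" "b \<in> G" "c \<in> G" "d \<in> G"
        using \<open>z \<in> R\<close> by (auto simp: R_def divide_inverse)
      show ?thesis using good_mult[OF diff[OF z(2,3)] good_inverse[OF diff[OF z(4,5)]]] unfolding z(1)
        by (simp add: power_numeral_reduce mult_ac)
    qed
    obtain g1 g2 where g12: "g1 \<in> G" "g2 \<in> G" "g1 \<noteq> g2"
      using True card_le_Suc0_iff_eq[of G] by auto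
    have R0: "0 \<in> R" using g12 unfolding R_def by force
    show ?thesis
    proof (cases "\<exists>z\<in>R. z + 1 \<notin> R")
      case False
      have nats: "of_nat k \<in> R" for k :: nat using R0 False by (induction k) (auto simp: add.commute)
      have "R = UNIV"
      proof -
        have "bij_betw (of_nat :: nat \<Rightarrow> 'a) {..<CARD('a)} UNIV" by (rule of_nat_bij_prime_field[OF q])
        hence "(UNIV :: 'a set) = of_nat ` {..<CARD('a)}" by (simp add: bij_betw_def)
        also have "\<dots> \<subseteq> R" using nats by auto
        finally show ?thesis by auto
      qed
      thus ?thesis using that[of R] Rg good_mono pw(2) by auto
    next
      case True
      then obtain z where z: "z \<in> R" "z + 1 \<notin> R" by blast
      define \<Lambda> where "\<Lambda> = (\<lambda>(g, g'). g + (1 + z) * g') ` (G \<times> G)"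
      have inj: "inj_on (\<lambda>(g, g'). g + (1 + z) * g') (G \<times> G)"
      proof (rule inj_onI, clarify)
        fix a b c d assume m: "a \<in> G" "b \<in> G" "c \<in> G" "d \<in> G" and e: "a + (1 + z) * b = c + (1 + z) * d"
        show "a = c \<and> b = d"
        proof (cases "b = d")
          case False
          have "(1 + z) * (b - d) = c - a" using e by (simp add: algebra_simps)
          hence "z + 1 = (c - a) / (b - d)" using False by (simp add: field_simps)
          hence "z + 1 \<in> R" unfolding R_def using m False by blast
          thus ?thesis using z by blast
        qed (use e in simp)
      qed
      have "card \<Lambda> = (card G)\<^sup>2" unfolding \<Lambda>_def card_image[OF inj] by (simp add: card_cartesian_product power2_eq_square)
      moreover have "good A (K ^ 8 * L ^ 9) u" if "u \<in> \<Lambda>" for u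
      proof -
        obtain g g' where g: "g \<in> G" "g' \<in> G" "u = g + (1 + z) * g'" using \<open>u \<in> \<Lambda>\<close> by (auto simp: \<Lambda>_def)
        have "good A (K * L\<^sup>2 * ((K * K\<^sup>2 * (K ^ 4 * L ^ 6)) * L)) u"
          unfolding g(3) by (intro good_add good_mult good_one Rg G g z)
        thus ?thesis by (simp add: power_numeral_reduce mult_ac)
      qed
      ultimately show ?thesis using that[of \<Lambda>] by simp
    qed
  qed
qed

text \<open>By Cauchy-Schwarz a good z gives at least n^3 / L solutions of a - z b = c - z d.
  Solutions with b different from d determine z, so all z together have at most n^4 of them; the n^2
  diagonal ones are at most half of n^3 / L as soon as n \<ge> 2 L.\<close>

lemma good_set_bound:
  assumes g: "\<And>z. z \<in> \<Lambda> \<Longrightarrow> good A L z" and n: "real (card A) \<ge> 2 * L" and L: "L \<ge> 1"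
  shows "real (card \<Lambda>) \<le> 2 * L * real (card A)"
proof -
  define n where "n = real (card A)"
  have n0: "n > 0" using card_A_pos by (simp add: n_def)
  define E where "E = (\<lambda>z. {(p, r). p \<in> A \<times> A \<and> r \<in> A \<times> A \<and> fst p - z * snd p = fst r - z * snd r})"
  have finE: "finite (E z)" for z by simp
  have Elow: "n ^ 3 / L \<le> real (card (E z))" if z: "z \<in> \<Lambda>" for z
  proof -
    define I where "I = diffset A ((*) z ` A)"
    define c where "c = (\<lambda>y. real (card {p\<in>A \<times> A. fst p - z * snd p = y}))"
    have "(\<Sum>y\<in>I. c y) = n\<^sup>2"
    proof -
      have "(\<Sum>y\<in>I. card {p\<in>A \<times> A. fst p - z * snd p = y}) = card (A \<times> A)"
      proof -
        have sub: "(\<lambda>p. fst p - z * snd p) ` (A \<times> A) \<subseteq> I" by (auto simp: I_def intro!: diffsetI)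
        show ?thesis using sum.group[OF _ _ sub, of "\<lambda>_. 1::nat"] by simp
      qed
      hence "real (\<Sum>y\<in>I. card {p\<in>A \<times> A. fst p - z * snd p = y}) = real (card (A \<times> A))" by (simp only:)
      thus ?thesis by (simp add: c_def n_def card_cartesian_product power2_eq_square)
    qed
    moreover have "(\<Sum>y\<in>I. (c y)\<^sup>2) = real (card (E z))"
    proof -
      have "E z = (\<Union>y\<in>I. {p\<in>A \<times> A. fst p - z * snd p = y} \<times> {p\<in>A \<times> A. fst p - z * snd p = y})"
      proof (intro equalityI subsetI)
        fix x assume x: "x \<in> E z"
        obtain p r where pr: "x = (p, r)" by (cases x)
        have "fst p - z * snd p \<in> I" using x by (auto simp: E_def pr I_def intro!: diffsetI)
        thus "x \<in> (\<Union>y\<in>I. {p\<in>A \<times> A. fst p - z * snd p = y} \<times> {p\<in>A \<times> A. fst p - z * snd p = y})"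
          using x by (intro UN_I[of "fst p - z * snd p"]) (auto simp: E_def pr)
      qed (auto simp: E_def)
      hence "card (E z) = (\<Sum>y\<in>I. card ({p\<in>A \<times> A. fst p - z * snd p = y} \<times> {p\<in>A \<times> A. fst p - z * snd p = y}))"
        by (simp only:, subst card_UN_disjoint) auto
      thus ?thesis by (simp add: c_def card_cartesian_product power2_eq_square)
    qed
    ultimately have "(n\<^sup>2)\<^sup>2 \<le> real (card I) * real (card (E z))"
      using sum_squared_le_sum_of_squares[of c I] by (simp add: mult.commute)
    also have "\<dots> \<le> (L * n) * real (card (E z))"
      using g[OF z] by (intro mult_right_mono) (auto simp: good_def I_def n_def)
    finally have "n ^ 3 * n \<le> (L * real (card (E z))) * n" by (simp add: power_numeral_reduce mult_ac)
    hence "n ^ 3 \<le> L * real (card (E z))" using n0 by simp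
    thus ?thesis using L by (simp add: divide_le_eq mult.commute)
  qed
  have "card \<Lambda> * (n ^ 3 / L) \<le> (\<Sum>z\<in>\<Lambda>. real (card (E z)))"
    by (subst sum_constant[symmetric], rule sum_mono) (use Elow in auto)
  also have "\<dots> \<le> (\<Sum>z\<in>\<Lambda>. n\<^sup>2 + real (card {x\<in>E z. snd (fst x) \<noteq> snd (snd x)}))"
  proof (rule sum_mono)
    fix z
    have "E z \<subseteq> (\<lambda>p. (p, p)) ` (A \<times> A) \<union> {x\<in>E z. snd (fst x) \<noteq> snd (snd x)}" by (auto simp: E_def)
    hence "card (E z) \<le> card ((\<lambda>p. (p, p)) ` (A \<times> A) \<union> {x\<in>E z. snd (fst x) \<noteq> snd (snd x)})" by (intro card_mono) auto
    also have "\<dots> \<le> card ((\<lambda>p. (p, p)) ` (A \<times> A)) + card {x\<in>E z. snd (fst x) \<noteq> snd (snd x)}" by (rule card_Un_le)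
    also have "card ((\<lambda>p. (p, p)) ` (A \<times> A)) \<le> card (A \<times> A)" by (rule card_image_le) simp
    finally have "card (E z) \<le> card (A \<times> A) + card {x\<in>E z. snd (fst x) \<noteq> snd (snd x)}" by simp
    hence "real (card (E z)) \<le> real (card (A \<times> A) + card {x\<in>E z. snd (fst x) \<noteq> snd (snd x)})" by (rule of_nat_mono)
    thus "real (card (E z)) \<le> n\<^sup>2 + real (card {x\<in>E z. snd (fst x) \<noteq> snd (snd x)})"
      by (simp add: n_def card_cartesian_product power2_eq_square)
  qed
  also have "\<dots> = real (card \<Lambda>) * n\<^sup>2 + (\<Sum>z\<in>\<Lambda>. real (card {x\<in>E z. snd (fst x) \<noteq> snd (snd x)}))" by (simp add: sum.distrib)
  also have "(\<Sum>z\<in>\<Lambda>. real (card {x\<in>E z. snd (fst x) \<noteq> snd (snd x)})) = real (card (\<Union>z\<in>\<Lambda>. {x\<in>E z. snd (fst x) \<noteq> snd (snd x)}))"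
  proof (subst card_UN_disjoint)
    show "\<forall>z\<in>\<Lambda>. \<forall>z'\<in>\<Lambda>. z \<noteq> z' \<longrightarrow> {x\<in>E z. snd (fst x) \<noteq> snd (snd x)} \<inter> {x\<in>E z'. snd (fst x) \<noteq> snd (snd x)} = {}"
    proof (intro ballI impI equals0I)
      fix z z' x assume ne: "z \<noteq> z'" and x: "x \<in> {x\<in>E z. snd (fst x) \<noteq> snd (snd x)} \<inter> {x\<in>E z'. snd (fst x) \<noteq> snd (snd x)}"
      obtain a b c d where abcd: "x = ((a, b), (c, d))" by (cases x) auto
      have e: "a - z * b = c - z * d" "a - z' * b = c - z' * d" "b \<noteq> d" using x by (auto simp: abcd E_def)
      have "(z - z') * (b - d) = (c - z * d - (a - z * b)) - (c - z' * d - (a - z' * b))" by (simp add: algebra_simps)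
      also have "\<dots> = 0" using e by simp
      finally show False using ne e(3) by simp
    qed
  qed auto
  also have "card (\<Union>z\<in>\<Lambda>. {x\<in>E z. snd (fst x) \<noteq> snd (snd x)}) \<le> card ((A \<times> A) \<times> (A \<times> A))"
    by (intro card_mono) (auto simp: E_def)
  also have "real (card ((A \<times> A) \<times> (A \<times> A))) = n ^ 4" by (simp add: n_def card_cartesian_product power_numeral_reduce)
  finally have main: "real (card \<Lambda>) * (n ^ 3 / L) \<le> real (card \<Lambda>) * n\<^sup>2 + n ^ 4" by simp
  have "n\<^sup>2 * (2 * L) \<le> n\<^sup>2 * n" using n by (intro mult_left_mono) (auto simp: n_def)
  hence "n\<^sup>2 \<le> n ^ 3 / (2 * L)" using L by (simp add: le_divide_eq power_numeral_reduce mult_ac)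
  hence "real (card \<Lambda>) * n\<^sup>2 \<le> real (card \<Lambda>) * (n ^ 3 / (2 * L))" by (intro mult_left_mono) auto
  moreover define h where "h = real (card \<Lambda>) * (n ^ 3 / (2 * L))"
  moreover have "real (card \<Lambda>) * (n ^ 3 / L) = 2 * h" by (simp add: h_def)
  moreover have "h \<le> n4" if "x \<le> h" "y = 2 * h" "y \<le> x + n4" for x y n4 :: real using that by linarith
  ultimately have "h \<le> n ^ 4" using main by blast
  hence "real (card \<Lambda>) * (n ^ 3 / (2 * L)) \<le> n ^ 4" by (simp only: h_def)
  hence "real (card \<Lambda>) * n ^ 3 \<le> (2 * L * n) * n ^ 3" using L by (simp add: field_simps power_numeral_reduce)
  thus ?thesis using n0 by (simp add: n_def)
qed

text \<open>A solution consists of t, the ratio l = t' / t and an a with a' = l (a + z) - z. If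
  fewer than M / L ratios were popular, there would be too few solutions. For a popular l the image
  of its a's under this affine map lies both in \<open>A\<close> and in a translate of l A, and the
  triangle inequality through the image shows that l is good.\<close>

lemma popular_dilates:
  assumes T: "0 \<notin> T" and L: "L \<ge> 1"
  defines "M \<equiv> real (card T)" and "n \<equiv> real (card A)"
  assumes E: "real (card {(a, a', t, t'). a \<in> A \<and> a' \<in> A \<and> t \<in> T \<and> t' \<in> T \<and> (a + z) * t' = (a' + z) * t}) > 2 * n * M\<^sup>2 / L"
  obtains G where "real (card G) \<ge> M / L" "\<And>g. g \<in> G \<Longrightarrow> good A (K\<^sup>2 * L) g"
proof -
  have n0: "n > 0" using card_A_pos by (simp add: n_def)
  define D where "D = (\<lambda>l. {a\<in>A. l * (a + z) - z \<in> A})"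
  define G where "G = {l. l \<noteq> 0 \<and> real (card (D l)) \<ge> n / L}"
  have Dn: "real (card (D l)) \<le> n" for l unfolding n_def by (intro of_nat_mono card_mono) (auto simp: D_def)
  have good: "good A (K\<^sup>2 * L) l" if "l \<in> G" for l
  proof -
    have l0: "l \<noteq> 0" and cD: "real (card (D l)) \<ge> n / L" using that by (auto simp: G_def)
    define Y where "Y = (\<lambda>a. l * (a + z) - z) ` D l"
    have cY: "card Y = card (D l)" unfolding Y_def by (rule card_image) (use l0 in \<open>auto simp: inj_on_def\<close>)
    have YA: "Y \<subseteq> A" by (auto simp: Y_def D_def)
    have "card (diffset A Y) \<le> card (diffset A A)" using YA by (intro card_mono) (auto simp: diffset_def)
    hence c1: "real (card (diffset A Y)) \<le> K * n" using KD by (simp add: n_def)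
    have "diffset Y ((*) l ` A) \<subseteq> (\<lambda>u. l * u + (l * z - z)) ` diffset A A"
    proof
      fix u assume "u \<in> diffset Y ((*) l ` A)"
      then obtain a a' where a: "a \<in> A" "a' \<in> A" "u = l * (a + z) - z - l * a'" by (auto simp: diffset_def Y_def D_def)
      hence "u = l * (a - a') + (l * z - z)" by (simp add: algebra_simps)
      thus "u \<in> (\<lambda>u. l * u + (l * z - z)) ` diffset A A" using a by (auto intro!: imageI diffsetI)
    qed
    hence "card (diffset Y ((*) l ` A)) \<le> card ((\<lambda>u. l * u + (l * z - z)) ` diffset A A)" by (intro card_mono) auto
    also have "\<dots> \<le> card (diffset A A)" by (rule card_image_le) simp
    finally have c2: "real (card (diffset Y ((*) l ` A))) \<le> K * n" using KD by (simp add: n_def)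
    have "real (card (diffset A ((*) l ` A)) * card Y) \<le> real (card (diffset A Y) * card (diffset Y ((*) l ` A)))"
      by (intro of_nat_mono ruzsa_triangle) auto
    also have "\<dots> \<le> (K * n) * (K * n)" unfolding of_nat_mult using c1 c2 K_ge_1 n0 by (intro mult_mono) auto
    finally have h: "real (card (diffset A ((*) l ` A))) * real (card Y) \<le> K\<^sup>2 * n * n" by (simp add: power2_eq_square mult_ac)
    have "n \<le> L * real (card Y)" using cD cY L by (simp add: divide_le_eq mult.commute)
    hence "real (card (diffset A ((*) l ` A))) * n \<le> real (card (diffset A ((*) l ` A))) * (L * real (card Y))" by (intro mult_left_mono) auto
    also have "\<dots> = L * (real (card (diffset A ((*) l ` A))) * real (card Y))" by simp
    also have "\<dots> \<le> L * (K\<^sup>2 * n * n)" using h L by (intro mult_left_mono) auto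
    finally have "real (card (diffset A ((*) l ` A))) * n \<le> (K\<^sup>2 * L * n) * n" by (simp add: mult_ac)
    thus ?thesis using n0 by (simp add: good_def n_def)
  qed
  have "real (card G) \<ge> M / L"
  proof (rule ccontr)
    assume "\<not> real (card G) \<ge> M / L"
    hence GM: "real (card G) \<le> M / L" by simp
    define Q where "Q = {(a, a', t, t'). a \<in> A \<and> a' \<in> A \<and> t \<in> T \<and> t' \<in> T \<and> (a + z) * t' = (a' + z) * t}"
    have "card Q \<le> card (SIGMA p:T \<times> T. D (snd p / fst p))"
    proof (rule card_inj_on_le[of "\<lambda>(a, a', t, t'). ((t, t'), a)"])
      show "inj_on (\<lambda>(a, a', t, t'). ((t, t'), a)) Q"
      proof (rule inj_onI, clarsimp)
        fix a a' t t' b assume "(a, a', t, t') \<in> Q" "(a, b, t, t') \<in> Q"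
        hence "(a' + z) * t = (b + z) * t" "t \<noteq> 0" using T by (auto simp: Q_def)
        thus "a' = b" by simp
      qed
      show "(\<lambda>(a, a', t, t'). ((t, t'), a)) ` Q \<subseteq> (SIGMA p:T \<times> T. D (snd p / fst p))"
      proof (clarsimp simp: Q_def D_def)
        fix a a' t t' assume a: "a' \<in> A" "t \<in> T" "(a + z) * t' = (a' + z) * t"
        have "t \<noteq> 0" using a T by auto
        hence "t' * (a + z) / t - z = a'" using a(3) by (simp add: field_simps)
        thus "t' * (a + z) / t - z \<in> A" using a by simp
      qed
    qed simp
    hence "real (card Q) \<le> real (card (SIGMA p:T \<times> T. D (snd p / fst p)))" by (rule of_nat_mono)
    also have "\<dots> = (\<Sum>p\<in>T \<times> T. real (card (D (snd p / fst p))))" by simp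
    also have "\<dots> \<le> (\<Sum>p\<in>T \<times> T. (if snd p / fst p \<in> G then n else 0) + n / L)"
    proof (rule sum_mono)
      fix p assume p: "p \<in> T \<times> T"
      have "snd p / fst p \<noteq> 0" using p T by auto
      thus "real (card (D (snd p / fst p))) \<le> (if snd p / fst p \<in> G then n else 0) + n / L"
        using Dn[of "snd p / fst p"] n0 L by (auto simp: G_def intro: add_increasing2)
    qed
    also have "\<dots> = n * real (card {p\<in>T \<times> T. snd p / fst p \<in> G}) + M\<^sup>2 * (n / L)"
      by (simp add: sum.distrib sum.If_cases Int_def M_def card_cartesian_product power2_eq_square)
    also have "\<dots> \<le> n * (M * real (card G)) + M\<^sup>2 * (n / L)"
    proof -
      have "card {p\<in>T \<times> T. snd p / fst p \<in> G} \<le> card (T \<times> G)"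
      proof (rule card_inj_on_le[of "\<lambda>p. (fst p, snd p / fst p)"])
        show "inj_on (\<lambda>p. (fst p, snd p / fst p)) {p\<in>T \<times> T. snd p / fst p \<in> G}"
          using T by (auto simp: inj_on_def)
      qed auto
      hence "real (card {p\<in>T \<times> T. snd p / fst p \<in> G}) \<le> M * real (card G)"
        by (simp add: M_def card_cartesian_product flip: of_nat_mult)
      thus ?thesis using n0 by simp
    qed
    also have "n * (M * real (card G)) \<le> n * (M * (M / L))" using GM n0 by (intro mult_left_mono) (auto simp: M_def)
    also have "n * (M * (M / L)) + M\<^sup>2 * (n / L) = 2 * n * M\<^sup>2 / L" by (simp add: power2_eq_square field_simps)
    finally show False using E by (simp add: Q_def)
  qed
  thus ?thesis using that good by blast
qed

text \<open>Too many solutions give |T| / L good dilates with constant K^2 L, generation yields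
  min(p, (|T| / L)^2) of them with constant K^8 (K^2 L)^9 = K^26 L^9, and this exceeds what
  \<open>good_set_bound\<close> admits.\<close>

theorem energy_bound:
  assumes q: "prime CARD('a)" and T: "0 \<notin> T" and L: "L \<ge> 1"
    and n: "real (card A) \<ge> 2 * (K ^ 26 * L ^ 9)"
    and big: "2 * (K ^ 26 * L ^ 9) * real (card A) < min (real CARD('a)) ((real (card T) / L)\<^sup>2)"
  shows "real (card {(a, a', t, t'). a \<in> A \<and> a' \<in> A \<and> t \<in> T \<and> t' \<in> T \<and> (a + z) * t' = (a' + z) * t})
    \<le> 2 * real (card A) * (real (card T))\<^sup>2 / L"
proof (rule ccontr)
  assume "\<not> ?thesis"
  hence gt: "real (card {(a, a', t, t'). a \<in> A \<and> a' \<in> A \<and> t \<in> T \<and> t' \<in> T \<and> (a + z) * t' = (a' + z) * t})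
    > 2 * real (card A) * (real (card T))\<^sup>2 / L" by simp
  obtain G where G: "real (card G) \<ge> real (card T) / L" "\<And>g. g \<in> G \<Longrightarrow> good A (K\<^sup>2 * L) g"
    using popular_dilates[OF T L gt] by blast
  have KL: "K\<^sup>2 * L \<ge> 1" using mult_mono[of 1 "K\<^sup>2" 1 L] K_ge_1 L by (simp add: one_le_power)
  obtain \<Lambda> where \<Lambda>: "min (CARD('a)) ((card G)\<^sup>2) \<le> card \<Lambda>" "\<And>z. z \<in> \<Lambda> \<Longrightarrow> good A (K ^ 8 * (K\<^sup>2 * L) ^ 9) z"
    using good_generation[OF q G(2) KL] by blast
  have "(K\<^sup>2 * L) ^ 9 = K ^ 18 * L ^ 9" by (simp add: power_mult_distrib flip: power_mult)
  moreover have "K ^ 8 * (K ^ 18 * L ^ 9) = K ^ (8 + 18) * L ^ 9" by (simp only: power_add mult.assoc)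
  ultimately have e: "K ^ 8 * (K\<^sup>2 * L) ^ 9 = K ^ 26 * L ^ 9" by simp
  have "K ^ 26 * L ^ 9 \<ge> 1 * 1" using K_ge_1 L by (intro mult_mono one_le_power) auto
  hence "real (card \<Lambda>) \<le> 2 * (K ^ 26 * L ^ 9) * real (card A)"
    using good_set_bound[of \<Lambda> "K ^ 26 * L ^ 9"] \<Lambda>(2) n unfolding e by auto
  moreover have "min (real CARD('a)) ((real (card T) / L)\<^sup>2) \<le> real (card \<Lambda>)"
  proof -
    have "(real (card T) / L)\<^sup>2 \<le> (real (card G))\<^sup>2" using G(1) L by (intro power_mono) auto
    hence "min (real CARD('a)) ((real (card T) / L)\<^sup>2) \<le> min (real CARD('a)) ((real (card G))\<^sup>2)" by linarith
    also have "\<dots> = real (min (CARD('a)) ((card G)\<^sup>2))" by (simp add: of_nat_min)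
    also have "\<dots> \<le> real (card \<Lambda>)" using \<Lambda>(1) by (intro of_nat_mono)
    finally show ?thesis .
  qed
  ultimately show False using big by linarith
qed
end

section \<open>Moments of short character sums\<close>

lemma card_le_of_inverse_images:
  assumes "finite Y" "B \<subseteq> F ` Y"
  shows "card B \<le> card Y"
  using card_mono[OF finite_imageI[OF assms(1)] assms(2)] card_image_le[OF assms(1), of F] by linarith

definition occ :: "nat \<Rightarrow> (nat \<Rightarrow> nat) \<Rightarrow> nat \<Rightarrow> nat" where
  "occ r f j = card {i. i < r \<and> f i = j}"

lemma sum_occ:
  assumes "finite I" "f ` {..<r} \<subseteq> I"
  shows "(\<Sum>j\<in>I. occ r f j) = r"
proof -
  have "(\<Sum>j\<in>I. \<Sum>i\<in>{i\<in>{..<r}. f i = j}. (1::nat)) = (\<Sum>i\<in>{..<r}. 1)"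
    by (rule sum.group) (use assms in auto)
  thus ?thesis by (simp add: occ_def)
qed

text \<open>If no value occurs exactly once, the 2 r positions carry at most r values. The pair is
  then encoded by a list of r values and an index into the list for each position.\<close>

lemma card_paired_tuples_le:
  assumes r: "r \<ge> 1"
  shows "card {(f, g). f \<in> PiE {..<r} (\<lambda>_. {1..J}) \<and> g \<in> PiE {..<r} (\<lambda>_. {1..J}) \<and> (\<forall>j. occ r f j + occ r g j \<noteq> 1)}
    \<le> r ^ (2 * r) * J ^ r"
proof -
  define P where "P = PiE {..<r} (\<lambda>_. {..<r})"
  define H where "H = PiE {..<r} (\<lambda>_. {1..J})"
  define F where "F = (\<lambda>(a :: nat \<Rightarrow> nat, b :: nat \<Rightarrow> nat, h :: nat \<Rightarrow> nat). (\<lambda>i\<in>{..<r}. h (a i) :: nat, \<lambda>i\<in>{..<r}. h (b i) :: nat))"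
  let ?B = "{(f, g). f \<in> PiE {..<r} (\<lambda>_. {1..J}) \<and> g \<in> PiE {..<r} (\<lambda>_. {1..J}) \<and> (\<forall>j. occ r f j + occ r g j \<noteq> 1)}"
  have fin: "finite P" "finite H" unfolding P_def H_def by (auto intro!: finite_PiE)
  have "?B \<subseteq> F ` (P \<times> P \<times> H)"
  proof clarify
    fix f g assume f: "f \<in> PiE {..<r} (\<lambda>_. {1..J})" and g: "g \<in> PiE {..<r} (\<lambda>_. {1..J})" and ne: "\<forall>j. occ r f j + occ r g j \<noteq> 1"
    define I where "I = f ` {..<r} \<union> g ` {..<r}"
    have finI: "finite I" by (simp add: I_def)
    have ge2: "2 \<le> occ r f j + occ r g j" if "j \<in> I" for j
    proof -
      have "occ r f j > 0 \<or> occ r g j > 0" using that by (auto simp: I_def occ_def card_gt_0_iff)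
      thus ?thesis using ne[rule_format, of j] by linarith
    qed
    have "card I * 2 \<le> (\<Sum>j\<in>I. occ r f j + occ r g j)"
      using sum_mono[of I "\<lambda>_. 2" "\<lambda>j. occ r f j + occ r g j"] ge2 by simp
    also have "\<dots> = r + r" using finI by (simp add: sum.distrib sum_occ I_def)
    finally have cI: "card I \<le> r" by simp
    obtain e where e: "bij_betw e I {..<card I}" using finite_same_card_bij[OF finI, of "{..<card I}"] by auto
    define h where "h = (\<lambda>k\<in>{..<r}. if k < card I then the_inv_into I e k else f 0)"
    have he: "h (e j) = j" if "j \<in> I" for j
    proof -
      have "e j < card I" using e that by (auto simp: bij_betw_def)
      thus ?thesis using cI e that by (simp add: h_def bij_betw_def the_inv_into_f_f)
    qed
    have IJ: "I \<subseteq> {1..J}" using f g by (auto simp: I_def PiE_iff)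
    have f0: "f 0 \<in> {1..J}" using f r by (auto simp: PiE_iff)
    have "h \<in> H" unfolding H_def h_def restrict_PiE_iff
    proof safe
      fix k assume "k < r"
      have "the_inv_into I e k \<in> I" if "k < card I"
        using e that by (intro the_inv_into_into[of e I]) (auto simp: bij_betw_def)
      thus "(if k < card I then the_inv_into I e k else f 0) \<in> {1..J}" using IJ f0 by auto
    qed
    moreover have "(\<lambda>i\<in>{..<r}. e (f i)) \<in> P" "(\<lambda>i\<in>{..<r}. e (g i)) \<in> P"
    proof -
      have "e j < r" if "j \<in> I" for j
      proof -
        have "e j < card I" using e that by (auto simp: bij_betw_def)
        thus ?thesis using cI by linarith
      qed
      thus "(\<lambda>i\<in>{..<r}. e (f i)) \<in> P" "(\<lambda>i\<in>{..<r}. e (g i)) \<in> P" by (auto simp: P_def I_def)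
    qed
    moreover have "F (\<lambda>i\<in>{..<r}. e (f i), \<lambda>i\<in>{..<r}. e (g i), h) = (f, g)"
    proof -
      have "(\<lambda>i\<in>{..<r}. h ((\<lambda>i\<in>{..<r}. e (f i)) i)) = f"
      proof
        fix i show "(\<lambda>i\<in>{..<r}. h ((\<lambda>i\<in>{..<r}. e (f i)) i)) i = f i"
          using f he[of "f i"] by (cases "i < r") (auto simp: I_def PiE_iff extensional_def)
      qed
      moreover have "(\<lambda>i\<in>{..<r}. h ((\<lambda>i\<in>{..<r}. e (g i)) i)) = g"
      proof
        fix i show "(\<lambda>i\<in>{..<r}. h ((\<lambda>i\<in>{..<r}. e (g i)) i)) i = g i"
          using g he[of "g i"] by (cases "i < r") (auto simp: I_def PiE_iff extensional_def)
      qed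
      ultimately show ?thesis by (simp add: F_def)
    qed
    ultimately show "(f, g) \<in> F ` (P \<times> P \<times> H)"
      by (intro image_eqI[of _ F "(\<lambda>i\<in>{..<r}. e (f i), \<lambda>i\<in>{..<r}. e (g i), h)"]) (simp_all only: mem_Sigma_iff simp_thms)
  qed
  hence "card ?B \<le> card (P \<times> P \<times> H)" by (intro card_le_of_inverse_images) (use fin in auto)
  also have "\<dots> = r ^ r * (r ^ r * J ^ r)" by (simp add: card_cartesian_product P_def H_def card_PiE)
  also have "\<dots> = r ^ (2 * r) * J ^ r" by (simp add: power_add mult_2 mult.assoc)
  finally show ?thesis .
qed

section \<open>Moments through Weil's bound\<close>

locale mult_char =
  fixes \<chi> :: "'a::{finite_field,field_gcd} \<Rightarrow> complex"
  assumes prime_card: "prime CARD('a)"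
    and mult: "\<And>x y. \<chi> (x * y) = \<chi> x * \<chi> y" and zero: "\<chi> 0 = 0" and one: "\<chi> 1 = 1"
    and nontrivial: "\<exists>c. c \<noteq> 0 \<and> \<chi> c \<noteq> 1"
begin

lemma power: "\<chi> (x ^ n) = \<chi> x ^ n" and norm_eq_1: "x \<noteq> 0 \<Longrightarrow> norm (\<chi> x) = 1" and norm_le_1: "norm (\<chi> x) \<le> 1"
proof -
  obtain c where c: "c \<noteq> 0" "\<chi> c \<noteq> 1" using nontrivial by blast
  note p = mult_char_props[of \<chi> c, OF mult c zero one]
  show "\<chi> (x ^ n) = \<chi> x ^ n" "x \<noteq> 0 \<Longrightarrow> norm (\<chi> x) = 1" "norm (\<chi> x) \<le> 1" using p by auto
qed

lemma sum_eq_0: "(\<Sum>x\<in>UNIV. \<chi> x) = 0"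
  using nontrivial sum_mult_char_eq_0[of \<chi>, OF mult zero] by blast

lemma card_ge_3: "CARD('a) \<ge> 3"
proof -
  obtain c where c: "c \<noteq> 0" "\<chi> c \<noteq> 1" using nontrivial by blast
  hence "c \<noteq> 1" using one by auto
  hence "card {0, 1, c} = 3" using c by auto
  thus ?thesis using card_mono[of UNIV "{0, 1, c}"] by simp
qed

text \<open>Turning conjugates into powers brings the moments into the form of Weil's bound with
  nonnegative exponents. At 0 both sides vanish because a nontrivial character forces p \<ge> 3, so
  the exponent is positive.\<close>

lemma cnj_eq_power: "cnj (\<chi> x) = \<chi> x ^ (CARD('a) - 2)"
proof (cases "x = 0")
  case True
  thus ?thesis using card_ge_3 by (simp add: zero power_0_left)
next
  case False
  have "CARD('a) = Suc (Suc (CARD('a) - 2))" using card_ge_3 by simp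
  hence "\<chi> x * (\<chi> x * \<chi> x ^ (CARD('a) - 2)) = \<chi> x"
    using finite_field_power_card_eq_same[of x] power[of x "CARD('a)"] by (metis power_Suc)
  moreover have "\<chi> x * (\<chi> x * cnj (\<chi> x)) = \<chi> x"
    using norm_eq_1[OF False] complex_norm_square[of "\<chi> x"] by simp
  moreover have "\<chi> x \<noteq> 0" using norm_eq_1[OF False] by auto
  ultimately have "\<chi> x * (\<chi> x * cnj (\<chi> x)) = \<chi> x * (\<chi> x * \<chi> x ^ (CARD('a) - 2))" by simp
  thus ?thesis using \<open>\<chi> x \<noteq> 0\<close> by simp
qed

text \<open>Weil's bound after the substitution u = -x; indices below p give distinct shifts in the
  field.\<close>

lemma shifted_sum_bound:
  fixes I :: "nat set" and e :: "nat \<Rightarrow> nat"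
  assumes I: "finite I" "\<And>j. j \<in> I \<Longrightarrow> j < CARD('a)" and e: "\<And>j. j \<in> I \<Longrightarrow> e j \<ge> 1" "j0 \<in> I" "e j0 = 1"
  shows "norm (\<Sum>u\<in>UNIV. \<Prod>j\<in>I. \<chi> (u + of_nat j) ^ e j) \<le> real (card I) * sqrt (real CARD('a))"
proof -
  obtain c where c: "c \<noteq> 0" "\<chi> c \<noteq> 1" using nontrivial by blast
  have inj: "inj_on (of_nat :: nat \<Rightarrow> 'a) I"
    using of_nat_bij_prime_field[OF prime_card] I(2) by (auto simp: bij_betw_def intro: inj_on_subset)
  define S where "S = (of_nat ` I :: 'a set)"
  define e' where "e' = (\<lambda>b :: 'a. e (the_inv_into I of_nat b))"
  have e': "e' (of_nat j) = e j" if "j \<in> I" for j using inj that by (simp add: e'_def the_inv_into_f_f)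
  have "norm (\<Sum>x\<in>UNIV. \<Prod>b\<in>S. \<chi> (b - x) ^ e' b) \<le> real (card S) * sqrt (real CARD('a))"
    by (rule weil_bound[OF prime_card mult zero one c, of "of_nat j0"]) (use e e' in \<open>auto simp: S_def\<close>)
  also have "card S = card I" unfolding S_def by (rule card_image[OF inj])
  also have "(\<Sum>x\<in>UNIV. \<Prod>b\<in>S. \<chi> (b - x) ^ e' b) = (\<Sum>u\<in>UNIV. \<Prod>b\<in>S. \<chi> (b + u) ^ e' b)"
    by (rule sum.reindex_bij_witness[of _ uminus uminus]) auto
  also have "\<dots> = (\<Sum>u\<in>UNIV. \<Prod>j\<in>I. \<chi> (u + of_nat j) ^ e j)"
    unfolding S_def by (simp add: prod.reindex[OF inj] e' add.commute cong: prod.cong)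
  finally show ?thesis .
qed

definition tuple_sum :: "nat \<Rightarrow> (nat \<Rightarrow> nat) \<Rightarrow> (nat \<Rightarrow> nat) \<Rightarrow> complex" where
  "tuple_sum r f g = (\<Sum>u\<in>UNIV. (\<Prod>i<r. \<chi> (u + of_nat (f i))) * (\<Prod>i<r. cnj (\<chi> (u + of_nat (g i)))))"

lemma norm_tuple_sum_le: "norm (tuple_sum r f g) \<le> real CARD('a)"
proof -
  have "norm (tuple_sum r f g) \<le> (\<Sum>u\<in>(UNIV :: 'a set). 1)"
    unfolding tuple_sum_def
  proof (rule sum_norm_le)
    fix u :: 'a
    have "norm (\<Prod>i<r. \<chi> (u + of_nat (f i))) \<le> 1" "norm (\<Prod>i<r. cnj (\<chi> (u + of_nat (g i)))) \<le> 1"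
      unfolding prod_norm[symmetric] using norm_le_1 by (auto intro!: prod_le_1)
    thus "norm ((\<Prod>i<r. \<chi> (u + of_nat (f i))) * (\<Prod>i<r. cnj (\<chi> (u + of_nat (g i))))) \<le> 1"
      unfolding norm_mult by (intro mult_le_one) auto
  qed
  thus ?thesis by simp
qed

lemma tuple_sum_swap: "norm (tuple_sum r f g) = norm (tuple_sum r g f)"
proof -
  have "cnj (tuple_sum r f g) = tuple_sum r g f" by (simp add: tuple_sum_def mult.commute)
  thus ?thesis by (metis complex_mod_cnj)
qed

lemma prod_occ:
  fixes h :: "nat \<Rightarrow> 'b::comm_monoid_mult"
  assumes "finite I" "f ` {..<r} \<subseteq> I"
  shows "(\<Prod>i<r. h (f i)) = (\<Prod>j\<in>I. h j ^ occ r f j)"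
proof -
  have "(\<Prod>j\<in>I. \<Prod>i\<in>{i\<in>{..<r}. f i = j}. h (f i)) = (\<Prod>i\<in>{..<r}. h (f i))"
    by (rule prod.group) (use assms in auto)
  moreover have "(\<Prod>i\<in>{i\<in>{..<r}. f i = j}. h (f i)) = h j ^ occ r f j" for j
  proof -
    have "(\<Prod>i\<in>{i\<in>{..<r}. f i = j}. h (f i)) = (\<Prod>i\<in>{i\<in>{..<r}. f i = j}. h j)" by (intro prod.cong) auto
    thus ?thesis by (simp add: occ_def)
  qed
  ultimately show ?thesis by simp
qed

text \<open>The shift by j has exponent \<open>occ r f j + (CARD('a) - 2) * occ r g j\<close>. At
  \<open>j0\<close> this is 1, the exponent that Weil's bound asks for; if the single occurrence is
  in g instead, conjugation exchanges f and g.\<close>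

lemma tuple_sum_bound_aux:
  assumes f: "f \<in> PiE {..<r} (\<lambda>_. {1..J})" and g: "g \<in> PiE {..<r} (\<lambda>_. {1..J})" and J: "J < CARD('a)"
    and j0: "occ r f j0 = 1" "occ r g j0 = 0"
  shows "norm (tuple_sum r f g) \<le> 2 * real r * sqrt (real CARD('a))"
proof -
  define I where "I = f ` {..<r} \<union> g ` {..<r}"
  have finI: "finite I" and fI: "f ` {..<r} \<subseteq> I" and gI: "g ` {..<r} \<subseteq> I" by (auto simp: I_def)
  have IJ: "j < CARD('a)" if "j \<in> I" for j using that f g by (auto simp: I_def PiE_iff intro: le_less_trans[OF _ J])
  define e where "e = (\<lambda>j. occ r f j + (CARD('a) - 2) * occ r g j)"
  have q2: "CARD('a) - 2 \<ge> 1" using card_ge_3 by simp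
  have e1: "e j \<ge> 1" if "j \<in> I" for j
  proof -
    have "occ r f j > 0 \<or> occ r g j > 0" using that by (auto simp: I_def occ_def card_gt_0_iff)
    thus ?thesis using q2 by (auto simp: e_def Suc_le_eq)
  qed
  have j0I: "j0 \<in> I"
  proof -
    have "{i. i < r \<and> f i = j0} \<noteq> {}"
    proof
      assume "{i. i < r \<and> f i = j0} = {}"
      thus False using j0(1) by (simp only: occ_def card.empty)
    qed
    thus ?thesis by (auto simp: I_def)
  qed
  have "tuple_sum r f g = (\<Sum>u\<in>UNIV. \<Prod>j\<in>I. \<chi> (u + of_nat j) ^ e j)"
    unfolding tuple_sum_def
  proof (intro sum.cong refl)
    fix u
    have "(\<Prod>i<r. \<chi> (u + of_nat (f i))) = (\<Prod>j\<in>I. \<chi> (u + of_nat j) ^ occ r f j)"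
      by (rule prod_occ[OF finI fI, of "\<lambda>j. \<chi> (u + of_nat j)"])
    moreover have "(\<Prod>i<r. cnj (\<chi> (u + of_nat (g i)))) = (\<Prod>j\<in>I. (\<chi> (u + of_nat j) ^ (CARD('a) - 2)) ^ occ r g j)"
      unfolding cnj_eq_power by (rule prod_occ[OF finI gI, of "\<lambda>j. \<chi> (u + of_nat j) ^ (CARD('a) - 2)"])
    ultimately show "(\<Prod>i<r. \<chi> (u + of_nat (f i))) * (\<Prod>i<r. cnj (\<chi> (u + of_nat (g i)))) = (\<Prod>j\<in>I. \<chi> (u + of_nat j) ^ e j)"
      by (simp add: e_def power_add prod.distrib flip: power_mult)
  qed
  also have "norm \<dots> \<le> real (card I) * sqrt (real CARD('a))"
    by (rule shifted_sum_bound[OF finI IJ e1 j0I]) (use j0 in \<open>auto simp: e_def\<close>)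
  also have "\<dots> \<le> 2 * real r * sqrt (real CARD('a))"
  proof (rule mult_right_mono)
    have "card I \<le> card (f ` {..<r}) + card (g ` {..<r})" unfolding I_def by (rule card_Un_le)
    also have "\<dots> \<le> r + r" using card_image_le[of "{..<r}" f] card_image_le[of "{..<r}" g] by simp
    finally show "real (card I) \<le> 2 * real r" by simp
  qed simp
  finally show ?thesis .
qed

lemma tuple_sum_bound:
  assumes f: "f \<in> PiE {..<r} (\<lambda>_. {1..J})" and g: "g \<in> PiE {..<r} (\<lambda>_. {1..J})" and J: "J < CARD('a)"
    and j0: "occ r f j0 + occ r g j0 = 1"
  shows "norm (tuple_sum r f g) \<le> 2 * real r * sqrt (real CARD('a))"
proof (cases "occ r f j0 = 1")
  case True
  thus ?thesis using tuple_sum_bound_aux[OF f g J] j0 by simp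
next
  case False
  thus ?thesis using tuple_sum_bound_aux[OF g f J, of j0] j0 tuple_sum_swap[of r f g] by simp
qed

text \<open>The power expands into pairs of r-tuples. Pairs without a value of multiplicity one, at
  most r^(2 r) J^r of them, are bounded trivially by p; all others have square-root
  cancellation.\<close>

lemma moment_bound:
  assumes r: "r \<ge> 1" and J: "J < CARD('a)"
  shows "(\<Sum>u\<in>UNIV. norm (\<Sum>j=1..J. \<chi> (u + of_nat j)) ^ (2 * r)) \<le>
    real r ^ (2 * r) * real J ^ r * real CARD('a) + real J ^ (2 * r) * (2 * real r * sqrt (real CARD('a)))"
proof -
  define H where "H = PiE {..<r} (\<lambda>_. {1..J})"
  have finH: "finite H" unfolding H_def by (intro finite_PiE) auto
  have cH: "card H = J ^ r" unfolding H_def by (simp add: card_PiE)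
  have ex1: "(\<Sum>j=1..J. h j) ^ r = (\<Sum>f\<in>H. \<Prod>i<r. h (f i))" for h :: "nat \<Rightarrow> complex"
    using prod_sum_PiE[of "{..<r}" "\<lambda>_. {1..J}" "\<lambda>_ j. h j"] by (simp add: H_def)
  have "complex_of_real (\<Sum>u\<in>UNIV. norm (\<Sum>j=1..J. \<chi> (u + of_nat j)) ^ (2 * r)) = (\<Sum>(f, g)\<in>H \<times> H. tuple_sum r f g)"
  proof -
    have "complex_of_real (norm z ^ (2 * r)) = z ^ r * cnj z ^ r" for z
    proof -
      have "complex_of_real (norm z ^ (2 * r)) = complex_of_real ((norm z)\<^sup>2) ^ r" by (simp add: power_mult)
      thus ?thesis unfolding complex_norm_square by (simp add: power_mult_distrib)
    qed
    hence "complex_of_real (norm (\<Sum>j=1..J. \<chi> (u + of_nat j)) ^ (2 * r)) =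
       (\<Sum>f\<in>H. \<Prod>i<r. \<chi> (u + of_nat (f i))) * (\<Sum>g\<in>H. \<Prod>i<r. cnj (\<chi> (u + of_nat (g i))))" for u
      using ex1[of "\<lambda>j. \<chi> (u + of_nat j)"] ex1[of "\<lambda>j. cnj (\<chi> (u + of_nat j))"] by simp
    hence "complex_of_real (\<Sum>u\<in>UNIV. norm (\<Sum>j=1..J. \<chi> (u + of_nat j)) ^ (2 * r)) =
       (\<Sum>u\<in>UNIV. \<Sum>p\<in>H \<times> H. (\<Prod>i<r. \<chi> (u + of_nat (fst p i))) * (\<Prod>i<r. cnj (\<chi> (u + of_nat (snd p i)))))"
      by (simp add: sum_product sum.cartesian_product case_prod_beta)
    also have "\<dots> = (\<Sum>p\<in>H \<times> H. tuple_sum r (fst p) (snd p))" unfolding tuple_sum_def by (rule sum.swap)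
    finally show ?thesis by (simp add: case_prod_beta)
  qed
  hence "(\<Sum>u\<in>UNIV. norm (\<Sum>j=1..J. \<chi> (u + of_nat j)) ^ (2 * r)) = norm (\<Sum>(f, g)\<in>H \<times> H. tuple_sum r f g)"
    by (metis (no_types, lifting) norm_of_real abs_of_nonneg sum_nonneg zero_le_power norm_ge_zero)
  also have "\<dots> \<le> (\<Sum>p\<in>H \<times> H. norm (tuple_sum r (fst p) (snd p)))"
    using norm_sum[of "\<lambda>p. tuple_sum r (fst p) (snd p)" "H \<times> H"] by (simp add: case_prod_beta)
  also have "\<dots> \<le> (\<Sum>p\<in>H \<times> H. (if \<forall>j. occ r (fst p) j + occ r (snd p) j \<noteq> 1 then real CARD('a) else 0) + 2 * real r * sqrt (real CARD('a)))"
  proof (rule sum_mono)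
    fix p assume p: "p \<in> H \<times> H"
    show "norm (tuple_sum r (fst p) (snd p)) \<le> (if \<forall>j. occ r (fst p) j + occ r (snd p) j \<noteq> 1 then real CARD('a) else 0) + 2 * real r * sqrt (real CARD('a))"
    proof (cases "\<forall>j. occ r (fst p) j + occ r (snd p) j \<noteq> 1")
      case True
      show ?thesis unfolding if_P[OF True] by (rule order_trans[OF norm_tuple_sum_le]) simp
    next
      case False
      then obtain j0 where j0: "occ r (fst p) j0 + occ r (snd p) j0 = 1" unfolding not_all not_not by (rule exE)
      have "fst p \<in> PiE {..<r} (\<lambda>_. {1..J})" "snd p \<in> PiE {..<r} (\<lambda>_. {1..J})" using p by (simp_all only: H_def mem_Times_iff)
      from tuple_sum_bound[OF this J j0] show ?thesis unfolding if_not_P[OF False] by simp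
    qed
  qed
  also have "\<dots> = real (card {p\<in>H \<times> H. \<forall>j. occ r (fst p) j + occ r (snd p) j \<noteq> 1}) * real CARD('a) + real (card H) ^ 2 * (2 * real r * sqrt (real CARD('a)))"
    using finH by (simp add: sum.distrib sum.If_cases Int_def card_cartesian_product power2_eq_square)
  also have "\<dots> \<le> real (r ^ (2 * r) * J ^ r) * real CARD('a) + real (card H) ^ 2 * (2 * real r * sqrt (real CARD('a)))"
  proof -
    have "{p\<in>H \<times> H. \<forall>j. occ r (fst p) j + occ r (snd p) j \<noteq> 1} = {(f, g). f \<in> PiE {..<r} (\<lambda>_. {1..J}) \<and> g \<in> PiE {..<r} (\<lambda>_. {1..J}) \<and> (\<forall>j. occ r f j + occ r g j \<noteq> 1)}"
      by (auto simp: H_def)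
    hence "card {p\<in>H \<times> H. \<forall>j. occ r (fst p) j + occ r (snd p) j \<noteq> 1} \<le> r ^ (2 * r) * J ^ r"
      using card_paired_tuples_le[OF r, of J] by (simp only:)
    hence "real (card {p\<in>H \<times> H. \<forall>j. occ r (fst p) j + occ r (snd p) j \<noteq> 1}) \<le> real (r ^ (2 * r) * J ^ r)" by (rule of_nat_mono)
    thus ?thesis by (intro add_right_mono mult_right_mono) auto
  qed
  also have "\<dots> = real r ^ (2 * r) * real J ^ r * real CARD('a) + real J ^ (2 * r) * (2 * real r * sqrt (real CARD('a)))"
    by (simp add: cH power_mult[symmetric] mult.commute)
  finally show ?thesis .
qed

section \<open>Amplification by Hoelder's inequality\<close>

lemma sum_power_le:
  fixes w g :: "'b \<Rightarrow> real"
  assumes fin: "finite S" and w: "\<And>x. x \<in> S \<Longrightarrow> w x \<ge> 0" and g: "\<And>x. x \<in> S \<Longrightarrow> g x \<ge> 0" and r: "r \<ge> 1"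
  shows "(\<Sum>x\<in>S. w x * g x) ^ r \<le> (\<Sum>x\<in>S. w x) ^ (r - 1) * (\<Sum>x\<in>S. w x * g x ^ r)"
proof (cases "(\<Sum>x\<in>S. w x) = 0")
  case True
  hence "w x = 0" if "x \<in> S" for x using that sum_nonneg_eq_0_iff[OF fin] w by blast
  thus ?thesis using r by (simp add: power_0_left)
next
  case False
  define W where "W = (\<Sum>x\<in>S. w x)"
  have W: "W > 0" using False sum_nonneg[of S w] w by (simp add: W_def less_le)
  have ne: "S \<noteq> {}" using False by auto
  have "(\<Sum>x\<in>S. (w x / W) *\<^sub>R g x) ^ r \<le> (\<Sum>x\<in>S. (w x / W) * g x ^ r)"
  proof (rule convex_on_sum[OF fin ne, where f = "\<lambda>x. x ^ r" and C = "{0..}"])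
    show "convex_on {0..} (\<lambda>x :: real. x ^ r)"
      using convex_on_subset[OF convex_power_even, of r "{0..}"] convex_power_odd[of r] by (cases "even r") auto
    show "(\<Sum>x\<in>S. w x / W) = 1" using W by (simp add: W_def flip: sum_divide_distrib)
  qed (use w g W in auto)
  hence "((\<Sum>x\<in>S. w x * g x) / W) ^ r \<le> (\<Sum>x\<in>S. w x * g x ^ r) / W"
    by (simp add: sum_divide_distrib)
  hence "(\<Sum>x\<in>S. w x * g x) ^ r \<le> W ^ r * ((\<Sum>x\<in>S. w x * g x ^ r) / W)"
    using W by (simp add: power_divide pos_divide_le_eq mult.commute)
  also have "\<dots> = W ^ (r - 1) * (\<Sum>x\<in>S. w x * g x ^ r)" using W r by (cases r) auto
  finally show ?thesis by (simp add: W_def)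
qed

text \<open>Factoring out \<chi>(t), of absolute value 1, leaves shifts of u = (a + z) / t, so only
  the multiplicity w(u) matters. Hoelder's inequality separates the first moment of w, its second
  moment, which counts the solutions, and the 2 r-th moment of the short sums, now over all
  u.\<close>

lemma burgess_amplification:
  fixes A T :: "'a set"
  assumes T: "0 \<notin> T" and r: "r \<ge> 1"
  shows "(\<Sum>a\<in>A. \<Sum>t\<in>T. norm (\<Sum>j=1..J. \<chi> (a + z + of_nat j * t))) ^ (2 * r) \<le>
    (real (card A) * real (card T)) ^ (2 * r - 2) *
    real (card {(a, a', t, t'). a \<in> A \<and> a' \<in> A \<and> t \<in> T \<and> t' \<in> T \<and> (a + z) * t' = (a' + z) * t}) *
    (\<Sum>u\<in>UNIV. norm (\<Sum>j=1..J. \<chi> (u + of_nat j)) ^ (2 * r))"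
proof -
  define g where "g = (\<lambda>u. norm (\<Sum>j=1..J. \<chi> (u + of_nat j)))"
  define w where "w = (\<lambda>u. real (card {p\<in>A \<times> T. (fst p + z) / snd p = u}))"
  define Q where "Q = {(a, a', t, t'). a \<in> A \<and> a' \<in> A \<and> t \<in> T \<and> t' \<in> T \<and> (a + z) * t' = (a' + z) * t}"
  have wsum: "(\<Sum>u\<in>UNIV. w u * h u) = (\<Sum>p\<in>A \<times> T. h ((fst p + z) / snd p))" for h :: "'a \<Rightarrow> real"
    using sum_card_fibre[of "A \<times> T" "\<lambda>p. (fst p + z) / snd p" h] by (simp add: w_def)
  have "(\<Sum>a\<in>A. \<Sum>t\<in>T. norm (\<Sum>j=1..J. \<chi> (a + z + of_nat j * t))) = (\<Sum>p\<in>A \<times> T. g ((fst p + z) / snd p))"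
  proof -
    have "norm (\<Sum>j=1..J. \<chi> (a + z + of_nat j * t)) = g ((a + z) / t)" if "t \<in> T" for a t
    proof -
      have t0: "t \<noteq> 0" using that T by auto
      have "\<chi> (a + z + of_nat j * t) = \<chi> t * \<chi> ((a + z) / t + of_nat j)" for j
        using t0 by (simp add: mult[symmetric] distrib_left mult.commute)
      hence "(\<Sum>j=1..J. \<chi> (a + z + of_nat j * t)) = \<chi> t * (\<Sum>j=1..J. \<chi> ((a + z) / t + of_nat j))"
        by (simp add: sum_distrib_left)
      thus ?thesis by (simp add: g_def norm_mult norm_eq_1[OF t0])
    qed
    thus ?thesis by (simp add: sum.cartesian_product case_prod_beta)
  qed
  also have "\<dots> = (\<Sum>u\<in>UNIV. w u * g u)" by (rule wsum[symmetric])
  finally have eq: "(\<Sum>a\<in>A. \<Sum>t\<in>T. norm (\<Sum>j=1..J. \<chi> (a + z + of_nat j * t))) = (\<Sum>u\<in>UNIV. w u * g u)" .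
  have w0: "w u \<ge> 0" and g0: "g u \<ge> 0" for u by (auto simp: w_def g_def)
  have W1: "(\<Sum>u\<in>UNIV. w u) = real (card A) * real (card T)"
    using wsum[of "\<lambda>_. 1"] by (simp add: card_cartesian_product)
  have W2: "(\<Sum>u\<in>UNIV. (w u)\<^sup>2) = real (card Q)"
  proof -
    have "(\<Sum>u\<in>UNIV. (w u)\<^sup>2) = (\<Sum>p\<in>A \<times> T. w ((fst p + z) / snd p))"
      using wsum[of w] by (simp add: power2_eq_square)
    also have "\<dots> = real (card (SIGMA p:A \<times> T. {p'\<in>A \<times> T. (fst p' + z) / snd p' = (fst p + z) / snd p}))" by (simp add: w_def)
    also have "card (SIGMA p:A \<times> T. {p'\<in>A \<times> T. (fst p' + z) / snd p' = (fst p + z) / snd p}) = card Q"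
    proof (rule bij_betw_same_card[of "\<lambda>(p, p'). (fst p, fst p', snd p, snd p')"])
      have iff: "(a' + z) / t' = (a + z) / t \<longleftrightarrow> (a + z) * t' = (a' + z) * t" if "t \<in> T" "t' \<in> T" for a a' t t'
      proof -
        have "t \<noteq> 0" "t' \<noteq> 0" using that T by auto
        thus ?thesis using frac_eq_eq[of t' t "a' + z" "a + z"] by metis
      qed
      have *: "(SIGMA p:A \<times> T. {p'\<in>A \<times> T. (fst p' + z) / snd p' = (fst p + z) / snd p}) =
          {((a, t), (a', t')). (a, a', t, t') \<in> Q}"
      proof (rule Set.set_eqI)
        fix x :: "('a \<times> 'a) \<times> ('a \<times> 'a)"
        obtain a t a' t' where x: "x = ((a, t), (a', t'))" by (cases x) auto
        have "x \<in> (SIGMA p:A \<times> T. {p'\<in>A \<times> T. (fst p' + z) / snd p' = (fst p + z) / snd p}) \<longleftrightarrow>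
            (a \<in> A \<and> t \<in> T) \<and> (a' \<in> A \<and> t' \<in> T) \<and> (a' + z) / t' = (a + z) / t"
          by (simp only: x mem_Sigma_iff mem_Collect_eq fst_conv snd_conv)
        also have "\<dots> \<longleftrightarrow> (a \<in> A \<and> t \<in> T) \<and> (a' \<in> A \<and> t' \<in> T) \<and> (a + z) * t' = (a' + z) * t"
          using iff[of t t' a' a] by argo
        also have "\<dots> \<longleftrightarrow> x \<in> {((a, t), (a', t')). (a, a', t, t') \<in> Q}"
          by (simp only: x Q_def mem_Collect_eq case_prod_conv) argo
        finally show "x \<in> (SIGMA p:A \<times> T. {p'\<in>A \<times> T. (fst p' + z) / snd p' = (fst p + z) / snd p}) \<longleftrightarrow>
            x \<in> {((a, t), (a', t')). (a, a', t, t') \<in> Q}" .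
      qed
      show "bij_betw (\<lambda>(p, p'). (fst p, fst p', snd p, snd p')) (SIGMA p:A \<times> T. {p'\<in>A \<times> T. (fst p' + z) / snd p' = (fst p + z) / snd p}) Q"
        unfolding * by (rule bij_betw_byWitness[where f' = "\<lambda>(a, a', t, t'). ((a, t), (a', t'))"]) auto
    qed
    finally show ?thesis .
  qed
  have "(\<Sum>u\<in>UNIV. w u * g u) ^ r \<le> (\<Sum>u\<in>UNIV. w u) ^ (r - 1) * (\<Sum>u\<in>UNIV. w u * g u ^ r)"
    by (rule sum_power_le) (use w0 g0 r in auto)
  hence s1: "((\<Sum>u\<in>UNIV. w u * g u) ^ r)\<^sup>2 \<le> ((\<Sum>u\<in>UNIV. w u) ^ (r - 1) * (\<Sum>u\<in>UNIV. w u * g u ^ r))\<^sup>2"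
    using w0 g0 by (intro power_mono zero_le_power sum_nonneg) auto
  have s2: "((\<Sum>u\<in>UNIV. w u) ^ (r - 1) * (\<Sum>u\<in>UNIV. w u * g u ^ r))\<^sup>2 = (\<Sum>u\<in>UNIV. w u) ^ (2 * r - 2) * (\<Sum>u\<in>UNIV. w u * g u ^ r)\<^sup>2"
  proof -
    have "(r - 1) * 2 = 2 * r - 2" using r by simp
    thus ?thesis by (simp add: power_mult_distrib flip: power_mult)
  qed
  have s3: "(\<Sum>u\<in>UNIV. w u) ^ (2 * r - 2) * (\<Sum>u\<in>UNIV. w u * g u ^ r)\<^sup>2 \<le>
      (\<Sum>u\<in>UNIV. w u) ^ (2 * r - 2) * ((\<Sum>u\<in>UNIV. (w u)\<^sup>2) * (\<Sum>u\<in>UNIV. (g u ^ r)\<^sup>2))"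
    by (rule mult_left_mono[OF Cauchy_Schwarz_ineq_sum zero_le_power[OF sum_nonneg[OF w0]]])
  have pw: "(x ^ r)\<^sup>2 = x ^ (2 * r)" for x :: real by (simp add: mult.commute flip: power_mult)
  have "(\<Sum>u\<in>UNIV. w u * g u) ^ (2 * r) \<le>
      (real (card A) * real (card T)) ^ (2 * r - 2) * (real (card Q) * (\<Sum>u\<in>UNIV. g u ^ (2 * r)))"
    using order_trans[OF s1 ord_eq_le_trans[OF s2 s3]] unfolding pw W1 W2 .
  thus ?thesis unfolding eq unfolding Q_def g_def mult.assoc .
qed

end

section \<open>Ternary sums\<close>

lemma card_quads_le: "card (quads A t) \<le> card (A :: 'a::{ab_group_add,finite} set) ^ 3"
proof -
  have "card (quads A t) \<le> card (A \<times> A \<times> A)"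
  proof (rule card_inj_on_le)
    show "inj_on (\<lambda>(a1, a2, a3, a4). (a1, a2, a3)) (quads A t)"
      by (auto simp: inj_on_def quads_def algebra_simps)
    show "(\<lambda>(a1, a2, a3, a4). (a1, a2, a3)) ` quads A t \<subseteq> A \<times> A \<times> A" by (auto simp: quads_def)
  qed auto
  thus ?thesis by (simp add: card_cartesian_product power3_eq_cube)
qed

lemma freiman6_card_le:
  assumes fr: "freiman6 A \<phi> N" and N: "N > 0"
  shows "card A \<le> N"
proof -
  have "inj_on (\<lambda>a. nat (\<phi> a mod int N)) A"
  proof (rule inj_onI)
    fix a b assume ab: "a \<in> A" "b \<in> A" and "nat (\<phi> a mod int N) = nat (\<phi> b mod int N)"
    hence "\<phi> a mod int N = \<phi> b mod int N" using N eq_nat_nat_iff[of "\<phi> a mod int N" "\<phi> b mod int N"] by fastforce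
    hence "int N dvd \<phi> a - \<phi> b" by (simp add: mod_eq_dvd_iff)
    thus "a = b" using freiman6_4[OF fr, of a b b b b b b b] ab by simp
  qed
  moreover have "(\<lambda>a. nat (\<phi> a mod int N)) ` A \<subseteq> {..<N}" using N by (auto simp: nat_less_iff)
  ultimately show ?thesis using card_inj_on_le[of _ A "{..<N}"] by fastforce
qed

text \<open>Reverse Markov inequality for a function bounded from above only; it is applied to real
  parts, which may be negative.\<close>

lemma popular_subset:
  fixes g :: "'b \<Rightarrow> real"
  assumes fin: "finite S" and le: "\<And>x. x \<in> S \<Longrightarrow> g x \<le> M" and M: "M > 0" and c: "c \<ge> 0"
    and sum: "2 * c * M * real (card S) \<le> (\<Sum>x\<in>S. g x)"
  shows "c * real (card S) \<le> real (card {x\<in>S. g x \<ge> c * M})"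
proof -
  have "(\<Sum>x\<in>S. g x) \<le> (\<Sum>x\<in>S. M * (if g x \<ge> c * M then 1 else 0) + c * M)"
    using le M c by (intro sum_mono) (auto simp: add_increasing2)
  also have "\<dots> = M * real (card {x\<in>S. g x \<ge> c * M}) + real (card S) * (c * M)"
    unfolding sum.distrib card_eq_sum_indicator[OF fin] sum_distrib_left by simp
  finally have "M * (c * real (card S)) \<le> M * real (card {x\<in>S. g x \<ge> c * M})"
    using sum by (simp add: algebra_simps)
  thus ?thesis using M by simp
qed

text \<open>Cauchy-Schwarz over the pairs; for each a the sums a + b are distinct, so the full
  second moment of \<open>F\<close> is met at most once.\<close>

lemma norm_double_sum_le:
  fixes A B :: "'a::{ab_group_add,finite} set" and F :: "'a \<Rightarrow> complex"
  shows "(norm (\<Sum>a\<in>A. \<Sum>b\<in>B. F (a + b)))\<^sup>2 \<le> real (card A) ^ 2 * real (card B) * (\<Sum>x\<in>UNIV. (norm (F x))\<^sup>2)"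
proof -
  have cs: "(norm (\<Sum>p\<in>A \<times> B. F (fst p + snd p) * 1))\<^sup>2 \<le> (\<Sum>p\<in>A \<times> B. (norm (F (fst p + snd p)))\<^sup>2) * (\<Sum>p\<in>A \<times> B. (norm (1 :: complex))\<^sup>2)"
    by (rule cauchy_schwarz_complex) auto
  have "(\<Sum>p\<in>A \<times> B. (norm (F (fst p + snd p)))\<^sup>2) = (\<Sum>a\<in>A. \<Sum>b\<in>B. (norm (F (a + b)))\<^sup>2)"
    by (simp add: sum.cartesian_product case_prod_beta)
  also have "\<dots> \<le> (\<Sum>a\<in>A. \<Sum>x\<in>UNIV. (norm (F x))\<^sup>2)"
  proof (rule sum_mono)
    fix a
    have "(\<Sum>b\<in>B. (norm (F (a + b)))\<^sup>2) \<le> (\<Sum>b\<in>UNIV. (norm (F (b + a)))\<^sup>2)"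
      unfolding add.commute[of a] by (rule sum_mono2) auto
    also have "\<dots> = (\<Sum>x\<in>UNIV. (norm (F x))\<^sup>2)" by (rule sum_shift_UNIV)
    finally show "(\<Sum>b\<in>B. (norm (F (a + b)))\<^sup>2) \<le> (\<Sum>x\<in>UNIV. (norm (F x))\<^sup>2)" .
  qed
  finally have "(norm (\<Sum>p\<in>A \<times> B. F (fst p + snd p) * 1))\<^sup>2 \<le> (\<Sum>a\<in>A. \<Sum>x\<in>UNIV. (norm (F x))\<^sup>2) * (\<Sum>p\<in>A \<times> B. (norm (1 :: complex))\<^sup>2)"
    by (rule order_trans[OF cs mult_right_mono]) simp
  thus ?thesis
    by (simp add: sum.cartesian_product case_prod_beta card_cartesian_product power2_eq_square mult_ac)
qed

lemma sum_triple_reorder: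
  fixes h :: "'a::ab_semigroup_add \<Rightarrow> 'b::comm_monoid_add"
  shows "(\<Sum>a\<in>A. \<Sum>b\<in>B. \<Sum>c\<in>C. h (a + b + t + c)) = (\<Sum>p\<in>B \<times> C. \<Sum>a\<in>A. h (a + (fst p + snd p) + t))"
proof -
  have "(\<Sum>b\<in>B. \<Sum>c\<in>C. h (a + b + t + c)) = (\<Sum>p\<in>B \<times> C. h (a + (fst p + snd p) + t))" for a
    by (simp add: sum.cartesian_product case_prod_beta add_ac)
  thus ?thesis using sum.swap[of "\<lambda>a p. h (a + (fst p + snd p) + t)" "B \<times> C" A] by simp
qed

section \<open>Orthogonality and averaging over near-periods\<close>

context mult_char begin

text \<open>For nonzero y the summand is \<chi>(1 + e / y), and 1 + e / y runs through everything
  but 1; orthogonality leaves -\<chi>(1).\<close>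

lemma cross_correlation:
  assumes e: "e \<noteq> 0"
  shows "(\<Sum>y\<in>UNIV. \<chi> (y + e) * cnj (\<chi> y)) = -1"
proof -
  have inv: "cnj (\<chi> y) = \<chi> (inverse y)" if "y \<noteq> 0" for y
  proof -
    have "\<chi> y * cnj (\<chi> y) = 1" using norm_eq_1[OF that] complex_norm_square[of "\<chi> y"] by simp
    moreover have "\<chi> y * \<chi> (inverse y) = 1" using that one by (simp add: mult[symmetric])
    ultimately have "\<chi> y * cnj (\<chi> y) = \<chi> y * \<chi> (inverse y)" by simp
    moreover have "\<chi> y \<noteq> 0" using norm_eq_1[OF that] by auto
    ultimately show ?thesis by simp
  qed
  have "(\<Sum>y\<in>UNIV. \<chi> (y + e) * cnj (\<chi> y)) = (\<Sum>y\<in>UNIV - {0}. \<chi> (y + e) * cnj (\<chi> y))"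
    by (rule sum.mono_neutral_right) (auto simp: zero)
  also have "\<dots> = (\<Sum>y\<in>UNIV - {0}. \<chi> (1 + e / y))"
  proof (rule sum.cong[OF refl])
    fix y :: 'a assume "y \<in> UNIV - {0}"
    hence y: "y \<noteq> 0" by simp
    hence "(y + e) * inverse y = 1 + e / y" by (simp add: distrib_right divide_inverse)
    thus "\<chi> (y + e) * cnj (\<chi> y) = \<chi> (1 + e / y)" unfolding inv[OF y] mult[symmetric] by simp
  qed
  also have "\<dots> = (\<Sum>x\<in>UNIV - {1}. \<chi> x)"
    by (rule sum.reindex_bij_witness[of _ "\<lambda>x. e / (x - 1)" "\<lambda>y. 1 + e / y"]) (use e in auto)
  also have "\<dots> = -1"
    using sum.remove[of UNIV 1 \<chi>] sum_eq_0 one by (simp add: eq_neg_iff_add_eq_0 add.commute)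
  finally show ?thesis .
qed

text \<open>The off-diagonal correlations are -1, so discarding them only weakens the bound.\<close>

lemma second_moment: "(\<Sum>x\<in>UNIV. (norm (\<Sum>c\<in>C. \<chi> (x + c)))\<^sup>2) \<le> real CARD('a) * real (card C)"
proof -
  have "complex_of_real (\<Sum>x\<in>UNIV. (norm (\<Sum>c\<in>C. \<chi> (x + c)))\<^sup>2) = (\<Sum>x\<in>UNIV. \<Sum>c\<in>C. \<Sum>c'\<in>C. \<chi> (x + c) * cnj (\<chi> (x + c')))"
    by (simp only: of_real_sum complex_norm_square sum_product cnj_sum)
  also have "\<dots> = (\<Sum>c\<in>C. \<Sum>c'\<in>C. \<Sum>x\<in>UNIV. \<chi> (x + c) * cnj (\<chi> (x + c')))"
    by (subst sum.swap, rule sum.cong[OF refl], rule sum.swap)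
  finally have "(\<Sum>x\<in>UNIV. (norm (\<Sum>c\<in>C. \<chi> (x + c)))\<^sup>2) = (\<Sum>c\<in>C. \<Sum>c'\<in>C. Re (\<Sum>x\<in>UNIV. \<chi> (x + c) * cnj (\<chi> (x + c'))))"
    by (metis (no_types, lifting) Re_complex_of_real Re_sum sum.cong)
  also have "\<dots> \<le> (\<Sum>c\<in>C. \<Sum>c'\<in>C. if c' = c then real CARD('a) else 0)"
  proof (intro sum_mono)
    fix c c'
    show "Re (\<Sum>x\<in>UNIV. \<chi> (x + c) * cnj (\<chi> (x + c'))) \<le> (if c' = c then real CARD('a) else 0)"
    proof (cases "c' = c")
      case True
      have "norm (\<Sum>x\<in>UNIV. \<chi> (x + c) * cnj (\<chi> (x + c))) \<le> (\<Sum>x\<in>(UNIV :: 'a set). 1)"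
        by (rule sum_norm_le) (use norm_le_1 in \<open>auto simp: norm_mult intro!: mult_le_one\<close>)
      thus ?thesis using complex_Re_le_cmod[of "\<Sum>x\<in>UNIV. \<chi> (x + c) * cnj (\<chi> (x + c))"] True by simp
    next
      case False
      have "(\<Sum>x\<in>UNIV. \<chi> (x + c) * cnj (\<chi> (x + c'))) = -1"
        using cross_correlation[of "c - c'"] False sum_shift_UNIV[of "\<lambda>y. \<chi> (y + (c - c')) * cnj (\<chi> y)" c']
        by (simp add: add_diff_eq add.commute)
      thus ?thesis using False by simp
    qed
  qed
  also have "\<dots> = real CARD('a) * real (card C)" by (simp add: sum.delta)
  finally show ?thesis .
qed

text \<open>Together with |C| \<ge> \<delta> sqrt p this bounds |B| by a multiple of sqrt p, and |A|
  by symmetry.\<close>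

lemma sets_not_too_large:
  fixes A B C :: "'a set"
  assumes pos: "A \<noteq> {}" "B \<noteq> {}" "C \<noteq> {}" and \<epsilon>: "\<epsilon> > 0"
    and S: "\<epsilon> * real (card A) * real (card B) * real (card C) \<le> norm (\<Sum>a\<in>A. \<Sum>b\<in>B. \<Sum>c\<in>C. \<chi> (a + b + c))"
  shows "\<epsilon>\<^sup>2 * (real (card B) * real (card C)) \<le> real CARD('a)"
proof -
  have p: "real (card A) > 0" "real (card B) > 0" "real (card C) > 0" using pos by (auto simp: card_gt_0_iff)
  have "(\<epsilon> * real (card A) * real (card B) * real (card C))\<^sup>2 \<le> (norm (\<Sum>a\<in>A. \<Sum>b\<in>B. \<Sum>c\<in>C. \<chi> (a + b + c)))\<^sup>2"
    using S \<epsilon> by (intro power_mono) auto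
  also have "\<dots> \<le> real (card A) ^ 2 * real (card B) * (\<Sum>x\<in>UNIV. (norm (\<Sum>c\<in>C. \<chi> (x + c)))\<^sup>2)"
    by (rule norm_double_sum_le)
  also have "\<dots> \<le> real (card A) ^ 2 * real (card B) * (real CARD('a) * real (card C))"
    by (intro mult_left_mono second_moment) auto
  finally have "(real (card A) ^ 2 * real (card B) * real (card C)) * (\<epsilon>\<^sup>2 * (real (card B) * real (card C))) \<le>
      (real (card A) ^ 2 * real (card B) * real (card C)) * real CARD('a)"
    by (simp add: power2_eq_square mult_ac)
  moreover have "real (card A) ^ 2 * real (card B) * real (card C) > 0" by (intro mult_pos_pos zero_less_power p)
  ultimately show ?thesis by (simp only: mult_le_cancel_left_pos)
qed

text \<open>The convolution bound for the sums of \<chi> over translates of \<open>C\<close>: the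
  defect of the count is at most 2 \<eta> |A|^3 and the second moment at most p |C|. As p, that is
  w^8, is at most |B| |C| / \<delta>^2, the condition on 512 \<eta> K brings the squared error down
  to a quarter of (\<kappa> |A| |B| |C|)^2.\<close>

lemma near_period_shift:
  fixes A B C :: "'a set" and \<kappa> \<delta> \<eta> K w :: real
  assumes q: "real CARD('a) = w ^ 8" and \<eta>: "0 < \<eta>" "512 * \<eta> * K \<le> \<kappa> ^ 4 * \<delta> ^ 4" and \<kappa>: "\<kappa> > 0" and \<delta>: "\<delta> > 0" and w: "w > 0"
    and B: "\<delta> * w ^ 4 \<le> real (card B)" and C: "\<delta> * w ^ 4 \<le> real (card C)"
    and KD: "real (card (diffset A A)) \<le> K * real (card A)"
    and t: "(1 - 2 * \<eta>) * real (card (quads A 0)) \<le> real (card (quads A t))"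
  shows "norm ((\<Sum>a\<in>A. \<Sum>b\<in>B. \<Sum>c\<in>C. \<chi> (a + b + t + c)) - (\<Sum>a\<in>A. \<Sum>b\<in>B. \<Sum>c\<in>C. \<chi> (a + b + c))) \<le>
    \<kappa> / 2 * real (card A) * real (card B) * real (card C)"
proof (rule power2_le_imp_le)
  let ?Z = "(\<Sum>a\<in>A. \<Sum>b\<in>B. \<Sum>c\<in>C. \<chi> (a + b + t + c)) - (\<Sum>a\<in>A. \<Sum>b\<in>B. \<Sum>c\<in>C. \<chi> (a + b + c))"
  let ?n = "real (card A)" and ?b = "real (card B)" and ?c = "real (card C)"
  have "(norm ?Z)\<^sup>2 \<le> 4 * ?b * sqrt (real (card (diffset A A)) * (2 * \<eta> * real (card (quads A 0)))) * (\<Sum>x\<in>UNIV. (norm (\<Sum>c\<in>C. \<chi> (x + c)))\<^sup>2)"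
    by (rule near_period_convolution) (use t in \<open>simp add: algebra_simps\<close>)
  also have "\<dots> \<le> 4 * ?b * (?n\<^sup>2 * (\<kappa>\<^sup>2 * \<delta>\<^sup>2 / 16)) * (w ^ 8 * ?c)"
  proof (intro mult_mono)
    have "real (card (quads A 0)) \<le> ?n ^ 3"
      using of_nat_mono[OF card_quads_le[of A 0], where 'a = real] by simp
    hence "real (card (diffset A A)) * (2 * \<eta> * real (card (quads A 0))) \<le> (K * ?n) * (2 * \<eta> * ?n ^ 3)"
      using KD \<eta> by (intro mult_mono) (auto intro: order_trans[OF _ KD])
    also have "\<dots> = (512 * \<eta> * K) / 256 * ?n ^ 4" by (simp add: power_numeral_reduce)
    also have "\<dots> \<le> (\<kappa> ^ 4 * \<delta> ^ 4) / 256 * ?n ^ 4" using \<eta> by (intro mult_right_mono divide_right_mono) auto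
    also have "\<dots> = (?n\<^sup>2 * (\<kappa>\<^sup>2 * \<delta>\<^sup>2 / 16))\<^sup>2" by (simp add: power_mult_distrib power_divide flip: power_mult)
    finally show "sqrt (real (card (diffset A A)) * (2 * \<eta> * real (card (quads A 0)))) \<le> ?n\<^sup>2 * (\<kappa>\<^sup>2 * \<delta>\<^sup>2 / 16)"
      by (rule real_le_lsqrt[rotated]) simp
    show "(\<Sum>x\<in>UNIV. (norm (\<Sum>c\<in>C. \<chi> (x + c)))\<^sup>2) \<le> w ^ 8 * ?c" using second_moment[of C] q by simp
  qed (use \<eta>(1) in \<open>auto intro: sum_nonneg\<close>)
  also have "\<dots> = (\<kappa>\<^sup>2 / 4 * ?n\<^sup>2 * ?b * ?c) * ((\<delta> * w ^ 4) * (\<delta> * w ^ 4))" by (simp add: power2_eq_square power_numeral_reduce)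
  also have "\<dots> \<le> (\<kappa>\<^sup>2 / 4 * ?n\<^sup>2 * ?b * ?c) * (?b * ?c)"
    using B C \<delta> w by (intro mult_left_mono mult_mono) auto
  also have "\<dots> = (\<kappa> / 2 * ?n * ?b * ?c)\<^sup>2" by (simp add: power2_eq_square)
  finally show "(norm ?Z)\<^sup>2 \<le> (\<kappa> / 2 * ?n * ?b * ?c)\<^sup>2" .
qed (use \<kappa> in auto)

text \<open>Each shift changes the triple sum by at most half of its size, so the sum over j keeps
  half of J times that size. The absolute value goes around the sum over j alone, and some z = b + c
  is at least as good as the average.\<close>

lemma average_over_near_periods:
  fixes A B C T :: "'a set"
  assumes ne: "B \<noteq> {}" "C \<noteq> {}"
    and S: "\<kappa> * real (card A) * real (card B) * real (card C) \<le> norm (\<Sum>a\<in>A. \<Sum>b\<in>B. \<Sum>c\<in>C. \<chi> (a + b + c))"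
    and sh: "\<And>t j. t \<in> T \<Longrightarrow> 1 \<le> j \<Longrightarrow> j \<le> J \<Longrightarrow>
      norm ((\<Sum>a\<in>A. \<Sum>b\<in>B. \<Sum>c\<in>C. \<chi> (a + b + of_nat j * t + c)) - (\<Sum>a\<in>A. \<Sum>b\<in>B. \<Sum>c\<in>C. \<chi> (a + b + c))) \<le>
      \<kappa> / 2 * real (card A) * real (card B) * real (card C)"
  obtains z where "\<kappa> / 2 * real (card A) * real (card T) * real J \<le> (\<Sum>a\<in>A. \<Sum>t\<in>T. norm (\<Sum>j=1..J. \<chi> (a + z + of_nat j * t)))"
proof -
  let ?n = "real (card A)" and ?b = "real (card B)" and ?c = "real (card C)"
  define S where "S = (\<lambda>t. \<Sum>a\<in>A. \<Sum>b\<in>B. \<Sum>c\<in>C. \<chi> (a + b + t + c))"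
  define S0 where "S0 = (\<Sum>a\<in>A. \<Sum>b\<in>B. \<Sum>c\<in>C. \<chi> (a + b + c))"
  define g where "g = (\<lambda>p. \<Sum>a\<in>A. \<Sum>t\<in>T. norm (\<Sum>j=1..J. \<chi> (a + (fst p + snd p) + of_nat j * t)))"
  have lower: "real J * (\<kappa> / 2 * ?n * ?b * ?c) \<le> (\<Sum>p\<in>B \<times> C. \<Sum>a\<in>A. norm (\<Sum>j=1..J. \<chi> (a + (fst p + snd p) + of_nat j * t)))"
    if t: "t \<in> T" for t
  proof -
    have "norm (\<Sum>j=1..J. S (of_nat j * t) - S0) \<le> (\<Sum>j=1..J. \<kappa> / 2 * ?n * ?b * ?c)"
      by (rule sum_norm_le) (use sh[OF t] in \<open>auto simp: S_def S0_def\<close>)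
    hence 1: "norm (\<Sum>j=1..J. S (of_nat j * t) - S0) \<le> real J * (\<kappa> / 2 * ?n * ?b * ?c)" by simp
    have "(\<Sum>j=1..J. S (of_nat j * t) - S0) = (\<Sum>j=1..J. S (of_nat j * t)) - of_nat J * S0" by (simp add: sum_subtractf)
    hence 1: "norm ((\<Sum>j=1..J. S (of_nat j * t)) - of_nat J * S0) \<le> real J * (\<kappa> * ?n * ?b * ?c) / 2" using 1 by simp
    have "norm (of_nat J * S0) \<ge> real J * (\<kappa> * ?n * ?b * ?c)"
      using assms(3) by (simp add: norm_mult S0_def mult_left_mono)
    moreover have "norm (of_nat J * S0) \<le> norm (\<Sum>j=1..J. S (of_nat j * t)) + norm ((\<Sum>j=1..J. S (of_nat j * t)) - of_nat J * S0)"
      by (metis norm_triangle_sub norm_minus_commute)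
    ultimately have "real J * (\<kappa> * ?n * ?b * ?c) / 2 \<le> norm (\<Sum>j=1..J. S (of_nat j * t))"
      using 1 by linarith
    hence "real J * (\<kappa> / 2 * ?n * ?b * ?c) \<le> norm (\<Sum>j=1..J. S (of_nat j * t))" by simp
    also have "(\<Sum>j=1..J. S (of_nat j * t)) = (\<Sum>p\<in>B \<times> C. \<Sum>a\<in>A. \<Sum>j=1..J. \<chi> (a + (fst p + snd p) + of_nat j * t))"
      unfolding S_def sum_triple_reorder by (subst sum.swap, rule sum.cong[OF refl], rule sum.swap)
    also have "norm \<dots> \<le> (\<Sum>p\<in>B \<times> C. \<Sum>a\<in>A. norm (\<Sum>j=1..J. \<chi> (a + (fst p + snd p) + of_nat j * t)))"
      by (intro sum_norm_le order_refl)
    finally show ?thesis .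
  qed
  have "real (card T) * (real J * (\<kappa> / 2 * ?n * ?b * ?c)) \<le> (\<Sum>t\<in>T. \<Sum>p\<in>B \<times> C. \<Sum>a\<in>A. norm (\<Sum>j=1..J. \<chi> (a + (fst p + snd p) + of_nat j * t)))"
    using sum_mono[of T "\<lambda>_. real J * (\<kappa> / 2 * ?n * ?b * ?c)", OF lower] by simp
  also have "\<dots> = (\<Sum>p\<in>B \<times> C. g p)"
    unfolding g_def by (subst sum.swap, rule sum.cong[OF refl], rule sum.swap)
  finally have ge: "real (card T) * (real J * (\<kappa> / 2 * ?n * ?b * ?c)) \<le> (\<Sum>p\<in>B \<times> C. g p)" .
  have "\<exists>p\<in>B \<times> C. \<kappa> / 2 * ?n * real (card T) * real J \<le> g p"
  proof (rule ccontr)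
    assume "\<not> ?thesis"
    hence "(\<Sum>p\<in>B \<times> C. g p) < (\<Sum>p\<in>B \<times> C. \<kappa> / 2 * ?n * real (card T) * real J)"
      using ne by (intro sum_strict_mono) (auto simp: not_le)
    thus False using ge by (simp add: card_cartesian_product mult_ac)
  qed
  thus ?thesis using that unfolding g_def by blast
qed

end

text \<open>18 v^2 arises from 2 N^2 with N \<le> 3 v w^4. The number M of cells per frequency is 8
  J / \<eta> rounded up, at most 9 J / \<eta>, so M^D is at most (9 / \<eta>)^D w by the choice of
  J, and order w^4 drops to w^3. The factor 1 / 2 covers the removal of 0.\<close>

lemma large_near_period_set:
  fixes A :: "'a::finite_field set" and c \<eta> v w :: real
  assumes fr: "freiman6 A \<phi> N" and N: "N > 0" "real N \<le> 3 * v * w ^ 4" and A: "c * w ^ 4 \<le> real (card A)" and c: "c > 0"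
    and \<eta>: "0 < \<eta>" "\<eta> < 1/2" and D: "18 * v\<^sup>2 \<le> real D * (\<eta> * c\<^sup>2)" and w: "w > 1" "2 \<le> c * (\<eta> / 9) ^ D * w"
    and J: "J \<ge> (1::nat)" "real J ^ (4 * D) \<le> w ^ 4"
  obtains T where "0 \<notin> T" "c * (\<eta> / 9) ^ D / 2 * w ^ 3 \<le> real (card T)"
    "\<And>t j. t \<in> T \<Longrightarrow> 1 \<le> j \<Longrightarrow> j \<le> J \<Longrightarrow> real (card (quads A (of_nat j * t))) \<ge> (1 - 2 * \<eta>) * real (card (quads A 0))"
proof -
  define M where "M = nat \<lceil>8 * real J / \<eta>\<rceil>"
  have w4: "w ^ 4 > 0" using w by simp
  have n: "real (card A) > 0" using A c w4 by (meson less_le_trans mult_pos_pos)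
  hence ne: "A \<noteq> {}" by auto
  have "2 * real N ^ 2 \<le> 2 * (3 * v * w ^ 4)\<^sup>2" using N by (intro mult_left_mono power_mono) auto
  also have "\<dots> = 18 * v\<^sup>2 * (w ^ 4)\<^sup>2" by (simp add: power_mult_distrib)
  also have "\<dots> \<le> real D * (\<eta> * c\<^sup>2) * (w ^ 4)\<^sup>2" using D by (intro mult_right_mono) auto
  also have "\<dots> = real D * \<eta> * (c * w ^ 4)\<^sup>2" by (simp add: power_mult_distrib)
  also have "\<dots> \<le> real D * \<eta> * (real (card A))\<^sup>2" using A c w4 \<eta> by (intro mult_left_mono power_mono) auto
  finally have D': "2 * real N ^ 2 / (\<eta> * real (card A) ^ 2) \<le> real D"
    by (subst pos_divide_le_eq) (use n ne \<eta> in \<open>simp_all add: mult_ac\<close>)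
  have M: "8 * real J / \<eta> \<le> real M" unfolding M_def by linarith
  obtain T where T: "N \<le> card T * M ^ D" "\<And>t j. t \<in> T \<Longrightarrow> 1 \<le> j \<Longrightarrow> j \<le> J \<Longrightarrow> real (card (quads A (of_nat j * t))) \<ge> (1 - 2 * \<eta>) * real (card (quads A 0))"
    using near_periods[OF fr N(1) ne \<eta> J(1) D' M] by blast
  have "1 \<le> real J / \<eta>" using J \<eta> by (simp add: le_divide_eq)
  moreover have "real M \<le> 8 * real J / \<eta> + 1"
  proof -
    have "0 \<le> 8 * real J / \<eta>" using \<eta> by simp
    thus ?thesis unfolding M_def by linarith
  qed
  moreover have "real J * (9 / \<eta>) = 8 * real J / \<eta> + real J / \<eta>" by (simp add: field_simps)
  ultimately have M2: "real M \<le> real J * (9 / \<eta>)" by linarith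
  have "(real J ^ D) ^ 4 \<le> w ^ 4" using J(2) unfolding power_mult[symmetric] mult.commute[of D 4] .
  hence JD: "real J ^ D \<le> w" using w power_mono_iff[of "real J ^ D" w 4] by simp
  have "c * w ^ 4 \<le> real N" using A freiman6_card_le[OF fr N(1)] by linarith
  also have "\<dots> \<le> real (card T) * real M ^ D" using of_nat_mono[OF T(1), where 'a = real] by simp
  also have "\<dots> \<le> real (card T) * (real J * (9 / \<eta>)) ^ D" using M2 by (intro mult_left_mono power_mono) auto
  also have "\<dots> = real (card T) * real J ^ D * (9 / \<eta>) ^ D" by (simp only: power_mult_distrib mult.assoc)
  also have "\<dots> \<le> real (card T) * w * (9 / \<eta>) ^ D" using JD \<eta> by (intro mult_right_mono mult_left_mono) auto
  finally have "c * w ^ 4 \<le> (real (card T) * (9 / \<eta>) ^ D) * w" by (simp add: mult_ac)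
  hence "c * w ^ 3 * w \<le> (real (card T) * (9 / \<eta>) ^ D) * w" by (simp add: power_numeral_reduce mult_ac)
  hence "c * w ^ 3 \<le> real (card T) * (9 / \<eta>) ^ D" using w by simp
  hence "c * w ^ 3 * (\<eta> / 9) ^ D \<le> real (card T) * (9 / \<eta>) ^ D * (\<eta> / 9) ^ D" using \<eta> by (intro mult_right_mono) auto
  also have "\<dots> = real (card T)" using \<eta> by (simp add: mult.assoc flip: power_mult_distrib)
  finally have T3: "c * (\<eta> / 9) ^ D * w ^ 3 \<le> real (card T)" by (simp add: mult_ac)
  have "c * (\<eta> / 9) ^ D * w \<le> c * (\<eta> / 9) ^ D * w ^ 3"
    using w c \<eta> by (intro mult_left_mono self_le_power) auto
  hence two: "2 \<le> c * (\<eta> / 9) ^ D * w ^ 3" using w(2) by linarith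
  have "card T \<le> card (T - {0}) + 1" using card_Suc_Diff1[of T 0] by (cases "0 \<in> T") auto
  hence "real (card T) \<le> real (card (T - {0})) + 1" by linarith
  hence "c * (\<eta> / 9) ^ D / 2 * w ^ 3 \<le> real (card (T - {0}))" using T3 two
    by (simp only: times_divide_eq_left)
  thus ?thesis using T(2) by (intro that[of "T - {0}"]) auto
qed

section \<open>Choice of the parameters\<close>

lemma root_floor_bounds:
  fixes x :: real
  assumes "x \<ge> 1" "r \<ge> (1::nat)"
  obtains J :: nat where "J \<ge> 1" "real J ^ r \<le> x" "x \<le> 2 ^ r * real J ^ r"
proof -
  define J where "J = nat \<lfloor>root r x\<rfloor>"
  have r1: "root r x \<ge> 1" using assms by simp
  have J: "real J \<le> root r x" "root r x \<le> real J + 1" "J \<ge> 1" using r1 unfolding J_def by linarith+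
  have rx: "root r x ^ r = x" using assms by (simp add: real_root_pow_pos2)
  have "real J ^ r \<le> root r x ^ r" using J by (intro power_mono) auto
  moreover have "root r x ^ r \<le> (2 * real J) ^ r" using J r1 by (intro power_mono) auto
  ultimately show ?thesis using J rx by (intro that[of J]) (auto simp: power_mult_distrib)
qed

text \<open>With w the eighth root of the prime, the sets have size of order w^4, the range of the dilation
  factors j satisfies J^D \<le> w, and the set of near-periods has size of order at least w^3.\<close>

definition burgess_params :: "real \<Rightarrow> real \<Rightarrow> real \<Rightarrow> real \<Rightarrow> real \<Rightarrow> real \<Rightarrow> real \<Rightarrow> bool" where
  "burgess_params \<kappa> \<delta> c u v K q \<longleftrightarrow> (\<exists>\<eta> L w D r.
     0 < \<eta> \<and> \<eta> < 1/2 \<and> 512 * \<eta> * K \<le> \<kappa> ^ 4 * \<delta> ^ 4 \<and>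
     18 * v\<^sup>2 \<le> real D * (\<eta> * c\<^sup>2) \<and> r = 4 * D \<and> D \<ge> 1 \<and>
     L \<ge> 1 \<and> 2 * (real r ^ (2 * r) * 2 ^ r + 2 * real r) < L * ((\<kappa> / 2) ^ (2 * r) * c) \<and>
     q = w ^ 8 \<and> w > 1 \<and> 1 \<le> v * w \<and> 2 * (K ^ 26 * L ^ 9) \<le> c * w \<and> 2 * (K ^ 26 * L ^ 9) * u < w \<and>
     2 * (K ^ 26 * L ^ 9) * u < (c * (\<eta> / 9) ^ D / (2 * L))\<^sup>2 * w \<and> 2 \<le> c * (\<eta> / 9) ^ D * w)"

text \<open>The choices are not circular: \<eta> depends on \<kappa>, \<delta> and K, then D on
  \<eta>, r on D and L on r. Only w depends on q, and the remaining conditions are lower bounds for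
  w.\<close>

lemma burgess_params_eventually:
  fixes \<kappa> \<delta> c u v K :: real
  assumes pos: "\<kappa> > 0" "\<delta> > 0" "c > 0" "u > 0" "v > 0" "K > 0"
  shows "\<exists>Q. \<forall>q\<ge>Q. burgess_params \<kappa> \<delta> c u v K q"
proof -
  define \<eta> where "\<eta> = min (1/4) (\<kappa> ^ 4 * \<delta> ^ 4 / (512 * K))"
  have \<eta>: "0 < \<eta>" "\<eta> < 1/2" using pos by (auto simp: \<eta>_def)
  have "\<eta> * (512 * K) \<le> \<kappa> ^ 4 * \<delta> ^ 4"
    using pos by (subst pos_le_divide_eq[symmetric]) (auto simp: \<eta>_def)
  hence \<eta>K: "512 * \<eta> * K \<le> \<kappa> ^ 4 * \<delta> ^ 4" by (simp add: mult_ac)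
  obtain D0 :: nat where D0: "18 * v\<^sup>2 / (\<eta> * c\<^sup>2) \<le> real D0" using real_arch_simple by blast
  define D where "D = D0 + 1"
  have pc: "\<eta> * c\<^sup>2 > 0" using \<eta> pos by simp
  have "18 * v\<^sup>2 / (\<eta> * c\<^sup>2) \<le> real D" using D0 by (simp add: D_def)
  hence D: "18 * v\<^sup>2 \<le> real D * (\<eta> * c\<^sup>2)" "D \<ge> 1" unfolding pos_divide_le_eq[OF pc] by (simp_all add: D_def)
  define r where "r = 4 * D"
  define R where "R = 2 * (real r ^ (2 * r) * 2 ^ r + 2 * real r)"
  define y where "y = (\<kappa> / 2) ^ (2 * r) * c"
  have y: "y > 0" using pos by (simp add: y_def)
  have R: "R \<ge> 0" by (simp add: R_def)
  define L where "L = 1 + R / y"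
  have L: "L \<ge> 1" "R < L * y" using y R by (simp_all add: L_def distrib_right)
  define Y where "Y = 2 * (K ^ 26 * L ^ 9)"
  define z where "z = (c * (\<eta> / 9) ^ D / (2 * L))\<^sup>2"
  define e where "e = c * (\<eta> / 9) ^ D"
  have e: "e > 0" using pos \<eta> by (simp add: e_def)
  have z: "z > 0" using pos \<eta> L by (simp add: z_def)
  have Y: "Y \<ge> 0" using pos L by (simp add: Y_def)
  \<comment> \<open>The sum of all lower bounds; the summand 2 yields w > 1 and the strict
    inequalities.\<close>
  define W where "W = 2 + 1 / v + Y / c + Y * u + Y * u / z + 2 / e"
  have terms: "1 / v \<ge> 0" "Y / c \<ge> 0" "Y * u \<ge> 0" "Y * u / z \<ge> 0" "2 / e \<ge> 0"
    using pos Y z e by auto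
  have W: "W \<ge> 2" using terms by (simp add: W_def)
  have "burgess_params \<kappa> \<delta> c u v K q" if q: "q \<ge> W ^ 8" for q
  proof -
    define w where "w = root 8 q"
    have "W ^ 8 \<ge> 0" using W by simp
    hence q0: "q \<ge> 0" using q by linarith
    have wq: "q = w ^ 8" using q0 by (simp add: w_def)
    have "root 8 (W ^ 8) \<le> w" unfolding w_def using q by simp
    hence w: "W \<le> w" using W by (simp add: real_root_power_cancel)
    have w1: "w > 1" using w W by linarith
    have w2: "1 \<le> v * w"
    proof -
      have "1 / v \<le> w" using w terms unfolding W_def by linarith
      thus ?thesis using pos by (simp add: pos_divide_le_eq mult.commute)
    qed
    have w3: "Y \<le> c * w"
    proof -
      have "Y / c \<le> w" using w terms unfolding W_def by linarith
      thus ?thesis using pos by (simp add: pos_divide_le_eq mult.commute)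
    qed
    have w4: "Y * u < w" using w terms unfolding W_def by linarith
    have w5: "Y * u < z * w"
    proof -
      have "Y * u / z < w" using w terms unfolding W_def by linarith
      thus ?thesis using z by (simp add: pos_divide_less_eq mult.commute)
    qed
    have w6: "2 \<le> e * w"
    proof -
      have "2 / e \<le> w" using w terms unfolding W_def by linarith
      thus ?thesis using e by (simp add: pos_divide_le_eq mult.commute)
    qed
    show ?thesis
      unfolding burgess_params_def
      by (rule exI[of _ \<eta>], rule exI[of _ L], rule exI[of _ w], rule exI[of _ D], rule exI[of _ r])
        (intro conjI \<eta> \<eta>K D r_def L(1) L(2)[unfolded R_def y_def] wq w1 w2 w3[unfolded Y_def] w4[unfolded Y_def]
          w5[unfolded Y_def z_def] w6[unfolded e_def])
  qed
  thus ?thesis by blast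
qed

text \<open>In its application \<open>w\<close> is the square root of the prime. Cancelling the
  powers of n m and J leaves k^(2 r) n L \<le> 2 w R, which a large \<open>L\<close> excludes since
  n is at least c w.\<close>

lemma energy_moment_contradiction:
  fixes n m L w R k c J :: real
  assumes pos: "n > 0" "m > 0" "L > 0" "w > 0" "J > 0" "k > 0"
    and r: "r \<ge> (1::nat)"
    and ub: "(k * n * m * J) ^ (2 * r) \<le> (n * m) ^ (2 * r - 2) * (2 * n * m\<^sup>2 / L) * (J ^ (2 * r) * (w * R))"
    and n: "c * w \<le> n" and R: "2 * R < L * (k ^ (2 * r) * c)"
  shows False
proof -
  obtain s where s: "2 * r = s + 2" using r by (metis add.commute le_add_diff_inverse mult_2 one_le_numeral mult_le_mono numeral_One nat_mult_1_right order_refl)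
  have e: "2 * r - 2 = s" using s by simp
  have "((n * m) ^ s * (n * m\<^sup>2) * J ^ (2 * r) / L) * (k ^ (2 * r) * n * L) = (k * n * m * J) ^ (2 * r)"
    using pos by (simp add: s power_mult_distrib power_add power2_eq_square)
  also have "\<dots> \<le> ((n * m) ^ s * (n * m\<^sup>2) * J ^ (2 * r) / L) * (2 * w * R)"
    using ub unfolding e by (simp add: mult_ac)
  finally have "k ^ (2 * r) * n * L \<le> 2 * w * R"
    by (rule mult_left_le_imp_le) (use pos in simp)
  moreover have "k ^ (2 * r) * (c * w) * L \<le> k ^ (2 * r) * n * L"
    using n pos by (intro mult_right_mono mult_left_mono) auto
  ultimately have "w * (L * (k ^ (2 * r) * c)) \<le> w * (2 * R)" by (simp add: mult_ac)
  hence "L * (k ^ (2 * r) * c) \<le> 2 * R" using pos(4) by (rule mult_left_le_imp_le)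
  thus False using R by linarith
qed

context mult_char begin

text \<open>In powers of w = p^(1/8), |A| has order w^4 and |T| at least order w^3, so that |T|^2
  exceeds every fixed multiple of |A|, as \<open>energy_bound\<close> demands.\<close>

lemma structured_sum_small:
  fixes A B C :: "'a set" and \<kappa> \<delta> c u v K :: real
  assumes params: "burgess_params \<kappa> \<delta> c u v K (real CARD('a))"
    and pos: "\<kappa> > 0" "\<delta> > 0" "c > 0" "u > 0" "v > 0" "K > 0"
    and A: "c * sqrt (real CARD('a)) \<le> real (card A)" "real (card A) \<le> u * sqrt (real CARD('a))"
    and B: "\<delta> * sqrt (real CARD('a)) \<le> real (card B)" and C: "\<delta> * sqrt (real CARD('a)) \<le> real (card C)"
    and fr: "freiman6 A \<phi> N" "N > 0" "real N \<le> 2 * v * sqrt (real CARD('a)) + 1"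
    and KD: "real (card (diffset A A)) \<le> K * real (card A)" and KS: "real (card (A + A)) \<le> K * real (card A)"
  shows "norm (\<Sum>a\<in>A. \<Sum>b\<in>B. \<Sum>c\<in>C. \<chi> (a + b + c)) < \<kappa> * real (card A) * real (card B) * real (card C)"
proof (rule ccontr)
  assume "\<not> ?thesis"
  hence S: "\<kappa> * real (card A) * real (card B) * real (card C) \<le> norm (\<Sum>a\<in>A. \<Sum>b\<in>B. \<Sum>c\<in>C. \<chi> (a + b + c))" by simp
  obtain \<eta> L w D r where
    \<eta>: "0 < \<eta>" "\<eta> < 1/2" "512 * \<eta> * K \<le> \<kappa> ^ 4 * \<delta> ^ 4" and
    D: "18 * v\<^sup>2 \<le> real D * (\<eta> * c\<^sup>2)" "r = 4 * D" "D \<ge> 1" and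
    L: "L \<ge> 1" "2 * (real r ^ (2 * r) * 2 ^ r + 2 * real r) < L * ((\<kappa> / 2) ^ (2 * r) * c)" and
    q: "real CARD('a) = w ^ 8" and w: "w > 1" "1 \<le> v * w" "2 * (K ^ 26 * L ^ 9) \<le> c * w" "2 * (K ^ 26 * L ^ 9) * u < w"
     "2 * (K ^ 26 * L ^ 9) * u < (c * (\<eta> / 9) ^ D / (2 * L))\<^sup>2 * w" "2 \<le> c * (\<eta> / 9) ^ D * w"
    using params unfolding burgess_params_def by blast
  define Y where "Y = 2 * (K ^ 26 * L ^ 9)"
  have Y0: "Y \<ge> 0" using pos L by (simp add: Y_def)
  have sq: "sqrt (real CARD('a)) = w ^ 4"
  proof (rule real_sqrt_unique)
    show "(w ^ 4)\<^sup>2 = real CARD('a)" by (simp add: q flip: power_mult)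
  qed (use w in auto)
  have w4: "w ^ 4 > 0" "w \<le> w ^ 4" "w ^ 4 < w ^ 8"
    using w by (auto intro: self_le_power power_strict_increasing)
  have n0: "real (card A) > 0" using A(1) mult_pos_pos[OF pos(3) w4(1)] unfolding sq by linarith
  have b0: "real (card B) > 0" using B mult_pos_pos[OF pos(2) w4(1)] unfolding sq by linarith
  have c0: "real (card C) > 0" using C mult_pos_pos[OF pos(2) w4(1)] unfolding sq by linarith
  have ne: "A \<noteq> {}" "B \<noteq> {}" "C \<noteq> {}" using n0 b0 c0 by auto
  have r1: "r \<ge> 1" using D by simp
  \<comment> \<open>With J^r of order sqrt p = w^4 the two parts of the moment, J^r p and J^(2 r)
    sqrt p, are of the same order.\<close>
  obtain J :: nat where J: "J \<ge> 1" "real J ^ r \<le> w ^ 4" "w ^ 4 \<le> 2 ^ r * real J ^ r"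
    using root_floor_bounds[of "w ^ 4" r] w r1 by (auto simp: one_le_power)
  have "v * w \<le> v * w ^ 4" using w4 pos by simp
  hence N3: "real N \<le> 3 * v * w ^ 4" using fr(3) w(2) unfolding sq by linarith
  obtain T where T: "0 \<notin> T" "c * (\<eta> / 9) ^ D / 2 * w ^ 3 \<le> real (card T)"
    "\<And>t j. t \<in> T \<Longrightarrow> 1 \<le> j \<Longrightarrow> j \<le> J \<Longrightarrow> real (card (quads A (of_nat j * t))) \<ge> (1 - 2 * \<eta>) * real (card (quads A 0))"
    using large_near_period_set[OF fr(1,2) N3 A(1)[unfolded sq] pos(3) \<eta>(1,2) D(1) w(1) w(6) J(1)] J(2) D(2) by blast
  have m0: "real (card T) > 0"
  proof -
    have "c * (\<eta> / 9) ^ D / 2 * w ^ 3 > 0" using pos \<eta> w by simp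
    thus ?thesis using T(2) by linarith
  qed
  obtain z where z: "\<kappa> / 2 * real (card A) * real (card T) * real J \<le> (\<Sum>a\<in>A. \<Sum>t\<in>T. norm (\<Sum>j=1..J. \<chi> (a + z + of_nat j * t)))"
  proof (rule average_over_near_periods[OF ne(2,3) S])
    fix t j assume "t \<in> T" "1 \<le> j" "j \<le> J"
    thus "norm ((\<Sum>a\<in>A. \<Sum>b\<in>B. \<Sum>c\<in>C. \<chi> (a + b + of_nat j * t + c)) - (\<Sum>a\<in>A. \<Sum>b\<in>B. \<Sum>c\<in>C. \<chi> (a + b + c))) \<le>
      \<kappa> / 2 * real (card A) * real (card B) * real (card C)"
      using near_period_shift[OF q \<eta>(1,3) pos(1,2) _ B[unfolded sq] C[unfolded sq] KD T(3)] w by simp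
  qed blast
  have "real J ^ 1 \<le> real J ^ r" using J r1 by (intro power_increasing) auto
  hence "real J < real CARD('a)" using J(2) w4 unfolding q power_one_right by linarith
  hence Jq: "J < CARD('a)" by simp
  have energy: "real (card {(a, a', t, t'). a \<in> A \<and> a' \<in> A \<and> t \<in> T \<and> t' \<in> T \<and> (a + z) * t' = (a' + z) * t})
    \<le> 2 * real (card A) * (real (card T))\<^sup>2 / L"
  proof (rule energy_bound[OF ne(1) KD KS prime_card T(1) L(1)])
    have "c * w \<le> c * w ^ 4" using w4 pos by simp
    thus "2 * (K ^ 26 * L ^ 9) \<le> real (card A)" using w(3) A(1) unfolding sq by linarith
    have le: "Y * real (card A) \<le> Y * u * w ^ 4" using A(2) Y0 unfolding sq mult.assoc by (rule mult_left_mono)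
    have "Y * u * w ^ 4 < w * w ^ 4" using w(4) w4 unfolding Y_def by (intro mult_strict_right_mono) auto
    also have "\<dots> = w ^ 5" by (simp add: power_numeral_reduce)
    also have "\<dots> \<le> w ^ 8" using w by (intro power_increasing) auto
    finally have 1: "Y * real (card A) < real CARD('a)" using le unfolding q by linarith
    \<comment> \<open>Of the gap between w^4 and w^6 a single factor w is enough to absorb the
      constants.\<close>
    have "Y * u * w ^ 4 < (c * (\<eta> / 9) ^ D / (2 * L))\<^sup>2 * w * w ^ 4"
      using w(5) w4 unfolding Y_def by (intro mult_strict_right_mono) auto
    also have "\<dots> = (c * (\<eta> / 9) ^ D / (2 * L))\<^sup>2 * w ^ 5" by (simp add: power_numeral_reduce)
    also have "\<dots> \<le> (c * (\<eta> / 9) ^ D / (2 * L))\<^sup>2 * w ^ 6" using w by (intro mult_left_mono power_increasing) auto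
    also have "\<dots> = (c * (\<eta> / 9) ^ D / 2 * w ^ 3 / L)\<^sup>2" by (simp add: power_mult_distrib power_divide flip: power_mult)
    also have "\<dots> \<le> (real (card T) / L)\<^sup>2"
      using T(2) L pos \<eta> w by (intro power_mono divide_right_mono) auto
    finally have 2: "Y * real (card A) < (real (card T) / L)\<^sup>2" using le by linarith
    show "2 * (K ^ 26 * L ^ 9) * real (card A) < min (real CARD('a)) ((real (card T) / L)\<^sup>2)"
      using 1 2 unfolding Y_def by simp
  qed
  define R where "R = real r ^ (2 * r) * 2 ^ r + 2 * real r"
  have moment: "(\<Sum>u\<in>UNIV. norm (\<Sum>j=1..J. \<chi> (u + of_nat j)) ^ (2 * r)) \<le> real J ^ (2 * r) * (w ^ 4 * R)"
  proof -
    have "real r ^ (2 * r) * real J ^ r * w ^ 8 = real r ^ (2 * r) * real J ^ r * w ^ 4 * w ^ 4" by (simp add: mult.assoc flip: power_add)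
    also have "\<dots> \<le> real r ^ (2 * r) * real J ^ r * w ^ 4 * (2 ^ r * real J ^ r)"
      using J(3) w4 by (intro mult_left_mono) auto
    also have "\<dots> = real J ^ (2 * r) * (w ^ 4 * (real r ^ (2 * r) * 2 ^ r))" by (simp add: mult_2 power_add)
    finally show ?thesis using moment_bound[OF r1 Jq] unfolding sq unfolding q R_def by (simp add: algebra_simps)
  qed
  have "(\<kappa> / 2 * real (card A) * real (card T) * real J) ^ (2 * r) \<le> (\<Sum>a\<in>A. \<Sum>t\<in>T. norm (\<Sum>j=1..J. \<chi> (a + z + of_nat j * t))) ^ (2 * r)"
    using z pos by (intro power_mono) auto
  also have "\<dots> \<le> (real (card A) * real (card T)) ^ (2 * r - 2) *
    real (card {(a, a', t, t'). a \<in> A \<and> a' \<in> A \<and> t \<in> T \<and> t' \<in> T \<and> (a + z) * t' = (a' + z) * t}) *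
    (\<Sum>u\<in>UNIV. norm (\<Sum>j=1..J. \<chi> (u + of_nat j)) ^ (2 * r))"
    by (rule burgess_amplification[OF T(1) r1])
  also have "\<dots> \<le> (real (card A) * real (card T)) ^ (2 * r - 2) * (2 * real (card A) * (real (card T))\<^sup>2 / L) * (real J ^ (2 * r) * (w ^ 4 * R))"
    by (intro mult_mono mult_nonneg_nonneg order_refl energy moment) (use L in \<open>auto intro!: sum_nonneg divide_nonneg_nonneg\<close>)
  finally show False
    by (rule energy_moment_contradiction[rotated 7, OF _ A(1)[unfolded sq] L(2)[folded R_def]]) (use n0 m0 L w4 J pos r1 in auto)
qed

end

text \<open>In units of sqrt p, \<open>u\<close> bounds the sets from above and \<open>c\<close> the
  structured subset from below; 288 is 24 times 2 times 6, the losses of Balog-Szemeredi-Gowers, of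
  restricting to popular elements and of the Freiman model. \<open>k\<close> bounds the sumset that
  results, \<open>K\<close> compares it with its second summand, \<open>K ^ 12 * u\<close> bounds 6A
  - 6A, and the last argument is the doubling constant.\<close>

definition large_prime :: "real \<Rightarrow> real \<Rightarrow> nat \<Rightarrow> bool" where
  "large_prime \<delta> \<epsilon> p \<longleftrightarrow>
    (let u = 1 / (\<delta> * \<epsilon>\<^sup>2); c = \<epsilon>\<^sup>2 * \<delta> / 288;
         k = (16 / (\<epsilon>\<^sup>2 * \<delta>)) ^ 3 / ((\<epsilon> / 4) ^ 5 / 3072 * (\<epsilon> / 2 * \<delta>\<^sup>2)); K = k / (\<epsilon> / 16 * \<delta>)
     in burgess_params (\<epsilon> / 2) \<delta> c u (K ^ 12 * u) (K\<^sup>2 * u / c) (real p))"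

lemma large_prime_eventually:
  assumes "\<delta> > 0" "\<epsilon> > 0"
  shows "\<exists>p0. \<forall>p\<ge>p0. large_prime \<delta> \<epsilon> p"
proof -
  define u where "u = 1 / (\<delta> * \<epsilon>\<^sup>2)"
  define c where "c = \<epsilon>\<^sup>2 * \<delta> / 288"
  define k where "k = (16 / (\<epsilon>\<^sup>2 * \<delta>)) ^ 3 / ((\<epsilon> / 4) ^ 5 / 3072 * (\<epsilon> / 2 * \<delta>\<^sup>2))"
  define K where "K = k / (\<epsilon> / 16 * \<delta>)"
  have pos: "u > 0" "c > 0" "k > 0" using assms by (simp_all add: u_def c_def k_def)
  hence "K > 0" using assms by (simp add: K_def)
  obtain Q where Q: "\<And>q. q \<ge> Q \<Longrightarrow> burgess_params (\<epsilon> / 2) \<delta> c u (K ^ 12 * u) (K\<^sup>2 * u / c) q"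
    using burgess_params_eventually[of "\<epsilon> / 2" \<delta> c u "K ^ 12 * u" "K\<^sup>2 * u / c"] assms pos \<open>K > 0\<close> by auto
  obtain p0 :: nat where p0: "Q \<le> real p0" using real_arch_simple by blast
  have "large_prime \<delta> \<epsilon> p" if "p \<ge> p0" for p
    unfolding large_prime_def Let_def using Q[of "real p"] p0 that by (simp add: u_def c_def k_def K_def)
  thus ?thesis by blast
qed

lemma nsum_1 [simp]: "nsum 1 A = A" and nsum_2: "nsum 2 A = A + A"
  by (auto simp: numeral_2_eq_2 set_plus_def)

lemma diffset_zero [simp]: "diffset A {0} = A"
  by (force simp: diffset_def)

lemma diffset_mono: "A \<subseteq> C \<Longrightarrow> B \<subseteq> D \<Longrightarrow> diffset A B \<subseteq> diffset C D"
  unfolding diffset_def by (intro image_mono Sigma_mono)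

section \<open>From a large sum to a structured set\<close>

context mult_char begin

theorem triple_sum_bound:
  fixes A B C :: "'a set" and \<delta> \<epsilon> :: real
  assumes \<delta>: "\<delta> > 0" and \<epsilon>: "0 < \<epsilon>" "\<epsilon> \<le> 1" and large: "large_prime \<delta> \<epsilon> CARD('a)"
    and A: "\<delta> * sqrt (real CARD('a)) \<le> real (card A)" and B: "\<delta> * sqrt (real CARD('a)) \<le> real (card B)"
    and C: "\<delta> * sqrt (real CARD('a)) \<le> real (card C)"
  shows "norm (\<Sum>a\<in>A. \<Sum>b\<in>B. \<Sum>c\<in>C. \<chi> (a + b + c)) \<le> \<epsilon> * real (card A) * real (card B) * real (card C)"
proof (rule ccontr)
  assume neg: "\<not> ?thesis"
  define S where "S = (\<Sum>a\<in>A. \<Sum>b\<in>B. \<Sum>c\<in>C. \<chi> (a + b + c))"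
  define s where "s = sqrt (real CARD('a))"
  define u where "u = 1 / (\<delta> * \<epsilon>\<^sup>2)"
  define c where "c = \<epsilon>\<^sup>2 * \<delta> / 288"
  define k where "k = (16 / (\<epsilon>\<^sup>2 * \<delta>)) ^ 3 / ((\<epsilon> / 4) ^ 5 / 3072 * (\<epsilon> / 2 * \<delta>\<^sup>2))"
  define K where "K = k / (\<epsilon> / 16 * \<delta>)"
  have params: "burgess_params (\<epsilon> / 2) \<delta> c u (K ^ 12 * u) (K\<^sup>2 * u / c) (real CARD('a))"
    using large unfolding large_prime_def Let_def u_def c_def k_def K_def .
  have pos: "u > 0" "c > 0" "k > 0" using \<delta> \<epsilon> by (simp_all add: u_def c_def k_def)
  have K: "K > 0" using \<delta> \<epsilon> pos by (simp add: K_def)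
  have s: "s > 0" and ss: "s * s = real CARD('a)" using card_ge_3 by (simp_all add: s_def)
  have ds: "\<delta> * s > 0" using \<delta> s by simp
  let ?a = "real (card A)" and ?b = "real (card B)" and ?c = "real (card C)"
  have A: "\<delta> * s \<le> ?a" and B: "\<delta> * s \<le> ?b" and C: "\<delta> * s \<le> ?c" using A B C by (simp_all add: s_def)
  have p: "?a > 0" "?b > 0" "?c > 0" using A B C ds by linarith+
  hence ne: "A \<noteq> {}" "B \<noteq> {}" "C \<noteq> {}" by auto
  have nS: "\<epsilon> * ?a * ?b * ?c < norm S" using neg by (simp add: S_def)
  have upper: "x \<le> u * s" if x: "\<epsilon>\<^sup>2 * (x * ?c) \<le> real CARD('a)" "x \<ge> 0" for x
  proof -
    have "\<epsilon>\<^sup>2 * (x * (\<delta> * s)) \<le> \<epsilon>\<^sup>2 * (x * ?c)" using C x by (intro mult_left_mono) auto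
    hence "s * (x * (\<delta> * \<epsilon>\<^sup>2)) \<le> s * s" using x ss by (simp add: mult_ac)
    hence "x * (\<delta> * \<epsilon>\<^sup>2) \<le> s" using s by simp
    hence "x \<le> s / (\<delta> * \<epsilon>\<^sup>2)" using \<delta> \<epsilon> by (subst pos_le_divide_eq) auto
    thus ?thesis by (simp add: u_def)
  qed
  have bu: "?b \<le> u * s"
    using sets_not_too_large[OF ne \<epsilon>(1)] nS by (intro upper) (auto simp: S_def)
  have au: "?a \<le> u * s"
  proof (rule upper)
    have "S = (\<Sum>b\<in>B. \<Sum>a\<in>A. \<Sum>c\<in>C. \<chi> (b + a + c))"
      unfolding S_def by (subst sum.swap) (simp only: add.commute)
    thus "\<epsilon>\<^sup>2 * (?a * ?c) \<le> real CARD('a)"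
      using nS by (intro sets_not_too_large[of B A C]) (auto simp: ne \<epsilon> mult_ac)
  qed auto
  \<comment> \<open>A rotation makes the whole sum real and positive; \<open>f\<close> and
    \<open>g\<close> are real contributions whose averages can be compared.\<close>
  define \<theta> where "\<theta> = cnj S / complex_of_real (norm S)"
  define F where "F = (\<lambda>x. \<Sum>c\<in>C. \<chi> (x + c))"
  define f where "f = (\<lambda>x. Re (\<theta> * F x))"
  define g where "g = (\<lambda>a. \<Sum>b\<in>B. f (a + b))"
  have nS0: "norm S > 0" using nS p \<epsilon> by (smt (verit) mult_pos_pos)
  have \<theta>: "norm \<theta> = 1" "\<theta> * S = complex_of_real (norm S)"
  proof -
    show "norm \<theta> = 1" using nS0 by (simp add: \<theta>_def norm_divide)
    have "S * cnj S = complex_of_real (norm S) * complex_of_real (norm S)"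
      using complex_norm_square[of S] by (simp add: power2_eq_square)
    thus "\<theta> * S = complex_of_real (norm S)" using nS0 by (simp add: \<theta>_def mult.commute)
  qed
  have fF: "f x \<le> norm (F x)" for x
    using complex_Re_le_cmod[of "\<theta> * F x"] \<theta>(1) by (simp add: f_def norm_mult)
  have Fc: "norm (F x) \<le> ?c" for x
  proof -
    have "norm (F x) \<le> (\<Sum>c\<in>C. 1)" unfolding F_def by (rule sum_norm_le) (rule norm_le_1)
    thus ?thesis by simp
  qed
  have fc: "f x \<le> ?c" for x using fF[of x] Fc[of x] by linarith
  have gRe: "(\<Sum>a\<in>A'. g a) = Re (\<theta> * (\<Sum>a\<in>A'. \<Sum>b\<in>B. \<Sum>c\<in>C. \<chi> (a + b + c)))" for A'
    by (simp only: g_def f_def F_def sum_distrib_left Re_sum)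
  have gA: "(\<Sum>a\<in>A. g a) = norm S" unfolding gRe S_def[symmetric] \<theta>(2) by simp
  have gb: "g a \<le> ?b * ?c" for a
    using sum_mono[of B "\<lambda>b. f (a + b)" "\<lambda>_. ?c"] fc by (simp add: g_def)
  \<comment> \<open>Each single element of \<open>A1\<close> contributes its share, so whichever
    subset of \<open>A1\<close> is selected later, its triple sum remains large.\<close>
  define A1 where "A1 = {a\<in>A. g a \<ge> \<epsilon> / 2 * (?b * ?c)}"
  have A1: "\<epsilon> / 2 * ?a \<le> real (card A1)" unfolding A1_def
    by (rule popular_subset) (use gb p \<epsilon> nS gA in \<open>auto simp: mult_ac\<close>)
  have sub_large: "\<epsilon> / 2 * real (card A') * ?b * ?c \<le> norm (\<Sum>a\<in>A'. \<Sum>b\<in>B. \<Sum>c\<in>C. \<chi> (a + b + c))" if "A' \<subseteq> A1" for A'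
  proof -
    have "\<epsilon> / 2 * real (card A') * ?b * ?c = (\<Sum>a\<in>A'. \<epsilon> / 2 * (?b * ?c))" by (simp add: mult_ac)
    also have "\<dots> \<le> (\<Sum>a\<in>A'. g a)" by (rule sum_mono) (use that in \<open>auto simp: A1_def\<close>)
    also have "\<dots> \<le> norm (\<theta> * (\<Sum>a\<in>A'. \<Sum>b\<in>B. \<Sum>c\<in>C. \<chi> (a + b + c)))" unfolding gRe by (rule complex_Re_le_cmod)
    finally show ?thesis by (simp add: norm_mult \<theta>(1))
  qed
  have A1p: "real (card A1) > 0"
  proof -
    have "\<epsilon> / 2 * ?a > 0" using \<epsilon> p by simp
    thus ?thesis using A1 by linarith
  qed
  \<comment> \<open>For a in \<open>A1\<close> the mean of \<open>f\<close> over b is at least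
    (\<epsilon> / 2) |C|; half of this threshold is kept along the edges.\<close>
  define G where "G = {x\<in>A1 \<times> B. f (fst x + snd x) \<ge> \<epsilon> / 4 * ?c}"
  have "\<epsilon> / 4 * real (card (A1 \<times> B)) \<le> real (card G)" unfolding G_def
  proof (rule popular_subset)
    have "2 * (\<epsilon> / 4) * ?c * real (card (A1 \<times> B)) = (\<Sum>a\<in>A1. \<epsilon> / 2 * (?b * ?c))"
      by (simp add: card_cartesian_product mult_ac)
    also have "\<dots> \<le> (\<Sum>a\<in>A1. g a)" by (rule sum_mono) (auto simp: A1_def)
    also have "\<dots> = (\<Sum>x\<in>A1 \<times> B. f (fst x + snd x))" by (simp add: g_def sum.cartesian_product case_prod_beta)
    finally show "2 * (\<epsilon> / 4) * ?c * real (card (A1 \<times> B)) \<le> (\<Sum>x\<in>A1 \<times> B. f (fst x + snd x))" .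
  qed (use fc p \<epsilon> in auto)
  hence dens: "\<epsilon> / 4 * real (card A1) * ?b \<le> real (card G)" by (simp add: card_cartesian_product mult_ac)
  define D where "D = (\<lambda>(a, b). a + b) ` G"
  \<comment> \<open>The sums along \<open>G\<close> are points where the sum over \<open>C\<close>
    is large, and the second moment allows only O(sqrt p) of those.\<close>
  have D: "real (card D) \<le> 16 / (\<epsilon>\<^sup>2 * \<delta>) * s"
  proof -
    have "real (card D) * (\<epsilon> / 4 * ?c)\<^sup>2 = (\<Sum>x\<in>D. (\<epsilon> / 4 * ?c)\<^sup>2)" by simp
    also have "\<dots> \<le> (\<Sum>x\<in>D. (norm (F x))\<^sup>2)"
    proof (intro sum_mono power_mono)
      fix x assume "x \<in> D"
      hence "\<epsilon> / 4 * ?c \<le> f x" by (auto simp: D_def G_def)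
      thus "\<epsilon> / 4 * ?c \<le> norm (F x)" using fF[of x] by linarith
    qed (use \<epsilon> in auto)
    also have "\<dots> \<le> (\<Sum>x\<in>UNIV. (norm (F x))\<^sup>2)" by (rule sum_mono2) auto
    also have "\<dots> \<le> s * s * ?c" unfolding F_def ss by (rule second_moment)
    finally have "?c * (real (card D) * \<epsilon>\<^sup>2 * ?c) \<le> ?c * (16 * (s * s))" by (simp add: power2_eq_square mult_ac)
    hence "real (card D) * \<epsilon>\<^sup>2 * ?c \<le> 16 * (s * s)" using p by simp
    moreover have "real (card D) * \<epsilon>\<^sup>2 * (\<delta> * s) \<le> real (card D) * \<epsilon>\<^sup>2 * ?c" using C by (intro mult_left_mono) auto
    ultimately have "s * (real (card D) * (\<epsilon>\<^sup>2 * \<delta>)) \<le> s * (16 * s)" by (simp add: mult_ac)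
    hence "real (card D) * (\<epsilon>\<^sup>2 * \<delta>) \<le> 16 * s" using s by simp
    hence "real (card D) \<le> 16 * s / (\<epsilon>\<^sup>2 * \<delta>)" using \<delta> \<epsilon> by (subst pos_le_divide_eq) auto
    thus ?thesis by simp
  qed
  have A1ne: "A1 \<noteq> {}" using A1p by auto
  have GAB: "G \<subseteq> A1 \<times> B" by (auto simp: G_def)
  have \<epsilon>4: "0 < \<epsilon> / 4" "\<epsilon> / 4 \<le> 1" using \<epsilon> by auto
  obtain A2 B2 where A2: "A2 \<subseteq> A1" "B2 \<subseteq> B" "real (card A2) \<ge> \<epsilon> / 4 / 6 * real (card A1)" "real (card B2) \<ge> \<epsilon> / 4 / 4 * ?b"
    "real (card (A2 + B2)) * ((\<epsilon> / 4) ^ 5 / 3072 * real (card A1) * ?b) \<le> real (card D) ^ 3"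
    using balog_szemeredi_gowers[OF _ _ A1ne ne(2) GAB \<epsilon>4 dens] unfolding D_def by (metis finite)
  have "\<epsilon> / 16 * (\<delta> * s) \<le> \<epsilon> / 16 * ?b" using B \<epsilon> by (intro mult_left_mono) auto
  hence B2: "\<epsilon> / 16 * \<delta> * s \<le> real (card B2)" using A2(4) by simp
  have B2p: "real (card B2) > 0"
  proof -
    have "\<epsilon> / 16 * \<delta> * s > 0" using \<epsilon> \<delta> s by simp
    thus ?thesis using B2 by linarith
  qed
  have "\<epsilon> / 24 * (\<epsilon> / 2 * (\<delta> * s)) \<le> \<epsilon> / 24 * (\<epsilon> / 2 * ?a)" using A \<epsilon> by (intro mult_left_mono) auto
  also have "\<dots> \<le> \<epsilon> / 24 * real (card A1)" using A1 \<epsilon> by (intro mult_left_mono) auto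
  also have "\<dots> \<le> real (card A2)" using A2(3) by simp
  finally have A2c: "6 * (c * s) \<le> real (card A2)" by (simp add: c_def power2_eq_square mult_ac)
  define e where "e = (\<epsilon> / 4) ^ 5 / 3072 * (\<epsilon> / 2 * \<delta>\<^sup>2)"
  have e: "e > 0" using \<epsilon> \<delta> by (simp add: e_def)
  have "real (card (A2 + B2)) \<le> k * s"
  proof -
    have "(\<epsilon> / 2 * (\<delta> * s)) * (\<delta> * s) \<le> real (card A1) * ?b"
    proof (rule mult_mono)
      have "\<epsilon> / 2 * (\<delta> * s) \<le> \<epsilon> / 2 * ?a" using A \<epsilon> by (intro mult_left_mono) auto
      thus "\<epsilon> / 2 * (\<delta> * s) \<le> real (card A1)" using A1 by linarith
    qed (use B ds in auto)
    hence "(\<epsilon> / 4) ^ 5 / 3072 * ((\<epsilon> / 2 * (\<delta> * s)) * (\<delta> * s)) \<le> (\<epsilon> / 4) ^ 5 / 3072 * (real (card A1) * ?b)"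
      using \<epsilon> by (intro mult_left_mono) auto
    hence "e * s\<^sup>2 \<le> (\<epsilon> / 4) ^ 5 / 3072 * real (card A1) * ?b" by (simp add: e_def power2_eq_square mult_ac)
    hence "real (card (A2 + B2)) * (e * s\<^sup>2) \<le> real (card (A2 + B2)) * ((\<epsilon> / 4) ^ 5 / 3072 * real (card A1) * ?b)"
      by (intro mult_left_mono) auto
    also have "\<dots> \<le> real (card D) ^ 3" by (rule A2(5))
    also have "\<dots> \<le> (16 / (\<epsilon>\<^sup>2 * \<delta>) * s) ^ 3" using D by (intro power_mono) auto
    also have "\<dots> = (k * e) * s ^ 3" using e unfolding k_def e_def[symmetric] power_mult_distrib by simp
    finally have "(e * s\<^sup>2) * real (card (A2 + B2)) \<le> (e * s\<^sup>2) * (k * s)" by (simp add: power2_eq_square power3_eq_cube mult_ac)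
    moreover have "e * s\<^sup>2 > 0" using e s by simp
    ultimately show ?thesis by (simp only: mult_le_cancel_left_pos)
  qed
  also have "k * s = K * (\<epsilon> / 16 * \<delta> * s)" using \<epsilon> \<delta> by (simp add: K_def)
  also have "\<dots> \<le> K * real (card B2)" using B2 K by (intro mult_left_mono) auto
  finally have KB: "real (card (B2 + A2)) \<le> K * real (card B2)" by (simp add: add.commute)
  have B2ne: "B2 \<noteq> {}" using B2p by auto
  have B2u: "real (card B2) \<le> u * s"
    using bu of_nat_mono[OF card_mono[OF _ A2(2)], where 'a = real] by simp
  \<comment> \<open>\<open>B2\<close> is the set of comparison in Pluennecke's inequality; small
    doubling of \<open>A2\<close> itself results from h + l = 2.\<close>
  have pl: "real (card (diffset (nsum h A2) (nsum l A2))) \<le> K ^ (h + l) * (u * s)" for h l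
    by (rule order_trans[OF plunnecke_iterated[OF _ _ B2ne KB] mult_left_mono[OF B2u]]) (use K in auto)
  define N where "N = 2 * card (diffset (nsum 6 A2) (nsum 6 A2)) + 1"
  have N: "N > 2 * card (diffset (nsum 6 A2) (nsum 6 A2))" by (simp add: N_def)
  obtain A3 \<phi> where A3: "A3 \<subseteq> A2" "card A2 \<le> 6 * card A3" "freiman6 A3 \<phi> N"
    using freiman_model[OF prime_card N] by blast
  have A3c: "c * s \<le> real (card A3)" using A2c of_nat_mono[OF A3(2), where 'a = real] by simp
  have Nle: "real N \<le> 2 * (K ^ 12 * u) * s + 1" using pl[of 6 6] by (simp add: N_def mult.assoc)
  have Ku: "K\<^sup>2 * (u * s) \<le> K\<^sup>2 * u / c * real (card A3)"
  proof -
    have "K\<^sup>2 * u / c * (c * s) \<le> K\<^sup>2 * u / c * real (card A3)" using A3c K pos by (intro mult_left_mono) auto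
    thus ?thesis using pos by simp
  qed
  have D3: "real (card (diffset A3 A3)) \<le> K\<^sup>2 * u / c * real (card A3)"
  proof -
    have "card (diffset A3 A3) \<le> card (diffset A2 A2)" by (intro card_mono diffset_mono A3(1)) auto
    hence "real (card (diffset A3 A3)) \<le> real (card (diffset A2 A2))" by simp
    thus ?thesis using pl[of 1 1] Ku unfolding nsum_1 one_add_one by linarith
  qed
  have S3: "real (card (A3 + A3)) \<le> K\<^sup>2 * u / c * real (card A3)"
  proof -
    have "card (A3 + A3) \<le> card (A2 + A2)" by (intro card_mono set_plus_mono2 A3(1)) auto
    hence "real (card (A3 + A3)) \<le> real (card (A2 + A2))" by simp
    thus ?thesis using pl[of 2 0] Ku unfolding nsum_2 nsum.simps(1) diffset_zero add_0_right by linarith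
  qed
  have A3u: "real (card A3) \<le> u * s"
  proof -
    have "A3 \<subseteq> A" using A3(1) A2(1) by (auto simp: A1_def)
    hence "real (card A3) \<le> ?a" by (simp add: card_mono)
    thus ?thesis using au by linarith
  qed
  have "norm (\<Sum>a\<in>A3. \<Sum>b\<in>B. \<Sum>c\<in>C. \<chi> (a + b + c)) < \<epsilon> / 2 * real (card A3) * ?b * ?c"
    by (rule structured_sum_small[OF params _ \<delta> pos(2,1) _ _ A3c[unfolded s_def] A3u[unfolded s_def]
          B[unfolded s_def] C[unfolded s_def] A3(3) _ Nle[unfolded s_def] D3 S3])
       (use \<epsilon> K pos N in auto)
  thus False using sub_large[of A3] A3(1) A2(1) by fastforce
qed

end

section \<open>Transfer to the residue ring\<close>

lemma bound_residue_ring: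
  fixes \<chi> :: "int \<Rightarrow> complex" and A B C :: "int set"
  assumes prime: "prime CARD('a::{finite_field,field_gcd})" and p: "p = CARD('a)"
    and \<delta>: "\<delta> > 0" and \<epsilon>: "0 < \<epsilon>" "\<epsilon> \<le> 1" and large: "large_prime \<delta> \<epsilon> p"
    and \<chi>: "nontrivial_mult_character p \<chi>"
    and A: "A \<subseteq> carrier (residue_ring (int p))" "\<delta> * sqrt (real p) \<le> real (card A)"
    and B: "B \<subseteq> carrier (residue_ring (int p))" "\<delta> * sqrt (real p) \<le> real (card B)"
    and C: "C \<subseteq> carrier (residue_ring (int p))" "\<delta> * sqrt (real p) \<le> real (card C)"
  shows "norm (\<Sum>a\<in>A. \<Sum>b\<in>B. \<Sum>c\<in>C.
               \<chi> (a \<oplus>\<^bsub>residue_ring (int p)\<^esub> b \<oplus>\<^bsub>residue_ring (int p)\<^esub> c))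
         \<le> \<epsilon> * real (card A) * real (card B) * real (card C)"
proof -
  have pp: "prime p" using prime p by simp
  have p1: "p > 1" using pp by (rule prime_gt_1_nat)
  have R: "residues (int p)" "residues_prime p" using p1 pp by (simp_all add: residues_def residues_prime_def)
  note ring = residues.res_add_eq[OF R(1)] residues.res_mult_eq[OF R(1)] residues.res_zero_eq[OF R(1)]
  have carr: "carrier (residue_ring (int p)) = {0..<int p}"
    unfolding residues.res_carrier_eq[OF R(1)] by auto
  have units: "Units (residue_ring (int p)) = {0<..<int p}"
    unfolding residues_prime.res_prime_units_eq[OF R(2)] by auto
  \<comment> \<open>The character is carried to the field type along least nonnegative residues, the
    only points where \<open>\<chi>\<close> is constrained.\<close>
  define \<psi> where "\<psi> = (\<lambda>x :: 'a. \<chi> (int (lift_nat x)))"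
  have lift: "int (lift_nat (of_int x :: 'a)) = x mod int p" for x
  proof -
    define n where "n = nat (x mod int p)"
    have n: "int n = x mod int p" "n < p" using p1 by (simp_all add: n_def nat_less_iff)
    have "int p dvd x - int n" unfolding n(1) by (rule dvd_minus_mod)
    hence "(of_int (x - int n) :: 'a) = 0" unfolding p of_int_eq_0_iff_card[OF prime] .
    hence "(of_nat n :: 'a) = of_int x" by simp
    hence "lift_nat (of_int x :: 'a) = n" using n(2) unfolding p by (rule lift_nat_unique[OF prime])
    thus ?thesis using n(1) by simp
  qed
  have hom: "\<chi> \<in> hom (units_of (residue_ring (int p))) complex_units" and \<chi>0: "\<chi> 0 = 0"
    using \<chi> ring(3) by (auto simp: nontrivial_mult_character_def mult_character_def)
  have \<chi>m: "\<chi> (x * y mod int p) = \<chi> x * \<chi> y" if "x \<in> {0<..<int p}" "y \<in> {0<..<int p}" for x y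
    using hom that units unfolding hom_def by (simp add: units_of_carrier units_of_mult complex_units_def ring(2))
  have \<chi>n: "\<chi> x \<noteq> 0" if "x \<in> {0<..<int p}" for x
    using hom that units unfolding hom_def by (auto simp: units_of_carrier complex_units_def)
  have lb: "lift_nat (x :: 'a) < p" for x using lift_nat(2)[OF prime] p by simp
  have l0: "lift_nat x = 0 \<longleftrightarrow> x = 0" for x :: 'a
    using lift_nat(1)[OF prime, of x] lift_nat_unique[OF prime, of 0 0] by auto
  have l00: "lift_nat (0 :: 'a) = 0" using l0[of 0] by simp
  have \<psi>m: "\<psi> (x * y) = \<psi> x * \<psi> y" for x y
  proof (cases "x = 0 \<or> y = 0")
    case True
    thus ?thesis using \<chi>0 l00 by (auto simp: \<psi>_def)
  next
    case False
    have xy: "x * y = of_int (int (lift_nat x) * int (lift_nat y))" using lift_nat(1)[OF prime] by simp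
    have "int (lift_nat (x * y)) = int (lift_nat x) * int (lift_nat y) mod int p" unfolding xy by (rule lift)
    moreover have "lift_nat x > 0" "lift_nat y > 0" using False l0[of x] l0[of y] by auto
    ultimately show ?thesis unfolding \<psi>_def using \<chi>m[of "int (lift_nat x)" "int (lift_nat y)"] lb by simp
  qed
  \<comment> \<open>The value at 1 is idempotent and nonzero.\<close>
  have \<psi>1: "\<psi> 1 = 1"
  proof -
    have "\<psi> 1 \<noteq> 0" unfolding \<psi>_def using \<chi>n[of "int (lift_nat (1 :: 'a))"] l0[of 1] lb[of 1] by simp
    thus ?thesis using \<psi>m[of 1 1] by simp
  qed
  have \<psi>of: "\<psi> (of_int x) = \<chi> (x mod int p)" for x by (simp add: \<psi>_def lift)
  obtain g where g: "g \<in> {0<..<int p}" "\<chi> g \<noteq> 1" using \<chi> units by (auto simp: nontrivial_mult_character_def)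
  interpret M: mult_char \<psi>
  proof
    have "\<not> int p dvd g" using g(1) zdvd_imp_le[of "int p" g] by auto
    hence "of_int g \<noteq> (0 :: 'a)" unfolding p of_int_eq_0_iff_card[OF prime] .
    moreover have "\<psi> (of_int g) \<noteq> 1" using g by (simp add: \<psi>of)
    ultimately show "\<exists>c. c \<noteq> 0 \<and> \<psi> c \<noteq> 1" by (intro exI[of _ "of_int g"] conjI)
    show "\<psi> (x * y) = \<psi> x * \<psi> y" for x y by (rule \<psi>m)
    show "\<psi> 0 = 0" by (simp add: \<psi>_def l00 \<chi>0)
  qed (rule prime \<psi>1)+
  have inj: "inj_on (of_int :: int \<Rightarrow> 'a) {0..<int p}"
  proof (rule inj_onI)
    fix x y assume xy: "x \<in> {0..<int p}" "y \<in> {0..<int p}" and eq: "(of_int x :: 'a) = of_int y"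
    have "x mod int p = y mod int p" unfolding lift[symmetric] eq ..
    thus "x = y" using xy by (simp add: mod_pos_pos_trivial)
  qed
  have card: "card (of_int ` D :: 'a set) = card D" and re: "(\<Sum>x\<in>(of_int ` D :: 'a set). h x) = (\<Sum>d\<in>D. h (of_int d))"
    if "D \<subseteq> carrier (residue_ring (int p))" for D and h :: "'a \<Rightarrow> complex"
  proof -
    have "inj_on (of_int :: int \<Rightarrow> 'a) D" using that unfolding carr by (rule inj_on_subset[OF inj])
    thus "card (of_int ` D :: 'a set) = card D" "(\<Sum>x\<in>(of_int ` D :: 'a set). h x) = (\<Sum>d\<in>D. h (of_int d))"
      by (simp_all only: card_image sum.reindex o_def)
  qed
  have "norm (\<Sum>a\<in>of_int ` A. \<Sum>b\<in>of_int ` B. \<Sum>c\<in>of_int ` C. \<psi> (a + b + c))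
     \<le> \<epsilon> * real (card (of_int ` A :: 'a set)) * real (card (of_int ` B :: 'a set)) * real (card (of_int ` C :: 'a set))"
    by (rule M.triple_sum_bound[OF \<delta> \<epsilon> large[unfolded p]])
      (simp_all only: card A(1) B(1) C(1) A(2)[unfolded p] B(2)[unfolded p] C(2)[unfolded p])
  also have "(\<Sum>a\<in>of_int ` A. \<Sum>b\<in>of_int ` B. \<Sum>c\<in>of_int ` C. \<psi> (a + b + c)) =
      (\<Sum>a\<in>A. \<Sum>b\<in>B. \<Sum>c\<in>C. \<psi> (of_int (a + b + c)))"
    unfolding re[OF A(1)] re[OF B(1)] re[OF C(1)] of_int_add ..
  also have "\<dots> = (\<Sum>a\<in>A. \<Sum>b\<in>B. \<Sum>c\<in>C. \<chi> (a \<oplus>\<^bsub>residue_ring (int p)\<^esub> b \<oplus>\<^bsub>residue_ring (int p)\<^esub> c))"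
    unfolding \<psi>of ring(1) mod_add_left_eq ..
  finally show "norm (\<Sum>a\<in>A. \<Sum>b\<in>B. \<Sum>c\<in>C.
               \<chi> (a \<oplus>\<^bsub>residue_ring (int p)\<^esub> b \<oplus>\<^bsub>residue_ring (int p)\<^esub> c))
         \<le> \<epsilon> * real (card A) * real (card B) * real (card C)" unfolding card[OF A(1)] card[OF B(1)] card[OF C(1)] .
qed

text \<open>\<delta>, \<epsilon>, the character and the sets are quantified inside, so that refuting
  this for one chosen prime settles all of them; \<open>large_prime\<close> stands in for the bound
  p \<ge> p0.\<close>

definition counterexample :: "nat \<Rightarrow> bool" where
  "counterexample p \<longleftrightarrow> prime p \<and> (\<exists>\<delta> \<epsilon> \<chi> A B C. \<delta> > 0 \<and> 0 < \<epsilon> \<and> \<epsilon> \<le> 1 \<and> large_prime \<delta> \<epsilon> p \<and>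
     nontrivial_mult_character p \<chi> \<and>
     A \<subseteq> carrier (residue_ring (int p)) \<and> \<delta> * sqrt (real p) \<le> real (card A) \<and>
     B \<subseteq> carrier (residue_ring (int p)) \<and> \<delta> * sqrt (real p) \<le> real (card B) \<and>
     C \<subseteq> carrier (residue_ring (int p)) \<and> \<delta> * sqrt (real p) \<le> real (card C) \<and>
     \<not> norm (\<Sum>a\<in>A. \<Sum>b\<in>B. \<Sum>c\<in>C.
               \<chi> (a \<oplus>\<^bsub>residue_ring (int p)\<^esub> b \<oplus>\<^bsub>residue_ring (int p)\<^esub> c))
         \<le> \<epsilon> * real (card A) * real (card B) * real (card C))"

text \<open>The field with p elements is only available as a type, so the prime has to be fixed before
  the type is defined: we choose a potential counterexample.\<close>

definition exceptional_prime :: nat where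
  "exceptional_prime = (if \<exists>p. counterexample p then SOME p. counterexample p else 2)"

lemma prime_exceptional_prime: "prime exceptional_prime"
proof (cases "\<exists>p. counterexample p")
  case True
  hence "counterexample exceptional_prime" by (simp add: exceptional_prime_def someI_ex)
  thus ?thesis by (simp add: counterexample_def)
qed (simp add: exceptional_prime_def)

typedef exceptional_index = "{..<exceptional_prime}"
  using prime_gt_0_nat[OF prime_exceptional_prime] by blast

lemma card_exceptional_index: "CARD(exceptional_index) = exceptional_prime"
  using type_definition.card[OF type_definition_exceptional_index] by simp

instance exceptional_index :: prime_card
  by standard (simp add: card_exceptional_index prime_exceptional_prime)

text \<open>Any counterexample would make the chosen prime one; but for that prime the field exists
  as the type \<open>exceptional_index mod_ring\<close>, where the bound holds.\<close>

lemma no_counterexample: "\<not> counterexample p"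
proof
  assume "counterexample p"
  hence "\<exists>p. counterexample p" by blast
  hence ce: "counterexample exceptional_prime" by (simp add: exceptional_prime_def someI_ex)
  have card: "exceptional_prime = CARD(exceptional_index mod_ring)" by (simp add: card_exceptional_index)
  have "prime CARD(exceptional_index mod_ring)" using prime_exceptional_prime card by simp
  note bound = bound_residue_ring[OF this card]
  show False using ce bound unfolding counterexample_def by blast
qed

theorem theorem1:
  fixes \<delta> :: real
  assumes "\<delta> > 0"
  shows "\<forall>\<epsilon>::real. \<epsilon> > 0 \<longrightarrow>
    (\<exists>p0::nat. \<forall>(p::nat) (\<chi> :: int \<Rightarrow> complex) (A :: int set) (B :: int set) (C :: int set).
       p \<ge> p0 \<longrightarrow> prime p \<longrightarrow> nontrivial_mult_character p \<chi> \<longrightarrow>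
       A \<subseteq> carrier (residue_ring (int p)) \<longrightarrow>
       B \<subseteq> carrier (residue_ring (int p)) \<longrightarrow>
       C \<subseteq> carrier (residue_ring (int p)) \<longrightarrow>
       real (card A) \<ge> \<delta> * sqrt (real p) \<longrightarrow>
       real (card B) \<ge> \<delta> * sqrt (real p) \<longrightarrow>
       real (card C) \<ge> \<delta> * sqrt (real p) \<longrightarrow>
       norm (\<Sum>a\<in>A. \<Sum>b\<in>B. \<Sum>c\<in>C.
               \<chi> (a \<oplus>\<^bsub>residue_ring (int p)\<^esub> b \<oplus>\<^bsub>residue_ring (int p)\<^esub> c))
         \<le> \<epsilon> * real (card A) * real (card B) * real (card C))"
proof (intro allI impI)
  fix \<epsilon> :: real assume "\<epsilon> > 0"
  \<comment> \<open>\<open>triple_sum_bound\<close> assumes \<epsilon> \<le> 1; for larger values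
    the bound with 1 is stronger.\<close>
  hence \<epsilon>: "0 < min \<epsilon> 1" "min \<epsilon> 1 \<le> 1" by auto
  obtain p0 where p0: "\<And>p. p \<ge> p0 \<Longrightarrow> large_prime \<delta> (min \<epsilon> 1) p"
    using large_prime_eventually[OF assms \<epsilon>(1)] by blast
  show "\<exists>p0::nat. \<forall>(p::nat) (\<chi> :: int \<Rightarrow> complex) (A :: int set) (B :: int set) (C :: int set).
       p \<ge> p0 \<longrightarrow> prime p \<longrightarrow> nontrivial_mult_character p \<chi> \<longrightarrow>
       A \<subseteq> carrier (residue_ring (int p)) \<longrightarrow>
       B \<subseteq> carrier (residue_ring (int p)) \<longrightarrow>
       C \<subseteq> carrier (residue_ring (int p)) \<longrightarrow>
       real (card A) \<ge> \<delta> * sqrt (real p) \<longrightarrow>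
       real (card B) \<ge> \<delta> * sqrt (real p) \<longrightarrow>
       real (card C) \<ge> \<delta> * sqrt (real p) \<longrightarrow>
       norm (\<Sum>a\<in>A. \<Sum>b\<in>B. \<Sum>c\<in>C.
               \<chi> (a \<oplus>\<^bsub>residue_ring (int p)\<^esub> b \<oplus>\<^bsub>residue_ring (int p)\<^esub> c))
         \<le> \<epsilon> * real (card A) * real (card B) * real (card C)"
  proof (intro exI[of _ p0] allI impI)
    fix p \<chi> and A B C :: "int set"
    assume a: "p \<ge> p0" "prime p" "nontrivial_mult_character p \<chi>"
       "A \<subseteq> carrier (residue_ring (int p))" "B \<subseteq> carrier (residue_ring (int p))" "C \<subseteq> carrier (residue_ring (int p))"
       "real (card A) \<ge> \<delta> * sqrt (real p)" "real (card B) \<ge> \<delta> * sqrt (real p)" "real (card C) \<ge> \<delta> * sqrt (real p)"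
    have "norm (\<Sum>a\<in>A. \<Sum>b\<in>B. \<Sum>c\<in>C. \<chi> (a \<oplus>\<^bsub>residue_ring (int p)\<^esub> b \<oplus>\<^bsub>residue_ring (int p)\<^esub> c))
       \<le> min \<epsilon> 1 * real (card A) * real (card B) * real (card C)"
    proof (rule ccontr)
      assume "\<not> ?thesis"
      hence "counterexample p" unfolding counterexample_def using assms \<epsilon> p0[OF a(1)] a by blast
      thus False using no_counterexample by blast
    qed
    also have "\<dots> \<le> \<epsilon> * real (card A) * real (card B) * real (card C)" by (intro mult_right_mono) auto
    finally show "norm (\<Sum>a\<in>A. \<Sum>b\<in>B. \<Sum>c\<in>C. \<chi> (a \<oplus>\<^bsub>residue_ring (int p)\<^esub> b \<oplus>\<^bsub>residue_ring (int p)\<^esub> c))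
       \<le> \<epsilon> * real (card A) * real (card B) * real (card C)" .
  qed
qed

end
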